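(* Let $n\ge 2$, $0<\lambda\le\Lambda<\infty$ and $\gamma\ge 0$. There exist constants $\delta>0$ and $C>0$, depending only on $n,\lambda,\Lambda$ and $\gamma$, such that the following holds. Let $f\in C(B_1)\cap L^n(B_1)$ and let $u\in C(\overline{B}_1)$ satisfy $$|Du|^{\gamma}\,\mathcal{P}^{-}_{\lambda,\Lambda}(D^2u)\le f(x)\le |Du|^{\gamma}\,\mathcal{P}^{+}_{\lambda,\Lambda}(D^2u)\quad\text{in } B_1$$ in the viscosity sense. Then $|Du|^{\gamma}Du\in W^{1,\delta}(B_{1/2})$ and $$\big\||Du|^{\gamma}Du\big\|_{W^{1,\delta}(B_{1/2})}\le C\left(\|u\|_{L^\infty(B_1)}^{1+\gamma}+\|f\|_{L^n(B_1)}\right).$$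
   Context: $B_r\subset\mathbb{R}^n$ is the open ball of radius $r$ centered at $0$. Pucci operators: for a symmetric real $n\times n$ matrix $N$ with eigenvalues $e_i(N)$, $$\mathcal{P}^{+}_{\lambda,\Lambda}(N)=\lambda\sum_{e_i(N)<0}e_i(N)+\Lambda\sum_{e_i(N)>0}e_i(N),\qquad \mathcal{P}^{-}_{\lambda,\Lambda}(N)=\Lambda\sum_{e_i(N)<0}e_i(N)+\lambda\sum_{e_i(N)>0}e_i(N).$$ Viscosity sense: $|Du|^\gamma\mathcal{P}^-_{\lambda,\Lambda}(D^2u)\le f$ in $B_1$ means that for every $x_0\in B_1$ and every $\psi\in C^2(B_1)$ such that $u-\psi$ has a local minimum at $x_0$, one has $|D\psi(x_0)|^\gamma\mathcal{P}^-_{\lambda,\Lambda}(D^2\psi(x_0))\le f(x_0)$. Likewise $|Du|^\gamma\mathcal{P}^+_{\lambda,\Lambda}(D^2u)\ge f$ in $B_1$ means that for every $x_0\in B_1$ and every $\psi\in C^2(B_1)$ such that $u-\psi$ has a local maximum at $x_0$, one has $|D\psi(x_0)|^\gamma\mathcal{P}^+_{\lambda,\Lambda}(D^2\psi(x_0))\ge f(x_0)$. (When $\gamma=0$, $|\cdot|^\gamma=1$.) $W^{1,\delta}$ is the Sobolev-type space of vector fields $G$ with $G\in L^\delta$ and weak derivative $DG\in L^\delta$, with the usual norm (a quasi-norm if $\delta<1$); $\delta$ is not required to be $\ge 1$.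
   Formalization: For δ<1 the weak derivative of |Du|^γDu is read as the a.e. approximate derivative, because the field need not be locally integrable and may have no weak derivative; Du is the classical gradient, shown to exist a.e. in B_{1/2}. *)

theory Defs
  imports "HOL-Analysis.Analysis" "HOL-Probability.Essential_Supremum"
begin

section \<open>Derivatives and \<open>C\<^sup>k\<close> functions\<close>

definition partial_deriv :: "'n::finite \<Rightarrow> (real ^ 'n \<Rightarrow> real) \<Rightarrow> real ^ 'n \<Rightarrow> real" where
  "partial_deriv i \<phi> x = frechet_derivative \<phi> (at x) (axis i 1)"

definition grad :: "(real ^ 'n::finite \<Rightarrow> real) \<Rightarrow> real ^ 'n \<Rightarrow> real ^ 'n" where
  "grad \<phi> x = (\<chi> i. partial_deriv i \<phi> x)"

definition hessian :: "(real ^ 'n::finite \<Rightarrow> real) \<Rightarrow> real ^ 'n \<Rightarrow> real ^ 'n ^ 'n" where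
  "hessian \<phi> x = (\<chi> i j. partial_deriv i (partial_deriv j \<phi>) x)"

text \<open>Intended for open \<open>S\<close> only.\<close>

fun Ck_on :: "nat \<Rightarrow> (real ^ 'n::finite) set \<Rightarrow> (real ^ 'n \<Rightarrow> real) \<Rightarrow> bool" where
  "Ck_on 0 S \<phi> \<longleftrightarrow> continuous_on S \<phi>"
| "Ck_on (Suc k) S \<phi> \<longleftrightarrow>
     (\<forall>x\<in>S. \<phi> differentiable (at x)) \<and> (\<forall>i. Ck_on k S (partial_deriv i \<phi>))"

definition test_function :: "(real ^ 'n::finite) set \<Rightarrow> (real ^ 'n \<Rightarrow> real) \<Rightarrow> bool" where
  "test_function \<Omega> \<phi> \<longleftrightarrow>
     (\<forall>k. Ck_on k UNIV \<phi>) \<and> compact (closure {x. \<phi> x \<noteq> 0}) \<and> closure {x. \<phi> x \<noteq> 0} \<subseteq> \<Omega>"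

section \<open>Pucci operators\<close>

definition eigenspace :: "real ^ 'n ^ 'n \<Rightarrow> real \<Rightarrow> (real ^ 'n::finite) set" where
  "eigenspace N e = {v. N *v v = e *\<^sub>R v}"

definition eigenvalues :: "real ^ 'n ^ 'n::finite \<Rightarrow> real set" where
  "eigenvalues N = {e. \<exists>v. v \<noteq> 0 \<and> N *v v = e *\<^sub>R v}"

text \<open>
  In the Pucci operators the eigenvalues \<open>e\<^sub>1(N), \<dots>, e\<^sub>n(N)\<close> of a symmetric matrix are
  listed with multiplicity. The sums below run over the distinct eigenvalues, each weighted
  by the dimension of its eigenspace.
\<close>

definition neg_eigen_sum :: "real ^ 'n ^ 'n::finite \<Rightarrow> real" where
  "neg_eigen_sum N = (\<Sum>e\<in>{e \<in> eigenvalues N. e < 0}. real (dim (eigenspace N e)) * e)"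

definition pos_eigen_sum :: "real ^ 'n ^ 'n::finite \<Rightarrow> real" where
  "pos_eigen_sum N = (\<Sum>e\<in>{e \<in> eigenvalues N. e > 0}. real (dim (eigenspace N e)) * e)"

definition pucci_plus :: "real \<Rightarrow> real \<Rightarrow> real ^ 'n ^ 'n::finite \<Rightarrow> real" where
  "pucci_plus lam Lam N = lam * neg_eigen_sum N + Lam * pos_eigen_sum N"

definition pucci_minus :: "real \<Rightarrow> real \<Rightarrow> real ^ 'n ^ 'n::finite \<Rightarrow> real" where
  "pucci_minus lam Lam N = Lam * neg_eigen_sum N + lam * pos_eigen_sum N"

section \<open>Viscosity inequalities\<close>

text \<open>\<open>0 powr 0 = 0\<close>, whereas \<open>|p|\<^sup>\<gamma> = 1\<close> is required for \<open>\<gamma> = 0\<close>, also at \<open>p = 0\<close>.\<close>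

definition norm_pow :: "real ^ 'n::finite \<Rightarrow> real \<Rightarrow> real" where
  "norm_pow p \<gamma> = (if \<gamma> = 0 then 1 else norm p powr \<gamma>)"

definition local_min_at :: "(real ^ 'n::finite \<Rightarrow> real) \<Rightarrow> real ^ 'n \<Rightarrow> bool" where
  "local_min_at w x0 \<longleftrightarrow> (\<forall>\<^sub>F x in nhds x0. w x0 \<le> w x)"

definition local_max_at :: "(real ^ 'n::finite \<Rightarrow> real) \<Rightarrow> real ^ 'n \<Rightarrow> bool" where
  "local_max_at w x0 \<longleftrightarrow> (\<forall>\<^sub>F x in nhds x0. w x \<le> w x0)"

text \<open>\<open>|Du|\<^sup>\<gamma> P\<^sup>-(D\<^sup>2u) \<le> f\<close> in the open set \<open>\<Omega>\<close>\<close>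

definition visc_minus_le ::
  "real \<Rightarrow> real \<Rightarrow> real \<Rightarrow> (real ^ 'n::finite) set \<Rightarrow> (real ^ 'n \<Rightarrow> real) \<Rightarrow> (real ^ 'n \<Rightarrow> real) \<Rightarrow> bool"
where
  "visc_minus_le lam Lam \<gamma> \<Omega> u f \<longleftrightarrow>
     (\<forall>x0\<in>\<Omega>. \<forall>\<psi>. Ck_on 2 \<Omega> \<psi> \<and> local_min_at (\<lambda>x. u x - \<psi> x) x0 \<longrightarrow>
        norm_pow (grad \<psi> x0) \<gamma> * pucci_minus lam Lam (hessian \<psi> x0) \<le> f x0)"

text \<open>\<open>|Du|\<^sup>\<gamma> P\<^sup>+(D\<^sup>2u) \<ge> f\<close> in the open set \<open>\<Omega>\<close>\<close>

definition visc_plus_ge ::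
  "real \<Rightarrow> real \<Rightarrow> real \<Rightarrow> (real ^ 'n::finite) set \<Rightarrow> (real ^ 'n \<Rightarrow> real) \<Rightarrow> (real ^ 'n \<Rightarrow> real) \<Rightarrow> bool"
where
  "visc_plus_ge lam Lam \<gamma> \<Omega> u f \<longleftrightarrow>
     (\<forall>x0\<in>\<Omega>. \<forall>\<psi>. Ck_on 2 \<Omega> \<psi> \<and> local_max_at (\<lambda>x. u x - \<psi> x) x0 \<longrightarrow>
        norm_pow (grad \<psi> x0) \<gamma> * pucci_plus lam Lam (hessian \<psi> x0) \<ge> f x0)"

section \<open>Lebesgue spaces\<close>

definition in_Lp ::
  "real \<Rightarrow> (real ^ 'n::finite) set \<Rightarrow> (real ^ 'n \<Rightarrow> 'b::real_normed_vector) \<Rightarrow> bool" where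
  "in_Lp p \<Omega> g \<longleftrightarrow> g \<in> borel_measurable (lebesgue_on \<Omega>) \<and>
     integrable (lebesgue_on \<Omega>) (\<lambda>x. norm (g x) powr p)"

definition Lp_norm ::
  "real \<Rightarrow> (real ^ 'n::finite) set \<Rightarrow> (real ^ 'n \<Rightarrow> 'b::real_normed_vector) \<Rightarrow> real" where
  "Lp_norm p \<Omega> g = (LINT x|lebesgue_on \<Omega>. norm (g x) powr p) powr (1 / p)"

definition Linf_norm ::
  "(real ^ 'n::finite) set \<Rightarrow> (real ^ 'n \<Rightarrow> real) \<Rightarrow> real" where
  "Linf_norm \<Omega> g = real_of_ereal (esssup (lebesgue_on \<Omega>) (\<lambda>x. ereal \<bar>g x\<bar>))"

section \<open>The spaces \<open>W\<^sup>1\<^sup>,\<^sup>p\<close>, \<open>p > 0\<close>\<close>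

text \<open>In the Jacobian \<open>V\<close> of a vector field \<open>G\<close>, the entry \<open>V $ i $ j\<close> is \<open>\<partial>\<^sub>j G\<^sub>i\<close>.\<close>

definition distributional_deriv ::
  "(real ^ 'n::finite) set \<Rightarrow> (real ^ 'n \<Rightarrow> real ^ 'n) \<Rightarrow> (real ^ 'n \<Rightarrow> real ^ 'n ^ 'n) \<Rightarrow> bool" where
  "distributional_deriv \<Omega> G V \<longleftrightarrow>
     (\<forall>\<phi> i j. test_function \<Omega> \<phi> \<longrightarrow>
        (LINT x|lebesgue_on \<Omega>. G x $ i * partial_deriv j \<phi> x)
          = - (LINT x|lebesgue_on \<Omega>. V x $ i $ j * \<phi> x))"

text \<open>Approximate differentiability of \<open>G\<close> at \<open>x\<close> with derivative \<open>A\<close>, in the sense of Federer.\<close>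

definition has_approx_deriv ::
  "(real ^ 'n::finite \<Rightarrow> real ^ 'n) \<Rightarrow> real ^ 'n ^ 'n \<Rightarrow> real ^ 'n \<Rightarrow> bool" where
  "has_approx_deriv G A x \<longleftrightarrow>
     (\<forall>\<epsilon>>0. ((\<lambda>r. measure lebesgue
                   {y \<in> ball x r. norm (G y - G x - A *v (y - x)) > \<epsilon> * norm (y - x)}
                 / measure lebesgue (ball x r)) \<longlongrightarrow> 0) (at_right 0))"

text \<open>
  For \<open>p \<ge> 1\<close> the weak derivative is the distributional one. For \<open>p < 1\<close> a field in \<open>L\<^sup>p\<close>
  need not be locally integrable and then defines no distribution, so the weak derivative is
  taken in the sense of approximate differentiability almost everywhere. It is unique up to
  null sets, and it is the distributional derivative whenever \<open>G\<close> is in \<open>W\<^sup>1\<^sup>,\<^sup>1\<close> locally.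

  The case \<open>p < 1\<close> cannot be avoided for the field \<open>|Du|\<^sup>\<gamma> Du\<close>. For \<open>0 < \<alpha> < 1\<close> and
  \<open>(x, y)\<close> in the product of two planes, \<open>u = (|x|\<^sup>2 - |y|\<^sup>2) (|x|\<^sup>2 + |y|\<^sup>2) powr (\<alpha>/2 - 1)\<close> is
  homogeneous of degree \<open>\<alpha>\<close>. At every point other than 0 its Hessian has eigenvalues of both
  signs, at least of order \<open>r powr (\<alpha> - 2)\<close>, and no \<open>C\<^sup>2\<close> function touches \<open>u\<close> at 0 from
  either side. Hence \<open>u\<close> satisfies both viscosity inequalities with \<open>f = 0\<close> if \<open>\<Lambda>/\<lambda>\<close> is large,
  while \<open>|Du|\<^sup>\<gamma> Du\<close> has size \<open>r powr ((\<alpha> - 1) (1 + \<gamma>))\<close>, which is not locally integrable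
  once \<open>(1 - \<alpha>) (1 + \<gamma>) \<ge> 4\<close>.
\<close>

definition weak_deriv ::
  "real \<Rightarrow> (real ^ 'n::finite) set \<Rightarrow> (real ^ 'n \<Rightarrow> real ^ 'n) \<Rightarrow> (real ^ 'n \<Rightarrow> real ^ 'n ^ 'n) \<Rightarrow> bool"
where
  "weak_deriv p \<Omega> G V \<longleftrightarrow>
     (if p \<ge> 1 then distributional_deriv \<Omega> G V
      else (AE x in lebesgue_on \<Omega>. has_approx_deriv G (V x) x))"

text \<open>\<open>G\<close> belongs to \<open>W\<^sup>1\<^sup>,\<^sup>p(\<Omega>)\<close> and \<open>DG = V\<close>\<close>

definition in_W1p ::
  "real \<Rightarrow> (real ^ 'n::finite) set \<Rightarrow> (real ^ 'n \<Rightarrow> real ^ 'n) \<Rightarrow> (real ^ 'n \<Rightarrow> real ^ 'n ^ 'n) \<Rightarrow> bool"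
where
  "in_W1p p \<Omega> G V \<longleftrightarrow> in_Lp p \<Omega> G \<and> in_Lp p \<Omega> V \<and> weak_deriv p \<Omega> G V"

text \<open>The second field is meant to be the weak derivative of the first.\<close>

definition W1p_norm ::
  "real \<Rightarrow> (real ^ 'n::finite) set \<Rightarrow> (real ^ 'n \<Rightarrow> real ^ 'n) \<Rightarrow> (real ^ 'n \<Rightarrow> real ^ 'n ^ 'n) \<Rightarrow> real"
where
  "W1p_norm p \<Omega> G V = Lp_norm p \<Omega> G + Lp_norm p \<Omega> V"

text \<open>
  The field \<open>|Du|\<^sup>\<gamma> Du\<close>. For continuous \<open>u\<close> it has a meaning only at points of differentiability,
  so statements about it come with the assertion that \<open>u\<close> is differentiable almost everywhere.
\<close>

definition grad_field :: "real \<Rightarrow> (real ^ 'n::finite \<Rightarrow> real) \<Rightarrow> real ^ 'n \<Rightarrow> real ^ 'n" where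
  "grad_field \<gamma> u x = norm_pow (grad u x) \<gamma> *\<^sub>R grad u x"

end

(*
  Say that u is touched from below at x, with constant K, if some affine function stays below u up
  to an error K |z - x|^(1 + 1/(1 + gamma)), and up to an error of size K^(1 + gamma) |z - x|^2 once
  it is multiplied by |p|^gamma, p being the slope. The second error is what the quadratic test
  functions see, and all test functions used are quadratic. Sliding radial profiles under u and
  comparing the slopes at two contact points by means of a quadratic barrier shows that
  |p|^gamma p depends on the contact point in a Lipschitz way. By the area formula the contact set
  then has a measure bounded below, so wherever u is touched once with constant K it is touched
  with constant M K on a fixed fraction of the neighbourhood, unless |f|^n is large there in the
  mean. Where the slope of the given touching is large one subtracts it first, and the equation
  becomes uniformly elliptic. A Vitali covering yields geometric decay of the measure of the set not
  touched with constant K M^k.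

  The same holds for -u. Where u is touched from both sides with constant K, it is differentiable
  and |Du|^gamma Du is bounded and Lipschitz with constant of order K^(1 + gamma), hence by
  Rademacher's theorem approximately differentiable at almost every such point. Summing over k
  gives the integrability for small delta < 1.
*)
theory Submission
  imports Defs
begin

section \<open>Quadratic test functions\<close>

text \<open>The obstacle is the factor \<open>|Du|^gamma\<close>: where the slope vanishes the
  equation gives no control, and where the slope is large the ellipticity is not uniform. What
  survives is the scaling in which K corresponds to \<open>K powr (1 + gamma)\<close> for f and for
  \<open>|p|^gamma p\<close>. The exponent 1 + 1/(1 + gamma) is the one for which, at a contact x
  with the profile \<open>- A |z - y| powr (1 + 1/(1 + gamma))\<close>, the vector
  \<open>|p|^gamma p\<close> is a fixed multiple of y - x; so the centre y depends on x as regularly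
  as \<open>|p|^gamma p\<close> does. The contact set must also be localised near the centre. For
  this the power is continued outside a small ball by a Gaussian that is a strict subsolution there:
  its contacts occur only where f is not small and are charged to the integral of |f|^n, so that the
  remaining volume is left to contacts with the power part. The exponent delta comes from balancing
  the growth of K^(1 + gamma) against the decay of the sets without touching; it is below 1, which
  is why approximate derivatives enter.\<close>

lemma partial_deriv_eq:
  assumes "(\<phi> has_derivative D) (at x)"
  shows "partial_deriv i \<phi> x = D (axis i 1)"
  using frechet_derivative_at[OF assms] by (simp add: partial_deriv_def)

lemma grad_eq:
  assumes "(\<phi> has_derivative (\<lambda>h. p \<bullet> h)) (at x)"
  shows "grad \<phi> x = p"
  by (simp add: grad_def partial_deriv_eq[OF assms] vec_eq_iff inner_axis)

text \<open>Constants cancel in every comparison, so there is no constant term. For a unit vector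
  \<open>e\<close> and \<open>0 < s2 < s1\<close> the Hessian has one positive eigenvalue and n - 1
  equal negative ones: one convex direction is weighed against n - 1 concave ones.\<close>

definition quad :: "real ^ 'n::finite \<Rightarrow> real ^ 'n \<Rightarrow> real ^ 'n \<Rightarrow> real \<Rightarrow> real \<Rightarrow> real ^ 'n \<Rightarrow> real" where
  "quad x p e s1 s2 z = p \<bullet> (z - x) + s1 * (e \<bullet> (z - x))\<^sup>2 - s2 * (norm (z - x))\<^sup>2"

lemma quad_has_derivative:
  "(quad x p e s1 s2 has_derivative
     (\<lambda>h. (p + (2 * s1 * (e \<bullet> (y - x))) *\<^sub>R e - (2 * s2) *\<^sub>R (y - x)) \<bullet> h)) (at y)"
  unfolding quad_def[abs_def] power2_norm_eq_inner
  by (auto intro!: derivative_eq_intros simp: algebra_simps inner_simps inner_commute fun_eq_iff)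

lemma grad_quad:
  "grad (quad x p e s1 s2) y = p + (2 * s1 * (e \<bullet> (y - x))) *\<^sub>R e - (2 * s2) *\<^sub>R (y - x)"
  by (rule grad_eq[OF quad_has_derivative])

lemma partial_deriv_quad:
  "partial_deriv j (quad x p e s1 s2)
     = (\<lambda>y. p $ j + 2 * s1 * (e \<bullet> (y - x)) * e $ j - 2 * s2 * (y - x) $ j)"
  by (rule ext) (simp add: partial_deriv_eq[OF quad_has_derivative] inner_axis)

lemma partial_deriv_quad_has_derivative:
  "((\<lambda>y. p $ j + 2 * s1 * (e \<bullet> (y - x)) * e $ j - 2 * s2 * (y - x) $ j) has_derivative
     (\<lambda>h. 2 * s1 * (e \<bullet> h) * e $ j - 2 * s2 * h $ j)) (at y)"
  by (auto intro!: derivative_eq_intros bounded_linear.has_derivative[OF bounded_linear_vec_nth])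

lemma hessian_quad:
  "hessian (quad x p e s1 s2) y = (\<chi> i j. 2 * s1 * e $ i * e $ j - (if i = j then 2 * s2 else 0))"
proof -
  have "partial_deriv i (partial_deriv j (quad x p e s1 s2)) y
      = 2 * s1 * e $ i * e $ j - (if i = j then 2 * s2 else 0)" for i j
    unfolding partial_deriv_quad partial_deriv_eq[OF partial_deriv_quad_has_derivative]
    by (auto simp: inner_axis) (auto simp: axis_def)
  thus ?thesis by (simp add: hessian_def)
qed

lemma Ck_on_quad: "Ck_on 2 S (quad x p e s1 s2)"
proof -
  have 2: "partial_deriv i (\<lambda>y. p $ j + 2 * s1 * (e \<bullet> (y - x)) * e $ j - 2 * s2 * (y - x) $ j) =
     (\<lambda>_. 2 * s1 * (e \<bullet> axis i 1) * e $ j - 2 * s2 * axis i 1 $ j)" for i j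
    by (rule ext) (simp only: partial_deriv_eq[OF partial_deriv_quad_has_derivative])
  show ?thesis
    unfolding numeral_2_eq_2 Ck_on.simps partial_deriv_quad 2
    using quad_has_derivative partial_deriv_quad_has_derivative
    unfolding differentiable_def
    by (fastforce intro!: continuous_intros)
qed

lemma quad_mult_vec:
  "(\<chi> i j. a * e $ i * e $ j - (if i = j then b else 0)) *v w
     = (a * (e \<bullet> w)) *\<^sub>R e - b *\<^sub>R w"
  by (simp add: vec_eq_iff matrix_vector_mult_def inner_vec_def algebra_simps sum_subtractf
      sum_distrib_left sum_distrib_right if_distrib[of "\<lambda>x. _ * x"] cong: if_cong)

text \<open>The matrix acts as \<open>a - b\<close> on the line of \<open>e\<close> and as
  \<open>- b\<close> on the orthogonal complement, of dimension n - 1. The condition n >= 2 makes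
  this complement nonzero, so that \<open>- b\<close> really occurs among the
  \<open>eigenvalues\<close>.\<close>

lemma pucci_minus_quad:
  fixes e :: "real ^ 'n::finite"
  assumes e: "norm e = 1" and b: "0 < b" "b < a" and n: "CARD('n) \<ge> 2"
  shows "pucci_minus lam Lam (\<chi> i j. a * e $ i * e $ j - (if i = j then b else 0))
    = lam * (a - b) - Lam * (real CARD('n) - 1) * b"
proof -
  let ?N = "(\<chi> i j. a * e $ i * e $ j - (if i = j then b else 0)) :: real ^ 'n ^ 'n"
  have ee: "e \<bullet> e = 1" using e by (simp add: norm_eq_1)
  have mv: "?N *v w = (a * (e \<bullet> w)) *\<^sub>R e - b *\<^sub>R w" for w by (rule quad_mult_vec)
  have eN0: "eigenspace ?N (- b) = {w. e \<bullet> w = 0}"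
    using ee b by (auto simp: eigenspace_def mv)
  have eN1: "eigenspace ?N (a - b) = span {e}"
  proof -
    have "w \<in> span {e}" if "?N *v w = (a - b) *\<^sub>R w" for w
    proof -
      have "a *\<^sub>R w = a *\<^sub>R ((e \<bullet> w) *\<^sub>R e)" using that unfolding mv by (simp add: algebra_simps)
      hence "w = (e \<bullet> w) *\<^sub>R e" using b by (metis less_irrefl less_trans scaleR_left_imp_eq)
      thus ?thesis by (metis span_base span_scale singletonI)
    qed
    moreover have "?N *v (c *\<^sub>R e) = (a - b) *\<^sub>R (c *\<^sub>R e)" for c
      unfolding mv using ee by (simp add: algebra_simps)
    ultimately show ?thesis unfolding eigenspace_def span_singleton by blast
  qed
  have d1: "dim (eigenspace ?N (a - b)) = 1" using ee unfolding eN1 by auto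
  have d0: "dim (eigenspace ?N (- b)) = CARD('n) - 1"
    unfolding eN0 using dim_hyperplane[of e] ee by (metis DIM_cart DIM_real inner_zero_left mult.right_neutral zero_neq_one)
  have ev: "eigenvalues ?N = {- b, a - b}"
  proof
    show "eigenvalues ?N \<subseteq> {- b, a - b}"
    proof
      fix l assume "l \<in> eigenvalues ?N"
      then obtain w where w: "w \<noteq> 0" "?N *v w = l *\<^sub>R w" by (auto simp: eigenvalues_def)
      have *: "(a * (e \<bullet> w)) *\<^sub>R e = (l + b) *\<^sub>R w" using w(2) unfolding mv by (simp add: algebra_simps)
      have "a * (e \<bullet> w) = (l + b) * (e \<bullet> w)" using arg_cong[OF *, of "\<lambda>x. e \<bullet> x"] ee by simp
      then show "l \<in> {- b, a - b}" using * w by (cases "e \<bullet> w = 0") auto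
    qed
    have "eigenspace ?N (a - b) \<noteq> {0}" "eigenspace ?N (- b) \<noteq> {0}"
      using d1 d0 n by (metis dim_singleton zero_neq_one, metis dim_singleton diff_is_0_eq not_less_eq_eq numeral_2_eq_2 One_nat_def)
    moreover have "0 \<in> eigenspace ?N l" for l by (simp add: eigenspace_def)
    ultimately show "{- b, a - b} \<subseteq> eigenvalues ?N"
      by (auto simp: eigenvalues_def eigenspace_def)
  qed
  have s1: "{l \<in> eigenvalues ?N. l < 0} = {- b}" and s2: "{l \<in> eigenvalues ?N. l > 0} = {a - b}"
    using b by (auto simp: ev)
  have one: "sum f {c} = f c" for f :: "real \<Rightarrow> real" and c by simp
  have "real (CARD('n) - 1) = real CARD('n) - 1" using n by (simp add: of_nat_diff)
  thus ?thesis
    unfolding pucci_minus_def neg_eigen_sum_def pos_eigen_sum_def s1 s2 one d0 d1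
    by (simp add: algebra_simps)
qed

text \<open>The viscosity inequality restricted to the quadratic tests above, with the Pucci value
  written out. The bound \<open>L\<close> on the slope serves the case of large slopes: once an
  affine function has been subtracted, an inequality with exponent 0 is available only for tests of
  bounded slope.\<close>

definition visc_super ::
  "real \<Rightarrow> real \<Rightarrow> real \<Rightarrow> real \<Rightarrow> (real ^ 'n::finite) set \<Rightarrow> (real ^ 'n \<Rightarrow> real) \<Rightarrow> (real ^ 'n \<Rightarrow> real) \<Rightarrow> bool"
where
  "visc_super lam Lam \<gamma> L \<Omega> v g \<longleftrightarrow>
     (\<forall>x\<in>\<Omega>. \<forall>p e s1 s2. norm p \<le> L \<and> norm e = 1 \<and> 0 < s2 \<and> s2 < s1 \<and>
        (\<forall>\<^sub>F z in nhds x. v x + quad x p e s1 s2 z \<le> v z) \<longrightarrow>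
        norm_pow p \<gamma> * (2 * (lam * (s1 - s2) - Lam * (real CARD('n) - 1) * s2)) \<le> g x)"

lemma visc_minus_le_imp_super:
  fixes u :: "real ^ 'n::finite \<Rightarrow> real"
  assumes v: "visc_minus_le lam Lam \<gamma> \<Omega> u f" and n: "CARD('n) \<ge> 2"
  shows "visc_super lam Lam \<gamma> L \<Omega> u f"
  unfolding visc_super_def
proof (intro ballI allI impI, elim conjE)
  fix x p e s1 s2
  assume x: "x \<in> \<Omega>" and e: "norm (e :: real ^ 'n) = 1" and s: "0 < s2" "s2 < s1"
    and ev: "\<forall>\<^sub>F z in nhds x. u x + quad x p e s1 s2 z \<le> u z"
  have q: "quad x p e s1 s2 x = 0" by (simp add: quad_def)
  have "local_min_at (\<lambda>z. u z - quad x p e s1 s2 z) x"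
    unfolding local_min_at_def using ev by eventually_elim (simp add: q)
  hence "norm_pow (grad (quad x p e s1 s2) x) \<gamma> * pucci_minus lam Lam (hessian (quad x p e s1 s2) x) \<le> f x"
    using v x Ck_on_quad unfolding visc_minus_le_def by blast
  moreover have "hessian (quad x p e s1 s2) x
      = (\<chi> i j. 2 * s1 * e $ i * e $ j - (if i = j then 2 * s2 else 0))" by (rule hessian_quad)
  moreover have "grad (quad x p e s1 s2) x = p" by (simp add: grad_quad)
  ultimately have "norm_pow p \<gamma> * (lam * (2 * s1 - 2 * s2) - Lam * (real CARD('n) - 1) * (2 * s2)) \<le> f x"
    using pucci_minus_quad[OF e, of "2 * s2" "2 * s1" lam Lam] s n by simp
  moreover have "lam * (2 * s1 - 2 * s2) - Lam * (real CARD('n) - 1) * (2 * s2)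
      = 2 * (lam * (s1 - s2) - Lam * (real CARD('n) - 1) * s2)" by (simp add: algebra_simps)
  ultimately show "norm_pow p \<gamma> * (2 * (lam * (s1 - s2) - Lam * (real CARD('n) - 1) * s2)) \<le> f x"
    by simp
qed

lemma visc_super_mono:
  "\<lbrakk>visc_super lam Lam \<gamma> L \<Omega> v g; L' \<le> L; \<Omega>' \<subseteq> \<Omega>; \<And>x. x \<in> \<Omega>' \<Longrightarrow> g x \<le> g' x\<rbrakk>
    \<Longrightarrow> visc_super lam Lam \<gamma> L' \<Omega>' v g'"
  unfolding visc_super_def by (meson order_trans subsetD)

section \<open>Touching from below\<close>

text \<open>The function \<open>s \<mapsto> s\<^sup>\<gamma>\<close> with the convention \<open>0\<^sup>0 = 1\<close> of \<^const>\<open>norm_pow\<close>.\<close>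

definition pw :: "real \<Rightarrow> real \<Rightarrow> real" where
  "pw \<gamma> s = (if \<gamma> = 0 then 1 else s powr \<gamma>)"

lemma norm_pow_eq: "norm_pow p \<gamma> = pw \<gamma> (norm p)"
  by (simp add: norm_pow_def pw_def)

lemma pw_nonneg [simp]: "0 \<le> pw \<gamma> s"
  by (simp add: pw_def)

lemma pw_pos [simp]: "0 < s \<Longrightarrow> 0 < pw \<gamma> s"
  by (simp add: pw_def)

lemma pw_mono: "\<lbrakk>0 \<le> \<gamma>; 0 \<le> s; s \<le> s'\<rbrakk> \<Longrightarrow> pw \<gamma> s \<le> pw \<gamma> s'"
  by (simp add: pw_def powr_mono2)

lemma pw_mult: "\<lbrakk>0 \<le> s; 0 \<le> s'\<rbrakk> \<Longrightarrow> pw \<gamma> (s * s') = pw \<gamma> s * pw \<gamma> s'"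
  by (simp add: pw_def powr_mult)

lemma pw_times_self: "\<lbrakk>0 \<le> \<gamma>; 0 \<le> s\<rbrakk> \<Longrightarrow> pw \<gamma> s * s = s powr (1 + \<gamma>)"
  by (cases "s = 0") (auto simp: pw_def powr_add)

text \<open>For the power \<open>1 + 1 / (1 + gamma)\<close> the expression
  \<open>|Dv|^gamma D^2 v\<close> is homogeneous of degree 0. With \<open>gamma = 0\<close> the two
  bounds coincide. Otherwise the second is the stronger one at distances d with
  \<open>K * d powr (1 / (1 + gamma)) < norm p\<close>, and the first at larger distances; for
  \<open>p = 0\<close> only the first carries information.\<close>

definition touches_below ::
  "real \<Rightarrow> real \<Rightarrow> (real ^ 'n::finite) set \<Rightarrow> (real ^ 'n \<Rightarrow> real) \<Rightarrow> real ^ 'n \<Rightarrow> real ^ 'n \<Rightarrow> bool"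
where
  "touches_below \<gamma> K S v x p \<longleftrightarrow> (\<forall>z\<in>S.
     v x + p \<bullet> (z - x) - v z \<le> K * norm (z - x) powr (1 + 1 / (1 + \<gamma>)) \<and>
     norm_pow p \<gamma> * (v x + p \<bullet> (z - x) - v z) \<le> K powr (1 + \<gamma>) * (norm (z - x))\<^sup>2)"

lemma touches_below_mono:
  assumes "touches_below \<gamma> K S v x p" "0 \<le> K" "K \<le> K'" "S' \<subseteq> S" "0 \<le> \<gamma>"
  shows "touches_below \<gamma> K' S' v x p"
  unfolding touches_below_def
proof
  fix z assume "z \<in> S'"
  hence *: "v x + p \<bullet> (z - x) - v z \<le> K * norm (z - x) powr (1 + 1 / (1 + \<gamma>))"
     "norm_pow p \<gamma> * (v x + p \<bullet> (z - x) - v z) \<le> K powr (1 + \<gamma>) * (norm (z - x))\<^sup>2"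
    using assms unfolding touches_below_def by auto
  have "K * norm (z - x) powr (1 + 1 / (1 + \<gamma>)) \<le> K' * norm (z - x) powr (1 + 1 / (1 + \<gamma>))"
    using assms by (simp add: mult_right_mono)
  moreover have "K powr (1 + \<gamma>) * (norm (z - x))\<^sup>2 \<le> K' powr (1 + \<gamma>) * (norm (z - x))\<^sup>2"
    using assms by (simp add: mult_right_mono powr_mono2)
  ultimately show "v x + p \<bullet> (z - x) - v z \<le> K' * norm (z - x) powr (1 + 1 / (1 + \<gamma>)) \<and>
     norm_pow p \<gamma> * (v x + p \<bullet> (z - x) - v z) \<le> K' powr (1 + \<gamma>) * (norm (z - x))\<^sup>2"
    using * by linarith
qed

text \<open>In the applications \<open>P\<close> is the sum and \<open>m\<close> the distance of two
  slopes. If \<open>P <= 8 * m\<close>, the slope \<open>p\<close> may vanish but \<open>m\<close>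
  is comparable with \<open>P\<close>, and the power bound is used. Otherwise
  \<open>norm p >= P / 4\<close>, and the quadratic bound can be divided by
  \<open>|p|^gamma\<close>.\<close>

lemma touch_error_le:
  assumes t: "touches_below \<gamma> K S v x p" and z: "z \<in> S" "norm (z - x) \<le> c * r"
    and pos: "0 \<le> \<gamma>" "0 < K" "0 < c" "0 < r" "0 < m" "m \<le> P"
    and p: "(P - m) / 2 \<le> norm p"
    and big1: "pw \<gamma> 8 * (K * c powr (1 + 1 / (1 + \<gamma>))) powr (1 + \<gamma>) * r \<le> pw \<gamma> P * m"
    and big2: "pw \<gamma> 4 * (K powr (1 + \<gamma>) * c\<^sup>2) * r \<le> pw \<gamma> P * m"
  shows "v x + p \<bullet> (z - x) - v z \<le> m * r"
proof (cases "P \<le> 8 * m")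
  case True
  let ?B = "K * c powr (1 + 1 / (1 + \<gamma>))"
  have "pw \<gamma> P * m \<le> pw \<gamma> 8 * pw \<gamma> m * m"
    using pw_mono[of \<gamma> P "8 * m"] True pos by (simp add: pw_mult mult_right_mono)
  also have "\<dots> = pw \<gamma> 8 * m powr (1 + \<gamma>)" using pos by (simp add: pw_times_self)
  finally have "pw \<gamma> 8 * ?B powr (1 + \<gamma>) * r \<le> pw \<gamma> 8 * m powr (1 + \<gamma>)" using big1 by linarith
  hence "pw \<gamma> 8 * (?B powr (1 + \<gamma>) * r) \<le> pw \<gamma> 8 * m powr (1 + \<gamma>)" by (simp only: mult.assoc)
  hence "?B powr (1 + \<gamma>) * r \<le> m powr (1 + \<gamma>)"
    by (rule mult_left_le_imp_le) simp
  hence "(?B powr (1 + \<gamma>) * r) powr (1 / (1 + \<gamma>)) \<le> (m powr (1 + \<gamma>)) powr (1 / (1 + \<gamma>))"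
    using pos by (intro powr_mono2) auto
  hence *: "?B * r powr (1 / (1 + \<gamma>)) \<le> m"
    using pos by (simp add: powr_mult powr_powr)
  have "v x + p \<bullet> (z - x) - v z \<le> K * norm (z - x) powr (1 + 1 / (1 + \<gamma>))"
    using t z by (auto simp: touches_below_def)
  also have "\<dots> \<le> K * (c * r) powr (1 + 1 / (1 + \<gamma>))"
    using z pos by (intro mult_left_mono powr_mono2) auto
  also have "\<dots> = ?B * r powr (1 / (1 + \<gamma>)) * r" using pos by (simp add: powr_mult powr_add)
  also have "\<dots> \<le> m * r" using * pos by (simp add: mult_right_mono)
  finally show ?thesis .
next
  case False
  have Pp: "P / 4 \<le> norm p" "0 < P" using False p pos by auto
  hence pp: "pw \<gamma> P \<le> pw \<gamma> 4 * pw \<gamma> (norm p)"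
    using pw_mono[of \<gamma> P "4 * norm p"] pos by (simp add: pw_mult)
  have pp0: "0 < pw \<gamma> (norm p)" using Pp by (intro pw_pos) linarith
  show ?thesis
  proof (rule ccontr)
    assume n: "\<not> ?thesis"
    have "pw \<gamma> P * m * r \<le> pw \<gamma> 4 * (pw \<gamma> (norm p) * (m * r))"
      using pp pos by (simp add: mult.assoc[symmetric] mult_right_mono)
    also have "\<dots> < pw \<gamma> 4 * (pw \<gamma> (norm p) * (v x + p \<bullet> (z - x) - v z))"
      using n pp0 by (simp add: mult_less_cancel_left_pos)
    also have "\<dots> \<le> pw \<gamma> 4 * (K powr (1 + \<gamma>) * (norm (z - x))\<^sup>2)"
      using t z by (intro mult_left_mono) (auto simp: touches_below_def norm_pow_eq)
    also have "\<dots> \<le> pw \<gamma> 4 * (K powr (1 + \<gamma>) * (c * r)\<^sup>2)"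
      using z by (intro mult_left_mono power_mono) auto
    also have "\<dots> = pw \<gamma> 4 * (K powr (1 + \<gamma>) * c\<^sup>2) * r * r" by (simp add: power2_eq_square)
    also have "\<dots> \<le> pw \<gamma> P * m * r" using big2 pos by (intro mult_right_mono) auto
    finally show False by simp
  qed
qed


section \<open>Comparison of the slopes at two contact points\<close>

lemma quad_recenter:
  "quad x p e s1 s2 z = quad x p e s1 s2 y
     + quad y (p + (2 * s1 * (e \<bullet> (y - x))) *\<^sub>R e - (2 * s2) *\<^sub>R (y - x)) e s1 s2 z"
proof -
  define h k where "h = y - x" and "k = z - y"
  have [simp]: "y - x = h" "z - y = k" "z - x = h + k" by (simp_all add: h_def k_def)
  show ?thesis
    unfolding quad_def power2_norm_eq_inner
    by (simp add: inner_simps power2_eq_square algebra_simps inner_commute)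
qed

lemma visc_super_quad_min:
  assumes v: "visc_super lam Lam \<gamma> L \<Omega> v g" and y: "y \<in> \<Omega>" "y \<in> interior S"
    and min: "\<And>z. z \<in> S \<Longrightarrow> v y - quad x p e s1 s2 y \<le> v z - quad x p e s1 s2 z"
    and q: "q = p + (2 * s1 * (e \<bullet> (y - x))) *\<^sub>R e - (2 * s2) *\<^sub>R (y - x)" "norm q \<le> L"
    and s: "norm (e :: real ^ 'n::finite) = 1" "0 < s2" "s2 < s1"
  shows "norm_pow q \<gamma> * (2 * (lam * (s1 - s2) - Lam * (real CARD('n) - 1) * s2)) \<le> g y"
proof -
  have "\<forall>\<^sub>F z in nhds y. v y + quad y q e s1 s2 z \<le> v z"
  proof -
    have "\<forall>\<^sub>F z in nhds y. z \<in> S"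
      using y(2) eventually_nhds interior_subset open_interior by blast
    thus ?thesis
    proof eventually_elim
      case (elim z)
      show ?case using min[OF elim] quad_recenter[of x p e s1 s2 z y] by (simp add: q)
    qed
  qed
  thus ?thesis using v y s q unfolding visc_super_def by blast
qed

text \<open>
  If the slopes \<open>p0\<close>, \<open>p1\<close> at two touching points were far apart, \<open>v\<close> would lie above a convex
  wedge, and a convex quadratic polynomial with gradient of size \<open>|p0| + |p1|\<close> could be fitted
  under that wedge.
\<close>

lemma slope_estimate:
  fixes lam Lam \<gamma> K :: real
  assumes n: "CARD('n::finite) \<ge> 2" and lam: "0 < lam" "lam \<le> Lam" and \<gamma>: "0 \<le> \<gamma>" and K: "0 < K"
  shows "\<exists>c\<ge>2. \<exists>C>0. \<forall>v g (x0 :: real ^ 'n) x1 p0 p1 r L \<Gamma>.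
    visc_super lam Lam \<gamma> L (ball x0 (c * r)) v g \<longrightarrow> continuous_on (cball x0 (c * r)) v \<longrightarrow>
    0 < r \<longrightarrow> dist x0 x1 \<le> r \<longrightarrow>
    touches_below \<gamma> K (cball x0 (c * r)) v x0 p0 \<longrightarrow> touches_below \<gamma> K (cball x0 (c * r)) v x1 p1 \<longrightarrow>
    (\<forall>z\<in>ball x0 (c * r). g z \<le> \<Gamma>) \<longrightarrow> 0 \<le> \<Gamma> \<longrightarrow> 4 * (norm p0 + norm p1) \<le> L \<longrightarrow>
    pw \<gamma> (norm p0 + norm p1) * norm (p1 - p0) \<le> C * (1 + \<Gamma>) * r"
proof -
  define n1 where "n1 = real CARD('n) - 1"
  have n1: "1 \<le> n1" using n by (simp add: n1_def)
  \<comment> \<open>\<open>k1\<close> and \<open>k2\<close> are the curvatures of the barrier in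
    units of \<open>m / R\<close>. \<open>k2\<close> is so small that the Pucci value of the barrier
    stays positive, and \<open>c = 4 / k2\<close> makes its drop \<open>s2 * R^2\<close> on the
    sphere of radius \<open>R = c * r\<close> equal to \<open>4 * m * r\<close>. The value 1/32
    keeps the gradient of the barrier within \<open>m / 8\<close> of its slope at the
    centre.\<close>
  define k1 :: real where "k1 = 1 / 32"
  define k2 where "k2 = k1 * lam / (2 * (lam + Lam * n1))"
  define c where "c = 4 / k2"
  \<comment> \<open>Above the threshold \<open>D * r\<close> both touching errors are at most
    \<open>m * r\<close> by \<open>touch_error_le\<close>; below it the claim is trivial. The factor
    \<open>2 * c\<close> appears because points of the ball of radius \<open>c * r\<close> about
    \<open>x0\<close> have distance at most \<open>c * r + r\<close> from \<open>x1\<close>.\<close>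
  define D where "D = max (pw \<gamma> 8 * (K * (2 * c) powr (1 + 1 / (1 + \<gamma>))) powr (1 + \<gamma>))
     (pw \<gamma> 4 * (K powr (1 + \<gamma>) * (2 * c)\<^sup>2))"
  define C where "C = D + pw \<gamma> 64 * c / (lam * k1)"
  have k1: "0 < k1" by (simp add: k1_def)
  have Ln: "0 < Lam * n1" using lam n1 by (intro mult_pos_pos) auto
  have k2: "0 < k2" "k2 \<le> k1 / 2" "lam * (k1 - k2) - Lam * n1 * k2 = lam * k1 / 2"
  proof -
    show "0 < k2" using lam k1 Ln by (simp add: k2_def)
    show "k2 \<le> k1 / 2" using lam k1 Ln by (simp add: k2_def divide_simps)
    have "k2 * (lam + Lam * n1) = k1 * lam / 2" using lam Ln by (simp add: k2_def divide_simps)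
    thus "lam * (k1 - k2) - Lam * n1 * k2 = lam * k1 / 2" by (simp add: algebra_simps)
  qed
  have kc: "k2 * c = 4" using k2 by (simp add: c_def)
  have c: "2 \<le> c" using k2 by (simp add: c_def k1_def divide_simps)
  have D0: "0 \<le> D" by (simp add: D_def le_max_iff_disj)
  have C: "0 < C" using D0 lam k1 c by (simp add: C_def add_nonneg_pos)
  have main: "pw \<gamma> (norm p0 + norm p1) * norm (p1 - p0) \<le> C * (1 + \<Gamma>) * r"
    if v: "visc_super lam Lam \<gamma> L (ball x0 (c * r)) v g" and cv: "continuous_on (cball x0 (c * r)) v"
      and r: "0 < r" and x1: "dist x0 x1 \<le> r"
      and t0: "touches_below \<gamma> K (cball x0 (c * r)) v x0 p0"
      and t1: "touches_below \<gamma> K (cball x0 (c * r)) v x1 p1"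
      and g: "\<forall>z\<in>ball x0 (c * r). g z \<le> \<Gamma>" and \<Gamma>: "0 \<le> \<Gamma>"
      and L: "4 * (norm p0 + norm p1) \<le> L"
    for v g and x0 x1 p0 p1 :: "real ^ 'n" and r L \<Gamma>
  proof (cases "pw \<gamma> (norm p0 + norm p1) * norm (p1 - p0) \<le> D * r")
    case True
    also have "D * r \<le> C * (1 + \<Gamma>) * r"
    proof -
      have "D \<le> C" using lam k1 c by (simp add: C_def)
      also have "C \<le> C * (1 + \<Gamma>)" using C \<Gamma> by (simp add: algebra_simps)
      finally show ?thesis using r by (simp add: mult_right_mono)
    qed
    finally show ?thesis .
  next
    case False
    define P where "P = norm p0 + norm p1"
    define m where "m = norm (p1 - p0)"
    define R where "R = c * r"
    have R: "0 < R" "k2 * R = 4 * r" "r \<le> R" using c r kc by (auto simp: R_def)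
    have big: "D * r < pw \<gamma> P * m" using False by (simp add: P_def m_def)
    have m: "0 < m"
    proof (rule ccontr)
      assume "\<not> 0 < m"
      hence "m = 0" by (simp add: m_def)
      thus False using big mult_nonneg_nonneg[OF D0, of r] r by simp
    qed
    have mP: "m \<le> P" unfolding m_def P_def by (metis add.commute norm_triangle_ineq4)
    have p0: "(P - m) / 2 \<le> norm p0" and p1: "(P - m) / 2 \<le> norm p1"
      using norm_triangle_ineq2[of p1 p0] norm_triangle_ineq2[of p0 p1]
      by (auto simp: P_def m_def norm_minus_commute field_simps)
    have big': "pw \<gamma> 8 * (K * (2 * c) powr (1 + 1 / (1 + \<gamma>))) powr (1 + \<gamma>) * r \<le> pw \<gamma> P * m"
      "pw \<gamma> 4 * (K powr (1 + \<gamma>) * (2 * c)\<^sup>2) * r \<le> pw \<gamma> P * m"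
    proof -
      have "pw \<gamma> 8 * (K * (2 * c) powr (1 + 1 / (1 + \<gamma>))) powr (1 + \<gamma>) * r \<le> D * r"
        "pw \<gamma> 4 * (K powr (1 + \<gamma>) * (2 * c)\<^sup>2) * r \<le> D * r"
        using r by (auto intro!: mult_right_mono simp: D_def)
      thus "pw \<gamma> 8 * (K * (2 * c) powr (1 + 1 / (1 + \<gamma>))) powr (1 + \<gamma>) * r \<le> pw \<gamma> P * m"
        "pw \<gamma> 4 * (K powr (1 + \<gamma>) * (2 * c)\<^sup>2) * r \<le> pw \<gamma> P * m" using big by linarith+
    qed
    have e0: "v x0 + p0 \<bullet> (z - x0) - v z \<le> m * r" if "z \<in> cball x0 R" for z
    proof (rule touch_error_le[OF t0 _ _ \<gamma> K _ r m mP p0 big'])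
      show "z \<in> cball x0 (c * r)" using that by (simp add: R_def)
      have "norm (z - x0) \<le> R" using that by (simp add: dist_norm norm_minus_commute)
      also have "\<dots> \<le> 2 * c * r" using c r by (simp add: R_def)
      finally show "norm (z - x0) \<le> 2 * c * r" .
    qed (use c in simp)
    have e1: "v x1 + p1 \<bullet> (z - x1) - v z \<le> m * r" if "z \<in> cball x0 R" for z
    proof (rule touch_error_le[OF t1 _ _ \<gamma> K _ r m mP p1 big'])
      show "z \<in> cball x0 (c * r)" using that by (simp add: R_def)
      have "norm (z - x1) \<le> norm (z - x0) + norm (x0 - x1)" 
        using norm_triangle_ineq[of "z - x0" "x0 - x1"] by simp
      also have "\<dots> \<le> R + r" using that x1 by (simp add: dist_norm norm_minus_commute)
      also have "\<dots> \<le> 2 * c * r" using c r R by (simp add: R_def)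
      finally show "norm (z - x1) \<le> 2 * c * r" .
    qed (use c in simp)
    define e where "e = (1 / m) *\<^sub>R (p1 - p0)"
    have e: "norm e = 1" "p1 - p0 = m *\<^sub>R e" using m by (auto simp: e_def m_def)
    have low0: "v x0 + p0 \<bullet> (z - x0) - m * r \<le> v z" if "z \<in> cball x0 R" for z
      using e0[OF that] by simp
    \<comment> \<open>Of the three units \<open>m * r\<close>, two are the touching errors at
      \<open>x0\<close> and \<open>x1\<close>, and one bounds the inner product of
      \<open>p1 - p0\<close> with \<open>x1 - x0\<close>.\<close>
    have low1: "v x0 + p0 \<bullet> (z - x0) + m * (e \<bullet> (z - x0)) - 3 * m * r \<le> v z" if z: "z \<in> cball x0 R" for z
    proof -
      have "x1 \<in> cball x0 R" using x1 R by simp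
      hence "v x0 + p0 \<bullet> (x1 - x0) - m * r \<le> v x1" by (rule low0)
      moreover have "v x1 + p1 \<bullet> (z - x1) - v z \<le> m * r" by (rule e1[OF z])
      moreover have "p0 \<bullet> (x1 - x0) + p1 \<bullet> (z - x1) = p0 \<bullet> (z - x0) + (p1 - p0) \<bullet> (z - x0) - (p1 - p0) \<bullet> (x1 - x0)"
        by (simp add: inner_simps)
      moreover have "(p1 - p0) \<bullet> (x1 - x0) \<le> m * r"
      proof -
        have "m * norm (x1 - x0) \<le> m * r" using x1 m by (intro mult_left_mono) (auto simp: dist_norm norm_minus_commute)
        thus ?thesis using norm_cauchy_schwarz[of "p1 - p0" "x1 - x0"] unfolding m_def by linarith
      qed
      moreover have "(p1 - p0) \<bullet> (z - x0) = m * (e \<bullet> (z - x0))" by (simp add: e)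
      ultimately show ?thesis by linarith
    qed
    \<comment> \<open>A slope strictly between \<open>p0\<close> and \<open>p1\<close>, so that the
      wedge exceeds the affine part of the barrier by at least \<open>m / 4\<close> times the
      distance from its edge. The two candidates differ by \<open>m / 2\<close>, so one of them has
      norm at least \<open>m / 4\<close>; this keeps the gradient factor from vanishing at the
      contact point.\<close>
    obtain \<theta> where \<theta>: "\<theta> = 1/4 \<or> \<theta> = 3/4" and \<theta>m: "m / 4 \<le> norm (p0 + (\<theta> * m) *\<^sub>R e)"
    proof -
      have "(p0 + ((3/4) * m) *\<^sub>R e) - (p0 + ((1/4) * m) *\<^sub>R e) = (m / 2) *\<^sub>R e"
        by (simp add: scaleR_left_diff_distrib[symmetric])
      hence "m / 2 \<le> norm (p0 + ((3/4) * m) *\<^sub>R e) + norm (p0 + ((1/4) * m) *\<^sub>R e)"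
        using norm_triangle_ineq4[of "p0 + ((3/4) * m) *\<^sub>R e" "p0 + ((1/4) * m) *\<^sub>R e"] e m by simp
      thus ?thesis using that[of "1/4"] that[of "3/4"] by linarith
    qed
    have \<theta>P: "P / 2 - 3 / 2 * m \<le> norm (p0 + (\<theta> * m) *\<^sub>R e)"
    proof -
      have "norm p0 - norm ((\<theta> * m) *\<^sub>R e) \<le> norm (p0 + (\<theta> * m) *\<^sub>R e)"
        by (metis norm_diff_ineq)
      moreover have "norm ((\<theta> * m) *\<^sub>R e) \<le> m" using \<theta> e m by auto
      ultimately show ?thesis using p0 by (simp add: field_simps)
    qed
    have \<theta>U: "norm (p0 + (\<theta> * m) *\<^sub>R e) \<le> 2 * P"
    proof -
      have "norm (p0 + (\<theta> * m) *\<^sub>R e) \<le> norm p0 + norm ((\<theta> * m) *\<^sub>R e)" by (rule norm_triangle_ineq)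
      moreover have "norm ((\<theta> * m) *\<^sub>R e) \<le> m" using \<theta> e m by auto
      moreover have "norm p0 \<le> P" by (simp add: P_def)
      ultimately show ?thesis using mP by linarith
    qed
    define s1 s2 where "s1 = m / R * k1" and "s2 = m / R * k2"
    have s: "0 < s2" "s2 < s1" 
    proof -
      show "0 < s2" using m R k2 by (simp add: s2_def)
      have "k2 < k1" using k1 k2 by linarith
      thus "s2 < s1" using m R unfolding s1_def s2_def by (intro mult_strict_left_mono) auto
    qed
    let ?q = "quad x0 (p0 + (\<theta> * m) *\<^sub>R e) e s1 s2"
    have "continuous_on (cball x0 R) (\<lambda>z. v z - ?q z)"
      unfolding quad_def using cv by (intro continuous_intros) (simp add: R_def)
    moreover have "cball x0 R \<noteq> {}" using R by simp
    ultimately obtain y where y: "y \<in> cball x0 R" "\<And>z. z \<in> cball x0 R \<Longrightarrow> v y - ?q y \<le> v z - ?q z"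
      using continuous_attains_inf[OF compact_cball, of x0 R "\<lambda>z. v z - ?q z"] by blast
    \<comment> \<open>On the sphere the wedge absorbs the convex term, and the concave term
      contributes \<open>4 * m * r\<close>, more than the \<open>3 * m * r\<close> lost in the lower
      bounds for \<open>v\<close>. Hence the minimum is interior.\<close>
    have yb: "y \<in> ball x0 R"
    proof (rule ccontr)
      assume "y \<notin> ball x0 R"
      hence h: "norm (y - x0) = R" using y by (simp add: dist_norm norm_minus_commute)
      define \<sigma> where "\<sigma> = e \<bullet> (y - x0)"
      have \<sigma>: "\<bar>\<sigma>\<bar> \<le> R" using Cauchy_Schwarz_ineq2[of e "y - x0"] e h by (simp add: \<sigma>_def)
      have "s1 * \<sigma>\<^sup>2 \<le> m * \<bar>\<sigma>\<bar> / 4"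
      proof -
        have "\<sigma>\<^sup>2 \<le> R * \<bar>\<sigma>\<bar>" using \<sigma> using mult_right_mono[OF \<sigma>, of "\<bar>\<sigma>\<bar>"] by (simp add: power2_eq_square)
        hence "s1 * \<sigma>\<^sup>2 \<le> s1 * (R * \<bar>\<sigma>\<bar>)" using s by (intro mult_left_mono) auto
        also have "\<dots> = k1 * (m * \<bar>\<sigma>\<bar>)" using R by (simp add: s1_def)
        also have "\<dots> \<le> m * \<bar>\<sigma>\<bar> / 4" using m by (simp add: k1_def)
        finally show ?thesis .
      qed
      moreover have "s2 * (norm (y - x0))\<^sup>2 = 4 * (m * r)"
      proof -
        have "s2 * R\<^sup>2 = m * (k2 * R)" using R by (simp add: s2_def power2_eq_square)
        thus ?thesis using R h by simp
      qed
      moreover have "\<theta> * m * \<sigma> + m * \<bar>\<sigma>\<bar> / 4 \<le> max 0 (m * \<sigma>)"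
      proof -
        define w where "w = m * \<sigma>"
        have "\<theta> * w + \<bar>w\<bar> / 4 \<le> max 0 w" using \<theta> by (elim disjE; hypsubst) (auto simp: max_def abs_if)
        moreover have "m * \<bar>\<sigma>\<bar> = \<bar>w\<bar>" using m by (simp add: w_def abs_mult)
        ultimately show ?thesis by (simp add: w_def mult.assoc)
      qed
      moreover have "v x0 + p0 \<bullet> (y - x0) + max 0 (m * \<sigma>) - 3 * m * r \<le> v y"
      proof -
        have "0 \<le> m * r" using m r by simp
        thus ?thesis using low0[OF y(1)] low1[OF y(1)] by (auto simp: max_def \<sigma>_def)
      qed
      moreover have "?q y = p0 \<bullet> (y - x0) + \<theta> * m * \<sigma> + s1 * \<sigma>\<^sup>2 - s2 * (norm (y - x0))\<^sup>2"
        by (simp add: quad_def inner_simps \<sigma>_def algebra_simps)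
      moreover have "?q x0 = 0" by (simp add: quad_def)
      moreover have "v y - ?q y \<le> v x0 - ?q x0" using R by (intro y) auto
      moreover have "0 < m * r" using m r by simp
      ultimately show False by linarith
    qed
    define q where "q = (p0 + (\<theta> * m) *\<^sub>R e) + (2 * s1 * (e \<bullet> (y - x0))) *\<^sub>R e - (2 * s2) *\<^sub>R (y - x0)"
    have qd: "norm (q - (p0 + (\<theta> * m) *\<^sub>R e)) \<le> m / 8"
    proof -
      have h: "norm (y - x0) \<le> R" using yb by (simp add: dist_norm norm_minus_commute)
      have \<sigma>: "\<bar>e \<bullet> (y - x0)\<bar> \<le> R" using Cauchy_Schwarz_ineq2[of e "y - x0"] e h by simp
      have "norm (q - (p0 + (\<theta> * m) *\<^sub>R e)) = norm ((2 * s1 * (e \<bullet> (y - x0))) *\<^sub>R e - (2 * s2) *\<^sub>R (y - x0))"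
        by (simp add: q_def algebra_simps)
      also have "\<dots> \<le> norm ((2 * s1 * (e \<bullet> (y - x0))) *\<^sub>R e) + norm ((2 * s2) *\<^sub>R (y - x0))"
        by (rule norm_triangle_ineq4)
      also have "\<dots> = 2 * s1 * \<bar>e \<bullet> (y - x0)\<bar> + 2 * s2 * norm (y - x0)" using e s by (simp add: abs_mult)
      also have "\<dots> \<le> 2 * s1 * R + 2 * s2 * R" using \<sigma> h s by (intro add_mono mult_left_mono) auto
      also have "\<dots> = 2 * m * (k1 + k2)" using R by (simp add: s1_def s2_def algebra_simps)
      also have "\<dots> \<le> 2 * m * (2 * k1)" using m k2 k1 by (intro mult_left_mono) auto
      finally show ?thesis by (simp add: k1_def)
    qed
    \<comment> \<open>The slope \<open>q\<close> has norm at least \<open>m / 8\<close> and at least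
      \<open>P / 2 - 13 / 8 * m\<close>. The first bound suffices if \<open>m >= P / 8\<close>, the
      second if \<open>m < P / 8\<close>.\<close>
    have q: "P / 64 \<le> norm q" "norm q \<le> 4 * P"
      using qd \<theta>m \<theta>P \<theta>U mP m norm_triangle_ineq2[of "p0 + (\<theta> * m) *\<^sub>R e" q] norm_triangle_ineq2[of q "p0 + (\<theta> * m) *\<^sub>R e"]
      by (auto simp: norm_minus_commute)
    have "norm_pow q \<gamma> * (2 * (lam * (s1 - s2) - Lam * (real CARD('n) - 1) * s2)) \<le> g y"
      using yb q(2) L s e(1) y(2)
      by (intro visc_super_quad_min[OF v, where S = "cball x0 R" and x = x0 and p = "p0 + (\<theta> * m) *\<^sub>R e"])
        (auto simp: R_def q_def P_def)
    also have "\<dots> \<le> \<Gamma>" using g yb by (simp add: R_def)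
    also have "2 * (lam * (s1 - s2) - Lam * (real CARD('n) - 1) * s2) = m / R * (lam * k1)"
    proof -
      have "2 * (lam * (s1 - s2) - Lam * n1 * s2) = m / R * (2 * (lam * (k1 - k2) - Lam * n1 * k2))"
        by (simp add: s1_def s2_def algebra_simps)
      also have "\<dots> = m / R * (lam * k1)" unfolding k2 by simp
      finally show ?thesis by (simp only: n1_def)
    qed
    finally have *: "pw \<gamma> (norm q) * (m / R * (lam * k1)) \<le> \<Gamma>" by (simp add: norm_pow_eq)
    have "pw \<gamma> P \<le> pw \<gamma> 64 * pw \<gamma> (norm q)"
      using pw_mono[OF \<gamma>, of P "64 * norm q"] q m mP by (simp add: pw_mult)
    hence "pw \<gamma> P * (m / R * (lam * k1)) \<le> pw \<gamma> 64 * pw \<gamma> (norm q) * (m / R * (lam * k1))"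
      using m R lam k1 by (intro mult_right_mono) auto
    also have "\<dots> \<le> pw \<gamma> 64 * \<Gamma>" using mult_left_mono[OF *, of "pw \<gamma> 64"] by (simp add: mult.assoc)
    finally have "pw \<gamma> P * m \<le> pw \<gamma> 64 * c / (lam * k1) * \<Gamma> * r"
      using R(1) lam k1 by (simp add: divide_simps R_def mult_ac)
    also have "\<dots> \<le> C * (1 + \<Gamma>) * r"
    proof -
      have "pw \<gamma> 64 * c / (lam * k1) \<le> C" using D0 by (simp add: C_def)
      hence "pw \<gamma> 64 * c / (lam * k1) * \<Gamma> \<le> C * (1 + \<Gamma>)"
        using \<Gamma> C by (intro mult_mono) auto
      thus ?thesis using r by (intro mult_right_mono) auto
    qed
    finally show ?thesis by (simp add: P_def m_def)
  qed
  show ?thesis using c C main by blast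
qed

section \<open>Lebesgue points and Rademacher's theorem\<close>

definition density_point :: "'a::euclidean_space set \<Rightarrow> 'a \<Rightarrow> bool" where
  "density_point E x \<longleftrightarrow>
     ((\<lambda>r. measure lebesgue (ball x r - E) / measure lebesgue (ball x r)) \<longlongrightarrow> 0) (at_right 0)"

text \<open>Enclose \<open>E\<close> in an open \<open>U\<close> with \<open>U - E\<close> of
  measure below \<open>eta * epsilon\<close>. The deficient balls inside \<open>U\<close> form a
  Vitali cover; disjoint ones have more than the fraction \<open>eta\<close> of their measure in
  \<open>U - E\<close>, so their union has measure at most \<open>epsilon\<close>.\<close>

lemma negligible_density_deficient:
  fixes E :: "'a::euclidean_space set"
  assumes E: "E \<in> sets lebesgue" and \<eta>: "0 < \<eta>"
  shows "negligible {x \<in> E. \<forall>d>0. \<exists>r. 0 < r \<and> r < d \<and>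
     \<eta> * measure lebesgue (ball x r) < measure lebesgue (ball x r - E)}" (is "negligible ?Z")
  unfolding negligible_outer_le
proof (intro allI impI)
  fix \<epsilon> :: real assume \<epsilon>: "0 < \<epsilon>"
  obtain U where U: "open U" "E \<subseteq> U" "U - E \<in> lmeasurable" "emeasure lebesgue (U - E) < ennreal (\<eta> * \<epsilon>)"
    using sets_lebesgue_outer_open[OF E, of "\<eta> * \<epsilon>"] \<epsilon> \<eta> by auto
  have mU: "measure lebesgue (U - E) \<le> \<eta> * \<epsilon>"
    using U(3,4) \<epsilon> \<eta> by (simp add: emeasure_eq_measure2 ennreal_less_iff)
  define K where "K = {(x, r). x \<in> E \<and> 0 < r \<and> ball x r \<subseteq> U \<and>
     \<eta> * measure lebesgue (ball x r) < measure lebesgue (ball x r - E)}"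
  have cov: "\<exists>i. i \<in> K \<and> x \<in> ball (fst i) (snd i) \<and> snd i < d" if x: "x \<in> ?Z" and d: "0 < d" for x d
  proof -
    have xE: "x \<in> E" and xd: "\<And>d. 0 < d \<Longrightarrow> \<exists>r. 0 < r \<and> r < d \<and>
        \<eta> * measure lebesgue (ball x r) < measure lebesgue (ball x r - E)" using x by auto
    obtain d' where d': "0 < d'" "ball x d' \<subseteq> U" using U xE openE by blast
    obtain r where r: "0 < r" "r < min d d'" "\<eta> * measure lebesgue (ball x r) < measure lebesgue (ball x r - E)"
      using xd[of "min d d'"] d d' by auto
    have "ball x r \<subseteq> ball x d'" using r by (intro subset_ball) auto
    hence "(x, r) \<in> K" using xE r d' by (auto simp: K_def)
    thus ?thesis using r by (intro exI[of _ "(x, r)"]) auto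
  qed
  obtain C where C: "countable C" "C \<subseteq> K"
     "pairwise (\<lambda>i j. disjnt (ball (fst i) (snd i)) (ball (fst j) (snd j))) C"
     "negligible (?Z - (\<Union>i\<in>C. ball (fst i) (snd i)))"
    using Vitali_covering_theorem_balls[of ?Z K fst snd] cov by blast
  have bnd: "measure lebesgue (\<Union>i\<in>I. ball (fst i) (snd i)) \<le> \<epsilon>" if I: "I \<subseteq> C" "finite I" for I
  proof -
    have "\<eta> * measure lebesgue (\<Union>i\<in>I. ball (fst i) (snd i))
        \<le> \<eta> * (\<Sum>i\<in>I. measure lebesgue (ball (fst i) (snd i)))"
      using I \<eta> by (intro mult_left_mono measure_UNION_le) auto
    also have "\<dots> \<le> (\<Sum>i\<in>I. measure lebesgue (ball (fst i) (snd i) - E))"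
      unfolding sum_distrib_left using I C(2) by (intro sum_mono) (force simp: K_def)
    also have "\<dots> = measure lebesgue (\<Union>i\<in>I. ball (fst i) (snd i) - E)"
    proof (rule measure_UNION'[symmetric, OF I(2)])
      show "ball (fst i) (snd i) - E \<in> lmeasurable" for i
        using E by (intro fmeasurableI2[OF lmeasurable_ball[of "fst i" "snd i"]]) auto
      show "pairwise (\<lambda>i j. disjnt (ball (fst i) (snd i) - E) (ball (fst j) (snd j) - E)) I"
        using C(3) I(1) unfolding pairwise_def disjnt_def by blast
    qed
    also have "\<dots> \<le> measure lebesgue (U - E)"
    proof (rule measure_mono_fmeasurable[OF _ _ U(3)])
      show "(\<Union>i\<in>I. ball (fst i) (snd i) - E) \<subseteq> U - E" using I C(2) by (fastforce simp: K_def)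
      show "(\<Union>i\<in>I. ball (fst i) (snd i) - E) \<in> sets lebesgue" using I E by (intro sets.finite_UN) auto
    qed
    finally have "\<eta> * measure lebesgue (\<Union>i\<in>I. ball (fst i) (snd i)) \<le> \<eta> * \<epsilon>" using mU by linarith
    thus ?thesis using \<eta> by simp
  qed
  let ?T = "(?Z - (\<Union>i\<in>C. ball (fst i) (snd i))) \<union> (\<Union>i\<in>C. ball (fst i) (snd i))"
  have L: "(\<Union>i\<in>C. ball (fst i) (snd i)) \<in> lmeasurable"
    by (rule fmeasurable_UN_bound[OF C(1) _ bnd]) auto
  have "measure lebesgue (\<Union>i\<in>C. ball (fst i) (snd i)) \<le> \<epsilon>"
    by (rule measure_UN_bound[OF C(1) _ bnd]) auto
  moreover have "measure lebesgue ?T \<le> measure lebesgue (?Z - (\<Union>i\<in>C. ball (fst i) (snd i))) + measure lebesgue (\<Union>i\<in>C. ball (fst i) (snd i))"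
    by (rule measure_Un_le) (use C(4) L in \<open>auto simp: negligible_iff_measure fmeasurableD\<close>)
  ultimately have "measure lebesgue ?T \<le> \<epsilon>" using C(4) by (simp add: negligible_iff_measure)
  moreover have "?T \<in> lmeasurable" 
    by (rule fmeasurable.Un[OF _ L]) (use C(4) in \<open>simp only: negligible_iff_measure\<close>)
  ultimately show "\<exists>T. ?Z \<subseteq> T \<and> T \<in> lmeasurable \<and> measure lebesgue T \<le> \<epsilon>"
    by (intro exI[of _ ?T]) auto
qed

lemma negligible_not_density_point:
  fixes E :: "'a::euclidean_space set"
  assumes E: "E \<in> sets lebesgue"
  shows "negligible {x \<in> E. \<not> density_point E x}"
proof -
  let ?Z = "\<lambda>\<eta>. {x \<in> E. \<forall>d>0. \<exists>r. 0 < r \<and> r < d \<and>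
     \<eta> * measure lebesgue (ball x r) < measure lebesgue (ball x r - E)}"
  have "negligible (\<Union>k. ?Z (1 / Suc k))"
    by (rule negligible_countable_Union) (use negligible_density_deficient[OF E] in \<open>auto simp only: image_iff zero_less_divide_1_iff of_nat_0_less_iff\<close>)
  moreover have "{x \<in> E. \<not> density_point E x} \<subseteq> (\<Union>k. ?Z (1 / Suc k))"
  proof (rule subsetI, rule ccontr)
    fix x assume x': "x \<in> {x \<in> E. \<not> density_point E x}" and n: "x \<notin> (\<Union>k. ?Z (1 / Suc k))"
    hence x: "x \<in> E" by simp
    have "density_point E x"
      unfolding density_point_def
    proof (rule tendstoI)
      fix e :: real assume e: "0 < e"
      then obtain k where k: "1 / real (Suc k) < e" by (metis nat_approx_posE)
      obtain d where d: "d > 0" "\<And>r. 0 < r \<Longrightarrow> r < d \<Longrightarrow>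
          \<not> 1 / Suc k * measure lebesgue (ball x r) < measure lebesgue (ball x r - E)"
        using n x by blast
      have "\<forall>\<^sub>F r in at_right 0. r \<in> {0<..<d}" using d eventually_at_right_real by blast
      thus "\<forall>\<^sub>F r in at_right 0. dist (measure lebesgue (ball x r - E) / measure lebesgue (ball x r)) 0 < e"
      proof eventually_elim
        case (elim r)
        have p: "0 < measure lebesgue (ball x r)" using elim by (simp add: content_ball_pos)
        have "measure lebesgue (ball x r - E) \<le> 1 / Suc k * measure lebesgue (ball x r)"
          using d(2)[of r] elim by simp
        hence "measure lebesgue (ball x r - E) / measure lebesgue (ball x r) \<le> 1 / Suc k"
          using p by (simp add: divide_le_eq)
        thus ?case using k p by simp
      qed
    qed
    thus False using x' by simp
  qed
  ultimately show ?thesis by (rule negligible_subset)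
qed

definition lebesgue_point :: "('a::euclidean_space \<Rightarrow> real) \<Rightarrow> 'a \<Rightarrow> bool" where
  "lebesgue_point h x \<longleftrightarrow> (\<forall>\<epsilon>>0. \<forall>\<^sub>F r in at_right 0.
     (LINT y:ball x r|lebesgue. \<bar>h y - h x\<bar>) \<le> \<epsilon> * measure lebesgue (ball x r))"

lemma set_integrable_bounded_ball:
  fixes h :: "'a::euclidean_space \<Rightarrow> real"
  assumes "h \<in> borel_measurable lebesgue" "\<And>x. \<bar>h x\<bar> \<le> B"
  shows "set_integrable lebesgue (ball x r) h"
  unfolding set_integrable_def
proof (rule Bochner_Integration.integrable_bound)
  show "integrable lebesgue (\<lambda>y. B * indicator (ball x r) y :: real)"
    using lmeasurable_ball[of x r] unfolding lmeasurable_iff_integrable by (rule integrable_mult_right)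
  show "AE y in lebesgue. norm (indicator (ball x r) y *\<^sub>R h y) \<le> norm (B * indicator (ball x r) y)"
    using assms(2) by (intro AE_I2) (auto simp: indicator_def, meson abs_ge_self order_trans)
  show "(\<lambda>y. indicator (ball x r) y *\<^sub>R h y) \<in> borel_measurable lebesgue"
    by (intro borel_measurable_scaleR borel_measurable_indicator assms) auto
qed

text \<open>On a level set of the integer part of \<open>h * Suc k\<close> the function varies by at
  most \<open>1 / Suc k\<close>. A point that for every \<open>k\<close> is a density point of its
  own level set is a Lebesgue point, because off the level set the integrand is at most
  \<open>2 * B\<close> on a set of small relative measure.\<close>

lemma negligible_not_lebesgue_point:
  fixes h :: "'a::euclidean_space \<Rightarrow> real"
  assumes h: "h \<in> borel_measurable lebesgue" and B: "\<And>x. \<bar>h x\<bar> \<le> B"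
  shows "negligible {x. \<not> lebesgue_point h x}"
proof -
  define E where "E j k = {x. \<lfloor>h x * real (Suc k)\<rfloor> = j}" for j :: int and k :: nat
  have E: "E j k \<in> sets lebesgue" for j k
  proof -
    have "(\<lambda>x. \<lfloor>h x * real (Suc k)\<rfloor>) \<in> measurable lebesgue (count_space UNIV)"
      using h by measurable
    from measurable_sets[OF this, of "{j}"] show ?thesis by (simp add: E_def vimage_def)
  qed
  have B0: "0 \<le> B" using B[of undefined] by linarith
  have "negligible (\<Union>k. \<Union>j. {x \<in> E j k. \<not> density_point (E j k) x})"
    by (intro negligible_countable_Union) (auto intro!: negligible_countable_Union negligible_not_density_point E)
  moreover have "{x. \<not> lebesgue_point h x} \<subseteq> (\<Union>k. \<Union>j. {x \<in> E j k. \<not> density_point (E j k) x})"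
  proof (rule subsetI, rule ccontr)
    fix x assume nl: "x \<in> {x. \<not> lebesgue_point h x}"
      and n: "x \<notin> (\<Union>k. \<Union>j. {x \<in> E j k. \<not> density_point (E j k) x})"
    have "lebesgue_point h x"
      unfolding lebesgue_point_def
    proof (intro allI impI)
      fix \<epsilon> :: real assume \<epsilon>: "0 < \<epsilon>"
      then obtain k where k: "1 / real (Suc k) < \<epsilon> / 2" by (metis half_gt_zero nat_approx_posE)
      define j where "j = \<lfloor>h x * real (Suc k)\<rfloor>"
      have "density_point (E j k) x" using n by (auto simp: E_def j_def)
      hence "\<forall>\<^sub>F r in at_right 0. measure lebesgue (ball x r - E j k) / measure lebesgue (ball x r) < \<epsilon> / (4 * B + 1)"
        unfolding density_point_def using \<epsilon> B0 by (intro order_tendstoD) auto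
      moreover have "\<forall>\<^sub>F r in at_right (0::real). 0 < r" by (rule eventually_at_right_less)
      ultimately show "\<forall>\<^sub>F r in at_right 0. (LINT y:ball x r|lebesgue. \<bar>h y - h x\<bar>) \<le> \<epsilon> * measure lebesgue (ball x r)"
      proof eventually_elim
        case (elim r)
        have p: "0 < measure lebesgue (ball x r)" using elim by (simp add: content_ball_pos)
        have m: "measure lebesgue (ball x r - E j k) \<le> \<epsilon> / (4 * B + 1) * measure lebesgue (ball x r)"
          using elim(1) p by (simp add: divide_less_eq)
        have fm: "ball x r - E j k \<in> lmeasurable"
          using E[of j k] by (intro fmeasurableI2[OF lmeasurable_ball[of x r]]) auto
        let ?u = "\<lambda>y. 1 / Suc k * indicator (ball x r) y + 2 * B * indicator (ball x r - E j k) y :: real"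
        have iu: "integrable lebesgue ?u"
          using fm lmeasurable_ball[of x r] unfolding lmeasurable_iff_integrable
          by (intro Bochner_Integration.integrable_add integrable_mult_right)
        have "(LINT y:ball x r|lebesgue. \<bar>h y - h x\<bar>) \<le> (LINT y|lebesgue. ?u y)"
          unfolding set_lebesgue_integral_def
        proof (rule integral_mono[OF _ iu])
          have "set_integrable lebesgue (ball x r) (\<lambda>y. \<bar>h y - h x\<bar>)"
          proof (rule set_integrable_bounded_ball)
            show "(\<lambda>y. \<bar>h y - h x\<bar>) \<in> borel_measurable lebesgue"
              by (intro borel_measurable_abs borel_measurable_diff h) simp
            show "\<bar>\<bar>h y - h x\<bar>\<bar> \<le> 2 * B" for y using B[of x] B[of y] by linarith
          qed
          thus "integrable lebesgue (\<lambda>y. indicator (ball x r) y *\<^sub>R \<bar>h y - h x\<bar>)"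
            by (simp add: set_integrable_def)
          fix y
          have "\<bar>h y - h x\<bar> \<le> 2 * B" using B[of x] B[of y] by linarith
          moreover have "\<bar>h y - h x\<bar> \<le> 1 / Suc k" if "y \<in> E j k"
          proof -
            have f: "\<lfloor>h y * real (Suc k)\<rfloor> = \<lfloor>h x * real (Suc k)\<rfloor>" using that by (simp add: E_def j_def)
            have "\<bar>h y * real (Suc k) - h x * real (Suc k)\<bar> \<le> 1"
              using f by linarith
            hence "\<bar>h y - h x\<bar> * real (Suc k) \<le> 1"
              by (metis abs_mult abs_of_nat left_diff_distrib)
            thus ?thesis by (simp add: field_simps)
          qed
          ultimately show "indicator (ball x r) y *\<^sub>R \<bar>h y - h x\<bar> \<le> ?u y"
            using B0 by (auto simp: indicator_def intro: add_increasing)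
        qed
        also have "\<dots> = 1 / Suc k * measure lebesgue (ball x r) + 2 * B * measure lebesgue (ball x r - E j k)"
          using fm lmeasurable_ball[of x r] unfolding lmeasurable_iff_integrable
          by (subst Bochner_Integration.integral_add) (auto intro!: integrable_mult_right)
        also have "\<dots> \<le> \<epsilon> / 2 * measure lebesgue (ball x r) + 2 * B * (\<epsilon> / (4 * B + 1) * measure lebesgue (ball x r))"
          using k p m B0 by (intro add_mono mult_left_mono mult_right_mono) auto
        also have "\<dots> \<le> \<epsilon> * measure lebesgue (ball x r)"
        proof -
          have "2 * B * (\<epsilon> / (4 * B + 1)) \<le> \<epsilon> / 2" using B0 \<epsilon> by (simp add: divide_simps)
          hence "2 * B * (\<epsilon> / (4 * B + 1)) * measure lebesgue (ball x r) \<le> \<epsilon> / 2 * measure lebesgue (ball x r)"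
            using p by (intro mult_right_mono) auto
          thus ?thesis by (simp only: mult.assoc)
        qed
        finally show ?case .
      qed
    qed
    thus False using nl by simp
  qed
  ultimately show ?thesis by (rule negligible_subset)
qed

section \<open>Measure of images under locally Lipschitz maps\<close>

lemma norm_diff_le_cube:
  fixes x y u v :: "'a::euclidean_space" and s :: real
  assumes "x \<in> cbox u v" "y \<in> cbox u v" "\<And>i. i \<in> Basis \<Longrightarrow> v \<bullet> i - u \<bullet> i = s"
  shows "norm (x - y) \<le> DIM('a) * s"
proof -
  have "norm (x - y) \<le> (\<Sum>i\<in>Basis. \<bar>(x - y) \<bullet> i\<bar>)" by (rule norm_le_l1)
  also have "\<dots> \<le> (\<Sum>i\<in>(Basis::'a set). s)"
  proof (rule sum_mono)
    fix i :: 'a assume i: "i \<in> Basis"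
    show "\<bar>(x - y) \<bullet> i\<bar> \<le> s"
      using assms(1,2) assms(3)[OF i] i by (auto simp: mem_box inner_simps abs_le_iff) (smt (verit))+
  qed
  finally show ?thesis by simp
qed

text \<open>A one-sided area inequality with a crude constant. The Lipschitz constant
  \<open>f x\<close> is valid on a neighbourhood whose size depends on \<open>x\<close>, so
  \<open>covering_lemma\<close> is used to adapt dyadic cubes to these neighbourhoods. Each cube is
  compared only with its tag: its image lies in a ball about the image of the tag, of volume
  \<open>c * f ^ n\<close> times that of the cube. The \<open>+ 1\<close> pays for replacing
  \<open>f\<close> at the tag by \<open>f\<close> at the other points of the cube.\<close>

lemma local_lipschitz_image_measure:
  fixes T :: "'a::euclidean_space \<Rightarrow> 'a" and f :: "'a \<Rightarrow> real"
  assumes K: "K \<in> sets lebesgue" "bounded K" "K \<subseteq> \<Omega>" and \<Omega>: "open \<Omega>"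
    and f: "continuous_on \<Omega> f" "\<And>x. x \<in> \<Omega> \<Longrightarrow> 0 \<le> f x \<and> f x \<le> B"
    and lip: "\<And>x. x \<in> K \<Longrightarrow> \<exists>r>0. \<forall>y\<in>K. dist x y < r \<longrightarrow> dist (T x) (T y) \<le> f x * dist x y"
    and Y: "Y \<subseteq> T ` K" "Y \<in> lmeasurable"
  shows "measure lebesgue Y \<le> measure lebesgue (ball (0::'a) 1) * DIM('a) ^ DIM('a)
           * (LINT x:K|lebesgue. (f x + 1) ^ DIM('a))"
proof (rule field_le_epsilon)
  fix e :: real assume e: "0 < e"
  let ?n = "DIM('a)"
  define c where "c = measure lebesgue (ball (0::'a) 1) * ?n ^ ?n"
  have c: "0 < c" by (auto simp: c_def content_ball_pos)
  show "measure lebesgue Y \<le> c * (LINT x:K|lebesgue. (f x + 1) ^ ?n) + e"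
  proof (cases "K = {}")
    case True thus ?thesis using e Y by (simp add: set_lebesgue_integral_def)
  next
    case False
    then have B0: "0 \<le> B" using f K by (meson ex_in_conv order_trans subsetD)
    obtain N where N: "0 < N" "\<And>x. x \<in> K \<Longrightarrow> norm x < N"
      using K(2) by (metis bounded_pos_less)
    have Kb: "K \<subseteq> cbox (- N *\<^sub>R One) (N *\<^sub>R One)"
    proof
      fix x assume "x \<in> K"
      hence "\<bar>x \<bullet> i\<bar> \<le> N" if "i \<in> Basis" for i using N(2)[of x] Basis_le_norm[OF that, of x] by linarith
      thus "x \<in> cbox (- N *\<^sub>R One) (N *\<^sub>R One)"
        unfolding mem_box by (auto simp: abs_le_iff) (smt (verit, best))+
    qed
    \<comment> \<open>The cubes may spill out of \<open>K\<close> by this measure. There the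
      integrand is bounded only by \<open>(B + 1) ^ n\<close>, and the excess must cost at most
      \<open>e\<close>.\<close>
    define \<epsilon> where "\<epsilon> = e / (c * (B + 1) ^ ?n)"
    have \<epsilon>: "0 < \<epsilon>" using e c B0 by (simp add: \<epsilon>_def)
    obtain U' where U': "open U'" "K \<subseteq> U'" "U' - K \<in> lmeasurable" "emeasure lebesgue (U' - K) < ennreal \<epsilon>"
      using sets_lebesgue_outer_open[OF K(1) \<epsilon>] by auto
    define U where "U = U' \<inter> \<Omega> \<inter> ball 0 N"
    have U: "open U" "K \<subseteq> U" "U \<subseteq> \<Omega>" "U \<in> lmeasurable"
      using U' K(3) \<Omega> N(2) by (auto simp: U_def open_Int intro!: lmeasurable_open bounded_Int)
    have UK: "U - K \<in> lmeasurable"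
      using U(4) K(1) by (intro fmeasurableI2[OF U(4)]) (auto simp: fmeasurableD)
    have "measure lebesgue (U - K) \<le> measure lebesgue (U' - K)"
      using U' UK by (intro measure_mono_fmeasurable) (auto simp: U_def fmeasurableD)
    moreover have "measure lebesgue (U' - K) < \<epsilon>"
      using U'(3,4) \<epsilon> by (simp add: emeasure_eq_measure2 ennreal_less_iff)
    ultimately have mUK: "measure lebesgue (U - K) \<le> \<epsilon>" by linarith
    have "\<exists>r>0. ball x r \<subseteq> U \<and> (\<forall>y\<in>ball x r. f x \<le> f y + 1) \<and>
        (\<forall>y\<in>K \<inter> ball x r. dist (T x) (T y) \<le> f x * dist x y)" if x: "x \<in> K" for x
    proof -
      obtain r1 where r1: "r1 > 0" "ball x r1 \<subseteq> U" using U x openE by blast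
      have "isCont f x" using f(1) \<Omega> K(3) x continuous_on_eq_continuous_at by blast
      then obtain r2 where r2: "r2 > 0" "\<And>y. dist y x < r2 \<Longrightarrow> dist (f y) (f x) < 1"
        unfolding continuous_at_eps_delta using zero_less_one by blast
      obtain r3 where r3: "r3 > 0" "\<And>y. y \<in> K \<Longrightarrow> dist x y < r3 \<Longrightarrow> dist (T x) (T y) \<le> f x * dist x y"
        using lip[OF x] by blast
      show ?thesis
      proof (intro exI[of _ "min r1 (min r2 r3)"] conjI ballI)
        fix y assume "y \<in> ball x (min r1 (min r2 r3))"
        thus "f x \<le> f y + 1" using r2(2)[of y] by (simp add: dist_commute dist_real_def)
      qed (use r1 r2 r3 in auto)
    qed
    then obtain \<rho> where \<rho>: "\<And>x. x \<in> K \<Longrightarrow> 0 < \<rho> x" "\<And>x. x \<in> K \<Longrightarrow> ball x (\<rho> x) \<subseteq> U"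
        "\<And>x y. x \<in> K \<Longrightarrow> y \<in> ball x (\<rho> x) \<Longrightarrow> f x \<le> f y + 1"
        "\<And>x y. x \<in> K \<Longrightarrow> y \<in> K \<inter> ball x (\<rho> x) \<Longrightarrow> dist (T x) (T y) \<le> f x * dist x y"
      by metis
    define \<gamma> where "\<gamma> x = ball x (if x \<in> K then \<rho> x else 1)" for x
    have g: "gauge \<gamma>" using \<rho>(1) by (simp add: gauge_def \<gamma>_def)
    have bne: "box (- N *\<^sub>R One) (N *\<^sub>R One :: 'a) \<noteq> {}" using N by (simp add: box_ne_empty)
    obtain \<D> where D: "countable \<D>" "\<Union>\<D> \<subseteq> cbox (- N *\<^sub>R One) (N *\<^sub>R One)"
      "\<And>Q. Q \<in> \<D> \<Longrightarrow> interior Q \<noteq> {} \<and> (\<exists>c d. Q = cbox c d)"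
      "pairwise (\<lambda>A B. interior A \<inter> interior B = {}) \<D>"
      "\<And>Q. Q \<in> \<D> \<Longrightarrow> \<exists>x \<in> K \<inter> Q. Q \<subseteq> \<gamma> x"
      "\<And>u v. cbox u v \<in> \<D> \<Longrightarrow> \<exists>n. \<forall>i \<in> Basis. v \<bullet> i - u \<bullet> i = (N *\<^sub>R One \<bullet> i - (- N *\<^sub>R One) \<bullet> i) / 2^n"
      "K \<subseteq> \<Union>\<D>"
      by (rule covering_lemma[OF Kb bne g]) (rule that; assumption)
    have "\<forall>Q\<in>\<D>. \<exists>x. x \<in> K \<and> x \<in> Q \<and> Q \<subseteq> ball x (\<rho> x)"
    proof
      fix Q assume "Q \<in> \<D>"
      then obtain x where "x \<in> K \<inter> Q" "Q \<subseteq> \<gamma> x" using D(5) by blast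
      thus "\<exists>x. x \<in> K \<and> x \<in> Q \<and> Q \<subseteq> ball x (\<rho> x)" by (intro exI[of _ x]) (simp add: \<gamma>_def)
    qed
    from bchoice[OF this] obtain \<xi> where
      "\<forall>Q\<in>\<D>. \<xi> Q \<in> K \<and> \<xi> Q \<in> Q \<and> Q \<subseteq> ball (\<xi> Q) (\<rho> (\<xi> Q))" by blast
    hence \<xi>: "\<And>Q. Q \<in> \<D> \<Longrightarrow> \<xi> Q \<in> K" "\<And>Q. Q \<in> \<D> \<Longrightarrow> \<xi> Q \<in> Q" "\<And>Q. Q \<in> \<D> \<Longrightarrow> Q \<subseteq> ball (\<xi> Q) (\<rho> (\<xi> Q))"
      by blast+
    have "\<exists>s::real. 0 \<le> s \<and> measure lebesgue (interior Q) = s ^ ?n \<and> (\<forall>x\<in>Q. \<forall>y\<in>Q. norm (x - y) \<le> real ?n * s)" if Q: "Q \<in> \<D>" for Q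
    proof -
      obtain u v where uv: "Q = cbox u v" using D(3)[OF Q] by blast
      obtain k where k: "\<And>i. i \<in> Basis \<Longrightarrow> v \<bullet> i - u \<bullet> i = 2 * N / 2 ^ k"
        using D(6)[of u v] Q uv by auto
      have le: "u \<bullet> i \<le> v \<bullet> i" if "i \<in> Basis" for i 
      proof -
        have "0 < 2 * N / 2 ^ k" using N by simp
        thus ?thesis using k[OF that] by linarith
      qed
      have "measure lebesgue (interior Q) = (\<Prod>i\<in>Basis. (v - u) \<bullet> i)"
        using le by (simp add: uv interior_cbox measure_lborel_box_eq)
      also have "\<dots> = (\<Prod>i\<in>(Basis::'a set). 2 * N / 2 ^ k)" by (intro prod.cong) (simp_all add: inner_diff_left k)
      also have "\<dots> = (2 * N / 2 ^ k) ^ ?n" by simp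
      finally have "measure lebesgue (interior Q) = (2 * N / 2 ^ k) ^ ?n" .
      moreover have "0 \<le> 2 * N / 2 ^ k" using N by simp
      moreover have "\<forall>x\<in>Q. \<forall>y\<in>Q. norm (x - y) \<le> real ?n * (2 * N / 2 ^ k)"
        using norm_diff_le_cube[of _ u v _ "2 * N / 2 ^ k"] k uv by blast
      ultimately show ?thesis by blast
    qed
    hence "\<forall>Q\<in>\<D>. \<exists>s::real. 0 \<le> s \<and> measure lebesgue (interior Q) = s ^ ?n \<and> (\<forall>x\<in>Q. \<forall>y\<in>Q. norm (x - y) \<le> real ?n * s)"
      by blast
    from bchoice[OF this] obtain s :: "'a set \<Rightarrow> real" where "\<forall>Q\<in>\<D>. 0 \<le> s Q \<and> measure lebesgue (interior Q) = s Q ^ ?n \<and>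
      (\<forall>x\<in>Q. \<forall>y\<in>Q. norm (x - y) \<le> real ?n * s Q)" by blast
    hence s: "\<And>Q. Q \<in> \<D> \<Longrightarrow> 0 \<le> s Q" "\<And>Q. Q \<in> \<D> \<Longrightarrow> measure lebesgue (interior Q) = s Q ^ ?n"
      "\<And>Q x y. Q \<in> \<D> \<Longrightarrow> x \<in> Q \<Longrightarrow> y \<in> Q \<Longrightarrow> norm (x - y) \<le> real ?n * s Q"
      by blast+
    have fxi: "0 \<le> f (\<xi> Q)" if "Q \<in> \<D>" for Q using \<xi>(1)[OF that] K(3) f(2) by blast
    define A where "A Q = cball (T (\<xi> Q)) (f (\<xi> Q) * (real ?n * s Q))" for Q
    have mA: "measure lebesgue (A Q) = c * ((f (\<xi> Q)) ^ ?n * measure lebesgue (interior Q))" if Q: "Q \<in> \<D>" for Q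
    proof -
      have "0 \<le> f (\<xi> Q) * (real ?n * s Q)" using fxi[OF Q] s(1)[OF Q] by simp
      hence "measure lebesgue (A Q) = (f (\<xi> Q) * (real ?n * s Q)) ^ ?n * measure lebesgue (ball (0::'a) 1)"
        using content_ball_conv_unit_ball[of "f (\<xi> Q) * (real ?n * s Q)" "T (\<xi> Q)"]
        by (simp add: A_def content_cball_conv_ball)
      thus ?thesis by (simp add: c_def power_mult_distrib s(2)[OF Q])
    qed
    have YA: "Y \<subseteq> (\<Union>Q\<in>\<D>. A Q)"
    proof
      fix y assume "y \<in> Y"
      then obtain x where x: "x \<in> K" "y = T x" using Y by blast
      then obtain Q where Q: "Q \<in> \<D>" "x \<in> Q" using D(7) by blast
      have "dist (T (\<xi> Q)) (T x) \<le> f (\<xi> Q) * dist (\<xi> Q) x"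
        using \<rho>(4)[OF \<xi>(1)[OF Q(1)]] x Q \<xi>(3)[OF Q(1)] by blast
      also have "\<dots> \<le> f (\<xi> Q) * (real ?n * s Q)"
        using s(3)[OF Q(1) \<xi>(2)[OF Q(1)] Q(2)] fxi[OF Q(1)] by (intro mult_left_mono) (auto simp: dist_norm)
      finally show "y \<in> (\<Union>Q\<in>\<D>. A Q)" using Q x by (auto simp: A_def)
    qed
    \<comment> \<open>This function dominates every sum of the values at the tags over disjoint cube
      interiors, on \<open>K\<close> as well as on the part of the cubes outside
      \<open>K\<close>.\<close>
    let ?h = "\<lambda>x. indicator K x *\<^sub>R (f x + 1) ^ ?n + (B + 1) ^ ?n * indicator (U - K) x :: real"
    have f1B: "(f x + 1) ^ ?n \<le> (B + 1) ^ ?n" if "x \<in> \<Omega>" for x using f(2)[OF that] by (intro power_mono) auto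
    have intK: "integrable lebesgue (\<lambda>x. indicator K x *\<^sub>R (f x + 1) ^ ?n)"
    proof (rule Bochner_Integration.integrable_bound)
      show "integrable lebesgue (\<lambda>x. (B + 1) ^ ?n * indicator U x :: real)"
        using U(4) unfolding lmeasurable_iff_integrable by (rule integrable_mult_right)
      have "continuous_on \<Omega> (\<lambda>x. (f x + 1) ^ ?n)" by (intro continuous_intros f)
      hence "(\<lambda>x. indicator \<Omega> x *\<^sub>R (f x + 1) ^ ?n) \<in> borel_measurable borel"
        using \<Omega> by (intro borel_measurable_continuous_on_indicator) auto
      hence "(\<lambda>x. indicator \<Omega> x *\<^sub>R (f x + 1) ^ ?n) \<in> borel_measurable lebesgue"
        by (intro measurable_completion) simp
      hence "(\<lambda>x. indicator K x *\<^sub>R (indicator \<Omega> x *\<^sub>R (f x + 1) ^ ?n)) \<in> borel_measurable lebesgue"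
        by (rule borel_measurable_scaleR[OF borel_measurable_indicator[OF K(1)]])
      also have "(\<lambda>x. indicator K x *\<^sub>R (indicator \<Omega> x *\<^sub>R (f x + 1) ^ ?n)) = (\<lambda>x. indicator K x *\<^sub>R (f x + 1) ^ ?n)"
        using K(3) by (auto simp: indicator_def fun_eq_iff)
      finally show "(\<lambda>x. indicator K x *\<^sub>R (f x + 1) ^ ?n) \<in> borel_measurable lebesgue" .
      show "AE x in lebesgue. norm (indicator K x *\<^sub>R (f x + 1) ^ ?n) \<le> norm ((B + 1) ^ ?n * indicator U x)"
        using U(2) f1B f(2) K(3) B0 by (intro AE_I2) (auto simp: indicator_def)
    qed
    have inth: "integrable lebesgue ?h"
      using UK unfolding lmeasurable_iff_integrable
      by (intro Bochner_Integration.integrable_add intK integrable_mult_right)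
    have inth': "(LINT x|lebesgue. ?h x) = (LINT x:K|lebesgue. (f x + 1) ^ ?n) + (B + 1) ^ ?n * measure lebesgue (U - K)"
      using UK intK unfolding lmeasurable_iff_integrable set_lebesgue_integral_def
      by (subst Bochner_Integration.integral_add) (auto intro!: integrable_mult_right)
    have bnd: "measure lebesgue (\<Union>Q\<in>I. A Q) \<le> c * (LINT x:K|lebesgue. (f x + 1) ^ ?n) + e" if I: "I \<subseteq> \<D>" "finite I" for I
    proof -
      have iQ: "interior Q \<in> lmeasurable" if QI: "Q \<in> I" for Q
      proof -
        obtain u v where "Q = cbox u v" using D(3)[of Q] QI I by blast
        thus ?thesis by (simp add: interior_cbox)
      qed
      have "measure lebesgue (\<Union>Q\<in>I. A Q) \<le> (\<Sum>Q\<in>I. measure lebesgue (A Q))"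
        by (rule measure_UNION_le[OF I(2)]) (auto simp: A_def)
      also have "\<dots> = c * (\<Sum>Q\<in>I. (f (\<xi> Q)) ^ ?n * measure lebesgue (interior Q))"
        unfolding sum_distrib_left by (intro sum.cong refl mA) (use I in auto)
      also have "(\<Sum>Q\<in>I. (f (\<xi> Q)) ^ ?n * measure lebesgue (interior Q))
          = (LINT x|lebesgue. (\<Sum>Q\<in>I. (f (\<xi> Q)) ^ ?n * indicator (interior Q) x))"
        using iQ unfolding lmeasurable_iff_integrable
        by (subst Bochner_Integration.integral_sum) (auto intro!: integrable_mult_right)
      also have "\<dots> \<le> (LINT x|lebesgue. ?h x)"
      proof (rule integral_mono[OF _ inth])
        show "integrable lebesgue (\<lambda>x. \<Sum>Q\<in>I. (f (\<xi> Q)) ^ ?n * indicator (interior Q) x)"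
          using iQ unfolding lmeasurable_iff_integrable
          by (intro Bochner_Integration.integrable_sum integrable_mult_right)
        fix x
        have h0: "0 \<le> ?h x" using f(2) K(3) B0 by (auto simp: indicator_def)
        show "(\<Sum>Q\<in>I. (f (\<xi> Q)) ^ ?n * indicator (interior Q) x) \<le> ?h x"
        proof (cases "\<exists>Q\<in>I. x \<in> interior Q")
          case False
          hence "(\<Sum>Q\<in>I. (f (\<xi> Q)) ^ ?n * indicator (interior Q) x) = 0" by (intro sum.neutral) auto
          thus ?thesis using h0 by linarith
        next
          case True
          then obtain Q where Q: "Q \<in> I" "x \<in> interior Q" by blast
          have "(\<Sum>Q'\<in>I. (f (\<xi> Q')) ^ ?n * indicator (interior Q') x) = (\<Sum>Q'\<in>{Q}. (f (\<xi> Q')) ^ ?n * indicator (interior Q') x)"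
          proof (rule sum.mono_neutral_right[OF I(2)])
            show "\<forall>i\<in>I - {Q}. f (\<xi> i) ^ ?n * indicator (interior i) x = 0"
            proof
              fix i assume i: "i \<in> I - {Q}"
              hence "interior i \<inter> interior Q = {}" using D(4) Q(1) I(1) unfolding pairwise_def by blast
              thus "f (\<xi> i) ^ ?n * indicator (interior i) x = 0" using Q(2) by (auto simp: indicator_def)
            qed
          qed (use Q in auto)
          also have "\<dots> = f (\<xi> Q) ^ ?n" using Q by simp
          also have "\<dots> \<le> ?h x"
          proof -
            have QD: "Q \<in> \<D>" using Q I by blast
            have xb: "x \<in> ball (\<xi> Q) (\<rho> (\<xi> Q))" using Q \<xi>(3)[OF QD] interior_subset by blast
            have xU: "x \<in> U" using xb \<rho>(2)[OF \<xi>(1)[OF QD]] by blast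
            have "f (\<xi> Q) \<le> f x + 1" by (rule \<rho>(3)[OF \<xi>(1)[OF QD] xb])
            hence "f (\<xi> Q) ^ ?n \<le> (f x + 1) ^ ?n" using fxi[OF QD] by (intro power_mono) auto
            moreover have "(f x + 1) ^ ?n \<le> (B + 1) ^ ?n" using f1B xU U(3) by blast
            ultimately show ?thesis using xU by (auto simp: indicator_def)
          qed
          finally show ?thesis .
        qed
      qed
      also have "\<dots> \<le> (LINT x:K|lebesgue. (f x + 1) ^ ?n) + (B + 1) ^ ?n * \<epsilon>"
        unfolding inth' using mUK B0 by (intro add_left_mono mult_left_mono) auto
      also have "c * ((LINT x:K|lebesgue. (f x + 1) ^ ?n) + (B + 1) ^ ?n * \<epsilon>)
          = c * (LINT x:K|lebesgue. (f x + 1) ^ ?n) + e"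
        using c B0 by (simp add: distrib_left \<epsilon>_def)
      finally show ?thesis using c by (simp add: mult_left_mono)
    qed
    have "(\<Union>Q\<in>\<D>. A Q) \<in> lmeasurable"
      by (rule fmeasurable_UN_bound[OF D(1) _ bnd]) (auto simp: A_def)
    hence "measure lebesgue Y \<le> measure lebesgue (\<Union>Q\<in>\<D>. A Q)"
      using YA Y by (intro measure_mono_fmeasurable) (auto simp: fmeasurableD)
    also have "\<dots> \<le> c * (LINT x:K|lebesgue. (f x + 1) ^ ?n) + e"
      by (rule measure_UN_bound[OF D(1) _ bnd]) (auto simp: A_def)
    finally show ?thesis .
  qed
qed

lemma local_lipschitz_const_image_measure:
  fixes T :: "'a::euclidean_space \<Rightarrow> 'a"
  assumes A: "A \<in> sets lebesgue" "bounded A" and M: "0 \<le> M"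
    and lip: "\<And>x y. dist (T x) (T y) \<le> M * dist x y" and Y: "T ` A \<in> lmeasurable"
  shows "measure lebesgue (T ` A) \<le> measure lebesgue (ball (0::'a) 1) * DIM('a) ^ DIM('a)
           * (M + 1) ^ DIM('a) * measure lebesgue A"
proof -
  have "A \<in> lmeasurable" using A bounded_set_imp_lmeasurable by blast
  moreover have "measure lebesgue (T ` A) \<le> measure lebesgue (ball (0::'a) 1) * DIM('a) ^ DIM('a)
           * (LINT x:A|lebesgue. (M + 1) ^ DIM('a))"
    by (rule local_lipschitz_image_measure[where \<Omega> = UNIV and B = M and f = "\<lambda>_. M", OF A])
      (use M lip Y in \<open>auto intro: exI[of _ 1]\<close>)
  ultimately show ?thesis by (simp add: set_lebesgue_integral_def mult_ac lmeasurable_iff_integrable)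
qed

section \<open>Lipschitz functions of one variable as integrals\<close>

lemma set_integrable_bounded_interval:
  fixes h :: "real \<Rightarrow> real"
  assumes h: "h \<in> borel_measurable borel" and B: "\<And>t. \<bar>h t\<bar> \<le> B"
  shows "set_integrable lborel {a..b} h"
  unfolding set_integrable_def
proof (rule Bochner_Integration.integrable_bound)
  show "integrable lborel (\<lambda>t. B * indicator {a..b} t :: real)"
    by (intro integrable_mult_right integrable_real_indicator emeasure_compact_finite) auto
  have "norm (indicator {a..b} t *\<^sub>R h t) \<le> norm (B * indicator {a..b} t)" for t
    using order_trans[OF B[of t] abs_ge_self] by (simp add: indicator_def)
  thus "AE t in lborel. norm (indicator {a..b} t *\<^sub>R h t) \<le> norm (B * indicator {a..b} t)"
    by simp
qed (use h in auto)

text \<open>Adding \<open>(L + 1) * t\<close> makes the function increasing with a Lipschitz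
  inverse. The measure that assigns to a set the length of its image is dominated by a multiple of
  Lebesgue measure, by the image estimate above; its Radon-Nikodym density, integrated over an
  interval, gives the increment.\<close>

lemma lipschitz_real_integral:
  fixes F :: "real \<Rightarrow> real"
  assumes L: "0 \<le> L" and lip: "\<And>s t. \<bar>F s - F t\<bar> \<le> L * \<bar>s - t\<bar>"
  obtains h B where "h \<in> borel_measurable borel" "\<And>t. \<bar>h t\<bar> \<le> B"
    "\<And>a b. a \<le> b \<Longrightarrow> F b - F a = (LINT t:{a..b}|lborel. h t)"
proof -
  define \<Phi> where "\<Phi> t = F t + (L + 1) * t" for t
  have up: "b - a \<le> \<Phi> b - \<Phi> a" and lo: "\<Phi> b - \<Phi> a \<le> (2 * L + 1) * (b - a)" if "a \<le> b" for a b
    using lip[of b a] that by (auto simp: \<Phi>_def algebra_simps abs_le_iff)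
  have mono: "strict_mono \<Phi>" using up by (smt (verit) strict_monoI)
  have lip\<Phi>: "dist (\<Phi> x) (\<Phi> y) \<le> (2 * L + 1) * dist x y" for x y
    using up[of x y] up[of y x] lo[of x y] lo[of y x] by (cases "x \<le> y") (auto simp: dist_real_def abs_if)
  have cont: "continuous_on UNIV \<Phi>"
    using lip\<Phi> L by (intro lipschitz_on_continuous_on[of "2 * L + 1"] lipschitz_onI) auto
  have surj: "\<exists>t. \<Phi> t = y" for y
  proof -
    define c where "c = \<bar>y - \<Phi> 0\<bar>"
    have "\<Phi> (- c) \<le> y" "y \<le> \<Phi> c" using up[of "- c" 0] up[of 0 c] by (auto simp: c_def)
    thus ?thesis using IVT'[of \<Phi> "- c" y c] cont continuous_on_subset by (force simp: c_def)
  qed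
  have bij: "bij \<Phi>" using mono surj by (metis bijI strict_mono_imp_inj_on surjI)
  define \<Psi> where "\<Psi> = inv \<Phi>"
  have \<Psi>\<Phi>: "\<Psi> (\<Phi> t) = t" and \<Phi>\<Psi>: "\<Phi> (\<Psi> t) = t" for t
    using bij by (auto simp: \<Psi>_def bij_is_inj bij_is_surj surj_f_inv_f)
  have vim: "\<Psi> -` A = \<Phi> ` A" for A 
  proof (intro equalityI subsetI)
    fix x assume "x \<in> \<Psi> -` A"
    thus "x \<in> \<Phi> ` A" by (intro image_eqI[of _ _ "\<Psi> x"]) (auto simp: \<Phi>\<Psi>)
  qed (auto simp: \<Psi>\<Phi>)
  have lip\<Psi>: "dist (\<Psi> x) (\<Psi> y) \<le> 1 * dist x y" for x y
    using up[of "\<Psi> x" "\<Psi> y"] up[of "\<Psi> y" "\<Psi> x"] 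
    by (cases "\<Psi> x \<le> \<Psi> y") (auto simp: dist_real_def \<Phi>\<Psi>)
  have \<Psi>m[measurable]: "\<Psi> \<in> borel_measurable borel"
    by (intro borel_measurable_continuous_onI lipschitz_on_continuous_on[of 1] lipschitz_onI) (use lip\<Psi> in auto)
  define \<mu> where "\<mu> = distr lborel borel \<Psi>"
  have \<mu>: "emeasure \<mu> A = emeasure lborel (\<Phi> ` A)" if "A \<in> sets borel" for A
    using that by (simp add: \<mu>_def emeasure_distr vim)
  have img: "\<Phi> ` A \<in> sets borel" if "A \<in> sets borel" for A
    using measurable_sets[OF \<Psi>m that] by (simp add: vim)
  define C where "C = measure lebesgue (ball (0::real) 1) * (2 * L + 1 + 1)"
  have C: "0 \<le> C" using L by (simp add: C_def)
  have \<mu>C: "emeasure \<mu> A \<le> ennreal C * emeasure lborel A" if A: "A \<in> sets borel" "bounded A" for A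
  proof -
    have bimg: "bounded (\<Phi> ` A)"
    proof -
      obtain N where N: "\<And>x. x \<in> A \<Longrightarrow> norm x \<le> N" using A(2) by (meson bounded_iff)
      have "norm (\<Phi> x) \<le> norm (\<Phi> 0) + (2 * L + 1) * N" if "x \<in> A" for x
      proof -
        have "norm (\<Phi> x) \<le> norm (\<Phi> 0) + dist (\<Phi> x) (\<Phi> 0)" by (simp add: dist_real_def)
        also have "dist (\<Phi> x) (\<Phi> 0) \<le> (2 * L + 1) * N"
          using order_trans[OF lip\<Phi>[of x 0] mult_left_mono[of "dist x 0" N "2 * L + 1"]] N[OF that] L by simp
        finally show ?thesis by simp
      qed
      thus ?thesis unfolding bounded_iff by blast
    qed
    have m: "\<Phi> ` A \<in> lmeasurable" "A \<in> lmeasurable"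
      by (rule bounded_set_imp_lmeasurable; use A bimg img in simp)+
    have "measure lebesgue (\<Phi> ` A) \<le> C * measure lebesgue A"
      using local_lipschitz_const_image_measure[of A "2 * L + 1" \<Phi>] A m lip\<Phi> L
      by (simp add: C_def)
    hence "ennreal (measure lebesgue (\<Phi> ` A)) \<le> ennreal C * ennreal (measure lebesgue A)"
      using C by (simp flip: ennreal_mult' add: ennreal_leI)
    moreover have "emeasure lborel (\<Phi> ` A) = ennreal (measure lebesgue (\<Phi> ` A))"
      using emeasure_eq_measure2[OF m(1)] img[OF A(1)] by simp
    moreover have "emeasure lborel A = ennreal (measure lebesgue A)"
      using emeasure_eq_measure2[OF m(2)] A(1) by simp
    ultimately show ?thesis by (simp only: \<mu>[OF A(1)])
  qed
  have ac: "absolutely_continuous lborel \<mu>"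
    unfolding absolutely_continuous_def
  proof
    fix N :: "real set" assume N: "N \<in> null_sets lborel"
    have Nk: "emeasure \<mu> (N \<inter> cball 0 (real k)) = 0" for k
    proof -
      have "emeasure \<mu> (N \<inter> cball 0 (real k)) \<le> ennreal C * emeasure lborel (N \<inter> cball 0 (real k))"
        using N by (intro \<mu>C bounded_Int) auto
      also have "emeasure lborel (N \<inter> cball 0 (real k)) = 0"
        by (rule emeasure_eq_0[OF null_setsD2[OF N] null_setsD1[OF N]]) blast
      finally show ?thesis by simp
    qed
    have "N = (\<Union>k. N \<inter> cball 0 (real k))" by (auto simp: real_arch_simple)
    also have "emeasure \<mu> \<dots> = 0"
      using N Nk by (intro emeasure_UN_eq_0) (auto simp: \<mu>_def)
    finally show "N \<in> null_sets \<mu>" 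
      by (rule null_setsI) (use null_setsD2[OF N] in \<open>simp add: \<mu>_def\<close>)
  qed
  obtain f where f[measurable]: "f \<in> borel_measurable lborel" and fd: "density lborel f = \<mu>"
    using sigma_finite_measure.Radon_Nikodym[OF sigma_finite_lborel ac] by (auto simp: \<mu>_def)
  have f\<mu>: "emeasure \<mu> A = (\<integral>\<^sup>+x. f x * indicator A x \<partial>lborel)" if "A \<in> sets borel" for A
    using that by (subst fd[symmetric]) (simp add: emeasure_density)
  \<comment> \<open>On a bounded set \<open>A k\<close> where the density is at least
    \<open>C + 1\<close>, the domination by \<open>C\<close> gives
    \<open>(C + 1) * m <= C * m\<close> for its measure \<open>m\<close>, so the set is
    null.\<close>
  have AEf: "AE x in lborel. f x < ennreal (C + 1)"
  proof -
    define A where "A k = {x. ennreal (C + 1) \<le> f x} \<inter> cball 0 (real k)" for k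
    have [measurable]: "A k \<in> sets borel" for k
      unfolding A_def using f by measurable
    have "emeasure lborel (A k) = 0" for k
    proof -
      have fin: "emeasure lborel (A k) < \<infinity>"
        by (rule emeasure_bounded_finite) (simp add: A_def bounded_Int)
      have "ennreal (C + 1) * emeasure lborel (A k) = (\<integral>\<^sup>+x. ennreal (C + 1) * indicator (A k) x \<partial>lborel)"
        by (simp add: nn_integral_cmult_indicator)
      also have "\<dots> \<le> (\<integral>\<^sup>+x. f x * indicator (A k) x \<partial>lborel)"
        by (intro nn_integral_mono) (auto simp: A_def indicator_def)
      also have "\<dots> = emeasure \<mu> (A k)" by (simp add: f\<mu>)
      also have "\<dots> \<le> ennreal C * emeasure lborel (A k)" by (intro \<mu>C) (auto simp: A_def bounded_Int)
      finally have *: "ennreal (C + 1) * emeasure lborel (A k) \<le> ennreal C * emeasure lborel (A k)" .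
      obtain m where m: "emeasure lborel (A k) = ennreal m" "0 \<le> m" using fin by (metis ennreal_cases infinity_ennreal_def less_irrefl)
      have c1: "0 \<le> C + 1" using C by simp
      have "ennreal ((C + 1) * m) \<le> ennreal (C * m)"
        using * unfolding m(1) ennreal_mult[OF c1 m(2)] ennreal_mult[OF C m(2)] .
      hence "(C + 1) * m \<le> C * m" using C m(2) by (subst (asm) ennreal_le_iff) auto
      thus ?thesis using m by (simp add: algebra_simps)
    qed
    hence "emeasure lborel (\<Union>k. A k) = 0" by (intro emeasure_UN_eq_0) auto
    moreover have "{x \<in> space lborel. \<not> f x < ennreal (C + 1)} = (\<Union>k. A k)"
      by (auto simp: A_def not_less real_arch_simple)
    ultimately show ?thesis by (intro AE_I[of _ _ "\<Union>k. A k"]) auto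
  qed
  \<comment> \<open>The truncation makes the density bounded everywhere and not only almost
    everywhere.\<close>
  define h1 where "h1 x = enn2real (min (f x) (ennreal (C + 1)))" for x
  have h1m[measurable]: "h1 \<in> borel_measurable borel" unfolding h1_def using f by measurable
  have h1: "0 \<le> h1 x" "h1 x \<le> C + 1" for x
    using C unfolding h1_def by (auto intro!: enn2real_leI)
  have fh1: "AE x in lborel. f x = ennreal (h1 x)"
    using AEf
  proof eventually_elim
    case (elim x)
    have "f x < top" using elim ennreal_less_top by (rule less_trans)
    thus ?case using less_imp_le[OF elim] by (simp add: h1_def min_absorb1)
  qed
  have key: "\<Phi> b - \<Phi> a = (LINT t:{a..b}|lborel. h1 t)" "set_integrable lborel {a..b} h1" if ab: "a \<le> b" for a b
  proof -
    show int: "set_integrable lborel {a..b} h1"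
      by (rule set_integrable_bounded_interval[OF h1m, of "C + 1"]) (use h1 in simp)
    have img: "\<Phi> ` {a..b} = {\<Phi> a..\<Phi> b}"
    proof
      show "\<Phi> ` {a..b} \<subseteq> {\<Phi> a..\<Phi> b}" using mono by (auto simp: strict_mono_less_eq)
      show "{\<Phi> a..\<Phi> b} \<subseteq> \<Phi> ` {a..b}"
      proof
        fix y assume "y \<in> {\<Phi> a..\<Phi> b}"
        hence "\<Phi> a \<le> \<Phi> (\<Psi> y)" "\<Phi> (\<Psi> y) \<le> \<Phi> b" by (auto simp: \<Phi>\<Psi>)
        hence "\<Psi> y \<in> {a..b}" using mono by (simp add: strict_mono_less_eq)
        thus "y \<in> \<Phi> ` {a..b}" by (metis \<Phi>\<Psi> imageI)
      qed
    qed
    have "ennreal (\<Phi> b - \<Phi> a) = emeasure \<mu> {a..b}"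
      using up[OF ab] ab by (simp add: \<mu> img)
    also have "\<dots> = (\<integral>\<^sup>+x. f x * indicator {a..b} x \<partial>lborel)" by (simp add: f\<mu>)
    also have "\<dots> = (\<integral>\<^sup>+x. ennreal (indicator {a..b} x *\<^sub>R h1 x) \<partial>lborel)"
      using fh1 by (intro nn_integral_cong_AE) (auto elim!: eventually_mono simp: indicator_def)
    also have "\<dots> = ennreal (LINT t:{a..b}|lborel. h1 t)"
      unfolding set_lebesgue_integral_def
      by (intro nn_integral_eq_integral int[unfolded set_integrable_def] AE_I2) (use h1 in auto)
    finally show "\<Phi> b - \<Phi> a = (LINT t:{a..b}|lborel. h1 t)"
      using up[OF ab] ab h1 by (subst (asm) ennreal_inj) (auto simp: set_lebesgue_integral_def intro!: Bochner_Integration.integral_nonneg)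
  qed
  show thesis
  proof
    show "(\<lambda>t. h1 t - (L + 1)) \<in> borel_measurable borel" by measurable
    show "\<bar>h1 t - (L + 1)\<bar> \<le> C + 1 + (L + 1)" for t using h1[of t] L C by linarith
    fix a b :: real assume ab: "a \<le> b"
    have "(LINT t:{a..b}|lborel. h1 t - (L + 1)) = (LINT t:{a..b}|lborel. h1 t) - (LINT t:{a..b}|lborel. L + 1)"
      by (intro set_integral_diff key ab) (rule set_integrable_bounded_interval[OF borel_measurable_const order_refl])
    also have "(LINT t:{a..b}|lborel. L + 1) = (L + 1) * (b - a)"
      using ab by (simp add: set_lebesgue_integral_def)
    finally show "F b - F a = (LINT t:{a..b}|lborel. h1 t - (L + 1))"
      using key(1)[OF ab] by (simp add: \<Phi>_def algebra_simps)
  qed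
qed

text \<open>The derivative of \<open>f\<close> along \<open>e\<close>. A limit over the sequence
  \<open>1 / Suc j\<close> is Borel measurable for continuous \<open>f\<close>, and the truncation
  to the interval from \<open>- L\<close> to \<open>L\<close> makes the function bounded everywhere,
  also where the quotients diverge and \<open>lim\<close> has an arbitrary value.\<close>

definition dd :: "real \<Rightarrow> ('a::euclidean_space \<Rightarrow> real) \<Rightarrow> 'a \<Rightarrow> 'a \<Rightarrow> real" where
  "dd L f e x = max (- L) (min L (lim (\<lambda>j. (f (x + (1 / Suc j) *\<^sub>R e) - f x) * real (Suc j))))"

lemma dd_bound: "0 \<le> L \<Longrightarrow> \<bar>dd L f e x\<bar> \<le> L"
  by (auto simp: dd_def)

lemma dd_measurable:
  assumes "continuous_on UNIV f"
  shows "dd L f e \<in> borel_measurable borel"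
proof -
  have [measurable]: "(\<lambda>x. (f (x + (1 / Suc j) *\<^sub>R e) - f x) * real (Suc j)) \<in> borel_measurable borel" for j
    by (intro borel_measurable_continuous_onI continuous_intros continuous_on_compose2[OF assms]) auto
  show ?thesis unfolding dd_def by measurable
qed

lemma pred_ball [measurable (raw)]:
  fixes f :: "'b \<Rightarrow> 'a::euclidean_space"
  assumes "f \<in> borel_measurable M"
  shows "Measurable.pred M (\<lambda>x. f x \<in> ball z r)"
  using measurable_sets[OF assms, of "ball z r"] unfolding pred_def
  by (simp add: vimage_def Int_def conj_commute)

lemma quotient_tendsto_at_lebesgue_point:
  fixes F h :: "real \<Rightarrow> real"
  assumes h: "h \<in> borel_measurable borel" "\<And>t. \<bar>h t\<bar> \<le> B"
    and F: "\<And>a b. a \<le> b \<Longrightarrow> F b - F a = (LINT t:{a..b}|lborel. h t)"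
    and t: "lebesgue_point h t"
  shows "(\<lambda>j. (F (t + 1 / Suc j) - F t) * real (Suc j)) \<longlonglongrightarrow> h t"
proof (rule LIMSEQ_I)
  fix e :: real assume e: "0 < e"
  have "\<forall>\<^sub>F r in at_right 0. (LINT y:ball t r|lebesgue. \<bar>h y - h t\<bar>) \<le> (e / 8) * measure lebesgue (ball t r)"
    by (rule t[unfolded lebesgue_point_def, rule_format]) (use e in simp)
  then obtain d where d: "0 < d" "\<And>r. 0 < r \<Longrightarrow> r < d \<Longrightarrow>
      (LINT y:ball t r|lebesgue. \<bar>h y - h t\<bar>) \<le> (e / 8) * measure lebesgue (ball t r)"
    unfolding eventually_at_right_field by blast
  obtain N where N: "1 / real (Suc N) < d / 2" using d by (metis half_gt_zero nat_approx_posE)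
  show "\<exists>N. \<forall>j\<ge>N. norm ((F (t + 1 / Suc j) - F t) * real (Suc j) - h t) < e"
  proof (intro exI allI impI)
    fix j assume j: "N \<le> j"
    define s where "s = 1 / real (Suc j)"
    have s: "0 < s" "s * real (Suc j) = 1" by (auto simp: s_def)
    have "s \<le> 1 / real (Suc N)" unfolding s_def using j by (intro divide_left_mono) auto
    hence sd: "2 * s < d" using N by linarith
    have hm: "h \<in> borel_measurable lebesgue" using h(1) by (intro measurable_completion) simp
    have int: "set_integrable lebesgue (ball t (2 * s)) (\<lambda>y. \<bar>h y - h t\<bar>)"
    proof (rule set_integrable_bounded_ball)
      show "(\<lambda>y. \<bar>h y - h t\<bar>) \<in> borel_measurable lebesgue"
        by (intro borel_measurable_abs borel_measurable_diff hm) simp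
      show "\<bar>\<bar>h y - h t\<bar>\<bar> \<le> 2 * B" for y using h(2)[of y] h(2)[of t] by linarith
    qed
    have intI: "set_integrable lborel {t..t+s} h"
      by (rule set_integrable_bounded_interval[OF h(1,2)])
    have "\<bar>F (t + s) - F t - s * h t\<bar> = \<bar>(LINT y:{t..t+s}|lborel. h y - h t)\<bar>"
    proof -
      have "(LINT y:{t..t+s}|lborel. h y - h t) = (LINT y:{t..t+s}|lborel. h y) - (LINT y:{t..t+s}|lborel. h t)"
        by (intro set_integral_diff intI) (rule set_integrable_bounded_interval[OF borel_measurable_const order_refl])
      thus ?thesis using F[of t "t + s"] s by (simp add: set_lebesgue_integral_def)
    qed
    also have "\<dots> = \<bar>(LINT y:{t..t+s}|lebesgue. h y - h t)\<bar>"
      unfolding set_lebesgue_integral_def using h(1) by (subst integral_completion) auto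
    also have "\<dots> \<le> (LINT y:{t..t+s}|lebesgue. \<bar>h y - h t\<bar>)"
      unfolding set_lebesgue_integral_def
      by (rule order_trans[OF integral_abs_bound]) (simp add: abs_mult)
    also have "\<dots> \<le> (LINT y:ball t (2 * s)|lebesgue. \<bar>h y - h t\<bar>)"
      unfolding set_lebesgue_integral_def
    proof (rule integral_mono)
      have sub: "{t..t + s} \<subseteq> ball t (2 * s)" using s by (auto simp: dist_real_def)
      show "integrable lebesgue (\<lambda>y. indicat_real {t..t + s} y *\<^sub>R \<bar>h y - h t\<bar>)"
        using set_integrable_subset[OF int _ sub] by (simp add: set_integrable_def)
      show "integrable lebesgue (\<lambda>y. indicat_real (ball t (2 * s)) y *\<^sub>R \<bar>h y - h t\<bar>)"
        using int by (simp add: set_integrable_def)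
      show "indicat_real {t..t + s} y *\<^sub>R \<bar>h y - h t\<bar> \<le> indicat_real (ball t (2 * s)) y *\<^sub>R \<bar>h y - h t\<bar>" for y
        using sub by (auto simp: indicator_def)
    qed
    also have "\<dots> \<le> (e / 8) * measure lebesgue (ball t (2 * s))" using d(2) s sd by simp
    also have "measure lebesgue (ball t (2 * s)) = 4 * s" using s by (simp add: ball_eq_greaterThanLessThan)
    finally have "\<bar>F (t + s) - F t - s * h t\<bar> * real (Suc j) \<le> (e / 8 * (4 * s)) * real (Suc j)"
      by (intro mult_right_mono) auto
    also have "\<dots> = e / 2 * (s * real (Suc j))" by simp
    also have "\<dots> < e" unfolding s(2) using e by simp
    also have "\<bar>F (t + s) - F t - s * h t\<bar> * real (Suc j) = \<bar>(F (t + s) - F t - s * h t) * real (Suc j)\<bar>" by (simp add: abs_mult)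
    also have "(F (t + s) - F t - s * h t) * real (Suc j) = (F (t + s) - F t) * real (Suc j) - h t"
    proof -
      have "(F (t + s) - F t - s * h t) * real (Suc j) = (F (t + s) - F t) * real (Suc j) - h t * (s * real (Suc j))"
        by (simp only: left_diff_distrib right_diff_distrib mult_ac)
      thus ?thesis unfolding s(2) by simp
    qed
    finally show "norm ((F (t + 1 / Suc j) - F t) * real (Suc j) - h t) < e" by (simp add: s_def)
  qed
qed

text \<open>Restricted to a line, \<open>f\<close> is the integral of some bounded density, which
  equals \<open>dd\<close> at each of its Lebesgue points. The exceptional set is null in the line
  itself, so the formula holds on every line and not only on almost every one.\<close>

lemma dd_integral:
  fixes f :: "'a::euclidean_space \<Rightarrow> real"
  assumes L: "0 \<le> L" and lip: "\<And>x y. \<bar>f x - f y\<bar> \<le> L * norm (x - y)" and e: "norm e = 1" and s: "0 \<le> s"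
  shows "f (x + s *\<^sub>R e) - f x = (LINT t:{0..s}|lborel. dd L f e (x + t *\<^sub>R e))"
proof -
  define F where "F t = f (x + t *\<^sub>R e)" for t
  have lF: "\<bar>F s - F t\<bar> \<le> L * \<bar>s - t\<bar>" for s t
    using lip[of "x + s *\<^sub>R e" "x + t *\<^sub>R e"] e by (simp add: F_def flip: scaleR_left_diff_distrib)
  obtain h B where h: "h \<in> borel_measurable borel" "\<And>t. \<bar>h t\<bar> \<le> B"
    "\<And>a b. a \<le> b \<Longrightarrow> F b - F a = (LINT t:{a..b}|lborel. h t)"
    using lipschitz_real_integral[OF L lF] by blast
  have dm: "dd L f e \<in> borel_measurable borel"
    by (intro dd_measurable lipschitz_on_continuous_on[of L] lipschitz_onI) (use lip L in \<open>auto simp: dist_norm\<close>)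
  have hm: "h \<in> borel_measurable lebesgue" using h(1) by (intro measurable_completion) simp
  have "AE t in lebesgue. lebesgue_point h t"
    using negligible_not_lebesgue_point[OF hm h(2)] unfolding negligible_iff_null_sets
    by (auto intro: AE_I')
  hence ae: "AE t in lborel. lebesgue_point h t"
    by (simp add: AE_completion_iff)
  have pt: "dd L f e (x + t *\<^sub>R e) = h t" if t: "lebesgue_point h t" for t
  proof -
    have lm: "(\<lambda>j. (F (t + 1 / Suc j) - F t) * real (Suc j)) \<longlonglongrightarrow> h t"
      by (rule quotient_tendsto_at_lebesgue_point[OF h t])
    have "\<bar>(F (t + 1 / Suc j) - F t) * real (Suc j)\<bar> \<le> L" for j
      using mult_right_mono[OF lF[of "t + 1 / Suc j" t], of "real (Suc j)"] by (simp add: abs_mult)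
    hence "\<bar>h t\<bar> \<le> L"
      by (intro tendsto_upperbound[OF tendsto_rabs[OF lm]] always_eventually) auto
    moreover have "lim (\<lambda>j. (f ((x + t *\<^sub>R e) + (1 / Suc j) *\<^sub>R e) - f (x + t *\<^sub>R e)) * real (Suc j)) = h t"
      using limI[OF lm] by (simp add: F_def algebra_simps)
    ultimately show ?thesis by (auto simp: dd_def)
  qed
  have "f (x + s *\<^sub>R e) - f x = (LINT t:{0..s}|lborel. h t)" using h(3)[OF s] by (simp add: F_def)
  also have "\<dots> = (LINT t:{0..s}|lborel. dd L f e (x + t *\<^sub>R e))"
    unfolding set_lebesgue_integral_def
  proof (rule integral_cong_AE)
    have "(\<lambda>t. dd L f e (x + t *\<^sub>R e)) \<in> borel_measurable borel"
      by (rule measurable_compose[OF _ dm]) (intro borel_measurable_continuous_onI continuous_intros)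
    thus "(\<lambda>t. indicat_real {0..s} t *\<^sub>R dd L f e (x + t *\<^sub>R e)) \<in> borel_measurable lborel" by simp
    show "(\<lambda>t. indicat_real {0..s} t *\<^sub>R h t) \<in> borel_measurable lborel" using h(1) by simp
    show "AE t in lborel. indicat_real {0..s} t *\<^sub>R h t = indicat_real {0..s} t *\<^sub>R dd L f e (x + t *\<^sub>R e)"
      using ae by eventually_elim (simp add: pt)
  qed
  finally show ?thesis .
qed

section \<open>Averaged increments and total differentiability\<close>

lemma nn_integral_lborel_shift:
  fixes f :: "'a::euclidean_space \<Rightarrow> ennreal"
  assumes "f \<in> borel_measurable borel"
  shows "(\<integral>\<^sup>+x. f (c + x) \<partial>lborel) = (\<integral>\<^sup>+x. f x \<partial>lborel)"
proof -
  have "(\<integral>\<^sup>+x. f x \<partial>lborel) = (\<integral>\<^sup>+x. f x \<partial>distr lborel borel ((+) c))" by (simp add: lborel_distr_plus)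
  also have "\<dots> = (\<integral>\<^sup>+x. f (c + x) \<partial>lborel)" using assms by (subst nn_integral_distr) auto
  finally show ?thesis ..
qed

text \<open>The increment of \<open>f\<close> along \<open>e\<close> is averaged over a ball, so that it can be compared with a
  volume integral of \<open>dd L f e\<close> by Tonelli's theorem.\<close>

lemma increment_average_nonneg:
  fixes f :: "'a::euclidean_space \<Rightarrow> real"
  assumes L: "0 \<le> L" and lip: "\<And>x y. \<bar>f x - f y\<bar> \<le> L * norm (x - y)" and e: "norm e = 1" and s: "0 \<le> s"
  shows "(\<integral>\<^sup>+a. ennreal \<bar>f (a + s *\<^sub>R e) - f a - c * s\<bar> * indicator (ball z \<rho>) a \<partial>lborel)
    \<le> ennreal s * (\<integral>\<^sup>+y. ennreal \<bar>dd L f e y - c\<bar> * indicator (ball z (\<rho> + s)) y \<partial>lborel)"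
proof -
  have dm[measurable]: "dd L f e \<in> borel_measurable borel"
    by (intro dd_measurable lipschitz_on_continuous_on[of L] lipschitz_onI) (use lip L in \<open>auto simp: dist_norm\<close>)
  have [measurable]: "(\<lambda>p. fst p + snd p *\<^sub>R e) \<in> borel_measurable (borel \<Otimes>\<^sub>M borel :: ('a \<times> real) measure)"
    unfolding borel_prod by (intro borel_measurable_continuous_onI continuous_intros)
  let ?g = "\<lambda>a t. ennreal \<bar>dd L f e (a + t *\<^sub>R e) - c\<bar> * indicator {0..s} t * indicator (ball z \<rho>) a"
  have gm: "(\<lambda>(a, t). ?g a t) \<in> borel_measurable (lborel \<Otimes>\<^sub>M lborel)"
    by (simp add: split_beta') measurable
  have pt: "ennreal \<bar>f (a + s *\<^sub>R e) - f a - c * s\<bar> * indicator (ball z \<rho>) a \<le> (\<integral>\<^sup>+t. ?g a t \<partial>lborel)" for a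
  proof -
    have lm: "(\<lambda>t. dd L f e (a + t *\<^sub>R e)) \<in> borel_measurable borel"
      by (rule measurable_compose[OF _ dm]) (intro borel_measurable_continuous_onI continuous_intros)
    have int: "set_integrable lborel {0..s} (\<lambda>t. dd L f e (a + t *\<^sub>R e))"
      by (rule set_integrable_bounded_interval[OF lm dd_bound[OF L]])
    have "f (a + s *\<^sub>R e) - f a - c * s = (LINT t:{0..s}|lborel. dd L f e (a + t *\<^sub>R e) - c)"
    proof -
      have "(LINT t:{0..s}|lborel. dd L f e (a + t *\<^sub>R e) - c) = (LINT t:{0..s}|lborel. dd L f e (a + t *\<^sub>R e)) - (LINT t:{0..s}|lborel. c)"
        by (intro set_integral_diff int) (rule set_integrable_bounded_interval[OF borel_measurable_const order_refl])
      thus ?thesis using dd_integral[OF L lip e s, of a] s by (simp add: set_lebesgue_integral_def)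
    qed
    also have "ennreal \<bar>\<dots>\<bar> \<le> (\<integral>\<^sup>+t. ennreal \<bar>dd L f e (a + t *\<^sub>R e) - c\<bar> * indicator {0..s} t \<partial>lborel)"
    proof -
      have "integrable lborel (\<lambda>t. indicat_real {0..s} t *\<^sub>R (dd L f e (a + t *\<^sub>R e) - c))"
        using set_integral_diff(1)[OF int set_integrable_bounded_interval[OF borel_measurable_const order_refl]]
        unfolding set_integrable_def .
      from integral_norm_bound_ennreal[OF this] show ?thesis
        unfolding set_lebesgue_integral_def
        by (simp add: abs_mult ennreal_mult' ennreal_indicator mult.commute)
    qed
    finally show ?thesis
      by (auto simp: indicator_def)
  qed
  have "(\<integral>\<^sup>+a. ennreal \<bar>f (a + s *\<^sub>R e) - f a - c * s\<bar> * indicator (ball z \<rho>) a \<partial>lborel)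
      \<le> (\<integral>\<^sup>+a. (\<integral>\<^sup>+t. ?g a t \<partial>lborel) \<partial>lborel)"
    by (intro nn_integral_mono pt)
  also have "\<dots> = (\<integral>\<^sup>+t. (\<integral>\<^sup>+a. ?g a t \<partial>lborel) \<partial>lborel)"
    using lborel_pair.Fubini[OF gm] by simp
  also have "\<dots> \<le> (\<integral>\<^sup>+t. (\<integral>\<^sup>+y. ennreal \<bar>dd L f e y - c\<bar> * indicator (ball z (\<rho> + s)) y \<partial>lborel) * indicator {0..s} t \<partial>lborel)"
  proof (rule nn_integral_mono)
    fix t :: real
    show "(\<integral>\<^sup>+a. ?g a t \<partial>lborel) \<le> (\<integral>\<^sup>+y. ennreal \<bar>dd L f e y - c\<bar> * indicator (ball z (\<rho> + s)) y \<partial>lborel) * indicator {0..s} t"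
    proof (cases "t \<in> {0..s}")
      case True
      have "(\<integral>\<^sup>+a. ?g a t \<partial>lborel) \<le> (\<integral>\<^sup>+a. ennreal \<bar>dd L f e (t *\<^sub>R e + a) - c\<bar> * indicator (ball z (\<rho> + s)) (t *\<^sub>R e + a) \<partial>lborel)"
      proof (rule nn_integral_mono)
        fix a
        have "t *\<^sub>R e + a \<in> ball z (\<rho> + s)" if "a \<in> ball z \<rho>"
        proof -
          have "dist z (t *\<^sub>R e + a) \<le> dist z a + dist a (t *\<^sub>R e + a)" by (rule dist_triangle)
          also have "dist a (t *\<^sub>R e + a) = t" using True e by (simp add: dist_norm)
          finally show ?thesis using that True by simp
        qed
        thus "?g a t \<le> ennreal \<bar>dd L f e (t *\<^sub>R e + a) - c\<bar> * indicator (ball z (\<rho> + s)) (t *\<^sub>R e + a)"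
          using True by (auto simp: indicator_def add.commute)
      qed
      also have "\<dots> = (\<integral>\<^sup>+y. ennreal \<bar>dd L f e y - c\<bar> * indicator (ball z (\<rho> + s)) y \<partial>lborel)"
        by (rule nn_integral_lborel_shift) measurable
      finally show ?thesis using True by simp
    qed simp
  qed
  also have "\<dots> = ennreal s * (\<integral>\<^sup>+y. ennreal \<bar>dd L f e y - c\<bar> * indicator (ball z (\<rho> + s)) y \<partial>lborel)"
    using s by (subst nn_integral_cmult_indicator) (auto simp: mult.commute)
  finally show ?thesis .
qed

text \<open>A negative \<open>s\<close> is reduced to \<open>- s\<close> by taking
  \<open>a + s *\<^sub>R e\<close> as the base point. This shift and the motion along
  \<open>e\<close> each enlarge the ball by the absolute value of \<open>s\<close>.\<close>

lemma increment_average: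
  fixes f :: "'a::euclidean_space \<Rightarrow> real"
  assumes L: "0 \<le> L" and lip: "\<And>x y. \<bar>f x - f y\<bar> \<le> L * norm (x - y)" and e: "norm e = 1"
  shows "(\<integral>\<^sup>+a. ennreal \<bar>f (a + s *\<^sub>R e) - f a - c * s\<bar> * indicator (ball z \<rho>) a \<partial>lborel)
    \<le> ennreal \<bar>s\<bar> * (\<integral>\<^sup>+y. ennreal \<bar>dd L f e y - c\<bar> * indicator (ball z (\<rho> + 2 * \<bar>s\<bar>)) y \<partial>lborel)"
proof (cases "0 \<le> s")
  case True
  have "(\<integral>\<^sup>+a. ennreal \<bar>f (a + s *\<^sub>R e) - f a - c * s\<bar> * indicator (ball z \<rho>) a \<partial>lborel)
    \<le> ennreal s * (\<integral>\<^sup>+y. ennreal \<bar>dd L f e y - c\<bar> * indicator (ball z (\<rho> + s)) y \<partial>lborel)"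
    by (rule increment_average_nonneg[OF L lip e True])
  also have "\<dots> \<le> ennreal \<bar>s\<bar> * (\<integral>\<^sup>+y. ennreal \<bar>dd L f e y - c\<bar> * indicator (ball z (\<rho> + 2 * \<bar>s\<bar>)) y \<partial>lborel)"
    using True by (intro mult_mono nn_integral_mono) (auto simp: indicator_def)
  finally show ?thesis .
next
  case False
  have cf: "continuous_on UNIV f"
    by (intro lipschitz_on_continuous_on[of L] lipschitz_onI) (use lip L in \<open>auto simp: dist_norm\<close>)
  have [measurable]: "f \<in> borel_measurable borel" using cf by (rule borel_measurable_continuous_onI)
  let ?s = "- s"
  let ?k = "\<lambda>a. ennreal \<bar>f (a + ?s *\<^sub>R e) - f a - c * ?s\<bar> * indicator (ball (z + s *\<^sub>R e) \<rho>) a"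
  have km: "?k \<in> borel_measurable borel" by measurable
  have "(\<integral>\<^sup>+a. ennreal \<bar>f (a + s *\<^sub>R e) - f a - c * s\<bar> * indicator (ball z \<rho>) a \<partial>lborel)
      = (\<integral>\<^sup>+a. ?k (s *\<^sub>R e + a) \<partial>lborel)"
  proof (rule nn_integral_cong)
    fix a
    have "indicator (ball (z + s *\<^sub>R e) \<rho>) (s *\<^sub>R e + a) = (indicator (ball z \<rho>) a :: ennreal)"
      by (simp add: indicator_def dist_norm algebra_simps)
    moreover have "\<bar>f (s *\<^sub>R e + a + ?s *\<^sub>R e) - f (s *\<^sub>R e + a) - c * ?s\<bar> = \<bar>f (a + s *\<^sub>R e) - f a - c * s\<bar>"
      by (simp add: algebra_simps abs_if)
    ultimately show "ennreal \<bar>f (a + s *\<^sub>R e) - f a - c * s\<bar> * indicator (ball z \<rho>) a = ?k (s *\<^sub>R e + a)" by simp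
  qed
  also have "\<dots> = (\<integral>\<^sup>+a. ?k a \<partial>lborel)" by (rule nn_integral_lborel_shift[OF km])
  also have "\<dots> \<le> ennreal ?s * (\<integral>\<^sup>+y. ennreal \<bar>dd L f e y - c\<bar> * indicator (ball (z + s *\<^sub>R e) (\<rho> + ?s)) y \<partial>lborel)"
    using False by (intro increment_average_nonneg[OF L lip e]) auto
  also have "\<dots> \<le> ennreal \<bar>s\<bar> * (\<integral>\<^sup>+y. ennreal \<bar>dd L f e y - c\<bar> * indicator (ball z (\<rho> + 2 * \<bar>s\<bar>)) y \<partial>lborel)"
  proof (rule mult_mono, simp add: abs_if)
    show "(\<integral>\<^sup>+y. ennreal \<bar>dd L f e y - c\<bar> * indicator (ball (z + s *\<^sub>R e) (\<rho> + ?s)) y \<partial>lborel)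
        \<le> (\<integral>\<^sup>+y. ennreal \<bar>dd L f e y - c\<bar> * indicator (ball z (\<rho> + 2 * \<bar>s\<bar>)) y \<partial>lborel)"
    proof (rule nn_integral_mono)
    fix y
    have "y \<in> ball z (\<rho> + 2 * \<bar>s\<bar>)" if "y \<in> ball (z + s *\<^sub>R e) (\<rho> + ?s)"
    proof -
      have "dist z y \<le> dist z (z + s *\<^sub>R e) + dist (z + s *\<^sub>R e) y" by (rule dist_triangle)
      also have "dist z (z + s *\<^sub>R e) = \<bar>s\<bar>" using e by (simp add: dist_norm)
      finally show ?thesis using that False by simp
    qed
    thus "ennreal \<bar>dd L f e y - c\<bar> * indicator (ball (z + s *\<^sub>R e) (\<rho> + ?s)) y
        \<le> ennreal \<bar>dd L f e y - c\<bar> * indicator (ball z (\<rho> + 2 * \<bar>s\<bar>)) y"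
      by (auto simp: indicator_def)
    qed
  qed auto
  finally show ?thesis .
qed

text \<open>The increment by \<open>h\<close> is taken along one coordinate axis after the other.
  The partial increments have norm at most \<open>norm h\<close>, so each step stays in the ball
  enlarged by \<open>norm h + 2 * norm h\<close>.\<close>

lemma increment_average_sum:
  fixes f :: "'a::euclidean_space \<Rightarrow> real"
  assumes L: "0 \<le> L" and lip: "\<And>x y. \<bar>f x - f y\<bar> \<le> L * norm (x - y)" and S: "finite S" "S \<subseteq> Basis"
  shows "(\<integral>\<^sup>+a. ennreal \<bar>f (a + (\<Sum>i\<in>S. (h \<bullet> i) *\<^sub>R i)) - f a - (\<Sum>i\<in>S. c i * (h \<bullet> i))\<bar> * indicator (ball x \<rho>) a \<partial>lborel)
    \<le> (\<Sum>i\<in>S. ennreal (norm h) * (\<integral>\<^sup>+y. ennreal \<bar>dd L f i y - c i\<bar> * indicator (ball x (\<rho> + 3 * norm h)) y \<partial>lborel))"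
  using S
proof (induction S)
  case empty
  show ?case by simp
next
  case (insert i S)
  have i: "i \<in> Basis" "norm i = 1" using insert by auto
  define hS where "hS = (\<Sum>i\<in>S. (h \<bullet> i) *\<^sub>R i)"
  define cS where "cS = (\<Sum>i\<in>S. c i * (h \<bullet> i))"
  have hi: "\<bar>h \<bullet> i\<bar> \<le> norm h" using Basis_le_norm[OF i(1)] .
  have nhS: "norm hS \<le> norm h"
  proof -
    have "hS \<bullet> b = (if b \<in> S then h \<bullet> b else 0)" if "b \<in> Basis" for b
    proof -
      have "hS \<bullet> b = (\<Sum>i\<in>S. if i = b then h \<bullet> b else 0)"
        unfolding hS_def inner_sum_left using insert.prems that
        by (intro sum.cong refl) (auto simp: inner_Basis)
      thus ?thesis using insert.hyps by simp
    qed
    thus ?thesis by (intro norm_le_componentwise) simp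
  qed
  have [measurable]: "f \<in> borel_measurable borel"
    by (intro borel_measurable_continuous_onI lipschitz_on_continuous_on[of L] lipschitz_onI) (use lip L in \<open>auto simp: dist_norm\<close>)
  let ?k = "\<lambda>b. ennreal \<bar>f (b + (h \<bullet> i) *\<^sub>R i) - f b - c i * (h \<bullet> i)\<bar> * indicator (ball (x + hS) \<rho>) b"
  have km: "?k \<in> borel_measurable borel" by measurable
  have "(\<integral>\<^sup>+a. ennreal \<bar>f (a + (\<Sum>i\<in>insert i S. (h \<bullet> i) *\<^sub>R i)) - f a - (\<Sum>i\<in>insert i S. c i * (h \<bullet> i))\<bar> * indicator (ball x \<rho>) a \<partial>lborel)
      \<le> (\<integral>\<^sup>+a. ?k (hS + a) + ennreal \<bar>f (a + hS) - f a - cS\<bar> * indicator (ball x \<rho>) a \<partial>lborel)"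
  proof (rule nn_integral_mono)
    fix a
    have eq: "f (a + (\<Sum>i\<in>insert i S. (h \<bullet> i) *\<^sub>R i)) - f a - (\<Sum>i\<in>insert i S. c i * (h \<bullet> i))
       = (f (hS + a + (h \<bullet> i) *\<^sub>R i) - f (hS + a) - c i * (h \<bullet> i)) + (f (a + hS) - f a - cS)"
      using insert.hyps by (simp add: hS_def cS_def algebra_simps)
    have ind: "indicator (ball (x + hS) \<rho>) (hS + a) = (indicator (ball x \<rho>) a :: ennreal)"
      by (simp add: indicator_def dist_norm algebra_simps)
    show "ennreal \<bar>f (a + (\<Sum>i\<in>insert i S. (h \<bullet> i) *\<^sub>R i)) - f a - (\<Sum>i\<in>insert i S. c i * (h \<bullet> i))\<bar> * indicator (ball x \<rho>) a
       \<le> ?k (hS + a) + ennreal \<bar>f (a + hS) - f a - cS\<bar> * indicator (ball x \<rho>) a"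
      unfolding eq ind by (auto simp: indicator_def abs_triangle_ineq ennreal_leI simp flip: ennreal_plus)
  qed
  also have "\<dots> = (\<integral>\<^sup>+a. ?k (hS + a) \<partial>lborel) + (\<integral>\<^sup>+a. ennreal \<bar>f (a + hS) - f a - cS\<bar> * indicator (ball x \<rho>) a \<partial>lborel)"
    by (intro nn_integral_add) measurable
  also have "\<dots> \<le> ennreal (norm h) * (\<integral>\<^sup>+y. ennreal \<bar>dd L f i y - c i\<bar> * indicator (ball x (\<rho> + 3 * norm h)) y \<partial>lborel)
     + (\<Sum>i\<in>S. ennreal (norm h) * (\<integral>\<^sup>+y. ennreal \<bar>dd L f i y - c i\<bar> * indicator (ball x (\<rho> + 3 * norm h)) y \<partial>lborel))"
  proof (intro add_mono)
    have "(\<integral>\<^sup>+a. ?k (hS + a) \<partial>lborel) = (\<integral>\<^sup>+a. ?k a \<partial>lborel)" by (rule nn_integral_lborel_shift[OF km])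
    also have "\<dots> \<le> ennreal \<bar>h \<bullet> i\<bar> * (\<integral>\<^sup>+y. ennreal \<bar>dd L f i y - c i\<bar> * indicator (ball (x + hS) (\<rho> + 2 * \<bar>h \<bullet> i\<bar>)) y \<partial>lborel)"
      by (rule increment_average[OF L lip i(2)])
    also have "\<dots> \<le> ennreal (norm h) * (\<integral>\<^sup>+y. ennreal \<bar>dd L f i y - c i\<bar> * indicator (ball x (\<rho> + 3 * norm h)) y \<partial>lborel)"
    proof (rule mult_mono)
      show "ennreal \<bar>h \<bullet> i\<bar> \<le> ennreal (norm h)" using hi by (rule ennreal_leI)
      show "(\<integral>\<^sup>+y. ennreal \<bar>dd L f i y - c i\<bar> * indicator (ball (x + hS) (\<rho> + 2 * \<bar>h \<bullet> i\<bar>)) y \<partial>lborel)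
          \<le> (\<integral>\<^sup>+y. ennreal \<bar>dd L f i y - c i\<bar> * indicator (ball x (\<rho> + 3 * norm h)) y \<partial>lborel)"
      proof (rule nn_integral_mono)
      fix y
      have "y \<in> ball x (\<rho> + 3 * norm h)" if "y \<in> ball (x + hS) (\<rho> + 2 * \<bar>h \<bullet> i\<bar>)"
      proof -
        have "dist x y \<le> dist x (x + hS) + dist (x + hS) y" by (rule dist_triangle)
        also have "dist x (x + hS) = norm hS" by (simp add: dist_norm)
        finally show ?thesis using that hi nhS by simp
      qed
      thus "ennreal \<bar>dd L f i y - c i\<bar> * indicator (ball (x + hS) (\<rho> + 2 * \<bar>h \<bullet> i\<bar>)) y
          \<le> ennreal \<bar>dd L f i y - c i\<bar> * indicator (ball x (\<rho> + 3 * norm h)) y"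
        by (auto simp: indicator_def)
      qed
    qed auto
    finally show "(\<integral>\<^sup>+a. ?k (hS + a) \<partial>lborel) \<le> ennreal (norm h) * (\<integral>\<^sup>+y. ennreal \<bar>dd L f i y - c i\<bar> * indicator (ball x (\<rho> + 3 * norm h)) y \<partial>lborel)" .
    show "(\<integral>\<^sup>+a. ennreal \<bar>f (a + hS) - f a - cS\<bar> * indicator (ball x \<rho>) a \<partial>lborel)
       \<le> (\<Sum>i\<in>S. ennreal (norm h) * (\<integral>\<^sup>+y. ennreal \<bar>dd L f i y - c i\<bar> * indicator (ball x (\<rho> + 3 * norm h)) y \<partial>lborel))"
      unfolding hS_def cS_def using insert by auto
  qed
  finally show ?case using insert.hyps by simp
qed

text \<open>Rademacher's theorem follows from this. The increment at \<open>x\<close> is replaced by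
  its mean over a ball of radius \<open>epsilon * r\<close>, where \<open>r = norm h\<close>; by the
  Lipschitz condition this costs \<open>2 * L * epsilon * r\<close>. The mean is controlled by the
  mean oscillation of the partial derivatives over the ball of radius \<open>4 * r\<close>, which is
  small relative to the volume, and the ratio of the two volumes does not depend on
  \<open>r\<close>.\<close>

lemma has_derivative_at_lebesgue_point:
  fixes f :: "'a::euclidean_space \<Rightarrow> real"
  assumes L: "0 \<le> L" and lip: "\<And>x y. \<bar>f x - f y\<bar> \<le> L * norm (x - y)"
    and x: "\<And>i. i \<in> Basis \<Longrightarrow> lebesgue_point (dd L f i) x"
  shows "(f has_derivative (\<lambda>h. \<Sum>i\<in>Basis. dd L f i x * (h \<bullet> i))) (at x)"
  unfolding has_derivative_at_alt
proof (intro conjI allI impI)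
  show "bounded_linear (\<lambda>h. \<Sum>i\<in>Basis. dd L f i x * (h \<bullet> i))"
    by (intro bounded_linear_sum bounded_linear_const_mult bounded_linear_inner_left)
  fix e :: real assume e: "0 < e"
  let ?n = "DIM('a)"
  define \<epsilon> where "\<epsilon> = min 1 (e / (4 * (L + 1)))"
  have \<epsilon>: "0 < \<epsilon>" "\<epsilon> \<le> 1" "2 * L * \<epsilon> \<le> e / 2"
  proof -
    show "0 < \<epsilon>" "\<epsilon> \<le> 1" using e L by (auto simp: \<epsilon>_def)
    have "2 * L * \<epsilon> \<le> 2 * (L + 1) * (e / (4 * (L + 1)))"
      using L e by (intro mult_mono) (auto simp: \<epsilon>_def)
    also have "\<dots> = e / 2" using L by (simp add: field_simps)
    finally show "2 * L * \<epsilon> \<le> e / 2" .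
  qed
  \<comment> \<open>The powers of \<open>epsilon\<close> and 4 compensate the ratio of the volumes
    of the balls of radius \<open>epsilon * r\<close> and \<open>4 * r\<close>, the factor
    \<open>DIM('a)\<close> the number of coordinate steps. Half of \<open>e\<close> remains for the
    Lipschitz error.\<close>
  define \<delta> where "\<delta> = e * \<epsilon> ^ ?n / (2 * ?n * 4 ^ ?n)"
  have \<delta>: "0 < \<delta>" using e \<epsilon> by (simp add: \<delta>_def)
  have "\<forall>\<^sub>F r in at_right 0. \<forall>i\<in>Basis. (LINT y:ball x r|lebesgue. \<bar>dd L f i y - dd L f i x\<bar>) \<le> \<delta> * measure lebesgue (ball x r)"
    using x \<delta> by (intro eventually_ball_finite) (auto simp: lebesgue_point_def)
  then obtain d where d: "0 < d" "\<And>r i. 0 < r \<Longrightarrow> r < d \<Longrightarrow> i \<in> Basis \<Longrightarrow>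
      (LINT y:ball x r|lebesgue. \<bar>dd L f i y - dd L f i x\<bar>) \<le> \<delta> * measure lebesgue (ball x r)"
    unfolding eventually_at_right_field by blast
  have dm: "dd L f i \<in> borel_measurable borel" for i
    by (intro dd_measurable lipschitz_on_continuous_on[of L] lipschitz_onI) (use lip L in \<open>auto simp: dist_norm\<close>)
  have I: "(\<integral>\<^sup>+y. ennreal \<bar>dd L f i y - dd L f i x\<bar> * indicator (ball x r) y \<partial>lborel) \<le> ennreal (\<delta> * measure lebesgue (ball x r))"
    if r: "0 < r" "r < d" and i: "i \<in> Basis" for r i
  proof -
    have dl: "dd L f i \<in> borel_measurable lebesgue" using dm[of i] by (intro measurable_completion) simp
    have int: "set_integrable lebesgue (ball x r) (\<lambda>y. \<bar>dd L f i y - dd L f i x\<bar>)"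
    proof (rule set_integrable_bounded_ball)
      show "(\<lambda>y. \<bar>dd L f i y - dd L f i x\<bar>) \<in> borel_measurable lebesgue"
        by (intro borel_measurable_abs borel_measurable_diff dl) simp
      show "\<bar>\<bar>dd L f i y - dd L f i x\<bar>\<bar> \<le> 2 * L" for y
        using dd_bound[OF L, of f i y] dd_bound[OF L, of f i x] by linarith
    qed
    have "(\<integral>\<^sup>+y. ennreal \<bar>dd L f i y - dd L f i x\<bar> * indicator (ball x r) y \<partial>lborel)
        = (\<integral>\<^sup>+y. ennreal (indicator (ball x r) y *\<^sub>R \<bar>dd L f i y - dd L f i x\<bar>) \<partial>lebesgue)"
      unfolding nn_integral_completion by (intro nn_integral_cong) (simp add: indicator_def)
    also have "\<dots> = ennreal (LINT y:ball x r|lebesgue. \<bar>dd L f i y - dd L f i x\<bar>)"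
      unfolding set_lebesgue_integral_def
      by (intro nn_integral_eq_integral int[unfolded set_integrable_def] AE_I2) auto
    also have "\<dots> \<le> ennreal (\<delta> * measure lebesgue (ball x r))" by (intro ennreal_leI d r i)
    finally show ?thesis .
  qed
  show "\<exists>d>0. \<forall>y. norm (y - x) < d \<longrightarrow>
      norm (f y - f x - (\<Sum>i\<in>Basis. dd L f i x * ((y - x) \<bullet> i))) \<le> e * norm (y - x)"
  proof (intro exI[of _ "d / 4"] conjI allI impI)
    show "0 < d / 4" using d by simp
    fix y assume y: "norm (y - x) < d / 4"
    define h where "h = y - x"
    define r where "r = norm h"
    define c where "c i = dd L f i x" for i
    show "norm (f y - f x - (\<Sum>i\<in>Basis. dd L f i x * ((y - x) \<bullet> i))) \<le> e * norm (y - x)"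
    proof (cases "r = 0")
      case True thus ?thesis by (simp add: r_def h_def)
    next
      case False
      hence r: "0 < r" "4 * r < d" using y by (auto simp: r_def h_def)
      define \<rho> where "\<rho> = \<epsilon> * r"
      have \<rho>: "0 < \<rho>" "\<rho> \<le> r" using r \<epsilon> by (auto simp: \<rho>_def)
      define X where "X = \<bar>f (x + h) - f x - (\<Sum>i\<in>Basis. c i * (h \<bullet> i))\<bar>"
      define m where "m = measure lebesgue (ball x \<rho>)"
      define \<omega> where "\<omega> = measure lebesgue (ball (0::'a) 1)"
      have \<omega>: "0 < \<omega>" by (simp add: \<omega>_def content_ball_pos)
      have m: "m = \<rho> ^ ?n * \<omega>" and m4: "measure lebesgue (ball x (4 * r)) = (4 * r) ^ ?n * \<omega>"
        using content_ball_conv_unit_ball[of \<rho> x] content_ball_conv_unit_ball[of "4 * r" x] \<rho> r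
        by (simp_all add: m_def \<omega>_def)
      have m0: "0 < m" using \<rho> \<omega> by (simp add: m)
      have em: "emeasure lborel (ball x \<rho>) = ennreal m"
        using emeasure_eq_measure2[OF lmeasurable_ball[of x \<rho>]] by (simp add: m_def)
      have hsum: "(\<Sum>i\<in>Basis. (h \<bullet> i) *\<^sub>R i) = h" by (rule euclidean_representation)
      have fm[measurable]: "f \<in> borel_measurable borel"
        by (intro borel_measurable_continuous_onI lipschitz_on_continuous_on[of L] lipschitz_onI) (use lip L in \<open>auto simp: dist_norm\<close>)
      let ?Q = "\<lambda>a. \<bar>f (a + h) - f a - (\<Sum>i\<in>Basis. c i * (h \<bullet> i))\<bar>"
      have "ennreal (X * m) = (\<integral>\<^sup>+a. ennreal X * indicator (ball x \<rho>) a \<partial>lborel)"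
        by (simp add: nn_integral_cmult_indicator em ennreal_mult' X_def)
      also have "\<dots> \<le> (\<integral>\<^sup>+a. ennreal (?Q a) * indicator (ball x \<rho>) a + ennreal (2 * L * \<rho>) * indicator (ball x \<rho>) a \<partial>lborel)"
      proof (rule nn_integral_mono)
        fix a
        have "X \<le> ?Q a + 2 * L * \<rho>" if a: "a \<in> ball x \<rho>"
        proof -
          have "L * norm (x - a) \<le> L * \<rho>" using a L by (intro mult_left_mono) (auto simp: dist_norm)
          hence "\<bar>f (x + h) - f (a + h)\<bar> \<le> L * \<rho>" "\<bar>f x - f a\<bar> \<le> L * \<rho>"
            using lip[of "x + h" "a + h"] lip[of x a] by auto
          thus ?thesis unfolding X_def by linarith
        qed
        have "a \<in> ball x \<rho> \<Longrightarrow> ennreal X \<le> ennreal (?Q a) + ennreal (2 * L * \<rho>)"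
        proof -
          assume "a \<in> ball x \<rho>"
          hence "X \<le> ?Q a + 2 * L * \<rho>" by (rule \<open>a \<in> ball x \<rho> \<Longrightarrow> X \<le> ?Q a + 2 * L * \<rho>\<close>)
          hence "ennreal X \<le> ennreal (?Q a + 2 * L * \<rho>)" by (rule ennreal_leI)
          also have "\<dots> = ennreal (?Q a) + ennreal (2 * L * \<rho>)" using L \<rho> by (intro ennreal_plus) auto
          finally show "ennreal X \<le> ennreal (?Q a) + ennreal (2 * L * \<rho>)" .
        qed
        then show "ennreal X * indicator (ball x \<rho>) a \<le> ennreal (?Q a) * indicator (ball x \<rho>) a + ennreal (2 * L * \<rho>) * indicator (ball x \<rho>) a"
          by (auto simp: indicator_def)
      qed
      also have "\<dots> = (\<integral>\<^sup>+a. ennreal (?Q a) * indicator (ball x \<rho>) a \<partial>lborel) + (\<integral>\<^sup>+a. ennreal (2 * L * \<rho>) * indicator (ball x \<rho>) a \<partial>lborel)"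
        by (rule nn_integral_add) measurable
      also have "(\<integral>\<^sup>+a. ennreal (2 * L * \<rho>) * indicator (ball x \<rho>) a \<partial>lborel) = ennreal (2 * L * \<rho> * m)"
        using L \<rho> by (simp add: nn_integral_cmult_indicator em ennreal_mult')
      also have "(\<integral>\<^sup>+a. ennreal (?Q a) * indicator (ball x \<rho>) a \<partial>lborel)
          \<le> (\<Sum>i\<in>Basis. ennreal (norm h) * (\<integral>\<^sup>+y. ennreal \<bar>dd L f i y - c i\<bar> * indicator (ball x (\<rho> + 3 * norm h)) y \<partial>lborel))"
        using increment_average_sum[OF L lip finite_Basis order_refl, of h c x \<rho>] unfolding hsum .
      also have "\<dots> \<le> (\<Sum>i\<in>(Basis::'a set). ennreal (r * (\<delta> * ((4 * r) ^ ?n * \<omega>))))"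
      proof (rule sum_mono)
        fix i :: 'a assume i: "i \<in> Basis"
        have "(\<integral>\<^sup>+y. ennreal \<bar>dd L f i y - c i\<bar> * indicator (ball x (\<rho> + 3 * norm h)) y \<partial>lborel)
           \<le> (\<integral>\<^sup>+y. ennreal \<bar>dd L f i y - dd L f i x\<bar> * indicator (ball x (4 * r)) y \<partial>lborel)"
          using \<rho> by (intro nn_integral_mono) (auto simp: c_def r_def indicator_def)
        also have "\<dots> \<le> ennreal (\<delta> * ((4 * r) ^ ?n * \<omega>))"
          using I[of "4 * r" i] r i unfolding m4 by simp
        finally have "ennreal (norm h) * (\<integral>\<^sup>+y. ennreal \<bar>dd L f i y - c i\<bar> * indicator (ball x (\<rho> + 3 * norm h)) y \<partial>lborel)
           \<le> ennreal r * ennreal (\<delta> * ((4 * r) ^ ?n * \<omega>))"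
          by (intro mult_mono) (auto simp: r_def)
        thus "ennreal (norm h) * (\<integral>\<^sup>+y. ennreal \<bar>dd L f i y - c i\<bar> * indicator (ball x (\<rho> + 3 * norm h)) y \<partial>lborel)
           \<le> ennreal (r * (\<delta> * ((4 * r) ^ ?n * \<omega>)))"
          using r by (simp add: ennreal_mult')
      qed
      also have "\<dots> = ennreal (?n * (r * (\<delta> * ((4 * r) ^ ?n * \<omega>))))"
        using r \<delta> \<omega> by (simp add: ennreal_of_nat_eq_real_of_nat ennreal_mult')
      finally have "ennreal (X * m) \<le> ennreal (?n * (r * (\<delta> * ((4 * r) ^ ?n * \<omega>)))) + ennreal (2 * L * \<rho> * m)"
        by simp
      also have "\<dots> = ennreal (?n * (r * (\<delta> * ((4 * r) ^ ?n * \<omega>))) + 2 * L * \<rho> * m)"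
        using r \<delta> \<omega> L \<rho> m0 by (intro ennreal_plus[symmetric]) auto
      finally have "X * m \<le> ?n * (r * (\<delta> * ((4 * r) ^ ?n * \<omega>))) + 2 * L * \<rho> * m"
        using r \<delta> \<omega> L \<rho> m0 by (subst (asm) ennreal_le_iff) (auto intro!: add_nonneg_nonneg)
      also have "?n * (r * (\<delta> * ((4 * r) ^ ?n * \<omega>))) = e / 2 * r * m"
        by (simp add: \<delta>_def m \<rho>_def power_mult_distrib)
      also have "2 * L * \<rho> * m = (2 * L * \<epsilon>) * r * m" by (simp add: \<rho>_def)
      also have "e / 2 * r * m + 2 * L * \<epsilon> * r * m \<le> e / 2 * r * m + e / 2 * r * m"
        using \<epsilon>(3) r m0 by (intro add_left_mono mult_right_mono) auto
      finally have "X * m \<le> e * r * m" by (simp add: mult_ac)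
      hence "X \<le> e * r" using m0 by simp
      thus ?thesis by (simp add: X_def c_def h_def r_def)
    qed
  qed
qed

text \<open>McShane's extension: the lower envelope of the cones
  \<open>f s + L * norm (x - s)\<close> with \<open>s\<close> in \<open>S\<close>.\<close>

lemma lipschitz_extension_real:
  fixes f :: "'a::real_normed_vector \<Rightarrow> real"
  assumes L: "0 \<le> L" and lip: "\<And>x y. x \<in> S \<Longrightarrow> y \<in> S \<Longrightarrow> \<bar>f x - f y\<bar> \<le> L * norm (x - y)"
  obtains g where "\<And>x. x \<in> S \<Longrightarrow> g x = f x" "\<And>x y. \<bar>g x - g y\<bar> \<le> L * norm (x - y)"
proof (cases "S = {}")
  case True
  show thesis by (rule that[of "\<lambda>_. 0"]) (use True L in auto)
next
  case False
  then obtain s0 where s0: "s0 \<in> S" by blast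
  define g where "g x = (INF s\<in>S. f s + L * norm (x - s))" for x
  have bdd: "bdd_below ((\<lambda>s. f s + L * norm (x - s)) ` S)" for x
  proof (rule bdd_belowI2)
    fix s assume s: "s \<in> S"
    have "norm (s0 - s) \<le> norm (s0 - x) + norm (x - s)" using norm_triangle_ineq[of "s0 - x" "x - s"] by simp
    hence "L * norm (s0 - s) \<le> L * (norm (s0 - x) + norm (x - s))"
      using L by (rule mult_left_mono)
    hence "L * norm (s0 - s) \<le> L * norm (s0 - x) + L * norm (x - s)" by (simp only: distrib_left)
    thus "f s0 - L * norm (s0 - x) \<le> f s + L * norm (x - s)" using lip[OF s0 s] by linarith
  qed
  have le: "g x \<le> g y + L * norm (x - y)" for x y
  proof -
    have "g x - L * norm (x - y) \<le> f s + L * norm (y - s)" if s: "s \<in> S" for s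
    proof -
      have "g x \<le> f s + L * norm (x - s)" unfolding g_def by (rule cINF_lower[OF bdd s])
      moreover have "norm (x - s) \<le> norm (x - y) + norm (y - s)" using norm_triangle_ineq[of "x - y" "y - s"] by simp
      hence "L * norm (x - s) \<le> L * (norm (x - y) + norm (y - s))"
        using L by (rule mult_left_mono)
      hence "L * norm (x - s) \<le> L * norm (x - y) + L * norm (y - s)" by (simp only: distrib_left)
      ultimately show ?thesis by linarith
    qed
    hence "g x - L * norm (x - y) \<le> g y" unfolding g_def[of y] by (intro cINF_greatest False)
    thus ?thesis by linarith
  qed
  show thesis
  proof (rule that[of g])
    show "g x = f x" if x: "x \<in> S" for x
    proof (rule antisym)
      show "g x \<le> f x" unfolding g_def using cINF_lower[OF bdd x, of x] by simp
      show "f x \<le> g x" unfolding g_def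
      proof (rule cINF_greatest[OF False])
        fix s assume "s \<in> S"
        thus "f x \<le> f s + L * norm (x - s)" using lip[OF x, of s] by linarith
      qed
    qed
    show "\<bar>g x - g y\<bar> \<le> L * norm (x - y)" for x y
      using le[of x y] le[of y x] by (simp add: abs_le_iff norm_minus_commute)
  qed
qed

section \<open>Touching by radial profiles\<close>

lemma powr_tangent:
  fixes s0 s \<theta> :: real
  assumes "0 \<le> \<theta>" "\<theta> \<le> 1" "0 < s0" "0 \<le> s"
  shows "s powr \<theta> \<le> s0 powr \<theta> + \<theta> * s0 powr (\<theta> - 1) * (s - s0)"
proof (cases "s = 0")
  case True
  have "s0 powr (\<theta> - 1) * s0 = s0 powr \<theta>" using assms by (simp add: powr_diff)
  hence "s0 powr \<theta> + \<theta> * s0 powr (\<theta> - 1) * (s - s0) = (1 - \<theta>) * s0 powr \<theta>" using True by (simp add: algebra_simps)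
  thus ?thesis using True assms by simp
next
  case False
  hence "s powr \<theta> * s0 powr (1 - \<theta>) \<le> \<theta> * s + (1 - \<theta>) * s0"
    using assms by (intro Youngs_inequality_0) auto
  hence "s0 powr (\<theta> - 1) * (s powr \<theta> * s0 powr (1 - \<theta>)) \<le> s0 powr (\<theta> - 1) * (\<theta> * s + (1 - \<theta>) * s0)"
    by (intro mult_left_mono) auto
  moreover have "s0 powr (\<theta> - 1) * s0 powr (1 - \<theta>) = 1" using assms by (simp flip: powr_add)
  moreover have "s0 powr (\<theta> - 1) * s0 = s0 powr \<theta>" using assms by (simp add: powr_diff)
  ultimately show ?thesis by (simp add: algebra_simps)
qed

lemma power2_powr: "0 \<le> s \<Longrightarrow> (s\<^sup>2) powr b = s powr (2 * b)" for s :: real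
proof (cases "s = 0")
  case False
  assume "0 \<le> s"
  hence "s\<^sup>2 = s powr 2" using False by simp
  thus ?thesis by (simp only: powr_powr)
qed simp

text \<open>As \<open>beta <= 2\<close>, the power is a concave function of the square of the norm,
  and its tangent gives a one-sided expansion with a quadratic error.\<close>

lemma norm_powr_expansion:
  fixes a h :: "'a::real_inner"
  assumes "1 \<le> \<beta>" "\<beta> \<le> 2" "a \<noteq> 0"
  shows "norm (a + h) powr \<beta> - norm a powr \<beta> - \<beta> * norm a powr (\<beta> - 2) * (a \<bullet> h)
      \<le> (\<beta> / 2) * norm a powr (\<beta> - 2) * (norm h)\<^sup>2"
proof -
  have sq: "norm z powr \<beta> = ((norm z)\<^sup>2) powr (\<beta> / 2)" for z :: 'a
    by (simp add: power2_powr)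
  have t: "((norm a)\<^sup>2) powr (\<beta> / 2 - 1) = norm a powr (\<beta> - 2)"
    by (simp add: power2_powr algebra_simps)
  have "((norm (a + h))\<^sup>2) powr (\<beta> / 2) \<le> ((norm a)\<^sup>2) powr (\<beta> / 2)
      + \<beta> / 2 * ((norm a)\<^sup>2) powr (\<beta> / 2 - 1) * ((norm (a + h))\<^sup>2 - (norm a)\<^sup>2)"
    using assms by (intro powr_tangent) auto
  moreover have "(norm (a + h))\<^sup>2 - (norm a)\<^sup>2 = 2 * (a \<bullet> h) + (norm h)\<^sup>2"
    by (simp add: power2_norm_eq_inner inner_simps inner_commute)
  ultimately show ?thesis unfolding sq[symmetric] t by (simp add: field_simps)
qed

text \<open>For \<open>norm h <= norm a\<close> the quadratic error is used, with
  \<open>norm a powr (beta - 2) <= norm h powr (beta - 2)\<close>. For larger \<open>h\<close> this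
  coefficient may blow up, and the terms are estimated separately: 4 comes from the power of
  \<open>a + h\<close>, 2 from the linear term.\<close>

lemma norm_powr_error:
  fixes a h :: "'a::real_inner"
  assumes "1 \<le> \<beta>" "\<beta> \<le> 2"
  shows "norm (a + h) powr \<beta> - norm a powr \<beta> - \<beta> * norm a powr (\<beta> - 2) * (a \<bullet> h) \<le> 6 * norm h powr \<beta>"
proof (cases "norm h \<le> norm a")
  case True
  show ?thesis
  proof (cases "a = 0")
    case a0: False
    have *: "norm (a + h) powr \<beta> - norm a powr \<beta> - \<beta> * norm a powr (\<beta> - 2) * (a \<bullet> h)
      \<le> (\<beta> / 2) * norm a powr (\<beta> - 2) * (norm h)\<^sup>2" by (rule norm_powr_expansion[OF assms a0])
    show ?thesis
    proof (cases "h = 0")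
      case False
      have "norm a powr (\<beta> - 2) \<le> norm h powr (\<beta> - 2)"
        using False True assms by (intro powr_mono2') auto
      hence "(\<beta> / 2) * norm a powr (\<beta> - 2) * (norm h)\<^sup>2 \<le> 1 * norm h powr (\<beta> - 2) * (norm h)\<^sup>2"
        using assms by (intro mult_right_mono mult_mono) auto
      also have "\<dots> = norm h powr \<beta>" using False by (simp add: powr_diff)
      also have "\<dots> \<le> 6 * norm h powr \<beta>" by simp
      finally show ?thesis using * by linarith
    qed simp
  qed (use True in auto)
next
  case False
  have "norm (a + h) \<le> 2 * norm h" using norm_triangle_ineq[of a h] False by linarith
  hence "norm (a + h) powr \<beta> \<le> (2 * norm h) powr \<beta>" using assms by (intro powr_mono2) auto
  also have "\<dots> = 2 powr \<beta> * norm h powr \<beta>" by (simp add: powr_mult)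
  also have "\<dots> \<le> 4 * norm h powr \<beta>"
    using powr_mono[of \<beta> 2 2] assms by (intro mult_right_mono) auto
  finally have 1: "norm (a + h) powr \<beta> \<le> 4 * norm h powr \<beta>" .
  have "- (\<beta> * norm a powr (\<beta> - 2) * (a \<bullet> h)) \<le> 2 * norm h powr \<beta>"
  proof (cases "a = 0")
    case a: False
    have "- (a \<bullet> h) \<le> norm a * norm h" using Cauchy_Schwarz_ineq2[of a h] by linarith
    hence "\<beta> * norm a powr (\<beta> - 2) * (- (a \<bullet> h)) \<le> \<beta> * norm a powr (\<beta> - 2) * (norm a * norm h)"
      using assms by (intro mult_left_mono) auto
    also have "\<dots> = \<beta> * (norm a powr (\<beta> - 1) * norm h)" using a by (simp add: powr_diff power2_eq_square)
    also have "\<dots> \<le> 2 * (norm h powr (\<beta> - 1) * norm h)"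
      using assms False by (intro mult_mono powr_mono2) auto
    also have "norm h powr (\<beta> - 1) * norm h = norm h powr \<beta>" using False by (auto simp: powr_diff)
    finally show ?thesis by simp
  qed simp
  thus ?thesis using 1 powr_ge_zero[of "norm a" \<beta>] by linarith
qed

lemma exponent_facts:
  fixes \<gamma> :: real
  assumes "0 \<le> \<gamma>"
  shows "1 \<le> 1 + 1 / (1 + \<gamma>)" "1 + 1 / (1 + \<gamma>) \<le> 2" "1 / (1 + \<gamma>) * \<gamma> + (1 + 1 / (1 + \<gamma>)) - 2 = 0"
proof -
  have "1 / (1 + \<gamma>) * \<gamma> + 1 / (1 + \<gamma>) = (1 + \<gamma>) * (1 / (1 + \<gamma>))" by (simp only: distrib_right mult_1 mult.commute add.commute)
  also have "\<dots> = 1" using assms by simp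
  finally show "1 / (1 + \<gamma>) * \<gamma> + (1 + 1 / (1 + \<gamma>)) - 2 = 0" by linarith
qed (use assms in \<open>auto simp: field_simps\<close>)

text \<open>The exponent is chosen such that \<open>|p|^gamma * norm (x - y) powr (beta - 2)\<close>
  is the constant \<open>(A * beta) powr gamma\<close> when \<open>x\<close> differs from
  \<open>y\<close>. This turns the expansion error into the quadratic touching bound, and it makes
  \<open>|p|^gamma p\<close> proportional to \<open>y - x\<close>, so that the centre is recovered
  from the contact point and the slope.\<close>

lemma touches_below_power:
  fixes x y :: "real ^ 'n::finite"
  assumes \<gamma>: "0 \<le> \<gamma>" and A: "0 < A" and \<beta>: "\<beta> = 1 + 1 / (1 + \<gamma>)"
    and c: "\<And>z. z \<in> S \<Longrightarrow> v x + A * norm (x - y) powr \<beta> - A * norm (z - y) powr \<beta> \<le> v z"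
    and p: "p = (- (A * \<beta> * norm (x - y) powr (\<beta> - 2))) *\<^sub>R (x - y)"
  shows "touches_below \<gamma> (6 * A) S v x p"
    "norm p = A * \<beta> * norm (x - y) powr (\<beta> - 1)"
    "y = x + (1 / (A * \<beta>) powr (1 + \<gamma>)) *\<^sub>R norm_pow p \<gamma> *\<^sub>R p"
proof -
  have b: "1 \<le> \<beta>" "\<beta> \<le> 2" "\<beta> - 1 = 1 / (1 + \<gamma>)" "1 < \<beta>" using exponent_facts[OF \<gamma>] \<gamma> by (auto simp: \<beta>)
  define a where "a = x - y"
  show np: "norm p = A * \<beta> * norm (x - y) powr (\<beta> - 1)"
  proof -
    have "norm (x - y) * norm (x - y) powr (\<beta> - 2) = norm (x - y) powr (1 + (\<beta> - 2))"
      by (rule powr_mult_base) simp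
    moreover have "norm p = A * \<beta> * (norm (x - y) * norm (x - y) powr (\<beta> - 2))"
      using A b(1) by (simp add: p abs_mult)
    ultimately show ?thesis by simp
  qed
  have E: "v x + p \<bullet> (z - x) - v z \<le> A * (norm (a + (z - x)) powr \<beta> - norm a powr \<beta> - \<beta> * norm a powr (\<beta> - 2) * (a \<bullet> (z - x)))"
    if "z \<in> S" for z
    using c[OF that] by (simp add: p a_def algebra_simps)
  have npw: "norm_pow p \<gamma> * norm a powr (\<beta> - 2) = (A * \<beta>) powr \<gamma>" if "a \<noteq> 0"
  proof (cases "\<gamma> = 0")
    case True
    thus ?thesis using that A by (simp add: norm_pow_def \<beta>)
  next
    case False
    have "norm p powr \<gamma> * norm a powr (\<beta> - 2) = (A * \<beta>) powr \<gamma> * (norm a powr ((\<beta> - 1) * \<gamma>) * norm a powr (\<beta> - 2))"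
      using A b by (simp add: np powr_mult powr_powr flip: a_def)
    also have "norm a powr ((\<beta> - 1) * \<gamma>) * norm a powr (\<beta> - 2) = norm a powr 0"
    proof -
      have ex: "(\<beta> - 1) * \<gamma> + (\<beta> - 2) = 0" using exponent_facts(3)[OF \<gamma>] by (simp add: \<beta>)
      show ?thesis by (simp only: powr_add[symmetric] ex)
    qed
    finally show ?thesis using False that by (simp add: norm_pow_def)
  qed
  show "touches_below \<gamma> (6 * A) S v x p"
    unfolding touches_below_def \<beta>[symmetric]
  proof (intro ballI conjI)
    fix z assume z: "z \<in> S"
    have "A * (norm (a + (z - x)) powr \<beta> - norm a powr \<beta> - \<beta> * norm a powr (\<beta> - 2) * (a \<bullet> (z - x))) \<le> A * (6 * norm (z - x) powr \<beta>)"
      using norm_powr_error[OF b(1,2)] A by (intro mult_left_mono) auto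
    thus first: "v x + p \<bullet> (z - x) - v z \<le> 6 * A * norm (z - x) powr \<beta>" using E[OF z] by linarith
    show "norm_pow p \<gamma> * (v x + p \<bullet> (z - x) - v z) \<le> (6 * A) powr (1 + \<gamma>) * (norm (z - x))\<^sup>2"
    proof (cases "a = 0")
      case True
      hence p0: "p = 0" by (simp add: p a_def)
      show ?thesis
      proof (cases "\<gamma> = 0")
        case g0: True
        thus ?thesis using first A by (simp add: norm_pow_def p0 \<beta>)
      qed (simp add: norm_pow_def p0)
    next
      case False
      have "norm_pow p \<gamma> * (v x + p \<bullet> (z - x) - v z)
          \<le> norm_pow p \<gamma> * (A * ((\<beta> / 2) * norm a powr (\<beta> - 2) * (norm (z - x))\<^sup>2))"
      proof (intro mult_left_mono)
        show "v x + p \<bullet> (z - x) - v z \<le> A * ((\<beta> / 2) * norm a powr (\<beta> - 2) * (norm (z - x))\<^sup>2)"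
          using E[OF z] mult_left_mono[OF norm_powr_expansion[OF b(1,2) False, of "z - x"], of A] A by linarith
      qed (simp add: norm_pow_def)
      also have "\<dots> = (A * \<beta>) powr \<gamma> * (A * (\<beta> / 2)) * (norm (z - x))\<^sup>2"
        using npw[OF False] by (simp add: mult_ac)
      also have "\<dots> \<le> (6 * A) powr \<gamma> * (6 * A) * (norm (z - x))\<^sup>2"
      proof -
        have 1: "A * \<beta> \<le> 6 * A" "A * (\<beta> / 2) \<le> 6 * A"
          using A b mult_left_mono[of \<beta> 2 A] by auto
        have "(A * \<beta>) powr \<gamma> \<le> (6 * A) powr \<gamma>" using 1 A b \<gamma> by (intro powr_mono2) auto
        hence "(A * \<beta>) powr \<gamma> * (A * (\<beta> / 2)) \<le> (6 * A) powr \<gamma> * (6 * A)"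
          by (rule mult_mono[OF _ 1(2)]) (use A b in auto)
        thus ?thesis by (rule mult_right_mono) simp
      qed
      also have "(6 * A) powr \<gamma> * (6 * A) = (6 * A) powr (1 + \<gamma>)" using A by (simp add: powr_add)
      finally show ?thesis .
    qed
  qed
  show "y = x + (1 / (A * \<beta>) powr (1 + \<gamma>)) *\<^sub>R norm_pow p \<gamma> *\<^sub>R p"
  proof (cases "a = 0")
    case True thus ?thesis by (simp add: p a_def)
  next
    case False
    have "norm_pow p \<gamma> *\<^sub>R p = (- (A * \<beta>) * (norm_pow p \<gamma> * norm a powr (\<beta> - 2))) *\<^sub>R a"
      by (simp add: p a_def)
    also have "\<dots> = (- ((A * \<beta>) powr (1 + \<gamma>))) *\<^sub>R a" using A b by (simp add: npw[OF False] powr_add)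
    finally show ?thesis using A b by (simp add: a_def)
  qed
qed

text \<open>By symmetry \<open>q\<close> may be taken as the shorter vector. After splitting off
  \<open>|p|^gamma (p - q)\<close>, the change of the modulus is estimated by Young's inequality,
  which treats \<open>gamma\<close> below and above 1 alike.\<close>

lemma norm_pow_scaleR_diff_le:
  fixes p q :: "real ^ 'n::finite"
  assumes \<gamma>: "0 \<le> \<gamma>"
  shows "norm (norm_pow p \<gamma> *\<^sub>R p - norm_pow q \<gamma> *\<^sub>R q) \<le> (1 + \<gamma>) * pw \<gamma> (norm p + norm q) * norm (p - q)"
proof -
  have main: "norm (norm_pow p \<gamma> *\<^sub>R p - norm_pow q \<gamma> *\<^sub>R q) \<le> (1 + \<gamma>) * pw \<gamma> (norm p + norm q) * norm (p - q)"
    if le: "norm q \<le> norm p" for p q :: "real ^ 'n"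
  proof -
    define a b where "a = norm p" and "b = norm q"
    have ab: "0 \<le> b" "b \<le> a" using le by (auto simp: a_def b_def)
    have y: "(pw \<gamma> a - pw \<gamma> b) * b \<le> \<gamma> * pw \<gamma> a * (a - b)"
    proof (cases "b = 0")
      case True
      thus ?thesis using ab \<gamma> by simp
    next
      case False
      hence p: "0 < b" "0 < a" using ab by auto
      have "(a powr (1 + \<gamma>)) powr (\<gamma> / (1 + \<gamma>)) * (b powr (1 + \<gamma>)) powr (1 / (1 + \<gamma>))
          \<le> \<gamma> / (1 + \<gamma>) * a powr (1 + \<gamma>) + 1 / (1 + \<gamma>) * b powr (1 + \<gamma>)"
        using \<gamma> p by (intro Youngs_inequality_0) (auto simp: field_simps)
      hence "a powr \<gamma> * b \<le> \<gamma> / (1 + \<gamma>) * a powr (1 + \<gamma>) + 1 / (1 + \<gamma>) * b powr (1 + \<gamma>)"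
        using \<gamma> p by (simp add: powr_powr)
      hence "(1 + \<gamma>) * (a powr \<gamma> * b) \<le> (1 + \<gamma>) * (\<gamma> / (1 + \<gamma>) * a powr (1 + \<gamma>) + 1 / (1 + \<gamma>) * b powr (1 + \<gamma>))"
        using \<gamma> by (intro mult_left_mono) auto
      also have "\<dots> = \<gamma> * a powr (1 + \<gamma>) + b powr (1 + \<gamma>)" using \<gamma> by (simp add: distrib_left)
      finally have "(1 + \<gamma>) * (a powr \<gamma> * b) \<le> \<gamma> * (a powr \<gamma> * a) + b powr \<gamma> * b"
        using p by (simp add: powr_add mult_ac)
      moreover have "pw \<gamma> a = a powr \<gamma>" "pw \<gamma> b = b powr \<gamma>" using p by (auto simp: pw_def)
      ultimately show ?thesis by (simp add: algebra_simps)
    qed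
    have "norm_pow p \<gamma> *\<^sub>R p - norm_pow q \<gamma> *\<^sub>R q = pw \<gamma> a *\<^sub>R (p - q) + (pw \<gamma> a - pw \<gamma> b) *\<^sub>R q"
      by (simp add: norm_pow_eq a_def b_def algebra_simps)
    hence "norm (norm_pow p \<gamma> *\<^sub>R p - norm_pow q \<gamma> *\<^sub>R q) \<le> norm (pw \<gamma> a *\<^sub>R (p - q)) + norm ((pw \<gamma> a - pw \<gamma> b) *\<^sub>R q)"
      by (metis norm_triangle_ineq)
    also have "\<dots> = pw \<gamma> a * norm (p - q) + (pw \<gamma> a - pw \<gamma> b) * b"
      using pw_mono[OF \<gamma> ab] by (simp add: b_def)
    also have "\<dots> \<le> pw \<gamma> a * norm (p - q) + \<gamma> * pw \<gamma> a * norm (p - q)"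
    proof -
      have "a - b \<le> norm (p - q)" unfolding a_def b_def by (rule norm_triangle_ineq2)
      hence "\<gamma> * pw \<gamma> a * (a - b) \<le> \<gamma> * pw \<gamma> a * norm (p - q)" using \<gamma> by (intro mult_left_mono) auto
      thus ?thesis using y by linarith
    qed
    also have "\<dots> = (1 + \<gamma>) * pw \<gamma> a * norm (p - q)" by (simp add: algebra_simps)
    also have "\<dots> \<le> (1 + \<gamma>) * pw \<gamma> (norm p + norm q) * norm (p - q)"
      using \<gamma> ab by (intro mult_right_mono mult_left_mono pw_mono) (auto simp: a_def)
    finally show ?thesis .
  qed
  show ?thesis
    using main[of q p] main[of p q] by (cases "norm q \<le> norm p") (auto simp: norm_minus_commute add.commute)
qed

section \<open>Gaussian profiles and their gluing to the power profile\<close>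

definition gauss_profile :: "real \<Rightarrow> real \<Rightarrow> real ^ 'n::finite \<Rightarrow> real" where
  "gauss_profile K \<kappa> z = K * exp (- \<kappa> * (norm z)\<^sup>2)"

lemma gauss_profile_pos: "0 < K \<Longrightarrow> 0 < gauss_profile K \<kappa> z"
  by (simp add: gauss_profile_def)

lemma norm_add_sq: "(norm (a + h))\<^sup>2 = (norm a)\<^sup>2 + 2 * (a \<bullet> h) + (norm h)\<^sup>2" for a h :: "'a::real_inner"
  by (simp add: power2_norm_eq_inner inner_simps inner_commute)

lemma gauss_profile_split:
  "gauss_profile K \<kappa> (a + h) = gauss_profile K \<kappa> a * exp (- \<kappa> * (2 * (a \<bullet> h) + (norm h)\<^sup>2))"
  by (simp add: gauss_profile_def norm_add_sq algebra_simps flip: exp_add)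

lemma gauss_profile_expansion1:
  assumes "0 < K" "0 < \<kappa>"
  shows "gauss_profile K \<kappa> a - 2 * \<kappa> * gauss_profile K \<kappa> a * (a \<bullet> h) - \<kappa> * K * (norm h)\<^sup>2 \<le> gauss_profile K \<kappa> (a + h)"
proof -
  have "1 - \<kappa> * (2 * (a \<bullet> h) + (norm h)\<^sup>2) \<le> exp (- \<kappa> * (2 * (a \<bullet> h) + (norm h)\<^sup>2))"
    using exp_ge_add_one_self[of "- \<kappa> * (2 * (a \<bullet> h) + (norm h)\<^sup>2)"] by simp
  hence "gauss_profile K \<kappa> a * (1 - \<kappa> * (2 * (a \<bullet> h) + (norm h)\<^sup>2)) \<le> gauss_profile K \<kappa> (a + h)"
    unfolding gauss_profile_split using gauss_profile_pos[OF assms(1), of \<kappa> a] by (intro mult_left_mono) auto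
  moreover have "gauss_profile K \<kappa> a * (\<kappa> * (norm h)\<^sup>2) \<le> K * (\<kappa> * (norm h)\<^sup>2)"
    using assms by (intro mult_right_mono) (auto simp: gauss_profile_def)
  ultimately show ?thesis by (simp add: algebra_simps)
qed

text \<open>The radial convexity has to survive in the lower bound. It comes from
  \<open>exp (- u) >= (1 - u / 2)^2\<close> for \<open>u <= 2\<close>: the term
  \<open>u^2 / 4\<close> has the leading part \<open>kappa^2 * r^2 * (e . h)^2\<close>, half of
  which is kept.\<close>

lemma gauss_profile_expansion2:
  assumes K: "0 < K" "0 < \<kappa>" and a: "a = r *\<^sub>R e" and e: "norm e = 1" "0 \<le> r"
    and h: "\<kappa> * (norm h)\<^sup>2 \<le> 1" "2 * \<kappa> * r * norm h \<le> 1"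
  shows "gauss_profile K \<kappa> a * (1 - 2 * \<kappa> * (a \<bullet> h) - 2 * \<kappa> * (norm h)\<^sup>2 + \<kappa>\<^sup>2 / 2 * r\<^sup>2 * (e \<bullet> h)\<^sup>2) \<le> gauss_profile K \<kappa> (a + h)"
  unfolding gauss_profile_split
proof (intro mult_left_mono)
  define u where "u = \<kappa> * (2 * (a \<bullet> h) + (norm h)\<^sup>2)"
  have "a \<bullet> h \<le> r * norm h" using norm_cauchy_schwarz[of a h] e by (simp add: a)
  hence "2 * \<kappa> * (a \<bullet> h) \<le> 2 * \<kappa> * (r * norm h)" using K by (intro mult_left_mono) auto
  hence u2: "u \<le> 2" using h by (simp add: u_def algebra_simps)
  have "(1 - u / 2)\<^sup>2 \<le> (exp (- u / 2))\<^sup>2"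
    using exp_ge_add_one_self[of "- u / 2"] u2 by (intro power_mono) auto
  also have "(exp (- u / 2))\<^sup>2 = exp (- u)" by (simp add: power2_eq_square flip: exp_add)
  finally have 1: "1 - u + u\<^sup>2 / 4 \<le> exp (- u)" by (simp add: power2_eq_square algebra_simps)
  have "2 * (r * (e \<bullet> h))\<^sup>2 - ((norm h)\<^sup>2)\<^sup>2 \<le> (2 * (a \<bullet> h) + (norm h)\<^sup>2)\<^sup>2"
    using zero_le_power2[of "r * (e \<bullet> h) + (norm h)\<^sup>2"] by (simp add: a power2_eq_square algebra_simps)
  hence "\<kappa>\<^sup>2 / 4 * (2 * (r * (e \<bullet> h))\<^sup>2 - ((norm h)\<^sup>2)\<^sup>2) \<le> \<kappa>\<^sup>2 / 4 * (2 * (a \<bullet> h) + (norm h)\<^sup>2)\<^sup>2"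
    by (intro mult_left_mono) auto
  moreover have "\<kappa>\<^sup>2 / 4 * (2 * (r * (e \<bullet> h))\<^sup>2 - ((norm h)\<^sup>2)\<^sup>2)
      = \<kappa>\<^sup>2 / 2 * r\<^sup>2 * (e \<bullet> h)\<^sup>2 - (\<kappa> * (norm h)\<^sup>2)\<^sup>2 / 4"
    by (simp add: power_mult_distrib field_simps)
  moreover have "\<kappa>\<^sup>2 / 4 * (2 * (a \<bullet> h) + (norm h)\<^sup>2)\<^sup>2 = u\<^sup>2 / 4"
    by (simp add: u_def power_mult_distrib)
  ultimately have 2: "\<kappa>\<^sup>2 / 2 * r\<^sup>2 * (e \<bullet> h)\<^sup>2 - (\<kappa> * (norm h)\<^sup>2)\<^sup>2 / 4 \<le> u\<^sup>2 / 4" by linarith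
  have "(\<kappa> * (norm h)\<^sup>2)\<^sup>2 \<le> \<kappa> * (norm h)\<^sup>2"
    using h(1) K mult_left_mono[OF h(1), of "\<kappa> * (norm h)\<^sup>2"] by (simp add: power2_eq_square)
  moreover have "0 \<le> \<kappa> * (norm h)\<^sup>2" using K by simp
  ultimately show "1 - 2 * \<kappa> * (a \<bullet> h) - 2 * \<kappa> * (norm h)\<^sup>2 + \<kappa>\<^sup>2 / 2 * r\<^sup>2 * (e \<bullet> h)\<^sup>2
      \<le> exp (- \<kappa> * (2 * (a \<bullet> h) + (norm h)\<^sup>2))"
    using 1 2 by (simp add: u_def algebra_simps)
qed (rule gauss_profile_pos[OF K(1), THEN less_imp_le])

text \<open>Near its centre a Gaussian is concave and its slope vanishes at the centre, so it cannot
  be used there and the power takes its place. If \<open>A >= 14 * K * kappa\<close>, the power is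
  the steeper of the two, and for \<open>norm z\<close> between 1/4 and 7 the profile is the larger
  of the two functions. A contact from below with the profile is then a contact with whichever piece
  is active.\<close>

definition profile :: "real \<Rightarrow> real \<Rightarrow> real \<Rightarrow> real \<Rightarrow> real ^ 'n::finite \<Rightarrow> real" where
  "profile \<beta> A K \<kappa> z = (if norm z \<le> 1 / 2
     then K * exp (- \<kappa> * (1 / 4)) + A * (1 / 2) powr \<beta> - A * norm z powr \<beta>
     else gauss_profile K \<kappa> z)"

lemma continuous_on_profile:
  assumes "0 < \<beta>"
  shows "continuous_on UNIV (profile \<beta> A K \<kappa>)"
proof -
  have "continuous_on UNIV (\<lambda>z :: real ^ 'n::finite. if norm z \<le> 1 / 2
     then K * exp (- \<kappa> * (1 / 4)) + A * (1 / 2) powr \<beta> - A * norm z powr \<beta>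
     else gauss_profile K \<kappa> z)"
  proof (rule continuous_on_cases_le)
    fix z :: "real ^ 'n" assume z: "norm z = 1 / 2"
    show "K * exp (- \<kappa> * (1 / 4)) + A * (1 / 2) powr \<beta> - A * norm z powr \<beta> = gauss_profile K \<kappa> z"
      unfolding gauss_profile_def z by (simp add: power2_eq_square)
  qed (use assms in \<open>auto intro!: continuous_intros continuous_on_powr' simp: gauss_profile_def\<close>)
  thus ?thesis unfolding profile_def[abs_def] .
qed

lemma exp_minus_diff_le: "exp (- a) - exp (- b) \<le> b - a" if "0 \<le> a" "a \<le> b" for a b :: real
proof -
  have "1 - (b - a) \<le> exp (- (b - a))" using exp_ge_add_one_self[of "- (b - a)"] by linarith
  hence "exp (- a) * (1 - (b - a)) \<le> exp (- a) * exp (- (b - a))" by (intro mult_left_mono) auto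
  also have "exp (- a) * exp (- (b - a)) = exp (- b)" by (simp flip: exp_add)
  finally have "exp (- a) - exp (- b) \<le> exp (- a) * (b - a)" by (simp add: algebra_simps)
  also have "\<dots> \<le> 1 * (b - a)" using that by (intro mult_right_mono) auto
  finally show ?thesis by simp
qed

text \<open>As functions of the square of the norm, the power falls at rate at least
  \<open>A / 14\<close> for \<open>norm z <= 7\<close>, and the Gaussian at rate at most
  \<open>K * kappa\<close>. The radius 7 exceeds the distance between a point of
  \<open>cball 0 6\<close> and a centre in \<open>cball 0 (1/4)\<close>.\<close>

lemma profile_ge_power:
  assumes "1 \<le> \<beta>" "\<beta> \<le> 2" "0 < K" "0 < \<kappa>" "14 * K * \<kappa> \<le> A" "norm z \<le> 7"
  shows "K * exp (- \<kappa> * (1 / 4)) + A * (1 / 2) powr \<beta> - A * norm z powr \<beta> \<le> profile \<beta> A K \<kappa> z"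
proof (cases "norm z \<le> 1 / 2")
  case False
  define r where "r = norm z"
  have r: "1 / 2 < r" "r \<le> 7" using False assms by (auto simp: r_def)
  have r2: "(1 / 2)\<^sup>2 \<le> r\<^sup>2" using r by (intro power_mono) auto
  have sq: "(r\<^sup>2) powr (\<beta> / 2) = r powr \<beta>" "((1/4) :: real) powr (\<beta> / 2) = (1 / 2) powr \<beta>"
      "(r\<^sup>2) powr (\<beta> / 2 - 1) = r powr (\<beta> - 2)"
  proof -
    show "(r\<^sup>2) powr (\<beta> / 2) = r powr \<beta>" "(r\<^sup>2) powr (\<beta> / 2 - 1) = r powr (\<beta> - 2)" using r by (simp_all add: power2_powr algebra_simps)
    have "((1/2)\<^sup>2 :: real) powr (\<beta> / 2) = (1 / 2) powr \<beta>" by (subst power2_powr) auto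
    thus "((1/4) :: real) powr (\<beta> / 2) = (1 / 2) powr \<beta>" by (simp add: power2_eq_square)
  qed
  have "((1/4) :: real) powr (\<beta> / 2) \<le> (r\<^sup>2) powr (\<beta> / 2) + (\<beta> / 2) * (r\<^sup>2) powr (\<beta> / 2 - 1) * (1/4 - r\<^sup>2)"
    using assms r by (intro powr_tangent) auto
  hence "(\<beta> / 2) * r powr (\<beta> - 2) * (r\<^sup>2 - 1/4) \<le> r powr \<beta> - (1 / 2) powr \<beta>"
    unfolding sq by (simp add: field_simps)
  moreover have "(1 / 2) * (1 / 7) * (r\<^sup>2 - 1/4) \<le> (\<beta> / 2) * r powr (\<beta> - 2) * (r\<^sup>2 - 1/4)"
  proof (intro mult_right_mono mult_mono)
    have "(1 / 7 :: real) = 7 powr (-1)" by (simp add: powr_minus_divide)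
    also have "\<dots> \<le> 7 powr (\<beta> - 2)" using assms by (intro powr_mono) auto
    also have "\<dots> \<le> r powr (\<beta> - 2)" using r assms by (intro powr_mono2') auto
    finally show "1 / 7 \<le> r powr (\<beta> - 2)" .
    show "0 \<le> r\<^sup>2 - 1/4" using r2 by (simp add: power2_eq_square)
  qed (use assms in auto)
  ultimately have "A * ((1 / 14) * (r\<^sup>2 - 1/4)) \<le> A * (r powr \<beta> - (1 / 2) powr \<beta>)"
    using assms by (intro mult_left_mono) (auto simp: mult_pos_pos intro: order_trans[OF _ assms(5)])
  moreover have "14 * K * \<kappa> * ((1 / 14) * (r\<^sup>2 - 1/4)) \<le> A * ((1 / 14) * (r\<^sup>2 - 1/4))"
    using assms r2 by (intro mult_right_mono) (auto simp: power2_eq_square)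
  moreover have "K * (exp (- (\<kappa> * (1/4))) - exp (- (\<kappa> * r\<^sup>2))) \<le> K * (\<kappa> * r\<^sup>2 - \<kappa> * (1/4))"
    using assms r2 by (intro mult_left_mono exp_minus_diff_le) (auto simp: power2_eq_square)
  ultimately have "K * (exp (- (\<kappa> * (1/4))) - exp (- (\<kappa> * r\<^sup>2))) \<le> A * (r powr \<beta> - (1 / 2) powr \<beta>)"
    by (simp add: algebra_simps)
  thus ?thesis using False by (simp add: profile_def gauss_profile_def r_def algebra_simps)
qed (simp add: profile_def)

lemma profile_ge_gauss:
  assumes "1 \<le> \<beta>" "\<beta> \<le> 2" "0 < K" "0 < \<kappa>" "14 * K * \<kappa> \<le> A" "1 / 4 \<le> norm z"
  shows "gauss_profile K \<kappa> z \<le> profile \<beta> A K \<kappa> z"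
proof (cases "norm z \<le> 1 / 2")
  case True
  define r where "r = norm z"
  have r: "r \<le> 1 / 2" "1 / 4 \<le> r" using True assms by (auto simp: r_def)
  have r2: "r\<^sup>2 \<le> (1 / 2)\<^sup>2" using r by (intro power_mono) auto
  have A: "0 \<le> A" using assms by (auto intro!: order_trans[OF _ assms(5)])
  have sq: "(r\<^sup>2) powr (\<beta> / 2) = r powr \<beta>" "((1/4) :: real) powr (\<beta> / 2) = (1 / 2) powr \<beta>"
  proof -
    show "(r\<^sup>2) powr (\<beta> / 2) = r powr \<beta>" using r by (simp add: power2_powr)
    have "((1/2)\<^sup>2 :: real) powr (\<beta> / 2) = (1 / 2) powr \<beta>" by (subst power2_powr) auto
    thus "((1/4) :: real) powr (\<beta> / 2) = (1 / 2) powr \<beta>" by (simp add: power2_eq_square)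
  qed
  have "(r\<^sup>2) powr (\<beta> / 2) \<le> ((1/4) :: real) powr (\<beta> / 2) + (\<beta> / 2) * (1/4) powr (\<beta> / 2 - 1) * (r\<^sup>2 - 1/4)"
    using assms by (intro powr_tangent) auto
  hence "(\<beta> / 2) * (1/4) powr (\<beta> / 2 - 1) * (1/4 - r\<^sup>2) \<le> (1 / 2) powr \<beta> - r powr \<beta>"
    unfolding sq by (simp add: field_simps)
  moreover have "(1 / 2) * 1 * (1/4 - r\<^sup>2) \<le> (\<beta> / 2) * (1/4) powr (\<beta> / 2 - 1) * (1/4 - r\<^sup>2)"
  proof (intro mult_right_mono mult_mono)
    have "(1 :: real) = (1/4) powr 0" by simp
    also have "\<dots> \<le> (1/4) powr (\<beta> / 2 - 1)" using assms by (intro powr_mono') auto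
    finally show "1 \<le> (1/4 :: real) powr (\<beta> / 2 - 1)" .
    show "0 \<le> 1/4 - r\<^sup>2" using r2 by (simp add: power2_eq_square)
  qed (use assms in auto)
  ultimately have "A * ((1 / 2) * (1/4 - r\<^sup>2)) \<le> A * ((1 / 2) powr \<beta> - r powr \<beta>)"
    using A by (intro mult_left_mono) auto
  moreover have "14 * K * \<kappa> * ((1 / 2) * (1/4 - r\<^sup>2)) \<le> A * ((1 / 2) * (1/4 - r\<^sup>2))"
    using assms r2 by (intro mult_right_mono) (auto simp: power2_eq_square)
  moreover have "0 \<le> K * \<kappa> * (1/4 - r\<^sup>2)" using assms r2 by (auto simp: power2_eq_square)
  moreover have "K * (exp (- (\<kappa> * r\<^sup>2)) - exp (- (\<kappa> * (1/4)))) \<le> K * (\<kappa> * (1/4) - \<kappa> * r\<^sup>2)"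
    using assms r2 by (intro mult_left_mono exp_minus_diff_le) (auto simp: power2_eq_square)
  ultimately have "K * (exp (- (\<kappa> * r\<^sup>2)) - exp (- (\<kappa> * (1/4)))) \<le> A * ((1 / 2) powr \<beta> - r powr \<beta>)"
    by (simp add: algebra_simps)
  thus ?thesis using True by (simp add: profile_def gauss_profile_def r_def algebra_simps)
qed (simp add: profile_def)

lemma profile_bounds:
  assumes "0 < K" "0 < \<kappa>" "0 \<le> A" "1 \<le> \<beta>"
  shows "0 \<le> profile \<beta> A K \<kappa> z" "profile \<beta> A K \<kappa> z \<le> K + A"
proof -
  have "exp (- \<kappa> * (1 / 4)) \<le> 1" "exp (- \<kappa> * (norm z)\<^sup>2) \<le> 1" using assms by auto
  hence e: "K * exp (- \<kappa> * (1 / 4)) \<le> K" "K * exp (- \<kappa> * (norm z)\<^sup>2) \<le> K" using assms by (auto simp: mult_le_cancel_left1)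
  have "(1/2 :: real) powr \<beta> \<le> 1" using assms powr_mono2[of \<beta> "1/2" 1] by simp
  hence "A * (1/2) powr \<beta> \<le> A * 1" using assms by (intro mult_left_mono) auto
  moreover have "0 \<le> A * norm z powr \<beta>" using assms by simp
  ultimately show "profile \<beta> A K \<kappa> z \<le> K + A" using e assms(3)
    by (cases "norm z \<le> 1 / 2"; simp only: profile_def gauss_profile_def if_True if_False; linarith)
  have "A * norm z powr \<beta> \<le> A * (1/2) powr \<beta>" if "norm z \<le> 1/2"
    using that assms by (intro mult_left_mono powr_mono2) auto
  moreover have "0 \<le> K * exp (- \<kappa> * (1 / 4))" using assms by simp
  moreover have "0 \<le> K * exp (- \<kappa> * (norm z)\<^sup>2)" using assms by simp
  ultimately show "0 \<le> profile \<beta> A K \<kappa> z"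
    by (cases "norm z \<le> 1 / 2"; simp only: profile_def gauss_profile_def if_True if_False; linarith)
qed

text \<open>Inverting the gradient of the Gaussian away from its centre: from the slope one recovers
  the radius, because \<open>r exp (-\<kappa> r\<^sup>2)\<close> is strictly decreasing there, and then the point.\<close>

lemma gauss_slope_injective:
  fixes a b :: "real ^ 'n::finite"
  assumes \<kappa>: "16 \<le> \<kappa>" and a: "1 / 2 \<le> norm a" "norm a \<le> 7" and b: "1 / 2 \<le> norm b" "norm b \<le> 7"
  shows "norm (a - b) \<le> (exp (49 * \<kappa>) + 98 * \<kappa> * exp (98 * \<kappa>) * (1 + 49 * \<kappa>))
     * norm (exp (- \<kappa> * (norm a)\<^sup>2) *\<^sub>R a - exp (- \<kappa> * (norm b)\<^sup>2) *\<^sub>R b)"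
proof -
  have main: "norm (a - b) \<le> (exp (49 * \<kappa>) + 98 * \<kappa> * exp (98 * \<kappa>) * (1 + 49 * \<kappa>))
     * norm (exp (- \<kappa> * (norm a)\<^sup>2) *\<^sub>R a - exp (- \<kappa> * (norm b)\<^sup>2) *\<^sub>R b)"
    if ab: "norm a \<le> norm b" and a: "1 / 2 \<le> norm a" and b: "norm b \<le> 7" for a b :: "real ^ 'n"
  proof -
    define r s where "r = norm a" and "s = norm b"
    define w where "w = norm (exp (- \<kappa> * r\<^sup>2) *\<^sub>R a - exp (- \<kappa> * s\<^sup>2) *\<^sub>R b)"
    have rs: "1/2 \<le> r" "r \<le> s" "s \<le> 7" using ab a b by (auto simp: r_def s_def)
    have r2: "r\<^sup>2 \<le> 7\<^sup>2" "s\<^sup>2 \<le> 7\<^sup>2" using rs by (intro power_mono; simp)+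
    have r49: "\<kappa> * r\<^sup>2 \<le> 49 * \<kappa>" "\<kappa> * s\<^sup>2 \<le> 49 * \<kappa>" using r2 \<kappa> by auto
    define \<tau> where "\<tau> = \<kappa> * (s\<^sup>2 - r\<^sup>2)"
    have rs2: "r\<^sup>2 \<le> s\<^sup>2" using rs by (intro power_mono) auto
    have \<tau>0: "0 \<le> \<tau>" using \<kappa> rs2 by (simp add: \<tau>_def)
    have \<tau>: "8 * (s - r) \<le> r * \<tau>" "\<tau> \<le> 49 * \<kappa>" "\<tau> \<le> 14 * \<kappa> * (s - r)"
    proof -
      have f: "\<tau> = \<kappa> * (s + r) * (s - r)" by (simp add: \<tau>_def power2_eq_square algebra_simps)
      have "8 * (s - r) \<le> (1/2 * (16 * 1)) * (s - r)" by simp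
      also have "\<dots> \<le> (r * (\<kappa> * (s + r))) * (s - r)" using rs \<kappa> by (intro mult_right_mono mult_mono) auto
      finally show "8 * (s - r) \<le> r * \<tau>" by (simp add: f mult_ac)
      have "\<kappa> * (s + r) * (s - r) \<le> \<kappa> * 14 * (s - r)" using rs \<kappa> by (intro mult_right_mono mult_left_mono) auto
      thus "\<tau> \<le> 14 * \<kappa> * (s - r)" by (simp add: f mult_ac)
      have "0 \<le> \<kappa> * r\<^sup>2" using \<kappa> by simp
      thus "\<tau> \<le> 49 * \<kappa>" using r49 by (simp add: \<tau>_def algebra_simps)
    qed
    have e\<tau>: "exp (- \<kappa> * s\<^sup>2) = exp (- \<kappa> * r\<^sup>2) * exp (- \<tau>)" by (simp add: \<tau>_def algebra_simps flip: exp_add)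
    have "exp (- \<tau>) * (1 + \<tau>) \<le> exp (- \<tau>) * exp \<tau>" using exp_ge_add_one_self[of \<tau>] by (intro mult_left_mono) auto
    hence inv: "exp (- \<tau>) * (1 + \<tau>) \<le> 1" by (simp flip: exp_add)
    \<comment> \<open>Monotonicity in quantitative form: for \<open>kappa >= 16\<close> and
      \<open>r >= 1/2\<close> the exponent gains \<open>tau\<close> with
      \<open>r * tau >= 8 * (s - r)\<close>, which outweighs the growth \<open>s - r\<close> of the
      radius.\<close>
    have "7 * (s - r) \<le> r * \<tau> + (r - s)" using \<tau>(1) by simp
    also have "\<dots> = r * (1 + \<tau>) - s" by (simp add: algebra_simps)
    also have "\<dots> \<le> r * (1 + \<tau>) - s * (exp (- \<tau>) * (1 + \<tau>))"
      using inv rs mult_left_mono[OF inv, of s] by simp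
    also have "\<dots> = (r - s * exp (- \<tau>)) * (1 + \<tau>)" by (simp add: algebra_simps)
    finally have k1: "7 * (s - r) \<le> (r - s * exp (- \<tau>)) * (1 + \<tau>)" .
    have k2: "exp (- \<kappa> * r\<^sup>2) * (r - s * exp (- \<tau>)) \<le> w"
    proof -
      have "norm (exp (- \<kappa> * r\<^sup>2) *\<^sub>R a) - norm (exp (- \<kappa> * s\<^sup>2) *\<^sub>R b) \<le> w" unfolding w_def by (rule norm_triangle_ineq2)
      hence "exp (- \<kappa> * r\<^sup>2) * r - exp (- \<kappa> * s\<^sup>2) * s \<le> w" by (simp add: r_def s_def)
      thus ?thesis by (simp only: e\<tau> left_diff_distrib right_diff_distrib mult_ac)
    qed
    have w0: "0 \<le> w" by (simp add: w_def)
    have k3: "s - r \<le> exp (49 * \<kappa>) * (1 + 49 * \<kappa>) * w"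
    proof -
      have "s - r \<le> 7 * (s - r)" using rs by simp
      also have "\<dots> \<le> (r - s * exp (- \<tau>)) * (1 + \<tau>)" by (rule k1)
      also have "r - s * exp (- \<tau>) = exp (\<kappa> * r\<^sup>2) * (exp (- \<kappa> * r\<^sup>2) * (r - s * exp (- \<tau>)))"
        by (simp add: mult.assoc[symmetric] flip: exp_add)
      also have "exp (\<kappa> * r\<^sup>2) * (exp (- \<kappa> * r\<^sup>2) * (r - s * exp (- \<tau>))) * (1 + \<tau>) \<le> exp (\<kappa> * r\<^sup>2) * w * (1 + \<tau>)"
        using k2 \<tau>0 by (intro mult_right_mono mult_left_mono) auto
      also have "\<dots> \<le> exp (49 * \<kappa>) * w * (1 + 49 * \<kappa>)"
        using r49 \<tau>0 \<tau>(2) w0 by (intro mult_mono) auto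
      finally show ?thesis by (simp add: mult_ac)
    qed
    have "a - b = exp (\<kappa> * r\<^sup>2) *\<^sub>R (exp (- \<kappa> * r\<^sup>2) *\<^sub>R a - exp (- \<kappa> * s\<^sup>2) *\<^sub>R b) - (1 - exp (- \<tau>)) *\<^sub>R b"
      unfolding e\<tau> by (simp add: algebra_simps mult.assoc[symmetric] flip: exp_add)
    hence "norm (a - b) \<le> norm (exp (\<kappa> * r\<^sup>2) *\<^sub>R (exp (- \<kappa> * r\<^sup>2) *\<^sub>R a - exp (- \<kappa> * s\<^sup>2) *\<^sub>R b)) + norm ((1 - exp (- \<tau>)) *\<^sub>R b)"
      by (metis norm_triangle_ineq4)
    also have "\<dots> = exp (\<kappa> * r\<^sup>2) * w + (1 - exp (- \<tau>)) * s" using \<tau>0 by (simp add: w_def s_def)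
    also have "\<dots> \<le> exp (49 * \<kappa>) * w + (14 * \<kappa> * (s - r)) * 7"
    proof (intro add_mono mult_mono)
      show "1 - exp (- \<tau>) \<le> 14 * \<kappa> * (s - r)" using exp_ge_add_one_self[of "- \<tau>"] \<tau>(3) by linarith
    qed (use r49 rs w0 \<kappa> in auto)
    also have "(14 * \<kappa> * (s - r)) * 7 \<le> 98 * \<kappa> * (exp (49 * \<kappa>) * (1 + 49 * \<kappa>) * w)"
      using k3 \<kappa> by (simp add: mult_left_mono)
    also have "\<dots> \<le> 98 * \<kappa> * (exp (98 * \<kappa>) * (1 + 49 * \<kappa>) * w)"
      using \<kappa> w0 by (intro mult_left_mono mult_right_mono) auto
    finally show ?thesis by (simp add: w_def r_def s_def algebra_simps)
  qed
  show ?thesis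
    using main[of a b] main[of b a] assms by (cases "norm a \<le> norm b") (auto simp: norm_minus_commute)
qed

text \<open>The area estimate: the centres of the touching profiles have measure controlled by the
  contact set, since by the slope estimate the centre is a Lipschitz function of the contact point.\<close>

lemma contact_image_measure:
  fixes lam Lam \<gamma> K0 C1 L Pmax :: real
  assumes n: "CARD('n::finite) \<ge> 2" and lam: "0 < lam" "lam \<le> Lam" and \<gamma>: "0 \<le> \<gamma>" and K0: "0 < K0"
    and C1: "0 < C1" and L: "8 * Pmax \<le> L"
  obtains C2 where "0 < C2" "\<And>v g R (p :: (real ^ 'n) \<times> (real ^ 'n) \<Rightarrow> real ^ 'n).
    \<lbrakk>visc_super lam Lam \<gamma> L (ball 0 6) v g; continuous_on (cball 0 6) v; continuous_on (cball 0 6) g;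
     \<And>x. x \<in> cball 0 6 \<Longrightarrow> 0 \<le> g x; compact R; \<And>x y. (x, y) \<in> R \<Longrightarrow> x \<in> ball 0 6;
     \<And>x y. (x, y) \<in> R \<Longrightarrow> touches_below \<gamma> K0 (cball x (1/4) \<inter> cball 0 6) v x (p (x, y));
     \<And>x y. (x, y) \<in> R \<Longrightarrow> norm (p (x, y)) \<le> Pmax;
     \<And>x0 y0 x1 y1. (x0, y0) \<in> R \<Longrightarrow> (x1, y1) \<in> R \<Longrightarrow> norm (y1 - y0) \<le> C1 * (norm (x1 - x0)
        + pw \<gamma> (norm (p (x0, y0)) + norm (p (x1, y1))) * norm (p (x1, y1) - p (x0, y0)))\<rbrakk>
    \<Longrightarrow> measure lebesgue (snd ` R) \<le> C2 * (LINT x:fst ` R|lebesgue. (1 + g x) ^ CARD('n))"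
proof -
  from slope_estimate[OF n lam \<gamma> K0] obtain c C where c: "2 \<le> c" and C: "0 < C"
    and est: "\<And>v g (x0 :: real ^ 'n) x1 p0 p1 r L \<Gamma>.
    visc_super lam Lam \<gamma> L (ball x0 (c * r)) v g \<Longrightarrow> continuous_on (cball x0 (c * r)) v \<Longrightarrow>
    0 < r \<Longrightarrow> dist x0 x1 \<le> r \<Longrightarrow>
    touches_below \<gamma> K0 (cball x0 (c * r)) v x0 p0 \<Longrightarrow> touches_below \<gamma> K0 (cball x0 (c * r)) v x1 p1 \<Longrightarrow>
    (\<forall>z\<in>ball x0 (c * r). g z \<le> \<Gamma>) \<Longrightarrow> 0 \<le> \<Gamma> \<Longrightarrow> 4 * (norm p0 + norm p1) \<le> L \<Longrightarrow>
    pw \<gamma> (norm p0 + norm p1) * norm (p1 - p0) \<le> C * (1 + \<Gamma>) * r"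
    by blast
  define D where "D = C1 * (1 + C)"
  have D: "0 < D" using C1 C by (simp add: D_def)
  define C2 where "C2 = measure lebesgue (ball (0 :: real ^ 'n) 1) * DIM(real ^ 'n) ^ DIM(real ^ 'n) * (2 * D + 1) ^ CARD('n)"
  show thesis
  proof (rule that[of C2])
    show "0 < C2" using D by (auto simp: C2_def content_ball_pos)
    fix v g and R :: "((real ^ 'n) \<times> (real ^ 'n)) set" and p
    assume v: "visc_super lam Lam \<gamma> L (ball 0 6) v g" and cv: "continuous_on (cball 0 6) v"
      and cg: "continuous_on (cball 0 6) g" and g0: "\<And>x. x \<in> cball 0 6 \<Longrightarrow> 0 \<le> g x"
      and R: "compact R" and Rb: "\<And>x y. (x, y) \<in> R \<Longrightarrow> x \<in> ball 0 6"
      and t: "\<And>x y. (x, y) \<in> R \<Longrightarrow> touches_below \<gamma> K0 (cball x (1/4) \<inter> cball 0 6) v x (p (x, y))"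
      and pm: "\<And>x y. (x, y) \<in> R \<Longrightarrow> norm (p (x, y)) \<le> Pmax"
      and ve: "\<And>x0 y0 x1 y1. (x0, y0) \<in> R \<Longrightarrow> (x1, y1) \<in> R \<Longrightarrow> norm (y1 - y0) \<le> C1 * (norm (x1 - x0)
        + pw \<gamma> (norm (p (x0, y0)) + norm (p (x1, y1))) * norm (p (x1, y1) - p (x0, y0)))"
    define K where "K = fst ` R"
    have K: "compact K" unfolding K_def by (intro compact_continuous_image R continuous_on_fst continuous_on_id)
    have Kb: "K \<subseteq> ball 0 6" using Rb by (auto simp: K_def)
    have Y: "compact (snd ` R)" by (intro compact_continuous_image R continuous_on_snd continuous_on_id)
    \<comment> \<open>The slope estimate becomes a bound for the motion of the centre, with
      \<open>g x0 + 1\<close> as upper bound for \<open>g\<close> near \<open>x0\<close>. The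
      admissible \<open>r\<close> depends on \<open>x0\<close> through the continuity of
      \<open>g\<close> and the distance to the sphere of radius 6.\<close>
    have loc: "\<exists>r0>0. \<forall>x1 y1 r. (x1, y1) \<in> R \<longrightarrow> 0 < r \<longrightarrow> r < r0 \<longrightarrow> norm (x1 - x0) \<le> r \<longrightarrow>
        norm (y1 - y0) \<le> D * (2 + g x0) * r" if xy: "(x0, y0) \<in> R" for x0 y0
    proof -
      have x0: "x0 \<in> ball 0 6" using Rb[OF xy] .
      have gx0: "0 \<le> g x0" using g0 x0 by simp
      have "continuous (at x0) g"
        using cg x0 by (meson continuous_on_eq_continuous_at continuous_on_subset ball_subset_cball open_ball)
      then obtain d1 where d1: "0 < d1" "\<And>z. dist z x0 < d1 \<Longrightarrow> dist (g z) (g x0) < 1"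
        unfolding continuous_at_eps_delta using zero_less_one by blast
      define d where "d = min d1 (min (1/8) (6 - norm x0))"
      have d: "0 < d" "d \<le> d1" "d \<le> 1/8" "d \<le> 6 - norm x0" using d1 x0 unfolding d_def min_def by auto
      show ?thesis
      proof (intro exI[of _ "d / c"] conjI allI impI)
        show "0 < d / c" using d c by simp
        fix x1 y1 r assume xy1: "(x1, y1) \<in> R" and r: "0 < r" "r < d / c" and x1: "norm (x1 - x0) \<le> r"
        have cr: "c * r < d" using r c by (simp add: field_simps)
        have rcr: "r \<le> c * r" using r c by simp
        have sub6: "cball x0 (c * r) \<subseteq> ball 0 6"
        proof
          fix z assume z: "z \<in> cball x0 (c * r)"
          have "norm z \<le> norm x0 + norm (z - x0)" using norm_triangle_ineq[of x0 "z - x0"] by simp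
          thus "z \<in> ball 0 6" using z cr d by (simp add: dist_norm norm_minus_commute)
        qed
        have sub0: "cball x0 (c * r) \<subseteq> cball x0 (1/4) \<inter> cball 0 6" using sub6 cr d by auto
        have sub1: "cball x0 (c * r) \<subseteq> cball x1 (1/4) \<inter> cball 0 6"
        proof
          fix z assume z: "z \<in> cball x0 (c * r)"
          have "norm (x1 - z) \<le> norm (x1 - x0) + norm (x0 - z)" using norm_triangle_ineq[of "x1 - x0" "x0 - z"] by simp
          hence "norm (x1 - z) \<le> 1/4" using z x1 rcr cr d by (simp add: dist_norm)
          thus "z \<in> cball x1 (1/4) \<inter> cball 0 6" using z sub6 by (auto simp: dist_norm)
        qed
        have est1: "pw \<gamma> (norm (p (x0, y0)) + norm (p (x1, y1))) * norm (p (x1, y1) - p (x0, y0)) \<le> C * (1 + (g x0 + 1)) * r"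
        proof (rule est)
          show "visc_super lam Lam \<gamma> L (ball x0 (c * r)) v g"
            by (rule visc_super_mono[OF v order_refl]) (use sub6 ball_subset_cball in blast, simp)
          show "continuous_on (cball x0 (c * r)) v"
            using cv sub6 by (meson ball_subset_cball continuous_on_subset order_trans)
          show "dist x0 x1 \<le> r" using x1 by (simp add: dist_norm norm_minus_commute)
          show "touches_below \<gamma> K0 (cball x0 (c * r)) v x0 (p (x0, y0))"
            using t[OF xy] sub0 K0 \<gamma> by (intro touches_below_mono[OF t[OF xy]]) auto
          show "touches_below \<gamma> K0 (cball x0 (c * r)) v x1 (p (x1, y1))"
            using sub1 K0 \<gamma> by (intro touches_below_mono[OF t[OF xy1]]) auto
          show "\<forall>z\<in>ball x0 (c * r). g z \<le> g x0 + 1"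
          proof
            fix z assume "z \<in> ball x0 (c * r)"
            hence "dist z x0 < d1" using cr d by (simp add: dist_commute)
            from d1(2)[OF this] show "g z \<le> g x0 + 1" by (simp add: dist_real_def)
          qed
          show "4 * (norm (p (x0, y0)) + norm (p (x1, y1))) \<le> L" 
          proof -
            have "norm (p (x0, y0)) + norm (p (x1, y1)) \<le> Pmax + Pmax" by (intro add_mono pm xy xy1)
            thus ?thesis using L by simp
          qed
        qed (use r gx0 in auto)
        have "norm (y1 - y0) \<le> C1 * (norm (x1 - x0)
          + pw \<gamma> (norm (p (x0, y0)) + norm (p (x1, y1))) * norm (p (x1, y1) - p (x0, y0)))" by (rule ve[OF xy xy1])
        also have "\<dots> \<le> C1 * (r + C * (1 + (g x0 + 1)) * r)"
          using est1 x1 C1 by (intro mult_left_mono add_mono) auto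
        also have "\<dots> = C1 * r * (1 + C * (2 + g x0))" by (simp add: algebra_simps)
        also have "\<dots> \<le> C1 * r * ((1 + C) * (2 + g x0))"
          using C1 r gx0 by (intro mult_left_mono) (auto simp: algebra_simps)
        finally show "norm (y1 - y0) \<le> D * (2 + g x0) * r" by (simp add: D_def mult_ac)
      qed
    qed
    \<comment> \<open>With \<open>x1 = x0\<close> the local bound holds for every small
      \<open>r\<close>, so a contact point belongs to only one centre, and the centre becomes a
      function of the contact point.\<close>
    have uniq: "y1 = y0" if xy: "(x0, y0) \<in> R" "(x0, y1) \<in> R" for x0 y0 y1
    proof (rule ccontr)
      assume ne: "y1 \<noteq> y0"
      obtain r0 where r0: "0 < r0" "\<And>r. 0 < r \<Longrightarrow> r < r0 \<Longrightarrow> norm (y1 - y0) \<le> D * (2 + g x0) * r"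
        using loc[OF xy(1)] xy(2) by (metis diff_self less_imp_le norm_zero)
      define M where "M = D * (2 + g x0)"
      have M: "0 < M" using D g0[of x0] Rb[OF xy(1)] by (simp add: M_def add_pos_nonneg)
      define r where "r = min (r0 / 2) (norm (y1 - y0) / (2 * M))"
      have r: "0 < r" "r < r0" using r0 ne M by (auto simp: r_def)
      have "norm (y1 - y0) \<le> M * r" using r0(2)[OF r] by (simp add: M_def)
      also have "\<dots> \<le> M * (norm (y1 - y0) / (2 * M))" using M by (intro mult_left_mono) (auto simp: r_def)
      also have "\<dots> = norm (y1 - y0) / 2" using M by simp
      finally show False using ne by simp
    qed
    define T where "T x = (SOME y. (x, y) \<in> R)" for x
    have TR: "(x, T x) \<in> R" if "x \<in> K" for x
    proof -
      obtain y where "(x, y) \<in> R" using \<open>x \<in> K\<close> by (auto simp: K_def)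
      thus ?thesis unfolding T_def by (rule someI)
    qed
    obtain B where B: "\<And>x. x \<in> cball 0 6 \<Longrightarrow> g x \<le> B"
    proof -
      have "bounded (g ` cball 0 6)" using compact_continuous_image[OF cg compact_cball] by (rule compact_imp_bounded)
      then obtain B where "\<And>y. y \<in> g ` cball 0 6 \<Longrightarrow> norm y \<le> B" unfolding bounded_iff by blast
      hence "g x \<le> B" if "x \<in> cball 0 6" for x using that by (force simp: abs_le_iff)
      thus ?thesis by (rule that)
    qed
    have "measure lebesgue (snd ` R) \<le> measure lebesgue (ball (0 :: real ^ 'n) 1) * DIM(real ^ 'n) ^ DIM(real ^ 'n)
           * (LINT x:K|lebesgue. (D * (2 + g x) + 1) ^ DIM(real ^ 'n))"
    proof (rule local_lipschitz_image_measure[where T = T and \<Omega> = "ball 0 6" and B = "D * (2 + B)"])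
      show "K \<in> sets lebesgue" using K by (simp add: compact_imp_closed borel_closed sets_completionI_sets)
      show "bounded K" using K by (rule compact_imp_bounded)
      show "continuous_on (ball 0 6) (\<lambda>x. D * (2 + g x))"
        by (intro continuous_intros continuous_on_subset[OF cg]) auto
      show "0 \<le> D * (2 + g x) \<and> D * (2 + g x) \<le> D * (2 + B)" if "x \<in> ball 0 6" for x
        using that D g0[of x] B[of x] by simp
      show "snd ` R \<subseteq> T ` K"
      proof
        fix y assume "y \<in> snd ` R"
        then obtain x where x: "(x, y) \<in> R" by force
        hence "x \<in> K" by (force simp: K_def)
        moreover have "y = T x" using uniq[OF TR x] calculation by simp
        ultimately show "y \<in> T ` K" by blast
      qed
      show "snd ` R \<in> lmeasurable" using Y by (rule lmeasurable_compact)
      show "\<exists>r>0. \<forall>y\<in>K. dist x y < r \<longrightarrow> dist (T x) (T y) \<le> D * (2 + g x) * dist x y" if x: "x \<in> K" for x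
      proof -
        obtain r0 where r0: "0 < r0" "\<And>x1 y1 r. (x1, y1) \<in> R \<Longrightarrow> 0 < r \<Longrightarrow> r < r0 \<Longrightarrow> norm (x1 - x) \<le> r \<Longrightarrow>
          norm (y1 - T x) \<le> D * (2 + g x) * r" using loc[OF TR[OF x]] by blast
        show ?thesis
        proof (intro exI[of _ r0] conjI ballI impI r0(1))
          fix y assume y: "y \<in> K" "dist x y < r0"
          show "dist (T x) (T y) \<le> D * (2 + g x) * dist x y"
          proof (cases "x = y")
            case False
            thus ?thesis using r0(2)[OF TR[OF y(1)], of "dist x y"] y(2) by (simp add: dist_norm norm_minus_commute)
          qed simp
        qed
      qed
    qed (use Kb in auto)
    also have "(LINT x:K|lebesgue. (D * (2 + g x) + 1) ^ DIM(real ^ 'n))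
        \<le> (LINT x:K|lebesgue. (2 * D + 1) ^ CARD('n) * (1 + g x) ^ CARD('n))"
    proof (rule set_integral_mono)
      have cgK: "continuous_on K g" using cg Kb by (meson ball_subset_cball continuous_on_subset order_trans)
      have int: "set_integrable lebesgue K h" if "continuous_on K h" for h :: "real ^ 'n \<Rightarrow> real"
        using borel_integrable_compact[OF K that] by (simp add: set_integrable_def integrable_completion)
      show "set_integrable lebesgue K (\<lambda>x. (D * (2 + g x) + 1) ^ DIM(real ^ 'n))"
        by (intro int continuous_intros cgK)
      show "set_integrable lebesgue K (\<lambda>x. (2 * D + 1) ^ CARD('n) * (1 + g x) ^ CARD('n))"
        by (intro int continuous_intros cgK)
      fix x assume "x \<in> K"
      hence gx: "0 \<le> g x" using g0 Kb by (meson ball_subset_cball subsetD)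
      have "D * (2 + g x) + 1 \<le> (2 * D + 1) * (1 + g x)" using gx D by (simp add: algebra_simps)
      hence "(D * (2 + g x) + 1) ^ CARD('n) \<le> ((2 * D + 1) * (1 + g x)) ^ CARD('n)"
        using gx D by (intro power_mono) auto
      thus "(D * (2 + g x) + 1) ^ DIM(real ^ 'n) \<le> (2 * D + 1) ^ CARD('n) * (1 + g x) ^ CARD('n)"
        by (simp add: power_mult_distrib)
    qed
    finally have "measure lebesgue (snd ` R) \<le> measure lebesgue (ball (0 :: real ^ 'n) 1) * DIM(real ^ 'n) ^ DIM(real ^ 'n)
        * (LINT x:K|lebesgue. (2 * D + 1) ^ CARD('n) * (1 + g x) ^ CARD('n))"
      by (simp add: mult_left_mono)
    thus "measure lebesgue (snd ` R) \<le> C2 * (LINT x:fst ` R|lebesgue. (1 + g x) ^ CARD('n))"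
      by (simp add: C2_def K_def mult_ac)
  qed
qed

section \<open>Contacts with the Gaussian part, and the contact estimate\<close>

lemma touches_below_gauss:
  fixes x y :: "real ^ 'n::finite"
  assumes \<gamma>: "0 \<le> \<gamma>" and K: "0 < K" "0 < \<kappa>" and K0: "1 \<le> K0" "\<kappa> * K \<le> K0" "pw \<gamma> P * (\<kappa> * K) \<le> K0"
    and c: "\<And>z. z \<in> S \<Longrightarrow> v x - gauss_profile K \<kappa> (x - y) + gauss_profile K \<kappa> (z - y) \<le> v z"
    and S: "S \<subseteq> cball x 1"
    and p: "p = (- (2 * \<kappa> * gauss_profile K \<kappa> (x - y))) *\<^sub>R (x - y)" "norm p \<le> P"
  shows "touches_below \<gamma> K0 S v x p"
  unfolding touches_below_def
proof (intro ballI conjI)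
  fix z assume z: "z \<in> S"
  define h where "h = z - x"
  have h1: "norm h \<le> 1" using z S by (auto simp: h_def dist_norm norm_minus_commute)
  have E: "v x + p \<bullet> (z - x) - v z \<le> \<kappa> * K * (norm h)\<^sup>2"
    using c[OF z] gauss_profile_expansion1[OF K, of "x - y" h] by (simp add: p h_def algebra_simps)
  \<comment> \<open>The quadratic error is bounded by the power one for \<open>norm h <= 1\<close>,
    hence the restriction of \<open>S\<close> to the unit ball about \<open>x\<close>.\<close>
  have "(norm h)\<^sup>2 \<le> norm h powr (1 + 1 / (1 + \<gamma>))"
  proof (cases "h = 0")
    case False
    have "(norm h)\<^sup>2 = norm h powr 2" using False by simp
    also have "\<dots> \<le> norm h powr (1 + 1 / (1 + \<gamma>))"
      using exponent_facts[OF \<gamma>] h1 by (intro powr_mono') auto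
    finally show ?thesis .
  qed simp
  hence "\<kappa> * K * (norm h)\<^sup>2 \<le> K0 * norm h powr (1 + 1 / (1 + \<gamma>))"
    using K0 K by (intro mult_mono) auto
  thus "v x + p \<bullet> (z - x) - v z \<le> K0 * norm (z - x) powr (1 + 1 / (1 + \<gamma>))" using E by (simp add: h_def)
  have "norm_pow p \<gamma> * (v x + p \<bullet> (z - x) - v z) \<le> pw \<gamma> (norm p) * (\<kappa> * K * (norm h)\<^sup>2)"
    unfolding norm_pow_eq using E by (intro mult_left_mono) auto
  also have "\<dots> \<le> pw \<gamma> P * (\<kappa> * K * (norm h)\<^sup>2)"
    using p(2) K \<gamma> by (intro mult_right_mono pw_mono) auto
  also have "\<dots> \<le> K0 * (norm h)\<^sup>2" using mult_right_mono[OF K0(3), of "(norm h)\<^sup>2"] by (simp add: mult_ac)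
  also have "\<dots> \<le> K0 powr (1 + \<gamma>) * (norm h)\<^sup>2"
    using K0(1) \<gamma> powr_mono[of 1 "1 + \<gamma>" K0] by (intro mult_right_mono) auto
  finally show "norm_pow p \<gamma> * (v x + p \<bullet> (z - x) - v z) \<le> K0 powr (1 + \<gamma>) * (norm (z - x))\<^sup>2" by (simp add: h_def)
qed

text \<open>Where a Gaussian profile touches, it is a strict subsolution, so the right-hand side
  cannot be small there.\<close>

lemma gauss_contact_rhs:
  fixes x y :: "real ^ 'n::finite"
  assumes n: "CARD('n) \<ge> 2" and lam: "0 < lam" "lam \<le> Lam" and \<gamma>: "0 \<le> \<gamma>" and K: "0 < K"
    and \<kappa>: "\<kappa> = 8 * (2 * lam + 2 * Lam * (real CARD('n) - 1) + 1) / lam"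
    and v: "visc_super lam Lam \<gamma> L \<Omega> v g" and x: "x \<in> \<Omega>" "x \<in> interior S"
    and c: "\<And>z. z \<in> S \<Longrightarrow> v x - gauss_profile K \<kappa> (x - y) + gauss_profile K \<kappa> (z - y) \<le> v z"
    and d: "1 / 2 \<le> norm (x - y)"
    and p: "p = (- (2 * \<kappa> * gauss_profile K \<kappa> (x - y))) *\<^sub>R (x - y)" "norm p \<le> L"
  shows "norm_pow p \<gamma> * (2 * \<kappa> * gauss_profile K \<kappa> (x - y)) \<le> g x"
proof -
  define n1 where "n1 = real CARD('n) - 1"
  have n1: "1 \<le> n1" using n by (simp add: n1_def)
  have Ln: "0 < Lam * n1" using lam n1 by (intro mult_pos_pos) auto
  \<comment> \<open>\<open>kappa\<close> is chosen so that the convex curvature \<open>s1\<close>,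
    at least \<open>G * kappa^2 / 8\<close>, outweighs the concave ones: \<open>lam * s1\<close>
    exceeds the sum of the two terms with \<open>s2 = 2 * G * kappa\<close> by at least
    \<open>G * kappa\<close>.\<close>
  have lk: "lam * \<kappa> / 8 = 2 * lam + 2 * Lam * n1 + 1" using lam by (simp add: \<kappa> n1_def)
  have k16: "16 < \<kappa>"
  proof (rule ccontr)
    assume "\<not> 16 < \<kappa>"
    hence "lam * \<kappa> \<le> lam * 16" using lam by (intro mult_left_mono) auto
    thus False using lk Ln lam by linarith
  qed
  define r where "r = norm (x - y)"
  define e where "e = (1 / r) *\<^sub>R (x - y)"
  define G where "G = gauss_profile K \<kappa> (x - y)"
  have G: "0 < G" using K by (simp add: G_def gauss_profile_pos)
  have r: "1 / 2 \<le> r" using d by (simp add: r_def)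
  have e: "norm e = 1" "x - y = r *\<^sub>R e" using r by (auto simp: e_def r_def)
  define s1 s2 where "s1 = G * (\<kappa>\<^sup>2 / 2 * r\<^sup>2)" and "s2 = G * (2 * \<kappa>)"
  have r2: "1 / 4 \<le> r\<^sup>2" using power_mono[OF r, of 2] by (simp add: power2_eq_square)
  have k8: "\<kappa> / 8 \<le> \<kappa> / 2 * r\<^sup>2" using mult_left_mono[OF r2, of "\<kappa> / 2"] k16 by simp
  have s1: "G * \<kappa> * (\<kappa> / 8) \<le> s1"
    using mult_left_mono[OF k8, of "G * \<kappa>"] G k16 by (simp add: s1_def power2_eq_square mult_ac)
  have s: "0 < s2" "s2 < s1"
  proof -
    show "0 < s2" using G k16 by (simp add: s2_def)
    have "G * \<kappa> * 2 < G * \<kappa> * (\<kappa> / 8)" using G k16 by (intro mult_strict_left_mono) auto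
    thus "s2 < s1" using s1 by (simp add: s2_def mult_ac)
  qed
  define \<rho> where "\<rho> = min (1 / \<kappa>) (1 / (2 * \<kappa> * r))"
  have \<rho>: "0 < \<rho>" using k16 r by (simp add: \<rho>_def)
  have "\<forall>\<^sub>F z in nhds x. v x + quad x p e s1 s2 z \<le> v z"
  proof -
    have "\<forall>\<^sub>F z in nhds x. z \<in> S \<inter> ball x \<rho>"
    proof (rule eventually_nhds_in_open[THEN eventually_mono])
      show "open (interior S \<inter> ball x \<rho>)" "x \<in> interior S \<inter> ball x \<rho>" using x \<rho> by auto
    qed (use interior_subset in auto)
    thus ?thesis
    proof eventually_elim
      case (elim z)
      define h where "h = z - x"
      have nh: "norm h < \<rho>" using elim by (simp add: h_def dist_norm norm_minus_commute)
      have h1: "\<kappa> * norm h \<le> 1" and h2: "2 * \<kappa> * r * norm h \<le> 1"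
      proof -
        have nh': "norm h < 1 / \<kappa>" "norm h < 1 / (2 * \<kappa> * r)" using nh by (simp_all add: \<rho>_def)
        have pos: "0 < \<kappa>" "0 < 2 * \<kappa> * r" using k16 r by auto
        show "\<kappa> * norm h \<le> 1" using nh'(1) pos(1) by (simp add: pos_less_divide_eq mult.commute)
        show "2 * \<kappa> * r * norm h \<le> 1" using nh'(2)[unfolded pos_less_divide_eq[OF pos(2)]] by (simp add: mult_ac)
      qed
      have "norm h \<le> 1" using h1 k16 mult_right_mono[of 1 \<kappa> "norm h"] by simp
      then have "\<kappa> * (norm h)\<^sup>2 \<le> 1" 
      proof -
        assume "norm h \<le> 1"
        hence "\<kappa> * norm h * norm h \<le> 1 * 1" using h1 k16 by (intro mult_mono) auto
        thus ?thesis by (simp add: power2_eq_square mult.assoc)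
      qed
      hence "G * (1 - 2 * \<kappa> * ((x - y) \<bullet> h) - 2 * \<kappa> * (norm h)\<^sup>2 + \<kappa>\<^sup>2 / 2 * r\<^sup>2 * (e \<bullet> h)\<^sup>2) \<le> gauss_profile K \<kappa> ((x - y) + h)"
        unfolding G_def using K k16 e r h2 by (intro gauss_profile_expansion2) auto
      moreover have "(x - y) + h = z - y" by (simp add: h_def)
      moreover have "v x - G + gauss_profile K \<kappa> (z - y) \<le> v z" using c elim by (simp add: G_def)
      moreover have "quad x p e s1 s2 z = G * (- 2 * \<kappa> * ((x - y) \<bullet> h) - 2 * \<kappa> * (norm h)\<^sup>2 + \<kappa>\<^sup>2 / 2 * r\<^sup>2 * (e \<bullet> h)\<^sup>2)"
        by (simp add: quad_def p(1) h_def[symmetric] G_def[symmetric] s1_def s2_def algebra_simps)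
      ultimately show ?case by (simp add: algebra_simps)
    qed
  qed
  hence "norm_pow p \<gamma> * (2 * (lam * (s1 - s2) - Lam * (real CARD('n) - 1) * s2)) \<le> g x"
    using v x(1) p(2) e(1) s unfolding visc_super_def by blast
  moreover have "2 * \<kappa> * G \<le> 2 * (lam * (s1 - s2) - Lam * n1 * s2)"
  proof -
    have "lam * (G * \<kappa> * (\<kappa> / 8)) \<le> lam * s1" using s1 lam by (intro mult_left_mono) auto
    moreover have "lam * (G * \<kappa> * (\<kappa> / 8)) = G * \<kappa> * (2 * lam + 2 * Lam * n1 + 1)" by (simp flip: lk)
    ultimately show ?thesis by (simp add: s2_def algebra_simps)
  qed
  ultimately show ?thesis
    using mult_left_mono[of "2 * \<kappa> * G" "2 * (lam * (s1 - s2) - Lam * n1 * s2)" "norm_pow p \<gamma>"]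
    by (simp add: n1_def G_def norm_pow_eq)
qed

text \<open>The profile is slid under \<open>v\<close> with centres in \<open>cball 0 (1/4)\<close>.
  Every centre has a contact point, either with the power part (\<open>Ri\<close>) or with the
  Gaussian part (\<open>Ro\<close>), and the area estimate bounds the volume of the centres by
  integrals over the two contact sets. At the outer contacts \<open>g >= c0\<close>, so their share
  is at most a multiple of the integral of \<open>g ^ n\<close>; if that is small, the inner contact
  set has measure bounded below.\<close>

lemma contact_measure:
  fixes lam Lam \<gamma> N :: real
  assumes n: "CARD('n::finite) \<ge> 2" and lam: "0 < lam" "lam \<le> Lam" and \<gamma>: "0 \<le> \<gamma>" and N: "0 \<le> N"
  obtains L M \<mu> \<eta> where "0 < L" "1 \<le> M" "0 < \<mu>" "0 < \<eta>"
    "\<And>v g (x0 :: real ^ 'n). \<lbrakk>visc_super lam Lam \<gamma> L (ball 0 6) v g; continuous_on (cball 0 6) v;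
       continuous_on (cball 0 6) g; \<And>x. x \<in> cball 0 6 \<Longrightarrow> 0 \<le> g x; x0 \<in> cball 0 4;
       \<And>z. z \<in> cball 0 6 \<Longrightarrow> v x0 - N \<le> v z; (LINT z:cball 0 6|lebesgue. g z ^ CARD('n)) \<le> \<eta>\<rbrakk>
     \<Longrightarrow> \<exists>Z. compact Z \<and> Z \<subseteq> ball 0 1 \<and> \<mu> \<le> measure lebesgue Z \<and>
       (\<forall>x\<in>Z. v x \<le> v x0 + M \<and> (\<exists>p. norm p \<le> M \<and> touches_below \<gamma> M (cball 0 6) v x p))"
proof -
  define \<beta> where "\<beta> = 1 + 1 / (1 + \<gamma>)"
  have \<beta>: "1 \<le> \<beta>" "\<beta> \<le> 2" using exponent_facts[OF \<gamma>] by (auto simp: \<beta>_def)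
  define \<kappa> where "\<kappa> = 8 * (2 * lam + 2 * Lam * (real CARD('n) - 1) + 1) / lam"
  have k16: "16 \<le> \<kappa>"
  proof -
    define X where "X = Lam * (real CARD('n) - 1)"
    have "0 \<le> X" unfolding X_def using lam n by (intro mult_nonneg_nonneg) auto
    moreover have "\<kappa> = 8 * (2 * lam + 2 * X + 1) / lam" by (simp add: \<kappa>_def X_def mult.assoc)
    ultimately show ?thesis using lam by (simp add: pos_le_divide_eq)
  qed
  \<comment> \<open>The profile has to drop by more than \<open>N\<close> between the distance 9/2,
    an upper bound for the distance of \<open>x0\<close> from a centre, and 11/2, a lower bound for
    that of a point of the sphere of radius 6. Then no contact occurs on this sphere.\<close>
  define K where "K = (N + 1) / (exp (- \<kappa> * (81/4)) - exp (- \<kappa> * (121/4)))"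
  have dK: "0 < exp (- \<kappa> * (81/4)) - exp (- \<kappa> * (121/4))" using k16 by simp
  have K: "0 < K" using dK N by (simp add: K_def)
  have Kd: "K * (exp (- \<kappa> * (81/4)) - exp (- \<kappa> * (121/4))) = N + 1" using dK by (simp add: K_def)
  define A where "A = 14 * K * \<kappa>"
  have A: "0 < A" using K k16 by (simp add: A_def)
  define F where "F = (profile \<beta> A K \<kappa> :: real ^ 'n \<Rightarrow> real)"
  define L where "L = 16 * A"
  define Kout where "Kout = 1 + \<kappa> * K + pw \<gamma> (2 * A) * (\<kappa> * K)"
  have kK: "0 < \<kappa> * K" using K k16 by simp
  have Kout: "1 \<le> Kout" "\<kappa> * K \<le> Kout" "pw \<gamma> (2 * A) * (\<kappa> * K) \<le> Kout"
    using kK by (auto simp: Kout_def)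
  define Cin where "Cin = 1 + (1 + \<gamma>) / (A * \<beta>) powr (1 + \<gamma>)"
  have Ab: "0 < (A * \<beta>) powr (1 + \<gamma>)" using A \<beta> by simp
  have Cin: "0 < Cin" using Ab \<gamma> by (simp add: Cin_def add_pos_nonneg)
  define Q where "Q = exp (49 * \<kappa>) + 98 * \<kappa> * exp (98 * \<kappa>) * (1 + 49 * \<kappa>)"
  have Q: "0 < Q" using k16 by (simp add: Q_def add_pos_pos)
  \<comment> \<open>\<open>pm\<close> is a lower bound for the slope at outer contacts; it keeps the
    gradient factor away from 0 and thereby gives the lower bound \<open>c0\<close> for the
    right-hand side there.\<close>
  define pm where "pm = \<kappa> * (K * exp (- (49 * \<kappa>)))"
  have pm: "0 < pm" using K k16 by (simp add: pm_def)
  define Co where "Co = 1 + Q / (2 * \<kappa> * K * pw \<gamma> pm)"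
  have Co: "0 < Co" using Q K k16 pm by (simp add: Co_def add_pos_nonneg)
  define c0 where "c0 = pw \<gamma> pm * (2 * \<kappa> * (K * exp (- (49 * \<kappa>))))"
  have c0: "0 < c0" using pm K k16 by (simp add: c0_def)
  have 6: "0 < 6 * A" using A by simp
  have L8: "8 * (2 * A) \<le> L" by (simp add: L_def)
  obtain C2 where C2: "0 < C2" and estin: "\<And>v g R (p :: (real ^ 'n) \<times> (real ^ 'n) \<Rightarrow> real ^ 'n).
    \<lbrakk>visc_super lam Lam \<gamma> L (ball 0 6) v g; continuous_on (cball 0 6) v; continuous_on (cball 0 6) g;
     \<And>x. x \<in> cball 0 6 \<Longrightarrow> 0 \<le> g x; compact R; \<And>x y. (x, y) \<in> R \<Longrightarrow> x \<in> ball 0 6;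
     \<And>x y. (x, y) \<in> R \<Longrightarrow> touches_below \<gamma> (6 * A) (cball x (1/4) \<inter> cball 0 6) v x (p (x, y));
     \<And>x y. (x, y) \<in> R \<Longrightarrow> norm (p (x, y)) \<le> 2 * A;
     \<And>x0 y0 x1 y1. (x0, y0) \<in> R \<Longrightarrow> (x1, y1) \<in> R \<Longrightarrow> norm (y1 - y0) \<le> Cin * (norm (x1 - x0)
        + pw \<gamma> (norm (p (x0, y0)) + norm (p (x1, y1))) * norm (p (x1, y1) - p (x0, y0)))\<rbrakk>
    \<Longrightarrow> measure lebesgue (snd ` R) \<le> C2 * (LINT x:fst ` R|lebesgue. (1 + g x) ^ CARD('n))"
    apply (rule contact_image_measure[OF n lam \<gamma> 6 Cin L8])
    subgoal premises prems by (rule prems(1)[OF prems(2)]) (rule prems(3); assumption)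
    done
  have Kout0: "0 < Kout" using Kout by simp
  obtain C3 where C3: "0 < C3" and estout: "\<And>v g R (p :: (real ^ 'n) \<times> (real ^ 'n) \<Rightarrow> real ^ 'n).
    \<lbrakk>visc_super lam Lam \<gamma> L (ball 0 6) v g; continuous_on (cball 0 6) v; continuous_on (cball 0 6) g;
     \<And>x. x \<in> cball 0 6 \<Longrightarrow> 0 \<le> g x; compact R; \<And>x y. (x, y) \<in> R \<Longrightarrow> x \<in> ball 0 6;
     \<And>x y. (x, y) \<in> R \<Longrightarrow> touches_below \<gamma> Kout (cball x (1/4) \<inter> cball 0 6) v x (p (x, y));
     \<And>x y. (x, y) \<in> R \<Longrightarrow> norm (p (x, y)) \<le> 2 * A;
     \<And>x0 y0 x1 y1. (x0, y0) \<in> R \<Longrightarrow> (x1, y1) \<in> R \<Longrightarrow> norm (y1 - y0) \<le> Co * (norm (x1 - x0)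
        + pw \<gamma> (norm (p (x0, y0)) + norm (p (x1, y1))) * norm (p (x1, y1) - p (x0, y0)))\<rbrakk>
    \<Longrightarrow> measure lebesgue (snd ` R) \<le> C3 * (LINT x:fst ` R|lebesgue. (1 + g x) ^ CARD('n))"
    apply (rule contact_image_measure[OF n lam \<gamma> Kout0 Co L8])
    subgoal premises prems by (rule prems(1)[OF prems(2)]) (rule prems(3); assumption)
    done
  define H where "H = C2 * 2 ^ CARD('n) + C3 * (1 + 1 / c0) ^ CARD('n)"
  have H: "0 < H" using C2 C3 c0 by (simp add: H_def add_pos_pos)
  define m4 where "m4 = measure lebesgue (cball (0 :: real ^ 'n) (1/4))"
  have m4: "0 < m4" by (simp add: m4_def content_cball_pos)
  \<comment> \<open>The volume \<open>m4\<close> of the centres will be at most \<open>H\<close>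
    times the sum of \<open>mu\<close> and the measure of the inner contact set; half of it is thus
    left for the latter. The same number serves as the smallness condition on the integral of
    \<open>g ^ n\<close>.\<close>
  define \<mu> where "\<mu> = m4 / (2 * H)"
  have \<mu>: "0 < \<mu>" "m4 = 2 * H * \<mu>" using m4 H by (auto simp: \<mu>_def)
  define M where "M = 1 + K + 6 * A"
  show thesis
  proof (rule that[of L M \<mu> \<mu>])
    show "0 < L" "1 \<le> M" "0 < \<mu>" "0 < \<mu>" using A K \<mu> by (auto simp: L_def M_def)
    fix v g and x0 :: "real ^ 'n"
    assume v: "visc_super lam Lam \<gamma> L (ball 0 6) v g" and cv: "continuous_on (cball 0 6) v"
      and cg: "continuous_on (cball 0 6) g" and g0: "\<And>x. x \<in> cball 0 6 \<Longrightarrow> 0 \<le> g x"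
      and x0: "x0 \<in> cball 0 4" and vN: "\<And>z. z \<in> cball 0 6 \<Longrightarrow> v x0 - N \<le> v z"
      and gn: "(LINT z:cball 0 6|lebesgue. g z ^ CARD('n)) \<le> \<mu>"
    have x06: "x0 \<in> cball 0 6" using x0 by simp
    define c where "c = {q \<in> cball 0 6 \<times> cball 0 (1/4). \<forall>z\<in>cball 0 6.
       v (fst q) - F (fst q - snd q) \<le> v z - F (z - snd q)}"
    have cF: "continuous_on UNIV F" unfolding F_def using \<beta> by (intro continuous_on_profile) auto
    have comp: "compact c"
    proof -
      have "c = (cball 0 6 \<times> cball 0 (1/4)) \<inter> (\<Inter>z\<in>cball 0 6. {q \<in> cball 0 6 \<times> cball 0 (1/4).
          v (fst q) - F (fst q - snd q) \<le> v z - F (z - snd q)})" by (auto simp: c_def)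
      also have "compact \<dots>"
      proof (intro compact_Int_closed compact_Times compact_cball closed_INT ballI)
        fix z :: "real ^ 'n" assume "z \<in> cball 0 6"
        show "closed {q \<in> cball 0 6 \<times> cball 0 (1/4). v (fst q) - F (fst q - snd q) \<le> v z - F (z - snd q)}"
          by (rule continuous_on_closed_Collect_le)
            (auto intro!: continuous_intros continuous_on_compose2[OF cv] continuous_on_compose2[OF cF] closed_Times)
      qed
      finally show ?thesis .
    qed
    have cD: "x \<in> cball 0 6" "y \<in> cball 0 (1/4)" "\<And>z. z \<in> cball 0 6 \<Longrightarrow> v x - F (x - y) \<le> v z - F (z - y)"
      if "(x, y) \<in> c" for x y using that by (auto simp: c_def)
    have Fx0: "K * exp (- \<kappa> * (81/4)) \<le> F (x0 - y)" if y: "y \<in> cball 0 (1/4)" for y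
    proof -
      have nz: "norm (x0 - y) \<le> 9/2" using x0 y norm_triangle_ineq4[of x0 y] by simp
      show ?thesis
      proof (cases "norm (x0 - y) \<le> 1/2")
        case True
        have "A * norm (x0 - y) powr \<beta> \<le> A * (1/2) powr \<beta>"
          using True A \<beta> by (intro mult_left_mono powr_mono2) auto
        moreover have "K * exp (- \<kappa> * (81/4)) \<le> K * exp (- \<kappa> * (1/4))" using K k16 by (intro mult_left_mono) auto
        ultimately show ?thesis using True by (simp add: F_def profile_def)
      next
        case False
        have "(norm (x0 - y))\<^sup>2 \<le> (9/2)\<^sup>2" using nz by (intro power_mono) auto
        hence "\<kappa> * (norm (x0 - y))\<^sup>2 \<le> \<kappa> * (81/4)" using k16 by (intro mult_left_mono) (auto simp: power2_eq_square)
        thus ?thesis using False K by (simp add: F_def profile_def gauss_profile_def)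
      qed
    qed
    have cint: "x \<in> ball 0 6" if q: "(x, y) \<in> c" for x y
    proof (rule ccontr)
      assume "x \<notin> ball 0 6"
      hence nx: "6 \<le> norm x" by simp
      have ny: "norm y \<le> 1/4" using cD(2)[OF q] by simp
      have nz: "11/2 \<le> norm (x - y)" using nx ny norm_triangle_ineq2[of x y] by linarith
      have "(11/2)\<^sup>2 \<le> (norm (x - y))\<^sup>2" using nz by (intro power_mono) auto
      hence "\<kappa> * (121/4) \<le> \<kappa> * (norm (x - y))\<^sup>2" using k16 by (intro mult_left_mono) (auto simp: power2_eq_square)
      hence "F (x - y) \<le> K * exp (- \<kappa> * (121/4))" using nz K by (simp add: F_def profile_def gauss_profile_def)
      moreover have "v x - F (x - y) \<le> v x0 - F (x0 - y)" by (rule cD(3)[OF q x06])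
      moreover have "v x0 - N \<le> v x" by (rule vN[OF cD(1)[OF q]])
      moreover have "K * exp (- \<kappa> * (81/4)) \<le> F (x0 - y)" by (rule Fx0[OF cD(2)[OF q]])
      ultimately show False using Kd by (simp add: algebra_simps)
    qed
    have n7: "norm (z - y) \<le> 7" if "z \<in> cball 0 6" "y \<in> cball 0 (1/4)" for z y :: "real ^ 'n"
      using that norm_triangle_ineq4[of z y] by simp
    \<comment> \<open>The two pieces share the sphere of radius 1/2 about the centre, so that both
      are closed.\<close>
    define Ri where "Ri = c \<inter> {q. norm (fst q - snd q) \<le> 1/2}"
    define Ro where "Ro = c \<inter> {q. 1/2 \<le> norm (fst q - snd q)}"
    have cRi: "compact Ri" and cRo: "compact Ro"
      unfolding Ri_def Ro_def by (intro compact_Int_closed comp closed_Collect_le continuous_intros)+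
    define pin where "pin q = (- (A * \<beta> * norm (fst q - snd q) powr (\<beta> - 2))) *\<^sub>R (fst q - snd q)" for q :: "(real ^ 'n) \<times> (real ^ 'n)"
    define pout where "pout q = (- (2 * \<kappa> * gauss_profile K \<kappa> (fst q - snd q))) *\<^sub>R (fst q - snd q)" for q :: "(real ^ 'n) \<times> (real ^ 'n)"
    have ic: "v x + A * norm (x - y) powr \<beta> - A * norm (z - y) powr \<beta> \<le> v z"
      if q: "(x, y) \<in> Ri" and z: "z \<in> cball 0 6" for x y z
    proof -
      have qc: "(x, y) \<in> c" and d: "norm (x - y) \<le> 1/2" using q by (auto simp: Ri_def)
      have "K * exp (- \<kappa> * (1 / 4)) + A * (1 / 2) powr \<beta> - A * norm (z - y) powr \<beta> \<le> F (z - y)"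
        unfolding F_def using \<beta> K k16 n7[OF z cD(2)[OF qc]] by (intro profile_ge_power) (auto simp: A_def)
      moreover have "F (x - y) = K * exp (- \<kappa> * (1 / 4)) + A * (1 / 2) powr \<beta> - A * norm (x - y) powr \<beta>"
        using d by (simp add: F_def profile_def)
      ultimately show ?thesis using cD(3)[OF qc z] by linarith
    qed
    have it: "touches_below \<gamma> (6 * A) (cball 0 6) v x (pin (x, y))" and ip: "norm (pin (x, y)) \<le> 2 * A"
      and iy: "y = x + (1 / (A * \<beta>) powr (1 + \<gamma>)) *\<^sub>R norm_pow (pin (x, y)) \<gamma> *\<^sub>R pin (x, y)" if q: "(x, y) \<in> Ri" for x y
    proof -
      have pd: "pin (x, y) = (- (A * \<beta> * norm (x - y) powr (\<beta> - 2))) *\<^sub>R (x - y)" by (simp add: pin_def)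
      note tb = touches_below_power[OF \<gamma> A \<beta>_def ic[OF q] pd, of "cball 0 6"]
      show "touches_below \<gamma> (6 * A) (cball 0 6) v x (pin (x, y))" using tb(1) by simp
      show "y = x + (1 / (A * \<beta>) powr (1 + \<gamma>)) *\<^sub>R norm_pow (pin (x, y)) \<gamma> *\<^sub>R pin (x, y)" using tb(3) by simp
      have "norm (x - y) powr (\<beta> - 1) \<le> 1" using q \<beta> powr_mono2[of "\<beta> - 1" "norm (x - y)" 1] by (auto simp: Ri_def)
      hence "A * \<beta> * norm (x - y) powr (\<beta> - 1) \<le> A * 2 * 1" using A \<beta> by (intro mult_mono) auto
      thus "norm (pin (x, y)) \<le> 2 * A" using tb(2) by simp
    qed
    have mi: "measure lebesgue (snd ` Ri) \<le> C2 * (LINT x:fst ` Ri|lebesgue. (1 + g x) ^ CARD('n))"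
    proof (rule estin[OF v cv cg g0 cRi])
      show "x \<in> ball 0 6" if "(x, y) \<in> Ri" for x y using cint that by (auto simp: Ri_def)
      show "touches_below \<gamma> (6 * A) (cball x (1/4) \<inter> cball 0 6) v x (pin (x, y))" if "(x, y) \<in> Ri" for x y
        using A \<gamma> by (intro touches_below_mono[OF it[OF that]]) auto
      show "norm (pin (x, y)) \<le> 2 * A" if "(x, y) \<in> Ri" for x y by (rule ip[OF that])
      fix xa ya xb yb assume qa: "(xa, ya) \<in> Ri" and qb: "(xb, yb) \<in> Ri"
      define p0 p1 where "p0 = pin (xa, ya)" and "p1 = pin (xb, yb)"
      define X where "X = pw \<gamma> (norm p0 + norm p1) * norm (p1 - p0)"
      have "yb - ya = (xb - xa) + (1 / (A * \<beta>) powr (1 + \<gamma>)) *\<^sub>R (norm_pow p1 \<gamma> *\<^sub>R p1 - norm_pow p0 \<gamma> *\<^sub>R p0)"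
        using iy[OF qa] iy[OF qb] unfolding p0_def[symmetric] p1_def[symmetric]
        by (metis (no_types, opaque_lifting) add_diff_add scaleR_right_diff_distrib)
      hence "norm (yb - ya) \<le> norm (xb - xa) + (1 / (A * \<beta>) powr (1 + \<gamma>)) * norm (norm_pow p1 \<gamma> *\<^sub>R p1 - norm_pow p0 \<gamma> *\<^sub>R p0)"
        using norm_triangle_ineq[of "xb - xa" "(1 / (A * \<beta>) powr (1 + \<gamma>)) *\<^sub>R (norm_pow p1 \<gamma> *\<^sub>R p1 - norm_pow p0 \<gamma> *\<^sub>R p0)"]
        by simp
      also have "\<dots> \<le> norm (xb - xa) + (1 / (A * \<beta>) powr (1 + \<gamma>)) * ((1 + \<gamma>) * X)"
      proof (intro add_left_mono mult_left_mono)
        show "norm (norm_pow p1 \<gamma> *\<^sub>R p1 - norm_pow p0 \<gamma> *\<^sub>R p0) \<le> (1 + \<gamma>) * X"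
          using norm_pow_scaleR_diff_le[OF \<gamma>, of p1 p0] by (simp add: X_def add.commute mult.assoc)
      qed simp
      also have "\<dots> \<le> Cin * (norm (xb - xa) + X)"
      proof -
        define W where "W = (1 + \<gamma>) / (A * \<beta>) powr (1 + \<gamma>)"
        have "0 \<le> W" using Ab \<gamma> by (simp add: W_def)
        hence "0 \<le> W * norm (xb - xa)" by simp
        moreover have "0 \<le> X" by (simp add: X_def)
        moreover have "(1 / (A * \<beta>) powr (1 + \<gamma>)) * ((1 + \<gamma>) * X) = W * X" by (simp add: W_def)
        moreover have "Cin = 1 + W" by (simp add: Cin_def W_def)
        ultimately show ?thesis by (simp add: distrib_right distrib_left)
      qed
      finally show "norm (yb - ya) \<le> Cin * (norm (xb - xa)
        + pw \<gamma> (norm (pin (xa, ya)) + norm (pin (xb, yb))) * norm (pin (xb, yb) - pin (xa, ya)))"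
        by (simp only: X_def p0_def p1_def)
    qed
    \<comment> \<open>The Gaussian is known to lie below the profile at distance at least 1/4 from
      the centre. Points within 1/4 of an outer contact satisfy this, so outer touching is asserted
      only on \<open>cball x (1/4)\<close>.\<close>
    have oc: "v x - gauss_profile K \<kappa> (x - y) + gauss_profile K \<kappa> (z - y) \<le> v z"
      if q: "(x, y) \<in> Ro" and z: "z \<in> cball x (1/4) \<inter> cball 0 6" for x y z
    proof -
      have qc: "(x, y) \<in> c" and d: "1/2 \<le> norm (x - y)" using q by (auto simp: Ro_def)
      have "norm (x - y) \<le> norm (x - z) + norm (z - y)" using norm_triangle_ineq[of "x - z" "z - y"] by simp
      hence "1/4 \<le> norm (z - y)" using d z by (simp add: dist_norm)
      hence "gauss_profile K \<kappa> (z - y) \<le> F (z - y)"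
        unfolding F_def using \<beta> K k16 by (intro profile_ge_gauss) (auto simp: A_def)
      moreover have "F (x - y) = gauss_profile K \<kappa> (x - y)"
      proof (cases "norm (x - y) \<le> 1/2")
        case True
        hence "norm (x - y) = 1/2" using d by linarith
        note nz = this
        show ?thesis unfolding F_def profile_def gauss_profile_def nz by (simp add: power2_eq_square)
      qed (simp add: F_def profile_def)
      moreover have "v x - F (x - y) \<le> v z - F (z - y)" using cD(3)[OF qc] z by blast
      ultimately show ?thesis by linarith
    qed
    have o7: "norm (x - y) \<le> 7" "1/2 \<le> norm (x - y)" if "(x, y) \<in> Ro" for x y
      using that n7 cD[of x y] by (auto simp: Ro_def)
    have og: "K * exp (- (49 * \<kappa>)) \<le> gauss_profile K \<kappa> (x - y)" "gauss_profile K \<kappa> (x - y) \<le> K" if q: "(x, y) \<in> Ro" for x y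
    proof -
      have "(norm (x - y))\<^sup>2 \<le> 7\<^sup>2" using o7[OF q] by (intro power_mono) auto
      hence "\<kappa> * (norm (x - y))\<^sup>2 \<le> 49 * \<kappa>" using k16 by simp
      thus "K * exp (- (49 * \<kappa>)) \<le> gauss_profile K \<kappa> (x - y)" using K by (simp add: gauss_profile_def)
      show "gauss_profile K \<kappa> (x - y) \<le> K" using K k16 by (simp add: gauss_profile_def mult_le_cancel_left1)
    qed
    have onp: "norm (pout (x, y)) = 2 * \<kappa> * gauss_profile K \<kappa> (x - y) * norm (x - y)" for x y
      using K k16 gauss_profile_pos[of K \<kappa> "x - y"] by (simp add: pout_def abs_mult)
    have op: "norm (pout (x, y)) \<le> 2 * A" "pm \<le> norm (pout (x, y))" if q: "(x, y) \<in> Ro" for x y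
    proof -
      have "2 * \<kappa> * gauss_profile K \<kappa> (x - y) * norm (x - y) \<le> 2 * \<kappa> * K * 7"
        using o7[OF q] og[OF q] K k16 gauss_profile_pos[of K \<kappa> "x - y"] by (intro mult_mono) auto
      also have "\<dots> = A" by (simp add: A_def)
      also have "A \<le> 2 * A" using A by simp
      finally show "norm (pout (x, y)) \<le> 2 * A" by (simp add: onp)
      have "2 * \<kappa> * (K * exp (- (49 * \<kappa>))) * (1/2) \<le> 2 * \<kappa> * gauss_profile K \<kappa> (x - y) * norm (x - y)"
        using o7[OF q] og[OF q] K k16 less_imp_le[OF gauss_profile_pos[OF K, of \<kappa> "x - y"]] by (intro mult_mono) auto
      thus "pm \<le> norm (pout (x, y))" by (simp add: onp pm_def)
    qed
    have mo: "measure lebesgue (snd ` Ro) \<le> C3 * (LINT x:fst ` Ro|lebesgue. (1 + g x) ^ CARD('n))"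
    proof (rule estout[OF v cv cg g0 cRo])
      show "x \<in> ball 0 6" if "(x, y) \<in> Ro" for x y using cint that by (auto simp: Ro_def)
      show "touches_below \<gamma> Kout (cball x (1/4) \<inter> cball 0 6) v x (pout (x, y))" if q: "(x, y) \<in> Ro" for x y
      proof (rule touches_below_gauss[OF \<gamma> K _ Kout oc[OF q]])
        show "cball x (1/4) \<inter> cball 0 6 \<subseteq> cball x 1" by auto
      qed (use k16 op[OF q] in \<open>auto simp: pout_def\<close>)
      show "norm (pout (x, y)) \<le> 2 * A" if "(x, y) \<in> Ro" for x y by (rule op[OF that])
      fix xa ya xb yb assume qa: "(xa, ya) \<in> Ro" and qb: "(xb, yb) \<in> Ro"
      define p0 p1 where "p0 = pout (xa, ya)" and "p1 = pout (xb, yb)"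
      define X where "X = pw \<gamma> (norm p0 + norm p1) * norm (p1 - p0)"
      have pX: "pw \<gamma> pm * norm (p1 - p0) \<le> X"
        unfolding X_def using op[OF qa] op[OF qb] pm \<gamma>
        by (intro mult_right_mono pw_mono) (auto simp: p0_def p1_def)
      have "norm ((xb - yb) - (xa - ya)) \<le> Q * norm (exp (- \<kappa> * (norm (xb - yb))\<^sup>2) *\<^sub>R (xb - yb) - exp (- \<kappa> * (norm (xa - ya))\<^sup>2) *\<^sub>R (xa - ya))"
        unfolding Q_def using o7[OF qa] o7[OF qb] k16 by (intro gauss_slope_injective) auto
      also have "exp (- \<kappa> * (norm (xb - yb))\<^sup>2) *\<^sub>R (xb - yb) - exp (- \<kappa> * (norm (xa - ya))\<^sup>2) *\<^sub>R (xa - ya)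
          = (- (1 / (2 * \<kappa> * K))) *\<^sub>R (p1 - p0)"
        using K k16 by (simp add: p0_def p1_def pout_def gauss_profile_def scaleR_right_diff_distrib)
      also have "Q * norm ((- (1 / (2 * \<kappa> * K))) *\<^sub>R (p1 - p0)) = Q / (2 * \<kappa> * K * pw \<gamma> pm) * (pw \<gamma> pm * norm (p1 - p0))"
        using K k16 pw_pos[OF pm, of \<gamma>] by simp
      also have "\<dots> \<le> Q / (2 * \<kappa> * K * pw \<gamma> pm) * X"
        using pX Q K k16 by (intro mult_left_mono) auto
      finally have *: "norm ((xb - yb) - (xa - ya)) \<le> Q / (2 * \<kappa> * K * pw \<gamma> pm) * X" .
      have "yb - ya = (xb - xa) - ((xb - yb) - (xa - ya))" by simp
      hence "norm (yb - ya) \<le> norm (xb - xa) + norm ((xb - yb) - (xa - ya))" by (metis norm_triangle_ineq4)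
      also have "\<dots> \<le> norm (xb - xa) + Q / (2 * \<kappa> * K * pw \<gamma> pm) * X" using * by simp
      also have "\<dots> \<le> Co * (norm (xb - xa) + X)"
      proof -
        have "0 \<le> X" by (simp add: X_def)
        define W where "W = Q / (2 * \<kappa> * K * pw \<gamma> pm)"
        have "0 \<le> W" using Q K k16 by (simp add: W_def)
        hence "0 \<le> W * norm (xb - xa)" by simp
        moreover have "Co = 1 + W" by (simp add: Co_def W_def)
        ultimately show ?thesis using \<open>0 \<le> X\<close> unfolding W_def[symmetric] by (simp add: distrib_right distrib_left)
      qed
      finally show "norm (yb - ya) \<le> Co * (norm (xb - xa)
        + pw \<gamma> (norm (pout (xa, ya)) + norm (pout (xb, yb))) * norm (pout (xb, yb) - pout (xa, ya)))"
        by (simp add: X_def p0_def p1_def)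
    qed
    have gc0: "c0 \<le> g x" if xR: "x \<in> fst ` Ro" for x
    proof -
      obtain y where q: "(x, y) \<in> Ro" using xR by force
      have qc: "(x, y) \<in> c" using q by (simp add: Ro_def)
      have pq: "pout (x, y) = (- (2 * \<kappa> * gauss_profile K \<kappa> (x - y))) *\<^sub>R (x - y)" by (simp add: pout_def)
      have xi: "x \<in> interior (cball x (1/4) \<inter> cball 0 6)" using cint[OF qc] by simp
      have pL: "norm (pout (x, y)) \<le> L" using op(1)[OF q] A by (simp add: L_def)
      have "norm_pow (pout (x, y)) \<gamma> * (2 * \<kappa> * gauss_profile K \<kappa> (x - y)) \<le> g x"
        by (rule gauss_contact_rhs[OF n lam \<gamma> K \<kappa>_def v cint[OF qc] xi oc[OF q] o7(2)[OF q] pq pL])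
      moreover have "c0 \<le> norm_pow (pout (x, y)) \<gamma> * (2 * \<kappa> * gauss_profile K \<kappa> (x - y))"
        unfolding c0_def norm_pow_eq using op[OF q] og[OF q] pm \<gamma> K k16 by (intro mult_mono pw_mono mult_left_mono) auto
      ultimately show ?thesis by linarith
    qed
    have cover: "cball 0 (1/4) \<subseteq> snd ` Ri \<union> snd ` Ro"
    proof
      fix y :: "real ^ 'n" assume y: "y \<in> cball 0 (1/4)"
      have "continuous_on (cball 0 6) (\<lambda>z. v z - F (z - y))"
        by (intro continuous_intros cv continuous_on_compose2[OF cF]) auto
      moreover have "cball (0 :: real ^ 'n) 6 \<noteq> {}" by simp
      ultimately obtain x where "x \<in> cball 0 6" "\<And>z. z \<in> cball 0 6 \<Longrightarrow> v x - F (x - y) \<le> v z - F (z - y)"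
        using continuous_attains_inf[OF compact_cball, of 0 6 "\<lambda>z. v z - F (z - y)"] by blast
      hence "(x, y) \<in> c" using y by (simp add: c_def)
      hence "(x, y) \<in> Ri \<or> (x, y) \<in> Ro" by (auto simp: Ri_def Ro_def)
      thus "y \<in> snd ` Ri \<union> snd ` Ro" by force
    qed
    have Ki: "compact (fst ` Ri)" "compact (snd ` Ri)" and Ko: "compact (fst ` Ro)" "compact (snd ` Ro)"
      by (intro compact_continuous_image cRi cRo continuous_on_fst continuous_on_snd continuous_on_id)+
    have m4le: "m4 \<le> measure lebesgue (snd ` Ri) + measure lebesgue (snd ` Ro)"
    proof -
      have "m4 \<le> measure lebesgue (snd ` Ri \<union> snd ` Ro)"
        unfolding m4_def using cover Ki Ko by (intro measure_mono_fmeasurable) (auto intro: lmeasurable_compact fmeasurable.Un)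
      also have "\<dots> \<le> measure lebesgue (snd ` Ri) + measure lebesgue (snd ` Ro)"
        using Ki Ko by (intro measure_Un_le) (auto intro!: fmeasurableD lmeasurable_compact)
      finally show ?thesis .
    qed
    have int: "set_integrable lebesgue S h" if "compact S" "continuous_on S h" for S and h :: "real ^ 'n \<Rightarrow> real"
      using borel_integrable_compact[OF that] by (simp add: set_integrable_def integrable_completion)
    have subi: "fst ` Ri \<subseteq> cball 0 6" and subo: "fst ` Ro \<subseteq> cball 0 6"
      using cD(1) by (force simp: Ri_def Ro_def)+
    have mono: "(LINT x:S|lebesgue. g x ^ CARD('n)) \<le> \<mu>" if S: "compact S" "S \<subseteq> cball 0 6" for S
    proof -
      have "(LINT x:S|lebesgue. g x ^ CARD('n)) \<le> (LINT x:cball 0 6|lebesgue. g x ^ CARD('n))"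
        unfolding set_lebesgue_integral_def
      proof (rule integral_mono)
        show "integrable lebesgue (\<lambda>x. indicat_real S x *\<^sub>R g x ^ CARD('n))"
          using int[OF S(1), of "\<lambda>x. g x ^ CARD('n)"] continuous_on_subset[OF cg S(2)]
          by (simp add: set_integrable_def continuous_on_power)
        show "integrable lebesgue (\<lambda>x. indicat_real (cball 0 6) x *\<^sub>R g x ^ CARD('n))"
          using int[OF compact_cball, of 0 6 "\<lambda>x. g x ^ CARD('n)"] cg
          by (simp add: set_integrable_def continuous_on_power)
        show "indicat_real S x *\<^sub>R g x ^ CARD('n) \<le> indicat_real (cball 0 6) x *\<^sub>R g x ^ CARD('n)" for x
          using S(2) g0[of x] by (auto simp: indicator_def)
      qed
      thus ?thesis using gn by linarith
    qed
    have Ii: "(LINT x:fst ` Ri|lebesgue. (1 + g x) ^ CARD('n)) \<le> 2 ^ CARD('n) * (measure lebesgue (fst ` Ri) + \<mu>)"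
    proof -
      have cgi: "continuous_on (fst ` Ri) g" by (rule continuous_on_subset[OF cg subi])
      have "(LINT x:fst ` Ri|lebesgue. (1 + g x) ^ CARD('n)) \<le> (LINT x:fst ` Ri|lebesgue. 2 ^ CARD('n) * (1 + g x ^ CARD('n)))"
      proof (rule set_integral_mono)
        fix x assume "x \<in> fst ` Ri"
        hence gx: "0 \<le> g x" using g0 subi by blast
        have "(1 + g x) ^ CARD('n) \<le> (2 * max 1 (g x)) ^ CARD('n)" using gx by (intro power_mono) auto
        also have "\<dots> = 2 ^ CARD('n) * (max 1 (g x)) ^ CARD('n)" by (simp add: power_mult_distrib)
        also have "(max 1 (g x)) ^ CARD('n) \<le> 1 + g x ^ CARD('n)" using gx by (simp add: max_def)
        finally show "(1 + g x) ^ CARD('n) \<le> 2 ^ CARD('n) * (1 + g x ^ CARD('n))" by simp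
      qed (intro int Ki continuous_intros cgi)+
      also have "\<dots> = 2 ^ CARD('n) * ((LINT x:fst ` Ri|lebesgue. 1) + (LINT x:fst ` Ri|lebesgue. g x ^ CARD('n)))"
        by (subst set_integral_add(2)[symmetric]) (auto intro!: int Ki continuous_intros cgi)
      also have "(LINT x:fst ` Ri|lebesgue. (1::real)) = measure lebesgue (fst ` Ri)"
        using lmeasurable_compact[OF Ki(1)] by (simp add: set_lebesgue_integral_def lmeasurable_iff_integrable)
      also have "2 ^ CARD('n) * (measure lebesgue (fst ` Ri) + (LINT x:fst ` Ri|lebesgue. g x ^ CARD('n)))
          \<le> 2 ^ CARD('n) * (measure lebesgue (fst ` Ri) + \<mu>)"
        using mono[OF Ki(1) subi] by (intro mult_left_mono add_left_mono) auto
      finally show ?thesis .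
    qed
    have Io: "(LINT x:fst ` Ro|lebesgue. (1 + g x) ^ CARD('n)) \<le> (1 + 1 / c0) ^ CARD('n) * \<mu>"
    proof -
      have cgo: "continuous_on (fst ` Ro) g" by (rule continuous_on_subset[OF cg subo])
      have "(LINT x:fst ` Ro|lebesgue. (1 + g x) ^ CARD('n)) \<le> (LINT x:fst ` Ro|lebesgue. (1 + 1 / c0) ^ CARD('n) * g x ^ CARD('n))"
      proof (rule set_integral_mono)
        fix x assume x: "x \<in> fst ` Ro"
        have "1 \<le> g x / c0" using gc0[OF x] c0 by simp
        hence "1 + g x \<le> (1 + 1 / c0) * g x" by (simp add: algebra_simps)
        hence "(1 + g x) ^ CARD('n) \<le> ((1 + 1 / c0) * g x) ^ CARD('n)"
          using gc0[OF x] c0 by (intro power_mono) auto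
        thus "(1 + g x) ^ CARD('n) \<le> (1 + 1 / c0) ^ CARD('n) * g x ^ CARD('n)" by (simp add: power_mult_distrib)
      qed (intro int Ko continuous_intros cgo)+
      also have "\<dots> = (1 + 1 / c0) ^ CARD('n) * (LINT x:fst ` Ro|lebesgue. g x ^ CARD('n))" by simp
      also have "\<dots> \<le> (1 + 1 / c0) ^ CARD('n) * \<mu>"
        using mono[OF Ko(1) subo] c0 by (intro mult_left_mono) auto
      finally show ?thesis .
    qed
    have "m4 \<le> C2 * (2 ^ CARD('n) * (measure lebesgue (fst ` Ri) + \<mu>)) + C3 * ((1 + 1 / c0) ^ CARD('n) * \<mu>)"
      using m4le mi mo mult_left_mono[OF Ii, of C2] mult_left_mono[OF Io, of C3] C2 C3 by linarith
    also have "\<dots> \<le> H * (measure lebesgue (fst ` Ri) + \<mu>)"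
    proof -
      have "0 \<le> C3 * (1 + 1 / c0) ^ CARD('n) * measure lebesgue (fst ` Ri)" using C3 c0 by simp
      thus ?thesis by (simp add: H_def algebra_simps)
    qed
    finally have "H * (2 * \<mu>) \<le> H * (measure lebesgue (fst ` Ri) + \<mu>)" using \<mu> by (simp add: mult_ac)
    hence Zm: "\<mu> \<le> measure lebesgue (fst ` Ri)" using H by simp
    show "\<exists>Z. compact Z \<and> Z \<subseteq> ball 0 1 \<and> \<mu> \<le> measure lebesgue Z \<and>
       (\<forall>x\<in>Z. v x \<le> v x0 + M \<and> (\<exists>p. norm p \<le> M \<and> touches_below \<gamma> M (cball 0 6) v x p))"
    proof (intro exI[of _ "fst ` Ri"] conjI Ki(1) Zm ballI)
      show "fst ` Ri \<subseteq> ball 0 1"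
      proof
        fix x assume "x \<in> fst ` Ri"
        then obtain y where q: "(x, y) \<in> Ri" by force
        have "norm y \<le> 1/4" "norm (x - y) \<le> 1/2" using q cD(2)[of x y] by (auto simp: Ri_def)
        thus "x \<in> ball 0 1" using norm_triangle_ineq[of "x - y" y] by simp
      qed
      fix x assume "x \<in> fst ` Ri"
      then obtain y where q: "(x, y) \<in> Ri" by force
      have qc: "(x, y) \<in> c" using q by (simp add: Ri_def)
      have "v x - F (x - y) \<le> v x0 - F (x0 - y)" by (rule cD(3)[OF qc x06])
      moreover have "0 \<le> F (x0 - y)" "F (x - y) \<le> K + A"
        unfolding F_def using K k16 A \<beta> by (intro profile_bounds; simp)+
      ultimately show "v x \<le> v x0 + M" using A by (simp add: M_def)
      show "\<exists>p. norm p \<le> M \<and> touches_below \<gamma> M (cball 0 6) v x p"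
      proof (intro exI[of _ "pin (x, y)"] conjI)
        show "norm (pin (x, y)) \<le> M" using ip[OF q] A K by (simp add: M_def)
        show "touches_below \<gamma> M (cball 0 6) v x (pin (x, y))"
          using A K \<gamma> by (intro touches_below_mono[OF it[OF q]]) (auto simp: M_def)
      qed
    qed
  qed
qed

section \<open>Scaling\<close>

text \<open>Subtracting an affine function shifts the slopes of the tests by \<open>q\<close> and
  leaves their curvatures unchanged. Small slopes are treated with \<open>q = 0\<close>, large ones
  with \<open>q = p0\<close>.\<close>

lemma visc_super_scaled_test:
  fixes u :: "real ^ 'n::finite \<Rightarrow> real"
  assumes v: "\<And>L. visc_super lam Lam \<gamma> L \<Omega> u f" and \<rho>: "0 < \<rho>" and a: "0 < a"
    and w: "w = (\<lambda>z. (u (c + \<rho> *\<^sub>R z) - q \<bullet> (\<rho> *\<^sub>R z)) / a)" and z0: "c + \<rho> *\<^sub>R z0 \<in> \<Omega>"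
    and e: "norm e = 1" "0 < s2" "s2 < s1" and ev: "\<forall>\<^sub>F z in nhds z0. w z0 + quad z0 p e s1 s2 z \<le> w z"
  shows "norm_pow (q + (a / \<rho>) *\<^sub>R p) \<gamma> * (a / \<rho>\<^sup>2 * (2 * (lam * (s1 - s2) - Lam * (real CARD('n) - 1) * s2))) \<le> f (c + \<rho> *\<^sub>R z0)"
proof -
  define x where "x = c + \<rho> *\<^sub>R z0"
  define \<Phi> where "\<Phi> y = (1 / \<rho>) *\<^sub>R (y - c)" for y
  have \<Phi>x: "\<Phi> x = z0" using \<rho> by (simp add: \<Phi>_def x_def)
  have uw: "u y = a * w (\<Phi> y) + q \<bullet> (y - c)" for y
    using \<rho> a by (simp add: w \<Phi>_def)
  have "isCont \<Phi> x" unfolding \<Phi>_def by (intro continuous_intros)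
  hence "filterlim \<Phi> (nhds z0) (nhds x)" unfolding continuous_at \<Phi>x[symmetric] by (simp add: tendsto_at_iff_tendsto_nhds)
  from filterlim_iff[THEN iffD1, OF this, rule_format, OF ev]
  have "\<forall>\<^sub>F y in nhds x. w z0 + quad z0 p e s1 s2 (\<Phi> y) \<le> w (\<Phi> y)" .
  hence "\<forall>\<^sub>F y in nhds x. u x + quad x (q + (a / \<rho>) *\<^sub>R p) e (a / \<rho>\<^sup>2 * s1) (a / \<rho>\<^sup>2 * s2) y \<le> u y"
  proof eventually_elim
    case (elim y)
    define h where "h = \<Phi> y - z0"
    have yx: "y - x = \<rho> *\<^sub>R h" using \<rho> by (simp add: h_def \<Phi>_def x_def algebra_simps)
    have "quad x (q + (a / \<rho>) *\<^sub>R p) e (a / \<rho>\<^sup>2 * s1) (a / \<rho>\<^sup>2 * s2) y = q \<bullet> (y - x) + a * quad z0 p e s1 s2 (\<Phi> y)"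
      using \<rho> unfolding quad_def yx h_def[symmetric]
      by (simp add: inner_add_left power_mult_distrib power2_eq_square algebra_simps)
    moreover have "a * (w z0 + quad z0 p e s1 s2 (\<Phi> y)) \<le> a * w (\<Phi> y)" using elim a by (intro mult_left_mono) auto
    moreover have "u x = a * w z0 + q \<bullet> (x - c)" using uw[of x] by (simp add: \<Phi>x)
    moreover have "q \<bullet> (y - x) + q \<bullet> (x - c) = q \<bullet> (y - c)" by (simp add: inner_diff_right)
    ultimately show ?case unfolding uw[of y] by (simp add: distrib_left)
  qed
  moreover have "0 < a / \<rho>\<^sup>2 * s2" "a / \<rho>\<^sup>2 * s2 < a / \<rho>\<^sup>2 * s1" using a \<rho> e by (auto intro!: mult_strict_left_mono divide_strict_right_mono)
  ultimately have "norm_pow (q + (a / \<rho>) *\<^sub>R p) \<gamma> * (2 * (lam * (a / \<rho>\<^sup>2 * s1 - a / \<rho>\<^sup>2 * s2) - Lam * (real CARD('n) - 1) * (a / \<rho>\<^sup>2 * s2))) \<le> f x"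
    using v[of "norm (q + (a / \<rho>) *\<^sub>R p)"] z0 e(1) unfolding visc_super_def x_def by blast
  moreover have "2 * (lam * (a / \<rho>\<^sup>2 * s1 - a / \<rho>\<^sup>2 * s2) - Lam * (real CARD('n) - 1) * (a / \<rho>\<^sup>2 * s2))
     = a / \<rho>\<^sup>2 * (2 * (lam * (s1 - s2) - Lam * (real CARD('n) - 1) * s2))"
    unfolding right_diff_distrib[symmetric] by algebra
  ultimately show ?thesis by (simp add: x_def)
qed

lemma set_integral_affine:
  fixes h :: "'a::euclidean_space \<Rightarrow> real"
  assumes \<rho>: "0 < \<rho>" and h: "continuous_on (cball c (\<rho> * r)) h"
  shows "(LINT x:cball c (\<rho> * r)|lebesgue. h x) = \<rho> ^ DIM('a) * (LINT z:cball 0 r|lebesgue. h (c + \<rho> *\<^sub>R z))"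
proof -
  let ?F = "\<lambda>x. indicator (cball c (\<rho> * r)) x *\<^sub>R h x"
  have F: "?F \<in> borel_measurable borel" by (intro borel_measurable_continuous_on_indicator h) auto
  have eq: "?F (c + \<rho> *\<^sub>R z) = indicator (cball 0 r) z *\<^sub>R h (c + \<rho> *\<^sub>R z)" for z
    using \<rho> by (simp add: indicator_def dist_norm)
  have Tm: "(\<lambda>z. c + \<rho> *\<^sub>R z) \<in> borel_measurable borel" by (intro borel_measurable_continuous_onI continuous_intros)
  have Fm: "(\<lambda>z. ?F (c + \<rho> *\<^sub>R z)) \<in> borel_measurable borel" by (rule measurable_compose[OF Tm F])
  have "integral\<^sup>L lebesgue ?F = integral\<^sup>L lborel ?F" using F by (intro integral_completion) simp
  also have "\<dots> = integral\<^sup>L (density (distr lborel borel (\<lambda>z. c + \<rho> *\<^sub>R z)) (\<lambda>_. ennreal (\<bar>\<rho>\<bar> ^ DIM('a)))) ?F"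
    using \<rho> by (subst lborel_affine[of \<rho> c]) (auto simp: ennreal_power)
  also have "\<dots> = (LINT x|distr lborel borel (\<lambda>z. c + \<rho> *\<^sub>R z). \<bar>\<rho>\<bar> ^ DIM('a) *\<^sub>R ?F x)"
    using F by (intro integral_density) auto
  also have "\<dots> = (LINT z|lborel. \<bar>\<rho>\<bar> ^ DIM('a) *\<^sub>R ?F (c + \<rho> *\<^sub>R z))"
    using F Tm by (intro integral_distr) auto
  also have "\<dots> = \<rho> ^ DIM('a) * (LINT z|lborel. ?F (c + \<rho> *\<^sub>R z))" using \<rho> by simp
  also have "(LINT z|lborel. ?F (c + \<rho> *\<^sub>R z)) = (LINT z|lebesgue. ?F (c + \<rho> *\<^sub>R z))"
    using Fm by (intro integral_completion[symmetric]) simp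
  finally show ?thesis by (simp only: eq set_lebesgue_integral_def)
qed

section \<open>Propagation of touching from one point to a set of positive measure\<close>

definition touch_set :: "real \<Rightarrow> real \<Rightarrow> (real ^ 'n::finite \<Rightarrow> real) \<Rightarrow> (real ^ 'n) set" where
  "touch_set \<gamma> K u = {x \<in> ball 0 1. \<exists>p. touches_below \<gamma> K (cball 0 1) u x p}"

lemma powr_ge_one_bounds:
  fixes d \<beta> :: real
  assumes "1 \<le> d" "1 \<le> \<beta>" "\<beta> \<le> 2"
  shows "1 \<le> d powr \<beta>" "d \<le> d powr \<beta>" "d powr \<beta> \<le> d\<^sup>2"
  using assms powr_mono[of 0 \<beta> d] powr_mono[of 1 \<beta> d] powr_mono[of \<beta> 2 d] by auto

text \<open>The unit \<open>a = K * rho powr beta\<close> turns \<open>K\<close> and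
  \<open>rho\<close> into 1 and divides the right-hand side by \<open>K powr (1 + gamma)\<close>.
  The given touching bounds the rescaled function from below by a constant, so the contact estimate
  applies. It yields touching only relative to \<open>cball 0 6\<close>; farther out the touching at
  \<open>x0\<close> takes over.\<close>

lemma doubling_small_slope:
  fixes lam Lam \<gamma> N :: real
  assumes n: "CARD('n::finite) \<ge> 2" and lam: "0 < lam" "lam \<le> Lam" and \<gamma>: "0 \<le> \<gamma>" and N: "0 \<le> N"
  obtains M \<mu> \<eta> where "1 \<le> M" "0 < \<mu>" "0 < \<eta>"
    "\<And>u f K c \<rho> (x0 :: real ^ 'n) p0. \<lbrakk>continuous_on (cball 0 1) u; continuous_on (ball 0 1) f;
       \<And>L. visc_super lam Lam \<gamma> L (ball 0 1) u f; 0 < K; 0 < \<rho>; cball c (6 * \<rho>) \<subseteq> ball 0 1; x0 \<in> ball 0 1;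
       norm (x0 - c) \<le> 4 * \<rho>; touches_below \<gamma> K (cball 0 1) u x0 p0; norm p0 \<le> N * (K * \<rho> powr (1 / (1 + \<gamma>)));
       (LINT z:cball c (6 * \<rho>)|lebesgue. \<bar>f z\<bar> ^ CARD('n)) \<le> \<eta> * (\<rho> * K powr (1 + \<gamma>)) ^ CARD('n)\<rbrakk>
     \<Longrightarrow> \<exists>Z. compact Z \<and> Z \<subseteq> ball c \<rho> \<and> \<mu> * \<rho> ^ CARD('n) \<le> measure lebesgue Z \<and> Z \<subseteq> touch_set \<gamma> (M * K) u"
proof -
  define \<beta> where "\<beta> = 1 + 1 / (1 + \<gamma>)"
  have \<beta>: "1 \<le> \<beta>" "\<beta> \<le> 2" "\<beta> - 1 = 1 / (1 + \<gamma>)" using exponent_facts[OF \<gamma>] by (auto simp: \<beta>_def)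
  \<comment> \<open>A point of \<open>cball 0 6\<close> has distance at most 10 from the rescaled
    \<open>x0\<close>, which lies in \<open>cball 0 4\<close>, and
    \<open>10 powr beta <= 100\<close>.\<close>
  have N': "0 \<le> 10 * N + 100" using N by simp
  obtain L M \<mu> \<eta> where c1: "0 < L" "1 \<le> M" "0 < \<mu>" "0 < \<eta>" and main:
    "\<And>v g (x0 :: real ^ 'n). \<lbrakk>visc_super lam Lam \<gamma> L (ball 0 6) v g; continuous_on (cball 0 6) v;
       continuous_on (cball 0 6) g; \<And>x. x \<in> cball 0 6 \<Longrightarrow> 0 \<le> g x; x0 \<in> cball 0 4;
       \<And>z. z \<in> cball 0 6 \<Longrightarrow> v x0 - (10 * N + 100) \<le> v z; (LINT z:cball 0 6|lebesgue. g z ^ CARD('n)) \<le> \<eta>\<rbrakk>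
     \<Longrightarrow> \<exists>Z. compact Z \<and> Z \<subseteq> ball 0 1 \<and> \<mu> \<le> measure lebesgue Z \<and>
       (\<forall>x\<in>Z. v x \<le> v x0 + M \<and> (\<exists>p. norm p \<le> M \<and> touches_below \<gamma> M (cball 0 6) v x p))"
    apply (rule contact_measure[OF n lam \<gamma> N'])
    subgoal premises prems by (rule prems(1)[OF prems(2-5)]) (rule prems(6); assumption)
    done
  define M' where "M' = 2 * M + 2 * N + 4"
  have M': "1 \<le> M'" "M \<le> M'" using c1 N by (auto simp: M'_def)
  show thesis
  proof (rule that[of M' \<mu> \<eta>])
    show "1 \<le> M'" "0 < \<mu>" "0 < \<eta>" using M' c1 by auto
    fix u f and K \<rho> :: real and c x0 p0 :: "real ^ 'n"
    assume cu: "continuous_on (cball 0 1) u" and cf: "continuous_on (ball 0 1) f"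
      and v: "\<And>L. visc_super lam Lam \<gamma> L (ball 0 1) u f" and K: "0 < K" and \<rho>: "0 < \<rho>"
      and sub: "cball c (6 * \<rho>) \<subseteq> ball 0 1" and x0b: "x0 \<in> ball 0 1" and x0: "norm (x0 - c) \<le> 4 * \<rho>"
      and t0: "touches_below \<gamma> K (cball 0 1) u x0 p0" and p0: "norm p0 \<le> N * (K * \<rho> powr (1 / (1 + \<gamma>)))"
      and fn: "(LINT z:cball c (6 * \<rho>)|lebesgue. \<bar>f z\<bar> ^ CARD('n)) \<le> \<eta> * (\<rho> * K powr (1 + \<gamma>)) ^ CARD('n)"
    define T where "T = K powr (1 + \<gamma>)"
    have T: "0 < T" using K by (simp add: T_def)
    define a where "a = K * \<rho> powr \<beta>"
    have a: "0 < a" using K \<rho> by (simp add: a_def)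
    have a\<rho>: "a / \<rho> = K * \<rho> powr (\<beta> - 1)" using \<rho> by (simp add: a_def powr_diff)
    have aT: "pw \<gamma> (a / \<rho>) * (a / \<rho>\<^sup>2) = T"
    proof -
      have "a / \<rho>\<^sup>2 = K * \<rho> powr (\<beta> - 2)" using \<rho> by (simp add: a_def powr_diff)
      moreover have "pw \<gamma> (a / \<rho>) = K powr \<gamma> * \<rho> powr ((\<beta> - 1) * \<gamma>)"
        using K \<rho> by (simp add: a\<rho> pw_def powr_mult powr_powr)
      ultimately have "pw \<gamma> (a / \<rho>) * (a / \<rho>\<^sup>2) = (K powr \<gamma> * K) * (\<rho> powr ((\<beta> - 1) * \<gamma>) * \<rho> powr (\<beta> - 2))" by simp
      also have "K powr \<gamma> * K = T" using K by (simp add: T_def powr_add)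
      also have "\<rho> powr ((\<beta> - 1) * \<gamma>) * \<rho> powr (\<beta> - 2) = 1"
      proof -
        have ex: "(\<beta> - 1) * \<gamma> + (\<beta> - 2) = 0" using exponent_facts(3)[OF \<gamma>] by (simp add: \<beta>_def)
        show ?thesis using \<rho> by (simp add: powr_add[symmetric] ex)
      qed
      finally show ?thesis by simp
    qed
    have npa: "norm_pow (0 + (a / \<rho>) *\<^sub>R p) \<gamma> = pw \<gamma> (a / \<rho>) * norm_pow p \<gamma>" for p :: "real ^ 'n"
      using pw_mult[of "a / \<rho>" "norm p" \<gamma>] a \<rho> by (simp add: norm_pow_eq)
    define w where "w = (\<lambda>z. (u (c + \<rho> *\<^sub>R z) - 0 \<bullet> (\<rho> *\<^sub>R z)) / a)"
    have wu: "w z = u (c + \<rho> *\<^sub>R z) / a" for z by (simp add: w_def)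
    define g where "g z = \<bar>f (c + \<rho> *\<^sub>R z)\<bar> / T" for z
    have Tin: "c + \<rho> *\<^sub>R z \<in> cball c (6 * \<rho>)" if "z \<in> cball 0 6" for z
      using that \<rho> by (simp add: dist_norm mult.commute)
    define \<zeta> where "\<zeta> = (1 / \<rho>) *\<^sub>R (x0 - c)"
    have \<zeta>: "c + \<rho> *\<^sub>R \<zeta> = x0" using \<rho> by (simp add: \<zeta>_def)
    have \<zeta>n: "norm \<zeta> \<le> 4" using \<rho> x0 by (simp add: \<zeta>_def divide_le_eq)
    define q0 where "q0 = (\<rho> / a) *\<^sub>R p0"
    have q0: "norm q0 \<le> N"
    proof -
      have "norm q0 = norm p0 / (a / \<rho>)" using a \<rho> by (simp add: q0_def)
      also have "\<dots> \<le> N" using p0 a\<rho> K \<rho> by (simp add: divide_le_eq \<beta>(3))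
      finally show ?thesis .
    qed
    have wlow: "w \<zeta> + q0 \<bullet> (z - \<zeta>) - norm (z - \<zeta>) powr \<beta> \<le> w z" if z: "c + \<rho> *\<^sub>R z \<in> cball 0 1" for z
    proof -
      have d: "c + \<rho> *\<^sub>R z - x0 = \<rho> *\<^sub>R (z - \<zeta>)" by (simp add: \<zeta>[symmetric] algebra_simps)
      have "u x0 + p0 \<bullet> (c + \<rho> *\<^sub>R z - x0) - u (c + \<rho> *\<^sub>R z) \<le> K * norm (c + \<rho> *\<^sub>R z - x0) powr \<beta>"
        using t0 z unfolding touches_below_def \<beta>_def by blast
      also have "K * norm (c + \<rho> *\<^sub>R z - x0) powr \<beta> = a * norm (z - \<zeta>) powr \<beta>"
        using \<rho> by (simp add: d a_def powr_mult)
      finally have "(u x0 + p0 \<bullet> (\<rho> *\<^sub>R (z - \<zeta>)) - u (c + \<rho> *\<^sub>R z)) / a \<le> norm (z - \<zeta>) powr \<beta>"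
        using a by (simp add: d divide_le_eq mult.commute)
      thus ?thesis using a by (simp add: wu \<zeta> q0_def diff_divide_distrib add_divide_distrib algebra_simps)
    qed
    have "\<exists>Z. compact Z \<and> Z \<subseteq> ball 0 1 \<and> \<mu> \<le> measure lebesgue Z \<and>
       (\<forall>x\<in>Z. w x \<le> w \<zeta> + M \<and> (\<exists>p. norm p \<le> M \<and> touches_below \<gamma> M (cball 0 6) w x p))"
    proof (rule main)
      show "visc_super lam Lam \<gamma> L (ball 0 6) w g"
        unfolding visc_super_def
      proof (intro ballI allI impI, elim conjE)
        fix z p e s1 s2
        assume z: "z \<in> ball 0 6" and e: "norm (e :: real ^ 'n) = 1" "0 < s2" "s2 < s1"
          and ev: "\<forall>\<^sub>F y in nhds z. w z + quad z p e s1 s2 y \<le> w y"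
        have zb: "c + \<rho> *\<^sub>R z \<in> ball 0 1" using Tin[of z] z sub by auto
        have "norm_pow (0 + (a / \<rho>) *\<^sub>R p) \<gamma> * (a / \<rho>\<^sup>2 * (2 * (lam * (s1 - s2) - Lam * (real CARD('n) - 1) * s2))) \<le> f (c + \<rho> *\<^sub>R z)"
          by (rule visc_super_scaled_test[OF v \<rho> a w_def zb e ev])
        also have "norm_pow (0 + (a / \<rho>) *\<^sub>R p) \<gamma> = pw \<gamma> (a / \<rho>) * norm_pow p \<gamma>"
          by (rule npa)
        also have "pw \<gamma> (a / \<rho>) * norm_pow p \<gamma> * (a / \<rho>\<^sup>2 * (2 * (lam * (s1 - s2) - Lam * (real CARD('n) - 1) * s2)))
           = T * (norm_pow p \<gamma> * (2 * (lam * (s1 - s2) - Lam * (real CARD('n) - 1) * s2)))"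
          by (simp flip: aT)
        finally have "norm_pow p \<gamma> * (2 * (lam * (s1 - s2) - Lam * (real CARD('n) - 1) * s2)) \<le> f (c + \<rho> *\<^sub>R z) / T"
          using T by (simp add: le_divide_eq mult.commute)
        also have "\<dots> \<le> g z" using T by (simp add: g_def divide_right_mono)
        finally show "norm_pow p \<gamma> * (2 * (lam * (s1 - s2) - Lam * (real CARD('n) - 1) * s2)) \<le> g z" .
      qed
      show "continuous_on (cball 0 6) w"
        unfolding wu[abs_def] using Tin sub a
        by (intro continuous_intros continuous_on_compose2[OF cu]) force+
      show "continuous_on (cball 0 6) g"
        unfolding g_def[abs_def] using Tin sub T
        by (intro continuous_intros continuous_on_compose2[OF cf]) force+
      show "0 \<le> g z" for z using T by (simp add: g_def)
      show "\<zeta> \<in> cball 0 4" using \<zeta>n by simp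
      show "w \<zeta> - (10 * N + 100) \<le> w z" if z: "z \<in> cball 0 6" for z
      proof -
        have zb: "c + \<rho> *\<^sub>R z \<in> cball 0 1" using Tin[OF z] sub by auto
        have d: "norm (z - \<zeta>) \<le> 10" using z \<zeta>n norm_triangle_ineq4[of z \<zeta>] by simp
        have "\<bar>q0 \<bullet> (z - \<zeta>)\<bar> \<le> norm q0 * norm (z - \<zeta>)" by (rule Cauchy_Schwarz_ineq2)
        also have "\<dots> \<le> N * 10" using q0 d N by (intro mult_mono) auto
        finally have 1: "\<bar>q0 \<bullet> (z - \<zeta>)\<bar> \<le> N * 10" .
        have "norm (z - \<zeta>) powr \<beta> \<le> 10 powr \<beta>" using d \<beta> by (intro powr_mono2) auto
        also have "\<dots> \<le> 10\<^sup>2" using \<beta> by (intro powr_ge_one_bounds) auto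
        finally show ?thesis using wlow[OF zb] 1 by simp
      qed
      have cfa: "continuous_on (cball c (\<rho> * 6)) (\<lambda>z. \<bar>f z\<bar> ^ CARD('n))"
        using sub by (intro continuous_intros continuous_on_subset[OF cf]) (simp add: mult.commute)
      have "(LINT z:cball 0 6|lebesgue. g z ^ CARD('n)) = (LINT z:cball 0 6|lebesgue. \<bar>f (c + \<rho> *\<^sub>R z)\<bar> ^ CARD('n)) / T ^ CARD('n)"
        by (simp add: g_def power_divide)
      also have "\<dots> = (LINT z:cball c (\<rho> * 6)|lebesgue. \<bar>f z\<bar> ^ CARD('n)) / (\<rho> * T) ^ CARD('n)"
        using set_integral_affine[OF \<rho> cfa] \<rho> by (simp add: power_mult_distrib)
      also have "\<dots> \<le> \<eta>" using fn T \<rho> by (simp add: divide_le_eq T_def mult.commute)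
      finally show "(LINT z:cball 0 6|lebesgue. g z ^ CARD('n)) \<le> \<eta>" .
    qed
    then obtain Z where Z: "compact Z" "Z \<subseteq> ball 0 1" "\<mu> \<le> measure lebesgue Z"
      "\<And>x. x \<in> Z \<Longrightarrow> w x \<le> w \<zeta> + M" "\<And>x. x \<in> Z \<Longrightarrow> \<exists>p. norm p \<le> M \<and> touches_below \<gamma> M (cball 0 6) w x p" by blast
    define Z' where "Z' = (\<lambda>z. \<rho> *\<^sub>R z + c) ` Z"
    show "\<exists>Z. compact Z \<and> Z \<subseteq> ball c \<rho> \<and> \<mu> * \<rho> ^ CARD('n) \<le> measure lebesgue Z \<and> Z \<subseteq> touch_set \<gamma> (M' * K) u"
    proof (intro exI[of _ Z'] conjI)
      show "compact Z'" unfolding Z'_def by (intro compact_continuous_image continuous_intros Z)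
      show Z'c: "Z' \<subseteq> ball c \<rho>" using Z(2) \<rho> by (auto simp: Z'_def dist_norm)
      have "measure lebesgue Z' = \<rho> ^ CARD('n) * measure lebesgue Z"
        using measure_lebesgue_affine[of \<rho> c Z] \<rho> by (simp add: Z'_def)
      thus "\<mu> * \<rho> ^ CARD('n) \<le> measure lebesgue Z'" using Z(3) \<rho> by (simp add: mult.commute mult_right_mono)
      show "Z' \<subseteq> touch_set \<gamma> (M' * K) u"
      proof
        fix x assume xZ: "x \<in> Z'"
        then obtain z where z: "z \<in> Z" "x = c + \<rho> *\<^sub>R z" by (auto simp: Z'_def)
        obtain p where p: "norm p \<le> M" "touches_below \<gamma> M (cball 0 6) w z p" using Z(5)[OF z(1)] by blast
        have nz: "norm z < 1" using Z(2) z by auto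
        have "ball c \<rho> \<subseteq> cball c (6 * \<rho>)" using \<rho> by auto
        hence xb: "x \<in> ball 0 1" using Z'c xZ sub by blast
        have "touches_below \<gamma> (M' * K) (cball 0 1) u x ((a / \<rho>) *\<^sub>R p)"
          unfolding touches_below_def \<beta>_def[symmetric]
        proof (intro ballI)
          fix y :: "real ^ 'n" assume y: "y \<in> cball 0 1"
          define \<xi> where "\<xi> = (1 / \<rho>) *\<^sub>R (y - c)"
          have y\<xi>: "y = c + \<rho> *\<^sub>R \<xi>" using \<rho> by (simp add: \<xi>_def)
          define d where "d = norm (\<xi> - z)"
          define \<delta> where "\<delta> = w z + p \<bullet> (\<xi> - z) - w \<xi>"
          have yx: "y - x = \<rho> *\<^sub>R (\<xi> - z)" by (simp add: y\<xi> z algebra_simps)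
          have nyx: "norm (y - x) = \<rho> * d" using \<rho> by (simp add: yx d_def)
          have E: "u x + ((a / \<rho>) *\<^sub>R p) \<bullet> (y - x) - u y = a * \<delta>"
            using a \<rho> unfolding \<delta>_def wu z(2)[symmetric] y\<xi>[symmetric] yx
            by (simp add: inner_scaleR_left inner_scaleR_right algebra_simps)
          \<comment> \<open>Outside \<open>cball 0 6\<close> the distance \<open>d\<close> from the
            contact point is at least 5, so distances from the contact point and from the rescaled
            \<open>x0\<close> are comparable. The lower bound starts from the value at the rescaled
            \<open>x0\<close>, and \<open>w x <= w zeta + M\<close> on \<open>Z\<close> links it to
            the value at the contact point.\<close>
          have B: "\<delta> \<le> M' * d powr \<beta> \<and> norm_pow p \<gamma> * \<delta> \<le> M' powr (1 + \<gamma>) * d\<^sup>2"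
          proof (cases "\<xi> \<in> cball 0 6")
            case True
            have "touches_below \<gamma> M' (cball 0 6) w z p" using c1 M' \<gamma> by (intro touches_below_mono[OF p(2)]) auto
            thus ?thesis using True unfolding touches_below_def \<beta>_def d_def \<delta>_def by blast
          next
            case False
            have d5: "5 \<le> d" using False nz norm_triangle_ineq2[of \<xi> z] by (simp add: d_def)
            have d1: "1 \<le> d" using d5 by simp
            note pd = powr_ge_one_bounds[OF d1 \<beta>(1,2)]
            have dz: "norm (\<xi> - \<zeta>) \<le> 2 * d"
            proof -
              have "norm (\<xi> - \<zeta>) \<le> norm (\<xi> - z) + norm (z - \<zeta>)" using norm_triangle_ineq[of "\<xi> - z" "z - \<zeta>"] by simp
              moreover have "norm (z - \<zeta>) \<le> 5" using norm_triangle_ineq4[of z \<zeta>] nz \<zeta>n by linarith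
              ultimately show ?thesis using d5 by (simp add: d_def)
            qed
            have 1: "p \<bullet> (\<xi> - z) \<le> M * d"
              using norm_cauchy_schwarz[of p "\<xi> - z"] mult_right_mono[OF p(1), of d] by (simp add: d_def)
            have "- (q0 \<bullet> (\<xi> - \<zeta>)) \<le> norm q0 * norm (\<xi> - \<zeta>)" using Cauchy_Schwarz_ineq2[of q0 "\<xi> - \<zeta>"] by linarith
            also have "\<dots> \<le> N * (2 * d)" using q0 dz N by (intro mult_mono) auto
            finally have 2: "- (q0 \<bullet> (\<xi> - \<zeta>)) \<le> N * (2 * d)" .
            have "norm (\<xi> - \<zeta>) powr \<beta> \<le> (2 * d) powr \<beta>" using dz \<beta> by (intro powr_mono2) auto
            also have "\<dots> = 2 powr \<beta> * d powr \<beta>" using d1 by (simp add: powr_mult)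
            also have "\<dots> \<le> 4 * d powr \<beta>" using powr_ge_one_bounds(3)[of 2 \<beta>] \<beta> by (intro mult_right_mono) auto
            finally have 3: "norm (\<xi> - \<zeta>) powr \<beta> \<le> 4 * d powr \<beta>" .
            have 4: "w \<zeta> + q0 \<bullet> (\<xi> - \<zeta>) - norm (\<xi> - \<zeta>) powr \<beta> \<le> w \<xi>" using y by (intro wlow) (simp flip: y\<xi>)
            have "M * d \<le> M * d powr \<beta>" "N * (2 * d) \<le> N * (2 * d powr \<beta>)" "M * 1 \<le> M * d powr \<beta>"
              using pd c1 N by (intro mult_left_mono; simp)+
            hence \<delta>1: "\<delta> \<le> M' * d powr \<beta>"
              using 1 2 3 4 Z(4)[OF z(1)] by (simp add: \<delta>_def M'_def algebra_simps)
            have "norm_pow p \<gamma> * \<delta> \<le> norm_pow p \<gamma> * (M' * d powr \<beta>)"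
              using \<delta>1 by (intro mult_left_mono) (simp_all add: norm_pow_eq)
            also have "\<dots> \<le> pw \<gamma> M' * (M' * d\<^sup>2)"
              unfolding norm_pow_eq using pd M' p(1) \<gamma> by (intro mult_mono mult_left_mono pw_mono) auto
            also have "\<dots> = M' powr (1 + \<gamma>) * d\<^sup>2" using M' \<gamma> by (simp flip: pw_times_self)
            finally show ?thesis using \<delta>1 by simp
          qed
          have "a * \<delta> \<le> a * (M' * d powr \<beta>)" using B a by (intro mult_left_mono) auto
          also have "\<dots> = M' * K * (\<rho> * d) powr \<beta>" using \<rho> by (simp add: a_def powr_mult d_def)
          finally have B1: "a * \<delta> \<le> M' * K * norm (y - x) powr \<beta>" by (simp add: nyx)
          have "norm_pow ((a / \<rho>) *\<^sub>R p) \<gamma> * (a * \<delta>) = (pw \<gamma> (a / \<rho>) * (a / \<rho>\<^sup>2)) * \<rho>\<^sup>2 * (norm_pow p \<gamma> * \<delta>)"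
            using \<rho> npa[of p] by simp
          also have "\<dots> \<le> T * \<rho>\<^sup>2 * (M' powr (1 + \<gamma>) * d\<^sup>2)"
            unfolding aT using B T by (intro mult_left_mono) auto
          also have "\<dots> = (M' * K) powr (1 + \<gamma>) * (norm (y - x))\<^sup>2"
            using M' K by (simp add: T_def powr_mult nyx power_mult_distrib)
          finally show "u x + ((a / \<rho>) *\<^sub>R p) \<bullet> (y - x) - u y \<le> M' * K * norm (y - x) powr \<beta> \<and>
            norm_pow ((a / \<rho>) *\<^sub>R p) \<gamma> * (u x + ((a / \<rho>) *\<^sub>R p) \<bullet> (y - x) - u y) \<le> (M' * K) powr (1 + \<gamma>) * (norm (y - x))\<^sup>2"
            using B1 unfolding E by simp
        qed
        thus "x \<in> touch_set \<gamma> (M' * K) u" using xb by (auto simp: touch_set_def)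
      qed
    qed
  qed
qed

text \<open>If the slope \<open>p0\<close> is large, the affine function with slope \<open>p0\<close> is subtracted first: the
  gradient factor is then comparable with a constant, and the remaining equation is uniformly
  elliptic, that is, the case \<open>\<gamma> = 0\<close> of the contact estimate applies.\<close>

lemma doubling_large_slope:
  fixes lam Lam \<gamma> :: real
  assumes n: "CARD('n::finite) \<ge> 2" and lam: "0 < lam" "lam \<le> Lam" and \<gamma>: "0 \<le> \<gamma>"
  obtains N M \<mu> \<eta> where "0 \<le> N" "1 \<le> M" "0 < \<mu>" "0 < \<eta>"
    "\<And>u f K c \<rho> (x0 :: real ^ 'n) p0. \<lbrakk>continuous_on (cball 0 1) u; continuous_on (ball 0 1) f;
       \<And>L. visc_super lam Lam \<gamma> L (ball 0 1) u f; 0 < K; 0 < \<rho>; cball c (6 * \<rho>) \<subseteq> ball 0 1; x0 \<in> ball 0 1;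
       norm (x0 - c) \<le> 4 * \<rho>; touches_below \<gamma> K (cball 0 1) u x0 p0; N * (K * \<rho> powr (1 / (1 + \<gamma>))) < norm p0;
       (LINT z:cball c (6 * \<rho>)|lebesgue. \<bar>f z\<bar> ^ CARD('n)) \<le> \<eta> * (\<rho> * K powr (1 + \<gamma>)) ^ CARD('n)\<rbrakk>
     \<Longrightarrow> \<exists>Z. compact Z \<and> Z \<subseteq> ball c \<rho> \<and> \<mu> * \<rho> ^ CARD('n) \<le> measure lebesgue Z \<and> Z \<subseteq> touch_set \<gamma> (M * K) u"
proof -
  define \<beta> where "\<beta> = 1 + 1 / (1 + \<gamma>)"
  have \<beta>: "1 \<le> \<beta>" "\<beta> \<le> 2" "\<beta> - 1 = 1 / (1 + \<gamma>)" using exponent_facts[OF \<gamma>] by (auto simp: \<beta>_def)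
  have z0: "(0::real) \<le> 0" and N100: "(0::real) \<le> 100" by auto
  obtain L M \<mu> \<eta> where c1: "0 < L" "1 \<le> M" "0 < \<mu>" "0 < \<eta>" and main:
    "\<And>v g (x0 :: real ^ 'n). \<lbrakk>visc_super lam Lam 0 L (ball 0 6) v g; continuous_on (cball 0 6) v;
       continuous_on (cball 0 6) g; \<And>x. x \<in> cball 0 6 \<Longrightarrow> 0 \<le> g x; x0 \<in> cball 0 4;
       \<And>z. z \<in> cball 0 6 \<Longrightarrow> v x0 - 100 \<le> v z; (LINT z:cball 0 6|lebesgue. g z ^ CARD('n)) \<le> \<eta>\<rbrakk>
     \<Longrightarrow> \<exists>Z. compact Z \<and> Z \<subseteq> ball 0 1 \<and> \<mu> \<le> measure lebesgue Z \<and>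
       (\<forall>x\<in>Z. v x \<le> v x0 + M \<and> (\<exists>p. norm p \<le> M \<and> touches_below 0 M (cball 0 6) v x p))"
    apply (rule contact_measure[OF n lam z0 N100])
    subgoal premises prems by (rule prems(1)[OF prems(2-5)]) (rule prems(6); assumption)
    done
  \<comment> \<open>Rescaled slopes of norm at most \<open>L\<close> or \<open>M\<close> will then
    correspond to at most half of \<open>norm p0\<close>, so that the full slope stays between
    \<open>P / 2\<close> and \<open>3 / 2 * P\<close>.\<close>
  define N where "N = 1 + 2 * L + 2 * M"
  have N: "1 \<le> N" "2 * L \<le> N" "2 * M \<le> N" using c1 by (auto simp: N_def)
  define M1 where "M1 = 2 * M + 4"
  define M' where "M' = 2 * M1 + M + 37"
  have M': "1 \<le> M1" "M \<le> M1" "2 * M1 \<le> M'" "1 \<le> M'" "M1 \<le> M'" "M + 37 \<le> M'" using c1 by (auto simp: M'_def M1_def)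
  define \<eta>' where "\<eta>' = \<eta> / (pw \<gamma> 2) ^ CARD('n)"
  have g2: "0 < pw \<gamma> 2" by simp
  show thesis
  proof (rule that[of N M' \<mu> \<eta>'])
    show "0 \<le> N" "1 \<le> M'" "0 < \<mu>" "0 < \<eta>'" using N M' c1 g2 by (auto simp: \<eta>'_def)
    fix u f and K \<rho> :: real and c x0 p0 :: "real ^ 'n"
    assume cu: "continuous_on (cball 0 1) u" and cf: "continuous_on (ball 0 1) f"
      and v: "\<And>L. visc_super lam Lam \<gamma> L (ball 0 1) u f" and K: "0 < K" and \<rho>: "0 < \<rho>"
      and sub: "cball c (6 * \<rho>) \<subseteq> ball 0 1" and x0b: "x0 \<in> ball 0 1" and x0: "norm (x0 - c) \<le> 4 * \<rho>"
      and t0: "touches_below \<gamma> K (cball 0 1) u x0 p0" and p0: "N * (K * \<rho> powr (1 / (1 + \<gamma>))) < norm p0"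
      and fn: "(LINT z:cball c (6 * \<rho>)|lebesgue. \<bar>f z\<bar> ^ CARD('n)) \<le> \<eta>' * (\<rho> * K powr (1 + \<gamma>)) ^ CARD('n)"
    define T where "T = K powr (1 + \<gamma>)"
    have T: "0 < T" using K by (simp add: T_def)
    define P where "P = norm p0"
    have NKr: "N * (K * \<rho> powr (\<beta> - 1)) < P" using p0 by (simp add: P_def \<beta>(3))
    have Kr0: "0 < K * \<rho> powr (\<beta> - 1)" using K \<rho> by simp
    have P: "0 < P" using NKr Kr0 N by (smt (verit) mult_nonneg_nonneg)
    have KrP: "K * \<rho> powr (\<beta> - 1) \<le> P"
      using NKr mult_right_mono[OF N(1), of "K * \<rho> powr (\<beta> - 1)"] Kr0 by linarith
    have PN: "N * (T * \<rho>) \<le> pw \<gamma> P * P"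
    proof -
      have "N * (T * \<rho>) \<le> N powr (1 + \<gamma>) * (T * \<rho>)"
        using N(1) \<gamma> powr_mono[of 1 "1 + \<gamma>" N] T \<rho> by (intro mult_right_mono) auto
      also have "\<dots> = (N * (K * \<rho> powr (\<beta> - 1))) powr (1 + \<gamma>)"
        using N K \<rho> \<gamma> by (simp add: powr_mult powr_powr \<beta>(3) T_def)
      also have "\<dots> \<le> P powr (1 + \<gamma>)" using NKr Kr0 N \<gamma> by (intro powr_mono2) auto
      finally show ?thesis using P \<gamma> by (simp add: pw_times_self)
    qed
    have pwP: "0 < pw \<gamma> P" using P by simp
    define a where "a = T * \<rho>\<^sup>2 / pw \<gamma> P"
    have a: "0 < a" using T \<rho> pwP by (simp add: a_def)
    have aP: "pw \<gamma> P * a = T * \<rho>\<^sup>2" using pwP by (simp add: a_def)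
    have a\<rho>: "a / \<rho> * N \<le> P"
    proof -
      have "a / \<rho> * N = N * (T * \<rho>) / pw \<gamma> P" using \<rho> by (simp add: a_def power2_eq_square)
      also have "\<dots> \<le> P" using PN pwP by (simp add: divide_le_eq mult.commute)
      finally show ?thesis .
    qed
    have aLM: "a / \<rho> * L \<le> P / 2" "a / \<rho> * M \<le> P / 2"
    proof -
      have k: "k * X \<le> P / 2" if "k * N \<le> P" "2 * X \<le> N" "0 \<le> k" for k X
        using mult_left_mono[OF that(2,3)] that(1) by (simp add: algebra_simps)
      have "0 \<le> a / \<rho>" using a \<rho> by simp
      thus "a / \<rho> * L \<le> P / 2" "a / \<rho> * M \<le> P / 2" using k[OF a\<rho>] N by blast+
    qed
    define w where "w = (\<lambda>z. (u (c + \<rho> *\<^sub>R z) - p0 \<bullet> (\<rho> *\<^sub>R z)) / a)"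
    define g where "g z = pw \<gamma> 2 * (\<bar>f (c + \<rho> *\<^sub>R z)\<bar> / T)" for z
    have Tin: "c + \<rho> *\<^sub>R z \<in> cball c (6 * \<rho>)" if "z \<in> cball 0 6" for z
      using that \<rho> by (simp add: dist_norm mult.commute)
    define \<zeta> where "\<zeta> = (1 / \<rho>) *\<^sub>R (x0 - c)"
    have \<zeta>: "c + \<rho> *\<^sub>R \<zeta> = x0" using \<rho> by (simp add: \<zeta>_def)
    have \<zeta>n: "norm \<zeta> \<le> 4" using \<rho> x0 by (simp add: \<zeta>_def divide_le_eq)
    have wlow: "w \<zeta> - (norm (z - \<zeta>))\<^sup>2 \<le> w z" if z: "c + \<rho> *\<^sub>R z \<in> cball 0 1" for z
    proof -
      have d: "c + \<rho> *\<^sub>R z - x0 = \<rho> *\<^sub>R (z - \<zeta>)" by (simp add: \<zeta>[symmetric] algebra_simps)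
      define D where "D = u x0 + p0 \<bullet> (c + \<rho> *\<^sub>R z - x0) - u (c + \<rho> *\<^sub>R z)"
      have "pw \<gamma> P * D \<le> T * (norm (c + \<rho> *\<^sub>R z - x0))\<^sup>2"
        using t0 z unfolding touches_below_def D_def P_def T_def norm_pow_eq by blast
      also have "\<dots> = pw \<gamma> P * (a * (norm (z - \<zeta>))\<^sup>2)"
        unfolding mult.assoc[symmetric] aP using \<rho> by (simp add: d power_mult_distrib)
      finally have "D \<le> a * (norm (z - \<zeta>))\<^sup>2" using pwP by (simp add: mult_le_cancel_left_pos)
      hence "D / a \<le> (norm (z - \<zeta>))\<^sup>2" using a by (simp add: divide_le_eq mult.commute)
      moreover have "D / a = w \<zeta> - w z"
        using a by (simp add: D_def d w_def \<zeta> diff_divide_distrib add_divide_distrib algebra_simps)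
      ultimately show ?thesis by linarith
    qed
    have "\<exists>Z. compact Z \<and> Z \<subseteq> ball 0 1 \<and> \<mu> \<le> measure lebesgue Z \<and>
       (\<forall>x\<in>Z. w x \<le> w \<zeta> + M \<and> (\<exists>p. norm p \<le> M \<and> touches_below 0 M (cball 0 6) w x p))"
    proof (rule main)
      show g0: "0 \<le> g z" for z using T by (simp add: g_def)
      \<comment> \<open>Here the slope bound \<open>L\<close> is used: the gradient factor of the
        original equation is at least \<open>pw gamma P / pw gamma 2\<close> for such tests, and
        \<open>g\<close> contains the factor \<open>pw gamma 2\<close> in return.\<close>
      show "visc_super lam Lam 0 L (ball 0 6) w g"
        unfolding visc_super_def
      proof (intro ballI allI impI, elim conjE)
        fix z p e s1 s2
        assume z: "z \<in> ball 0 6" and pL: "norm p \<le> L" and e: "norm (e :: real ^ 'n) = 1" "0 < s2" "s2 < s1"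
          and ev: "\<forall>\<^sub>F y in nhds z. w z + quad z p e s1 s2 y \<le> w y"
        define X where "X = 2 * (lam * (s1 - s2) - Lam * (real CARD('n) - 1) * s2)"
        have zb: "c + \<rho> *\<^sub>R z \<in> ball 0 1" using Tin[of z] z sub by auto
        have *: "norm_pow (p0 + (a / \<rho>) *\<^sub>R p) \<gamma> * (a / \<rho>\<^sup>2 * X) \<le> f (c + \<rho> *\<^sub>R z)"
          unfolding X_def by (rule visc_super_scaled_test[OF v \<rho> a w_def zb e ev])
        have "X \<le> g z"
        proof (cases "X \<le> 0")
          case True thus ?thesis using g0[of z] by linarith
        next
          case False
          have "norm ((a / \<rho>) *\<^sub>R p) \<le> a / \<rho> * L" using pL a \<rho> by (simp add: mult_left_mono divide_right_mono)
          hence "P \<le> 2 * norm (p0 + (a / \<rho>) *\<^sub>R p)"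
            using aLM norm_diff_ineq[of p0 "(a / \<rho>) *\<^sub>R p"] unfolding P_def by linarith
          hence "pw \<gamma> P \<le> pw \<gamma> (2 * norm (p0 + (a / \<rho>) *\<^sub>R p))" using P \<gamma> by (intro pw_mono) auto
          hence "pw \<gamma> P \<le> pw \<gamma> 2 * norm_pow (p0 + (a / \<rho>) *\<^sub>R p) \<gamma>" by (simp add: pw_mult norm_pow_eq)
          hence "pw \<gamma> P * (a / \<rho>\<^sup>2 * X) \<le> pw \<gamma> 2 * norm_pow (p0 + (a / \<rho>) *\<^sub>R p) \<gamma> * (a / \<rho>\<^sup>2 * X)"
            using False a \<rho> by (intro mult_right_mono) auto
          also have "\<dots> \<le> pw \<gamma> 2 * f (c + \<rho> *\<^sub>R z)" using mult_left_mono[OF *, of "pw \<gamma> 2"] by (simp add: mult.assoc)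
          also have "pw \<gamma> P * (a / \<rho>\<^sup>2 * X) = T * X" using aP \<rho> by (simp add: field_simps)
          finally have "X \<le> pw \<gamma> 2 * f (c + \<rho> *\<^sub>R z) / T" using T by (simp add: le_divide_eq mult.commute)
          also have "\<dots> \<le> pw \<gamma> 2 * \<bar>f (c + \<rho> *\<^sub>R z)\<bar> / T" using T by (intro divide_right_mono mult_left_mono) auto
          finally show ?thesis by (simp add: g_def)
        qed
        thus "norm_pow p 0 * (2 * (lam * (s1 - s2) - Lam * (real CARD('n) - 1) * s2)) \<le> g z"
          by (simp add: X_def norm_pow_def)
      qed
      show "continuous_on (cball 0 6) w"
        unfolding w_def using Tin sub a
        by (intro continuous_intros continuous_on_compose2[OF cu]) force+
      show "continuous_on (cball 0 6) g"
        unfolding g_def[abs_def] using Tin sub T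
        by (intro continuous_intros continuous_on_compose2[OF cf]) force+
      show "\<zeta> \<in> cball 0 4" using \<zeta>n by simp
      show "w \<zeta> - 100 \<le> w z" if z: "z \<in> cball 0 6" for z
      proof -
        have zb: "c + \<rho> *\<^sub>R z \<in> cball 0 1" using Tin[OF z] sub by auto
        have d: "norm (z - \<zeta>) \<le> 10" using z \<zeta>n norm_triangle_ineq4[of z \<zeta>] by simp
        have "(norm (z - \<zeta>))\<^sup>2 \<le> 10\<^sup>2" using d by (intro power_mono) auto
        thus ?thesis using wlow[OF zb] by simp
      qed
      have cfa: "continuous_on (cball c (\<rho> * 6)) (\<lambda>z. \<bar>f z\<bar> ^ CARD('n))"
        using sub by (intro continuous_intros continuous_on_subset[OF cf]) (simp add: mult.commute)
      have "(LINT z:cball 0 6|lebesgue. g z ^ CARD('n)) = (LINT z:cball 0 6|lebesgue. \<bar>f (c + \<rho> *\<^sub>R z)\<bar> ^ CARD('n)) * (pw \<gamma> 2 / T) ^ CARD('n)"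
        unfolding g_def by (simp add: power_divide power_mult_distrib mult.commute)
      also have "\<dots> = (LINT z:cball c (\<rho> * 6)|lebesgue. \<bar>f z\<bar> ^ CARD('n)) * (pw \<gamma> 2) ^ CARD('n) / (\<rho> * T) ^ CARD('n)"
        using set_integral_affine[OF \<rho> cfa] \<rho> by (simp add: power_mult_distrib power_divide)
      also have "\<dots> \<le> \<eta>"
      proof -
        have "(LINT z:cball c (\<rho> * 6)|lebesgue. \<bar>f z\<bar> ^ CARD('n)) * (pw \<gamma> 2) ^ CARD('n)
            \<le> \<eta>' * (\<rho> * T) ^ CARD('n) * (pw \<gamma> 2) ^ CARD('n)"
          using fn by (intro mult_right_mono) (auto simp: T_def mult.commute)
        also have "\<dots> = \<eta> * (\<rho> * T) ^ CARD('n)" unfolding \<eta>'_def using g2 by (simp add: less_imp_neq[THEN not_sym])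
        finally show ?thesis using T \<rho> by (simp add: divide_le_eq)
      qed
      finally show "(LINT z:cball 0 6|lebesgue. g z ^ CARD('n)) \<le> \<eta>" .
    qed
    then obtain Z where Z: "compact Z" "Z \<subseteq> ball 0 1" "\<mu> \<le> measure lebesgue Z"
      "\<And>x. x \<in> Z \<Longrightarrow> w x \<le> w \<zeta> + M" "\<And>x. x \<in> Z \<Longrightarrow> \<exists>p. norm p \<le> M \<and> touches_below 0 M (cball 0 6) w x p" by blast
    define Z' where "Z' = (\<lambda>z. \<rho> *\<^sub>R z + c) ` Z"
    show "\<exists>Z. compact Z \<and> Z \<subseteq> ball c \<rho> \<and> \<mu> * \<rho> ^ CARD('n) \<le> measure lebesgue Z \<and> Z \<subseteq> touch_set \<gamma> (M' * K) u"
    proof (intro exI[of _ Z'] conjI)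
      show "compact Z'" unfolding Z'_def by (intro compact_continuous_image continuous_intros Z)
      show Z'c: "Z' \<subseteq> ball c \<rho>" using Z(2) \<rho> by (auto simp: Z'_def dist_norm)
      have "measure lebesgue Z' = \<rho> ^ CARD('n) * measure lebesgue Z"
        using measure_lebesgue_affine[of \<rho> c Z] \<rho> by (simp add: Z'_def)
      thus "\<mu> * \<rho> ^ CARD('n) \<le> measure lebesgue Z'" using Z(3) \<rho> by (simp add: mult.commute mult_right_mono)
      show "Z' \<subseteq> touch_set \<gamma> (M' * K) u"
      proof
        fix x assume xZ: "x \<in> Z'"
        then obtain z where z: "z \<in> Z" "x = c + \<rho> *\<^sub>R z" by (auto simp: Z'_def)
        obtain p where p: "norm p \<le> M" "touches_below 0 M (cball 0 6) w z p" using Z(5)[OF z(1)] by blast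
        have nz: "norm z < 1" using Z(2) z by auto
        have "ball c \<rho> \<subseteq> cball c (6 * \<rho>)" using \<rho> by auto
        hence xb: "x \<in> ball 0 1" using Z'c xZ sub by blast
        define q where "q = p0 + (a / \<rho>) *\<^sub>R p"
        have nap: "norm ((a / \<rho>) *\<^sub>R p) \<le> P / 2"
        proof -
          have "norm ((a / \<rho>) *\<^sub>R p) \<le> a / \<rho> * M" using p(1) a \<rho> by (simp add: mult_left_mono divide_right_mono)
          thus ?thesis using aLM by linarith
        qed
        have nq: "norm q \<le> 2 * P" using nap P norm_triangle_ineq[of p0 "(a / \<rho>) *\<^sub>R p"] unfolding q_def P_def by linarith
        have nx: "norm (x - x0) \<le> 5 * \<rho>"
        proof -
          have "x - x0 = \<rho> *\<^sub>R (z - \<zeta>)" by (simp add: z(2) \<zeta>[symmetric] algebra_simps)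
          moreover have "norm (z - \<zeta>) \<le> 5" using norm_triangle_ineq4[of z \<zeta>] nz \<zeta>n by linarith
          ultimately show ?thesis using \<rho> by simp
        qed
        have "touches_below \<gamma> (M' * K) (cball 0 1) u x q"
          unfolding touches_below_def \<beta>_def[symmetric]
        proof (intro ballI)
          fix y :: "real ^ 'n" assume y: "y \<in> cball 0 1"
          define \<xi> where "\<xi> = (1 / \<rho>) *\<^sub>R (y - c)"
          have y\<xi>: "y = c + \<rho> *\<^sub>R \<xi>" using \<rho> by (simp add: \<xi>_def)
          define d where "d = norm (\<xi> - z)"
          define \<delta> where "\<delta> = w z + p \<bullet> (\<xi> - z) - w \<xi>"
          define D where "D = u x + q \<bullet> (y - x) - u y"
          have yx: "y - x = \<rho> *\<^sub>R (\<xi> - z)" by (simp add: y\<xi> z algebra_simps)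
          have nyx: "norm (y - x) = \<rho> * d" using \<rho> by (simp add: yx d_def)
          have E: "D = a * \<delta>"
          proof -
            have "a * w z = u x - p0 \<bullet> (\<rho> *\<^sub>R z)" "a * w \<xi> = u y - p0 \<bullet> (\<rho> *\<^sub>R \<xi>)"
              using a by (simp_all add: w_def z(2) y\<xi>)
            moreover have "q \<bullet> (y - x) = p0 \<bullet> (\<rho> *\<^sub>R \<xi>) - p0 \<bullet> (\<rho> *\<^sub>R z) + a * (p \<bullet> (\<xi> - z))"
              using \<rho> by (simp add: q_def yx inner_add_left inner_diff_right algebra_simps)
            ultimately show ?thesis by (simp add: D_def \<delta>_def algebra_simps)
          qed
          have B: "\<delta> \<le> M1 * d\<^sup>2"
          proof (cases "\<xi> \<in> cball 0 6")
            case True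
            have "\<delta> \<le> M * d\<^sup>2" using p(2) True unfolding touches_below_def d_def \<delta>_def by (auto simp: powr_numeral)
            also have "\<dots> \<le> M1 * d\<^sup>2" using M' by (intro mult_right_mono) auto
            finally show ?thesis .
          next
            case False
            have d5: "5 \<le> d" using False nz norm_triangle_ineq2[of \<xi> z] by (simp add: d_def)
            have dz: "norm (\<xi> - \<zeta>) \<le> 2 * d"
            proof -
              have "norm (\<xi> - \<zeta>) \<le> norm (\<xi> - z) + norm (z - \<zeta>)" using norm_triangle_ineq[of "\<xi> - z" "z - \<zeta>"] by simp
              moreover have "norm (z - \<zeta>) \<le> 5" using norm_triangle_ineq4[of z \<zeta>] nz \<zeta>n by linarith
              ultimately show ?thesis using d5 by (simp add: d_def)
            qed
            have d2: "1 \<le> d\<^sup>2" "d \<le> d\<^sup>2" using d5 by (auto simp: power2_eq_square intro: order_trans[OF _ mult_mono[of 1 d 1 d]])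
            have 1: "p \<bullet> (\<xi> - z) \<le> M * d"
              using norm_cauchy_schwarz[of p "\<xi> - z"] mult_right_mono[OF p(1), of d] by (simp add: d_def)
            have "(norm (\<xi> - \<zeta>))\<^sup>2 \<le> (2 * d)\<^sup>2" using dz by (intro power_mono) auto
            hence 2: "(norm (\<xi> - \<zeta>))\<^sup>2 \<le> 4 * d\<^sup>2" by (simp add: power_mult_distrib)
            have 4: "w \<zeta> - (norm (\<xi> - \<zeta>))\<^sup>2 \<le> w \<xi>" using y by (intro wlow) (simp flip: y\<xi>)
            have "M * d \<le> M * d\<^sup>2" "M * 1 \<le> M * d\<^sup>2" using d2 c1 by (intro mult_left_mono; simp)+
            thus ?thesis using 1 2 4 Z(4)[OF z(1)] by (simp add: \<delta>_def M1_def algebra_simps)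
          qed
          have DT: "pw \<gamma> P * D \<le> T * (M1 * (norm (y - x))\<^sup>2)"
          proof -
            have "pw \<gamma> P * D = T * \<rho>\<^sup>2 * \<delta>" by (simp add: E aP flip: mult.assoc)
            also have "\<dots> \<le> T * \<rho>\<^sup>2 * (M1 * d\<^sup>2)" using B T by (intro mult_left_mono) auto
            finally show ?thesis by (simp add: nyx power_mult_distrib mult_ac)
          qed
          have second: "norm_pow q \<gamma> * D \<le> (M' * K) powr (1 + \<gamma>) * (norm (y - x))\<^sup>2"
          proof (cases "D \<le> 0")
            case True
            hence "norm_pow q \<gamma> * D \<le> 0" by (simp add: norm_pow_eq mult_nonneg_nonpos)
            also have "0 \<le> (M' * K) powr (1 + \<gamma>) * (norm (y - x))\<^sup>2" by simp
            finally show ?thesis .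
          next
            case False
            have "norm_pow q \<gamma> \<le> pw \<gamma> (2 * P)" unfolding norm_pow_eq using nq \<gamma> by (intro pw_mono) auto
            hence "norm_pow q \<gamma> * D \<le> pw \<gamma> 2 * (pw \<gamma> P * D)"
              using False P by (simp add: pw_mult mult_right_mono flip: mult.assoc)
            also have "\<dots> \<le> pw \<gamma> 2 * (T * (M1 * (norm (y - x))\<^sup>2))" using DT by (intro mult_left_mono) auto
            also have "\<dots> = pw \<gamma> 2 * M1 * T * (norm (y - x))\<^sup>2" by simp
            also have "\<dots> \<le> M' powr (1 + \<gamma>) * T * (norm (y - x))\<^sup>2"
            proof (intro mult_right_mono)
              have "pw \<gamma> 2 * M1 \<le> pw \<gamma> M' * M'" using M' \<gamma> by (intro mult_mono pw_mono) auto
              thus "pw \<gamma> 2 * M1 \<le> M' powr (1 + \<gamma>)" using M' \<gamma> by (simp add: pw_times_self)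
            qed (use T in auto)
            finally show ?thesis using M' K by (simp add: T_def powr_mult)
          qed
          \<comment> \<open>While \<open>K * norm (y - x) powr (beta - 1) <= P\<close>, the
            quadratic bound divided by \<open>pw gamma P\<close> already implies the power bound.
            Beyond that distance, which is at least \<open>rho\<close>, the touching at
            \<open>x0\<close> is used, after comparing value and slope at \<open>x\<close> with
            those at \<open>x0\<close>.\<close>
          have first: "D \<le> M' * K * norm (y - x) powr \<beta>"
          proof (cases "norm (y - x) powr (\<beta> - 1) * K \<le> P")
            case True
            show ?thesis
            proof (cases "y = x")
              case True thus ?thesis by (simp add: D_def)
            next
              case False
              define s where "s = norm (y - x)"
              have s: "0 < s" using False by (simp add: s_def)
              have "K powr \<gamma> * s powr ((\<beta> - 1) * \<gamma>) \<le> pw \<gamma> P"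
              proof -
                have "pw \<gamma> (s powr (\<beta> - 1) * K) \<le> pw \<gamma> P" using True K \<gamma> by (intro pw_mono) (auto simp: s_def)
                moreover have "pw \<gamma> (s powr (\<beta> - 1) * K) = K powr \<gamma> * s powr ((\<beta> - 1) * \<gamma>)"
                  using s K by (simp add: pw_def powr_mult powr_powr)
                ultimately show ?thesis by simp
              qed
              moreover have "(\<beta> - 1) * \<gamma> = 2 - \<beta>" using exponent_facts(3)[OF \<gamma>] by (simp add: \<beta>_def)
              ultimately have k: "K powr \<gamma> * s powr (2 - \<beta>) \<le> pw \<gamma> P" by simp
              have "pw \<gamma> P * D \<le> T * (M1 * s\<^sup>2)" using DT by (simp add: s_def)
              also have "\<dots> = M1 * K * s powr \<beta> * (K powr \<gamma> * s powr (2 - \<beta>))"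
                using K s by (simp add: T_def powr_add powr_diff)
              also have "\<dots> \<le> M1 * K * s powr \<beta> * pw \<gamma> P" using k M' K by (intro mult_left_mono) auto
              finally have "pw \<gamma> P * D \<le> pw \<gamma> P * (M1 * K * s powr \<beta>)" by (simp add: mult_ac)
              hence "D \<le> M1 * K * s powr \<beta>" using pwP by (simp add: mult_le_cancel_left_pos)
              also have "\<dots> \<le> M' * K * s powr \<beta>" using M' K by (intro mult_right_mono) auto
              finally show ?thesis by (simp add: s_def)
            qed
          next
            case False
            define s where "s = norm (y - x)"
            have sP: "P < s powr (\<beta> - 1) * K" using False by (simp add: s_def)
            have \<rho>s: "\<rho> \<le> s"
            proof (rule ccontr)
              assume "\<not> \<rho> \<le> s"
              hence "s powr (\<beta> - 1) \<le> \<rho> powr (\<beta> - 1)" using \<beta>(1) by (intro powr_mono2) (auto simp: s_def)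
              hence "s powr (\<beta> - 1) * K \<le> K * \<rho> powr (\<beta> - 1)" using K by simp
              thus False using sP KrP by linarith
            qed
            have s: "0 < s" using \<rho> \<rho>s by linarith
            have "u x0 + p0 \<bullet> (y - x0) - u y \<le> K * norm (y - x0) powr \<beta>"
              using t0 y unfolding touches_below_def \<beta>_def by blast
            also have "\<dots> \<le> K * (6 * s) powr \<beta>"
            proof (intro mult_left_mono powr_mono2)
              have "norm (y - x0) \<le> norm (y - x) + norm (x - x0)" using norm_triangle_ineq[of "y - x" "x - x0"] by simp
              thus "norm (y - x0) \<le> 6 * s" using nx \<rho>s by (simp add: s_def)
            qed (use \<beta> K in auto)
            also have "\<dots> = 6 powr \<beta> * (K * s powr \<beta>)" using s by (simp add: powr_mult)
            also have "\<dots> \<le> 36 * (K * s powr \<beta>)" using powr_ge_one_bounds(3)[of 6 \<beta>] \<beta> K by (intro mult_right_mono) auto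
            finally have 1: "u x0 + p0 \<bullet> (y - x0) - u y \<le> 36 * (K * s powr \<beta>)" .
            have 2: "u x \<le> u x0 + p0 \<bullet> (x - x0) + a * M"
            proof -
              have "a * w z \<le> a * (w \<zeta> + M)" using Z(4)[OF z(1)] a by (intro mult_left_mono) auto
              moreover have "a * w z = u x - p0 \<bullet> (\<rho> *\<^sub>R z)" "a * w \<zeta> = u x0 - p0 \<bullet> (\<rho> *\<^sub>R \<zeta>)"
                using a by (simp_all add: w_def z(2) \<zeta>)
              moreover have "p0 \<bullet> (x - x0) = p0 \<bullet> (\<rho> *\<^sub>R z) - p0 \<bullet> (\<rho> *\<^sub>R \<zeta>)"
                by (simp add: z(2) \<zeta>[symmetric] inner_diff_right inner_add_right)
              ultimately show ?thesis by (simp add: distrib_left)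
            qed
            have 3: "a * M \<le> M * (K * s powr \<beta>)"
            proof -
              have "pw \<gamma> (K * \<rho> powr (\<beta> - 1)) \<le> pw \<gamma> P" using KrP Kr0 \<gamma> by (intro pw_mono) auto
              moreover have "pw \<gamma> (K * \<rho> powr (\<beta> - 1)) * (K * \<rho> powr \<beta>) = T * \<rho>\<^sup>2"
              proof -
                have ex: "(\<beta> - 1) * \<gamma> + \<beta> = 2" using exponent_facts(3)[OF \<gamma>] by (simp add: \<beta>_def)
                have "pw \<gamma> (K * \<rho> powr (\<beta> - 1)) * (K * \<rho> powr \<beta>) = (K powr \<gamma> * K) * (\<rho> powr ((\<beta> - 1) * \<gamma>) * \<rho> powr \<beta>)"
                  using K \<rho> by (simp add: pw_def powr_mult powr_powr)
                also have "\<rho> powr ((\<beta> - 1) * \<gamma>) * \<rho> powr \<beta> = \<rho> powr 2" by (simp only: powr_add[symmetric] ex)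
                finally show ?thesis using K \<rho> by (simp add: T_def powr_add)
              qed
              ultimately have "T * \<rho>\<^sup>2 \<le> pw \<gamma> P * (K * \<rho> powr \<beta>)"
                using mult_right_mono[of "pw \<gamma> (K * \<rho> powr (\<beta> - 1))" "pw \<gamma> P" "K * \<rho> powr \<beta>"] K by simp
              hence "pw \<gamma> P * a \<le> pw \<gamma> P * (K * \<rho> powr \<beta>)" by (simp add: aP)
              hence "a \<le> K * \<rho> powr \<beta>" using pwP by (simp add: mult_le_cancel_left_pos)
              also have "\<dots> \<le> K * s powr \<beta>" using K \<rho> \<rho>s \<beta> by (intro mult_left_mono powr_mono2) auto
              finally show ?thesis using c1 by (simp add: mult.commute mult_right_mono)
            qed
            have 4: "(q - p0) \<bullet> (y - x) \<le> K * s powr \<beta>"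
            proof -
              have "(q - p0) \<bullet> (y - x) \<le> norm (q - p0) * norm (y - x)" by (rule norm_cauchy_schwarz)
              also have "\<dots> \<le> (s powr (\<beta> - 1) * K) * s"
              proof (intro mult_mono)
                have "norm (q - p0) \<le> P / 2" using nap unfolding q_def add_diff_cancel_left' .
                thus "norm (q - p0) \<le> s powr (\<beta> - 1) * K" using P sP by linarith
              qed (use K in \<open>auto simp: s_def\<close>)
              also have "\<dots> = K * s powr \<beta>" using s by (simp add: powr_diff)
              finally show ?thesis .
            qed
            have "D = (u x - u x0 - p0 \<bullet> (x - x0)) + (u x0 + p0 \<bullet> (y - x0) - u y) + (q - p0) \<bullet> (y - x)"
              by (simp add: D_def inner_diff_left inner_diff_right)
            also have "\<dots> \<le> M * (K * s powr \<beta>) + 36 * (K * s powr \<beta>) + K * s powr \<beta>" using 1 2 3 4 by linarith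
            also have "\<dots> = (M + 37) * (K * s powr \<beta>)" by (simp add: algebra_simps)
            also have "\<dots> \<le> M' * (K * s powr \<beta>)" using M' K by (intro mult_right_mono) auto
            finally show ?thesis by (simp add: s_def mult.assoc)
          qed
          show "u x + q \<bullet> (y - x) - u y \<le> M' * K * norm (y - x) powr \<beta> \<and>
            norm_pow q \<gamma> * (u x + q \<bullet> (y - x) - u y) \<le> (M' * K) powr (1 + \<gamma>) * (norm (y - x))\<^sup>2"
            using first second by (simp add: D_def)
        qed
        thus "x \<in> touch_set \<gamma> (M' * K) u" using xb by (auto simp: touch_set_def)
      qed
    qed
  qed
qed

lemma touch_set_mono: "\<lbrakk>0 \<le> \<gamma>; 0 \<le> K; K \<le> K'\<rbrakk> \<Longrightarrow> touch_set \<gamma> K u \<subseteq> touch_set \<gamma> K' u"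
  unfolding touch_set_def using touches_below_mono[OF _ _ _ order_refl] by blast

text \<open>The order of the constants matters: the case of large slopes determines the threshold
  \<open>N\<close>, and the case of small slopes accepts any threshold.\<close>

lemma doubling:
  fixes lam Lam \<gamma> :: real
  assumes n: "CARD('n::finite) \<ge> 2" and lam: "0 < lam" "lam \<le> Lam" and \<gamma>: "0 \<le> \<gamma>"
  obtains M \<mu> \<eta> where "1 \<le> M" "0 < \<mu>" "0 < \<eta>"
    "\<And>u f K c \<rho> (x0 :: real ^ 'n). \<lbrakk>continuous_on (cball 0 1) u; continuous_on (ball 0 1) f;
       \<And>L. visc_super lam Lam \<gamma> L (ball 0 1) u f; 0 < K; 0 < \<rho>; cball c (6 * \<rho>) \<subseteq> ball 0 1;
       x0 \<in> touch_set \<gamma> K u; norm (x0 - c) \<le> 4 * \<rho>;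
       (LINT z:cball c (6 * \<rho>)|lebesgue. \<bar>f z\<bar> ^ CARD('n)) \<le> \<eta> * (\<rho> * K powr (1 + \<gamma>)) ^ CARD('n)\<rbrakk>
     \<Longrightarrow> \<exists>Z. compact Z \<and> Z \<subseteq> ball c \<rho> \<and> \<mu> * \<rho> ^ CARD('n) \<le> measure lebesgue Z \<and> Z \<subseteq> touch_set \<gamma> (M * K) u"
proof -
  obtain N M2 \<mu>2 \<eta>2 where c2: "0 \<le> N" "1 \<le> M2" "0 < \<mu>2" "0 < \<eta>2" and large:
    "\<And>u f K c \<rho> (x0 :: real ^ 'n) p0. \<lbrakk>continuous_on (cball 0 1) u; continuous_on (ball 0 1) f;
       \<And>L. visc_super lam Lam \<gamma> L (ball 0 1) u f; 0 < K; 0 < \<rho>; cball c (6 * \<rho>) \<subseteq> ball 0 1; x0 \<in> ball 0 1;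
       norm (x0 - c) \<le> 4 * \<rho>; touches_below \<gamma> K (cball 0 1) u x0 p0; N * (K * \<rho> powr (1 / (1 + \<gamma>))) < norm p0;
       (LINT z:cball c (6 * \<rho>)|lebesgue. \<bar>f z\<bar> ^ CARD('n)) \<le> \<eta>2 * (\<rho> * K powr (1 + \<gamma>)) ^ CARD('n)\<rbrakk>
     \<Longrightarrow> \<exists>Z. compact Z \<and> Z \<subseteq> ball c \<rho> \<and> \<mu>2 * \<rho> ^ CARD('n) \<le> measure lebesgue Z \<and> Z \<subseteq> touch_set \<gamma> (M2 * K) u"
    apply (rule doubling_large_slope[OF n lam \<gamma>])
    subgoal premises prems by (rule prems(1)[OF prems(2-5)]) (rule prems(6); assumption)
    done
  obtain M1 \<mu>1 \<eta>1 where c1: "1 \<le> M1" "0 < \<mu>1" "0 < \<eta>1" and small: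
    "\<And>u f K c \<rho> (x0 :: real ^ 'n) p0. \<lbrakk>continuous_on (cball 0 1) u; continuous_on (ball 0 1) f;
       \<And>L. visc_super lam Lam \<gamma> L (ball 0 1) u f; 0 < K; 0 < \<rho>; cball c (6 * \<rho>) \<subseteq> ball 0 1; x0 \<in> ball 0 1;
       norm (x0 - c) \<le> 4 * \<rho>; touches_below \<gamma> K (cball 0 1) u x0 p0; norm p0 \<le> N * (K * \<rho> powr (1 / (1 + \<gamma>)));
       (LINT z:cball c (6 * \<rho>)|lebesgue. \<bar>f z\<bar> ^ CARD('n)) \<le> \<eta>1 * (\<rho> * K powr (1 + \<gamma>)) ^ CARD('n)\<rbrakk>
     \<Longrightarrow> \<exists>Z. compact Z \<and> Z \<subseteq> ball c \<rho> \<and> \<mu>1 * \<rho> ^ CARD('n) \<le> measure lebesgue Z \<and> Z \<subseteq> touch_set \<gamma> (M1 * K) u"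
    apply (rule doubling_small_slope[OF n lam \<gamma> c2(1)])
    subgoal premises prems by (rule prems(1)[OF prems(2-4)]) (rule prems(5); assumption)
    done
  define \<mu> \<eta> M where "\<mu> = min \<mu>1 \<mu>2" and "\<eta> = min \<eta>1 \<eta>2" and "M = max M1 M2"
  show thesis
  proof (rule that[of M \<mu> \<eta>])
    show "1 \<le> M" "0 < \<mu>" "0 < \<eta>" using c1 c2 by (auto simp: \<mu>_def \<eta>_def M_def)
    fix u f and K \<rho> :: real and c x0 :: "real ^ 'n"
    assume cu: "continuous_on (cball 0 1) u" and cf: "continuous_on (ball 0 1) f"
      and v: "\<And>L. visc_super lam Lam \<gamma> L (ball 0 1) u f" and K: "0 < K" and \<rho>: "0 < \<rho>"
      and sub: "cball c (6 * \<rho>) \<subseteq> ball 0 1" and x0t: "x0 \<in> touch_set \<gamma> K u" and x0: "norm (x0 - c) \<le> 4 * \<rho>"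
      and fn: "(LINT z:cball c (6 * \<rho>)|lebesgue. \<bar>f z\<bar> ^ CARD('n)) \<le> \<eta> * (\<rho> * K powr (1 + \<gamma>)) ^ CARD('n)"
    obtain p0 where x0b: "x0 \<in> ball 0 1" and t0: "touches_below \<gamma> K (cball 0 1) u x0 p0"
      using x0t by (auto simp: touch_set_def)
    have nn: "0 \<le> (\<rho> * K powr (1 + \<gamma>)) ^ CARD('n)" using \<rho> by simp
    have fin: "\<exists>Z. compact Z \<and> Z \<subseteq> ball c \<rho> \<and> \<mu> * \<rho> ^ CARD('n) \<le> measure lebesgue Z \<and> Z \<subseteq> touch_set \<gamma> (M * K) u"
      if ex: "\<exists>Z. compact Z \<and> Z \<subseteq> ball c \<rho> \<and> \<mu>' * \<rho> ^ CARD('n) \<le> measure lebesgue Z \<and> Z \<subseteq> touch_set \<gamma> (M' * K) u"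
        and le: "\<mu> \<le> \<mu>'" "M' \<le> M" "1 \<le> M'" for \<mu>' M'
    proof -
      obtain Z where Z: "compact Z" "Z \<subseteq> ball c \<rho>" "\<mu>' * \<rho> ^ CARD('n) \<le> measure lebesgue Z" "Z \<subseteq> touch_set \<gamma> (M' * K) u"
        using ex by blast
      have "\<mu> * \<rho> ^ CARD('n) \<le> \<mu>' * \<rho> ^ CARD('n)" using le \<rho> by (intro mult_right_mono) auto
      moreover have "touch_set \<gamma> (M' * K) u \<subseteq> touch_set \<gamma> (M * K) u"
        using le K by (intro touch_set_mono \<gamma>) (auto intro: mult_right_mono)
      ultimately show ?thesis using Z by (intro exI[of _ Z]) auto
    qed
    show "\<exists>Z. compact Z \<and> Z \<subseteq> ball c \<rho> \<and> \<mu> * \<rho> ^ CARD('n) \<le> measure lebesgue Z \<and> Z \<subseteq> touch_set \<gamma> (M * K) u"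
    proof (cases "norm p0 \<le> N * (K * \<rho> powr (1 / (1 + \<gamma>)))")
      case True
      have "\<eta> * (\<rho> * K powr (1 + \<gamma>)) ^ CARD('n) \<le> \<eta>1 * (\<rho> * K powr (1 + \<gamma>)) ^ CARD('n)"
        using nn by (intro mult_right_mono) (auto simp: \<eta>_def)
      hence "(LINT z:cball c (6 * \<rho>)|lebesgue. \<bar>f z\<bar> ^ CARD('n)) \<le> \<eta>1 * (\<rho> * K powr (1 + \<gamma>)) ^ CARD('n)" using fn by linarith
      from small[OF cu cf v K \<rho> sub x0b x0 t0 True this] show ?thesis
        by (rule fin) (use c1 in \<open>auto simp: \<mu>_def M_def\<close>)
    next
      case False
      hence p0: "N * (K * \<rho> powr (1 / (1 + \<gamma>))) < norm p0" by simp
      have "\<eta> * (\<rho> * K powr (1 + \<gamma>)) ^ CARD('n) \<le> \<eta>2 * (\<rho> * K powr (1 + \<gamma>)) ^ CARD('n)"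
        using nn by (intro mult_right_mono) (auto simp: \<eta>_def)
      hence "(LINT z:cball c (6 * \<rho>)|lebesgue. \<bar>f z\<bar> ^ CARD('n)) \<le> \<eta>2 * (\<rho> * K powr (1 + \<gamma>)) ^ CARD('n)" using fn by linarith
      from large[OF cu cf v K \<rho> sub x0b x0 t0 p0 this] show ?thesis
        by (rule fin) (use c2 in \<open>auto simp: \<mu>_def M_def\<close>)
    qed
  qed
qed

section \<open>Decay of the set without touching\<close>

text \<open>The touching is tested at the point at distance \<open>1 - s\<close> from
  \<open>x\<close> in the direction of \<open>p\<close>, which still lies in the closed unit
  ball.\<close>

lemma touch_slope_bound:
  fixes u :: "real ^ 'n::finite \<Rightarrow> real"
  assumes t: "touches_below \<gamma> K (cball 0 1) u x p" and x: "norm x \<le> s" "s \<le> 1" and K: "0 \<le> K" and \<gamma>: "0 \<le> \<gamma>"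
    and U: "\<And>z. z \<in> cball 0 1 \<Longrightarrow> \<bar>u z\<bar> \<le> U"
  shows "(1 - s) * norm p \<le> 2 * U + K"
proof (cases "p = 0")
  case True
  thus ?thesis using U[of 0] K by simp
next
  case False
  define z where "z = x + ((1 - s) / norm p) *\<^sub>R p"
  have nz: "norm (z - x) = 1 - s" using x False by (simp add: z_def)
  have "norm z \<le> norm x + norm (z - x)" using norm_triangle_ineq[of x "z - x"] by simp
  hence z: "z \<in> cball 0 1" using nz x by simp
  have "p \<bullet> (z - x) = (1 - s) * norm p"
    using False by (simp add: z_def power2_norm_eq_inner[symmetric] power2_eq_square)
  moreover have "u x + p \<bullet> (z - x) - u z \<le> K * (1 - s) powr (1 + 1 / (1 + \<gamma>))"
    using t z unfolding touches_below_def nz[symmetric] by blast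
  moreover have "K * (1 - s) powr (1 + 1 / (1 + \<gamma>)) \<le> K * 1"
  proof (intro mult_left_mono K)
    have "0 \<le> 1 - s" "1 - s \<le> 1" using x norm_ge_zero[of x] by linarith+
    thus "(1 - s) powr (1 + 1 / (1 + \<gamma>)) \<le> 1"
      using exponent_facts(1)[OF \<gamma>] powr_mono2[of "1 + 1 / (1 + \<gamma>)" "1 - s" 1] by simp
  qed
  moreover have "\<bar>u z\<bar> \<le> U" "\<bar>u x\<bar> \<le> U" using U z x by auto
  ultimately show ?thesis by linarith
qed

lemma continuous_on_norm_pow:
  assumes "0 \<le> \<gamma>"
  shows "continuous_on S (\<lambda>p. norm_pow p \<gamma>)"
proof (cases "\<gamma> = 0")
  case False
  thus ?thesis using assms unfolding norm_pow_def
    by (auto intro!: continuous_intros continuous_on_powr')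
qed (simp add: norm_pow_def)

text \<open>The set is the projection of a set of pairs of points and slopes. That set is closed by
  continuity of \<open>u\<close>, and the slopes are bounded because the points keep a positive
  distance from the unit sphere.\<close>

lemma compact_touch_set:
  fixes u :: "real ^ 'n::finite \<Rightarrow> real"
  assumes u: "continuous_on (cball 0 1) u" and \<gamma>: "0 \<le> \<gamma>" and K: "0 \<le> K" and s: "s < 1"
  shows "compact (touch_set \<gamma> K u \<inter> cball 0 s)"
proof -
  have "bounded (u ` cball 0 1)" using compact_continuous_image[OF u compact_cball] by (rule compact_imp_bounded)
  then obtain U where "\<And>y. y \<in> u ` cball 0 1 \<Longrightarrow> norm y \<le> U" unfolding bounded_iff by blast
  hence U: "\<bar>u z\<bar> \<le> U" if "z \<in> cball 0 1" for z using that by force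
  define B where "B = (2 * U + K) / (1 - s)"
  define \<beta> where "\<beta> = 1 + 1 / (1 + \<gamma>)"
  have \<beta>: "0 < \<beta>" using \<gamma> unfolding \<beta>_def by (intro add_pos_nonneg) auto
  define P where "P z = {q \<in> cball 0 s \<times> cball 0 B.
       u (fst q) + snd q \<bullet> (z - fst q) - u z \<le> K * norm (z - fst q) powr \<beta>} \<inter> {q \<in> cball 0 s \<times> cball 0 B.
       norm_pow (snd q) \<gamma> * (u (fst q) + snd q \<bullet> (z - fst q) - u z) \<le> K powr (1 + \<gamma>) * (norm (z - fst q))\<^sup>2}" for z
  define c where "c = (cball 0 s \<times> cball 0 B) \<inter> (\<Inter>z\<in>cball 0 1. P z)"
  have sub: "cball (0 :: real ^ 'n) s \<subseteq> cball 0 1" using s by auto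
  have cu: "continuous_on (cball 0 s \<times> cball 0 B) (\<lambda>q. u (fst q))"
    using sub by (intro continuous_on_compose2[OF u] continuous_intros) auto
  have "compact c"
    unfolding c_def P_def
  proof (intro compact_Int_closed compact_Times compact_cball closed_INT ballI closed_Int)
    fix z :: "real ^ 'n"
    show "closed {q \<in> cball 0 s \<times> cball 0 B. u (fst q) + snd q \<bullet> (z - fst q) - u z \<le> K * norm (z - fst q) powr \<beta>}"
      by (rule continuous_on_closed_Collect_le)
        (use \<beta> in \<open>auto intro!: continuous_intros cu closed_Times continuous_on_powr'\<close>)
    show "closed {q \<in> cball 0 s \<times> cball 0 B.
       norm_pow (snd q) \<gamma> * (u (fst q) + snd q \<bullet> (z - fst q) - u z) \<le> K powr (1 + \<gamma>) * (norm (z - fst q))\<^sup>2}"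
      by (rule continuous_on_closed_Collect_le)
        (auto intro!: continuous_intros cu closed_Times continuous_on_compose2[OF continuous_on_norm_pow[OF \<gamma>, of UNIV]])
  qed
  hence "compact (fst ` c)" by (intro compact_continuous_image continuous_on_fst continuous_on_id)
  also have "fst ` c = touch_set \<gamma> K u \<inter> cball 0 s"
  proof
    show "fst ` c \<subseteq> touch_set \<gamma> K u \<inter> cball 0 s"
    proof
      fix x assume "x \<in> fst ` c"
      then obtain p where xp: "(x, p) \<in> c" by force
      hence "touches_below \<gamma> K (cball 0 1) u x p"
        unfolding touches_below_def \<beta>_def[symmetric] by (auto simp: c_def P_def)
      moreover have "norm x \<le> s" using xp by (simp add: c_def)
      ultimately show "x \<in> touch_set \<gamma> K u \<inter> cball 0 s" using s by (auto simp: touch_set_def)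
    qed
    show "touch_set \<gamma> K u \<inter> cball 0 s \<subseteq> fst ` c"
    proof
      fix x assume x: "x \<in> touch_set \<gamma> K u \<inter> cball 0 s"
      then obtain p where t: "touches_below \<gamma> K (cball 0 1) u x p" and nx: "norm x \<le> s" by (auto simp: touch_set_def)
      have "(1 - s) * norm p \<le> 2 * U + K" by (rule touch_slope_bound[OF t nx _ K \<gamma> U]) (use s in auto)
      hence "norm p \<le> B" using s by (simp add: B_def le_divide_eq mult.commute)
      hence "(x, p) \<in> c" using t nx unfolding touches_below_def \<beta>_def[symmetric] by (auto simp: c_def P_def)
      thus "x \<in> fst ` c" by force
    qed
  qed
  finally show ?thesis .
qed

text \<open>A minimiser of \<open>u + A * norm (z - x) powr beta\<close> with
  \<open>A = K / 6\<close> is a touching point by \<open>touches_below_power\<close>, and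
  \<open>2 * U <= A * d^2\<close> keeps it within distance \<open>d\<close> of \<open>x\<close>.
  This supplies the first touching points for the decay argument.\<close>

lemma touch_set_near:
  fixes u :: "real ^ 'n::finite \<Rightarrow> real"
  assumes u: "continuous_on (cball 0 1) u" and \<gamma>: "0 \<le> \<gamma>" and K: "0 < K" and x: "norm x \<le> 1 / 2"
    and U: "\<And>z. z \<in> cball 0 1 \<Longrightarrow> \<bar>u z\<bar> \<le> U" and d: "0 < d" "d \<le> 1 / 4" "12 * U \<le> K * d\<^sup>2"
  shows "\<exists>x0 \<in> touch_set \<gamma> K u. dist x x0 \<le> d"
proof -
  define \<beta> where "\<beta> = 1 + 1 / (1 + \<gamma>)"
  have \<beta>: "1 \<le> \<beta>" "\<beta> \<le> 2" using exponent_facts[OF \<gamma>] by (auto simp: \<beta>_def)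
  define A where "A = K / 6"
  have A: "0 < A" using K by (simp add: A_def)
  have "continuous_on (cball 0 1) (\<lambda>z. u z + A * norm (z - x) powr \<beta>)"
    using \<beta> by (intro continuous_intros u continuous_on_powr') auto
  moreover have "cball (0 :: real ^ 'n) 1 \<noteq> {}" by simp
  ultimately obtain x0 where x0: "x0 \<in> cball 0 1"
      "\<And>z. z \<in> cball 0 1 \<Longrightarrow> u x0 + A * norm (x0 - x) powr \<beta> \<le> u z + A * norm (z - x) powr \<beta>"
    using continuous_attains_inf[OF compact_cball, of 0 1 "\<lambda>z. u z + A * norm (z - x) powr \<beta>"] by blast
  have "A * norm (x0 - x) powr \<beta> \<le> 2 * U"
    using x0(2)[of x] x U[of x] U[OF x0(1)] \<beta> by (simp add: abs_le_iff)
  also have "\<dots> \<le> A * d\<^sup>2" using d by (simp add: A_def)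
  also have "\<dots> \<le> A * d powr \<beta>"
  proof (intro mult_left_mono)
    have "d\<^sup>2 = d powr 2" using d by simp
    also have "\<dots> \<le> d powr \<beta>" using d \<beta> by (intro powr_mono') auto
    finally show "d\<^sup>2 \<le> d powr \<beta>" .
  qed (use A in simp)
  finally have le: "norm (x0 - x) powr \<beta> \<le> d powr \<beta>" using A by simp
  have nd: "norm (x0 - x) \<le> d"
  proof (rule ccontr)
    assume "\<not> ?thesis"
    hence "d powr \<beta> < norm (x0 - x) powr \<beta>" using d \<beta> by (intro powr_less_mono2) auto
    thus False using le by simp
  qed
  have c: "u x0 + A * norm (x0 - x) powr \<beta> - A * norm (z - x) powr \<beta> \<le> u z" if "z \<in> cball 0 1" for z
    using x0(2)[OF that] by linarith
  have "touches_below \<gamma> (6 * A) (cball 0 1) u x0 ((- (A * \<beta> * norm (x0 - x) powr (\<beta> - 2))) *\<^sub>R (x0 - x))"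
    by (rule touches_below_power(1)[OF \<gamma> A \<beta>_def c refl])
  moreover have "6 * A = K" by (simp add: A_def)
  moreover have "norm x0 < 1" using norm_triangle_ineq[of "x0 - x" x] nd d x by simp
  ultimately have "x0 \<in> touch_set \<gamma> K u" by (auto simp: touch_set_def)
  thus ?thesis using nd by (auto simp: dist_norm norm_minus_commute)
qed

section \<open>Vitali covering and geometric decay\<close>

definition bad_set :: "real \<Rightarrow> real \<Rightarrow> (real ^ 'n::finite \<Rightarrow> real) \<Rightarrow> (real ^ 'n) set" where
  "bad_set \<gamma> K u = ball 0 (1 / 2) - touch_set \<gamma> K u"

lemma open_bad_set:
  assumes "continuous_on (cball 0 1) u" "0 \<le> \<gamma>" "0 \<le> K"
  shows "open (bad_set \<gamma> K u)"
proof -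
  have "bad_set \<gamma> K u = ball 0 (1/2) - (touch_set \<gamma> K u \<inter> cball 0 (1/2))" by (auto simp: bad_set_def)
  thus ?thesis using compact_touch_set[OF assms, of "1/2"] by (simp add: open_Diff compact_imp_closed)
qed

lemma lmeasurable_bad_set:
  assumes "continuous_on (cball 0 1) u" "0 \<le> \<gamma>" "0 \<le> K"
  shows "bad_set \<gamma> K u \<in> lmeasurable"
  using open_bad_set[OF assms] by (intro lmeasurable_open bounded_subset[OF bounded_ball[of 0 "1/2"]]) (auto simp: bad_set_def)

lemma bad_set_antimono: "\<lbrakk>0 \<le> \<gamma>; 0 \<le> K; K \<le> K'\<rbrakk> \<Longrightarrow> bad_set \<gamma> K' u \<subseteq> bad_set \<gamma> K u"
  using touch_set_mono[of \<gamma> K K' u] by (auto simp: bad_set_def)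

text \<open>Around every point of the bad set there is a ball, of size comparable with the distance
  to the touching set, a fixed fraction of which leaves the bad set when \<open>K\<close> is replaced by
  \<open>M * K\<close>, unless the mean of \<open>|f|\<^sup>n\<close> on that ball is large.\<close>

lemma bad_set_step:
  fixes lam Lam \<gamma> :: real
  assumes n: "CARD('n::finite) \<ge> 2" and lam: "0 < lam" "lam \<le> Lam" and \<gamma>: "0 \<le> \<gamma>"
  obtains M \<theta> B where "2 \<le> M" "0 < \<theta>" "\<theta> < 1" "0 < B"
    "\<And>u (f :: real ^ 'n \<Rightarrow> real) U K. \<lbrakk>continuous_on (cball 0 1) u; continuous_on (ball 0 1) f;
       \<And>L. visc_super lam Lam \<gamma> L (ball 0 1) u f; 0 < K; \<And>z. z \<in> cball 0 1 \<Longrightarrow> \<bar>u z\<bar> \<le> U; 12 * 24\<^sup>2 * U \<le> K;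
       set_integrable lebesgue (ball 0 1) (\<lambda>z. \<bar>f z\<bar> ^ CARD('n))\<rbrakk>
     \<Longrightarrow> measure lebesgue (bad_set \<gamma> (M * K) u) \<le> \<theta> * measure lebesgue (bad_set \<gamma> K u)
         + B * ((LINT z:ball 0 1|lebesgue. \<bar>f z\<bar> ^ CARD('n)) / (K powr (1 + \<gamma>)) ^ CARD('n))"
proof -
  obtain M0 \<mu> \<eta> where c1: "1 \<le> M0" "0 < \<mu>" "0 < \<eta>" and dbl:
    "\<And>u f K c \<rho> (x0 :: real ^ 'n). \<lbrakk>continuous_on (cball 0 1) u; continuous_on (ball 0 1) f;
       \<And>L. visc_super lam Lam \<gamma> L (ball 0 1) u f; 0 < K; 0 < \<rho>; cball c (6 * \<rho>) \<subseteq> ball 0 1;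
       x0 \<in> touch_set \<gamma> K u; norm (x0 - c) \<le> 4 * \<rho>;
       (LINT z:cball c (6 * \<rho>)|lebesgue. \<bar>f z\<bar> ^ CARD('n)) \<le> \<eta> * (\<rho> * K powr (1 + \<gamma>)) ^ CARD('n)\<rbrakk>
     \<Longrightarrow> \<exists>Z. compact Z \<and> Z \<subseteq> ball c \<rho> \<and> \<mu> * \<rho> ^ CARD('n) \<le> measure lebesgue Z \<and> Z \<subseteq> touch_set \<gamma> (M0 * K) u"
    apply (rule doubling[OF n lam \<gamma>])
    subgoal premises prems by (rule prems(1)[OF prems(2-4)]) (rule prems(5); assumption)
    done
  \<comment> \<open>\<open>M >= 2\<close> makes the contribution of \<open>f\<close> decay
    geometrically when the step is iterated.\<close>
  define M where "M = max 2 M0"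
  define \<omega> where "\<omega> = measure lebesgue (ball (0 :: real ^ 'n) 1)"
  have \<omega>: "0 < \<omega>" by (simp add: \<omega>_def content_ball_pos)
  define C1 where "C1 = 30 ^ CARD('n) * \<omega>"
  have C1: "0 < C1" using \<omega> by (simp add: C1_def)
  define \<theta> where "\<theta> = max (1/2) (1 - \<mu> / C1)"
  show thesis
  proof (rule that[of M \<theta> "\<mu> / \<eta>"])
    show "2 \<le> M" "0 < \<theta>" "\<theta> < 1" "0 < \<mu> / \<eta>" using c1 C1 by (auto simp: M_def \<theta>_def)
    fix u f :: "real ^ 'n \<Rightarrow> real" and U K
    assume cu: "continuous_on (cball 0 1) u" and cf: "continuous_on (ball 0 1) f"
      and v: "\<And>L. visc_super lam Lam \<gamma> L (ball 0 1) u f" and K: "0 < K"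
      and U: "\<And>z. z \<in> cball 0 1 \<Longrightarrow> \<bar>u z\<bar> \<le> U" and UK: "12 * 24\<^sup>2 * U \<le> K"
      and fi: "set_integrable lebesgue (ball 0 1) (\<lambda>z. \<bar>f z\<bar> ^ CARD('n))"
    have K0: "0 \<le> K" and MK0: "0 \<le> M * K" using K by (auto simp: M_def)
    define D D' where "D = bad_set \<gamma> K u" and "D' = bad_set \<gamma> (M * K) u"
    have Dm: "D \<in> lmeasurable" "D' \<in> lmeasurable"
      unfolding D_def D'_def by (intro lmeasurable_bad_set cu \<gamma> K0 MK0)+
    have KMK: "K \<le> M * K" using K mult_right_mono[of 1 M K] by (simp add: M_def)
    have D'D: "D' \<subseteq> D" unfolding D_def D'_def by (rule bad_set_antimono[OF \<gamma> K0 KMK])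
    define T where "T = K powr (1 + \<gamma>)"
    have T: "0 < T" using K by (simp add: T_def)
    define Tc where "Tc = touch_set \<gamma> K u \<inter> cball 0 (3/4)"
    have Tc: "compact Tc" unfolding Tc_def by (intro compact_touch_set cu \<gamma> K0) simp
    define \<rho> where "\<rho> x = infdist x Tc" for x
    have near: "Tc \<noteq> {} \<and> \<rho> x \<le> 1 / 24" if x: "x \<in> ball 0 (1/2)" for x
    proof -
      obtain x0 where x0: "x0 \<in> touch_set \<gamma> K u" "dist x x0 \<le> 1 / 24"
        using touch_set_near[OF cu \<gamma> K _ U, of x "1/24"] x UK by (auto simp: power2_eq_square)
      have "norm x0 \<le> norm x + dist x x0" using norm_triangle_ineq[of x "x0 - x"] by (simp add: dist_norm norm_minus_commute)
      hence "x0 \<in> Tc" using x0 x by (simp add: Tc_def)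
      thus ?thesis using infdist_le[of x0 Tc x] x0(2) by (auto simp: \<rho>_def)
    qed
    have \<rho>0: "0 < \<rho> x" if x: "x \<in> D" for x
    proof -
      have "x \<in> ball 0 (1/2)" "x \<notin> Tc" using x by (auto simp: D_def bad_set_def Tc_def)
      thus ?thesis using near[of x] Tc in_closed_iff_infdist_zero[of Tc x] infdist_nonneg[of x Tc]
        by (auto simp: \<rho>_def compact_imp_closed less_le)
    qed
    \<comment> \<open>The centre is moved from \<open>x\<close> towards the origin by less than half
      the distance \<open>rho x\<close> to the touching set. Thus the ball of radius
      \<open>r x = rho x / 2\<close> lies in \<open>ball 0 (1/2)\<close> and also in the ball of
      radius \<open>rho x\<close> about \<open>x\<close>, which contains no point of
      \<open>Tc\<close>.\<close>
    define cc where "cc x = (1 - \<rho> x) *\<^sub>R x" for x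
    define r where "r x = \<rho> x / 2" for x
    have r: "0 < r x" "r x \<le> 1 / 48" if "x \<in> D" for x
      using \<rho>0[OF that] near[of x] that by (auto simp: r_def D_def bad_set_def)
    have ncc: "norm (x - cc x) \<le> r x" if x: "x \<in> D" for x
    proof -
      have "x - cc x = \<rho> x *\<^sub>R x" by (simp add: cc_def algebra_simps)
      hence "norm (x - cc x) = \<rho> x * norm x" using \<rho>0[OF x] by simp
      also have "\<dots> \<le> \<rho> x * (1/2)" using \<rho>0[OF x] x by (intro mult_left_mono) (auto simp: D_def bad_set_def)
      finally show ?thesis by (simp add: r_def)
    qed
    have nx: "norm x < 1/2" if "x \<in> D" for x using that by (simp add: D_def bad_set_def)
    have sub1: "cball (cc x) (6 * r x) \<subseteq> ball 0 1" if x: "x \<in> D" for x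
    proof
      fix z assume z: "z \<in> cball (cc x) (6 * r x)"
      have "norm z \<le> norm x + norm (x - cc x) + norm (cc x - z)"
        using norm_triangle_ineq4[of x "x - z"] norm_triangle_ineq[of "x - cc x" "cc x - z"] by simp
      thus "z \<in> ball 0 1" using z nx[OF x] ncc[OF x] r[OF x] by (simp add: dist_norm)
    qed
    have subD: "ball (cc x) (r x) \<subseteq> D" if x: "x \<in> D" for x
    proof
      fix z assume z: "z \<in> ball (cc x) (r x)"
      have nz: "norm z < 1/2"
      proof -
        have "norm z \<le> norm (cc x) + norm (z - cc x)" using norm_triangle_ineq[of "cc x" "z - cc x"] by simp
        moreover have "norm (cc x) = (1 - \<rho> x) * norm x" using r[OF x] by (simp add: cc_def r_def)
        moreover have "(1 - \<rho> x) * norm x \<le> (1 - \<rho> x) * (1/2)" using r[OF x] nx[OF x] by (intro mult_left_mono) (auto simp: r_def)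
        moreover have "norm (z - cc x) < \<rho> x / 2" using z by (simp add: dist_norm norm_minus_commute r_def)
        ultimately show ?thesis by (simp add: algebra_simps)
      qed
      have "dist x z < \<rho> x"
        using norm_triangle_ineq[of "x - cc x" "cc x - z"] ncc[OF x] z by (simp add: dist_norm r_def)
      hence "z \<notin> Tc" using infdist_le[of z Tc x] by (auto simp: \<rho>_def)
      thus "z \<in> D" using nz by (auto simp: D_def bad_set_def Tc_def)
    qed
    \<comment> \<open>On each ball \<open>cball (cc x) (6 * r x)\<close> this function has integral
      at least \<open>r x ^ n\<close>: either the bad set loses a fixed fraction of the ball, or the
      integral of \<open>|f| ^ n\<close> over it is large. Summing over disjoint balls then bounds
      the measure of \<open>D\<close> by one global integral.\<close>
    let ?h = "\<lambda>z. 1 / \<mu> * indicator (D - D') z + 1 / (\<eta> * T ^ CARD('n)) * (indicator (ball 0 1) z *\<^sub>R \<bar>f z\<bar> ^ CARD('n)) :: real"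
    have DD': "D - D' \<in> lmeasurable" using Dm by (intro fmeasurable.Diff)
    have hi: "integrable lebesgue ?h"
      using DD' fi unfolding lmeasurable_iff_integrable set_integrable_def
      by (intro Bochner_Integration.integrable_add integrable_mult_right)
    have h0: "0 \<le> ?h z" for z using c1 T by simp
    have hint: "(LINT z|lebesgue. ?h z) = 1 / \<mu> * (measure lebesgue D - measure lebesgue D')
        + 1 / (\<eta> * T ^ CARD('n)) * (LINT z:ball 0 1|lebesgue. \<bar>f z\<bar> ^ CARD('n))"
    proof -
      have "(LINT z|lebesgue. ?h z) = (LINT z|lebesgue. 1 / \<mu> * indicator (D - D') z)
         + (LINT z|lebesgue. 1 / (\<eta> * T ^ CARD('n)) * (indicator (ball 0 1) z *\<^sub>R \<bar>f z\<bar> ^ CARD('n)))"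
        using DD' fi unfolding lmeasurable_iff_integrable set_integrable_def
        by (intro Bochner_Integration.integral_add integrable_mult_right)
      moreover have "measure lebesgue (D - D') = measure lebesgue D - measure lebesgue D'"
        using Dm D'D by (intro measurable_measure_Diff) (auto simp: fmeasurableD)
      ultimately show ?thesis using DD' by (simp add: set_lebesgue_integral_def lmeasurable_iff_integrable)
    qed
    have key: "r x ^ CARD('n) \<le> (LINT z|lebesgue. indicator (cball (cc x) (6 * r x)) z * ?h z)" if x: "x \<in> D" for x
    proof -
      let ?B = "cball (cc x) (6 * r x)"
      have ih: "integrable lebesgue (\<lambda>z. indicator ?B z * ?h z)"
        using integrable_mult_indicator[OF _ hi, of ?B] by simp
      show ?thesis
      proof (cases "(LINT z:?B|lebesgue. \<bar>f z\<bar> ^ CARD('n)) \<le> \<eta> * (r x * T) ^ CARD('n)")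
        case True
        have "closed Tc" "Tc \<noteq> {}" using Tc near[of x] nx[OF x] by (auto simp: compact_imp_closed)
        then obtain x0 where x0: "x0 \<in> Tc" "infdist x Tc = dist x x0" using infdist_attains_inf by blast
        have "norm (x0 - cc x) \<le> 4 * r x"
          using norm_triangle_ineq[of "x0 - x" "x - cc x"] ncc[OF x] x0(2)
          by (simp add: r_def \<rho>_def dist_norm norm_minus_commute) (use norm_ge_zero[of "x0 - x"] in linarith)
        moreover have "x0 \<in> touch_set \<gamma> K u" using x0 by (simp add: Tc_def)
        ultimately obtain Z where Z: "compact Z" "Z \<subseteq> ball (cc x) (r x)" "\<mu> * r x ^ CARD('n) \<le> measure lebesgue Z"
            "Z \<subseteq> touch_set \<gamma> (M0 * K) u"
          using dbl[OF cu cf v K r(1)[OF x] sub1[OF x], of x0] True by (auto simp: T_def)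
        have "touch_set \<gamma> (M0 * K) u \<subseteq> touch_set \<gamma> (M * K) u"
          using K c1 by (intro touch_set_mono \<gamma>) (auto simp: M_def)
        hence ZD: "Z \<subseteq> D - D'" using Z(2,4) subD[OF x] by (auto simp: D'_def bad_set_def)
        have ZB: "Z \<subseteq> ?B"
        proof -
          have "ball (cc x) (r x) \<subseteq> ?B" using r[OF x] by auto
          thus ?thesis using Z(2) by blast
        qed
        have "r x ^ CARD('n) \<le> 1 / \<mu> * measure lebesgue Z" using Z(3) c1 by (simp add: le_divide_eq mult.commute)
        also have "\<dots> = (LINT z|lebesgue. 1 / \<mu> * indicator Z z)"
          using lmeasurable_compact[OF Z(1)] by (simp add: lmeasurable_iff_integrable)
        also have "\<dots> \<le> (LINT z|lebesgue. indicator ?B z * ?h z)"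
        proof (rule integral_mono[OF _ ih])
          show "integrable lebesgue (\<lambda>z. 1 / \<mu> * indicator Z z :: real)"
            using lmeasurable_compact[OF Z(1)] unfolding lmeasurable_iff_integrable by (rule integrable_mult_right)
          fix z
          show "1 / \<mu> * indicator Z z \<le> indicator ?B z * ?h z"
          proof (cases "z \<in> Z")
            case True
            thus ?thesis using ZD ZB c1 T by (auto simp: indicator_def)
          next
            case False
            thus ?thesis using mult_nonneg_nonneg[OF _ h0[of z], of "indicator ?B z"] by simp
          qed
        qed
        finally show ?thesis .
      next
        case False
        have si: "set_integrable lebesgue ?B (\<lambda>z. \<bar>f z\<bar> ^ CARD('n))"
          using set_integrable_subset[OF fi _ sub1[OF x]] by simp
        have "r x ^ CARD('n) = 1 / (\<eta> * T ^ CARD('n)) * (\<eta> * (r x * T) ^ CARD('n))"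
          using c1 T by (simp add: power_mult_distrib)
        also have "\<dots> \<le> 1 / (\<eta> * T ^ CARD('n)) * (LINT z:?B|lebesgue. \<bar>f z\<bar> ^ CARD('n))"
          using False c1 T by (intro mult_left_mono) auto
        also have "\<dots> = (LINT z|lebesgue. 1 / (\<eta> * T ^ CARD('n)) * (indicator ?B z *\<^sub>R \<bar>f z\<bar> ^ CARD('n)))"
          by (simp add: set_lebesgue_integral_def)
        also have "\<dots> \<le> (LINT z|lebesgue. indicator ?B z * ?h z)"
        proof (rule integral_mono[OF _ ih])
          show "integrable lebesgue (\<lambda>z. 1 / (\<eta> * T ^ CARD('n)) * (indicator ?B z *\<^sub>R \<bar>f z\<bar> ^ CARD('n)))"
            using si unfolding set_integrable_def by (rule integrable_mult_right)
          fix z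
          show "1 / (\<eta> * T ^ CARD('n)) * (indicator ?B z *\<^sub>R \<bar>f z\<bar> ^ CARD('n)) \<le> indicator ?B z * ?h z"
          proof (cases "z \<in> ?B")
            case True
            hence "z \<in> ball 0 1" using sub1[OF x] by blast
            thus ?thesis using True c1 by (simp add: indicator_def)
          qed simp
        qed
        finally show ?thesis .
      qed
    qed
    have covD: "D \<subseteq> (\<Union>x\<in>D. cball (cc x) (6 * r x))"
    proof
      fix x assume x: "x \<in> D"
      have "x \<in> cball (cc x) (6 * r x)" using ncc[OF x] r[OF x] by (simp add: dist_norm norm_minus_commute)
      thus "x \<in> (\<Union>x\<in>D. cball (cc x) (6 * r x))" using x by blast
    qed
    have rr: "0 < 6 * r x \<and> 6 * r x \<le> 1" if "x \<in> D" for x using r[OF that] by simp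
    obtain C where C: "countable C" "C \<subseteq> D"
      "pairwise (\<lambda>i j. disjnt (cball (cc i) (6 * r i)) (cball (cc j) (6 * r j))) C"
      "D \<subseteq> (\<Union>i\<in>C. cball (cc i) (5 * (6 * r i)))"
      by (rule Vitali_covering_lemma_cballs[OF covD, of 1]) (use rr in auto)
    have bnd: "measure lebesgue (\<Union>i\<in>I. cball (cc i) (5 * (6 * r i))) \<le> C1 * (LINT z|lebesgue. ?h z)"
      if I: "I \<subseteq> C" "finite I" for I
    proof -
      have "measure lebesgue (\<Union>i\<in>I. cball (cc i) (5 * (6 * r i))) \<le> (\<Sum>i\<in>I. measure lebesgue (cball (cc i) (5 * (6 * r i))))"
        by (rule measure_UNION_le[OF I(2)]) auto
      also have "\<dots> = (\<Sum>i\<in>I. C1 * r i ^ CARD('n))"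
      proof (rule sum.cong[OF refl])
        fix i assume "i \<in> I"
        hence "0 \<le> 30 * r i" using r I C by (meson less_imp_le mult_nonneg_nonneg subsetD zero_le_numeral)
        thus "measure lebesgue (cball (cc i) (5 * (6 * r i))) = C1 * r i ^ CARD('n)"
          using content_ball_conv_unit_ball[of "30 * r i" "cc i"]
          by (simp add: content_cball_conv_ball C1_def \<omega>_def power_mult_distrib)
      qed
      also have "\<dots> = C1 * (\<Sum>i\<in>I. r i ^ CARD('n))" by (simp add: sum_distrib_left)
      also have "(\<Sum>i\<in>I. r i ^ CARD('n)) \<le> (\<Sum>i\<in>I. (LINT z|lebesgue. indicator (cball (cc i) (6 * r i)) z * ?h z))"
        using I C by (intro sum_mono key) blast
      also have "\<dots> = (LINT z|lebesgue. (\<Sum>i\<in>I. indicator (cball (cc i) (6 * r i)) z * ?h z))"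
      proof (rule Bochner_Integration.integral_sum[symmetric])
        fix i show "integrable lebesgue (\<lambda>z. indicator (cball (cc i) (6 * r i)) z * ?h z)"
          using integrable_mult_indicator[OF _ hi, of "cball (cc i) (6 * r i)"] by simp
      qed
      also have "\<dots> \<le> (LINT z|lebesgue. ?h z)"
      proof (rule integral_mono[OF _ hi])
        show "integrable lebesgue (\<lambda>z. \<Sum>i\<in>I. indicator (cball (cc i) (6 * r i)) z * ?h z)"
        proof (rule Bochner_Integration.integrable_sum)
          fix i show "integrable lebesgue (\<lambda>z. indicator (cball (cc i) (6 * r i)) z * ?h z)"
            using integrable_mult_indicator[OF _ hi, of "cball (cc i) (6 * r i)"] by simp
        qed
        fix z
        have "(\<Sum>i\<in>I. indicator (cball (cc i) (6 * r i)) z) \<le> (1::real)"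
        proof (cases "\<exists>j\<in>I. z \<in> cball (cc j) (6 * r j)")
          case True
          then obtain j where j: "j \<in> I" "z \<in> cball (cc j) (6 * r j)" by blast
          have "(\<Sum>i\<in>I. indicator (cball (cc i) (6 * r i)) z) = (\<Sum>i\<in>{j}. indicator (cball (cc i) (6 * r i)) z :: real)"
          proof (rule sum.mono_neutral_right[OF I(2)])
            show "\<forall>i\<in>I - {j}. indicator (cball (cc i) (6 * r i)) z = (0::real)"
            proof
              fix i assume "i \<in> I - {j}"
              hence "disjnt (cball (cc i) (6 * r i)) (cball (cc j) (6 * r j))"
                using C(3) I(1) j(1) unfolding pairwise_def by blast
              hence "z \<notin> cball (cc i) (6 * r i)" using j(2) unfolding disjnt_def by blast
              thus "indicator (cball (cc i) (6 * r i)) z = (0::real)" by simp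
            qed
          qed (use j in auto)
          also have "\<dots> \<le> 1" by simp
          finally show ?thesis .
        next
          case False
          hence "(\<Sum>i\<in>I. indicator (cball (cc i) (6 * r i)) z) = (0::real)" by (intro sum.neutral) auto
          thus ?thesis by simp
        qed
        hence "(\<Sum>i\<in>I. indicator (cball (cc i) (6 * r i)) z) * ?h z \<le> 1 * ?h z" using h0 by (rule mult_right_mono)
        thus "(\<Sum>i\<in>I. indicator (cball (cc i) (6 * r i)) z * ?h z) \<le> ?h z" by (simp only: sum_distrib_right mult_1)
      qed
      finally show ?thesis using C1 by simp
    qed
    have UL: "(\<Union>i\<in>C. cball (cc i) (5 * (6 * r i))) \<in> lmeasurable"
      by (rule fmeasurable_UN_bound[OF C(1) _ bnd]) auto
    have "measure lebesgue D \<le> measure lebesgue (\<Union>i\<in>C. cball (cc i) (5 * (6 * r i)))"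
      using C(4) Dm UL by (intro measure_mono_fmeasurable) (auto simp: fmeasurableD)
    also have "\<dots> \<le> C1 * (LINT z|lebesgue. ?h z)"
      by (rule measure_UN_bound[OF C(1) _ bnd]) auto
    finally have fin: "measure lebesgue D \<le> C1 * (LINT z|lebesgue. ?h z)" .
    \<comment> \<open>The lost part of the bad set occurs on the right with the factor
      \<open>C1 / mu\<close>; multiplying by \<open>mu / C1\<close> and solving for the measure of
      \<open>D'\<close> produces the contraction factor.\<close>
    define I where "I = (LINT z:ball 0 1|lebesgue. \<bar>f z\<bar> ^ CARD('n))"
    have "\<mu> / C1 * measure lebesgue D \<le> \<mu> / C1 * (C1 * (1 / \<mu> * (measure lebesgue D - measure lebesgue D') + 1 / (\<eta> * T ^ CARD('n)) * I))"
      using fin C1 c1 unfolding hint I_def[symmetric] by (intro mult_left_mono) auto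
    also have "\<dots> = measure lebesgue D - measure lebesgue D' + \<mu> / \<eta> * (I / T ^ CARD('n))"
      using C1 c1 by (simp add: distrib_left)
    finally have "measure lebesgue D' \<le> (1 - \<mu> / C1) * measure lebesgue D + \<mu> / \<eta> * (I / T ^ CARD('n))"
      by (simp add: left_diff_distrib)
    also have "(1 - \<mu> / C1) * measure lebesgue D \<le> \<theta> * measure lebesgue D"
      by (intro mult_right_mono) (auto simp: \<theta>_def)
    finally show "measure lebesgue (bad_set \<gamma> (M * K) u) \<le> \<theta> * measure lebesgue (bad_set \<gamma> K u)
         + \<mu> / \<eta> * ((LINT z:ball 0 1|lebesgue. \<bar>f z\<bar> ^ CARD('n)) / (K powr (1 + \<gamma>)) ^ CARD('n))"
      by (simp add: D_def D'_def I_def T_def)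
  qed
qed

text \<open>Iteration of \<open>bad_set_step\<close>. At level \<open>k\<close> the constant is at
  least \<open>K * 2 ^ k\<close>, so the normalised integral of \<open>|f| ^ n\<close> is at most
  \<open>(1/2) ^ k\<close>. The rate \<open>tau\<close> lies strictly above both
  \<open>theta\<close> and 1/2, and \<open>H\<close> absorbs the contribution of \<open>f\<close>
  through \<open>B <= H * (tau - theta)\<close>.\<close>

lemma bad_set_decay:
  fixes lam Lam \<gamma> :: real
  assumes n: "CARD('n::finite) \<ge> 2" and lam: "0 < lam" "lam \<le> Lam" and \<gamma>: "0 \<le> \<gamma>"
  obtains M \<tau> H where "2 \<le> M" "0 < \<tau>" "\<tau> < 1" "0 < H"
    "\<And>u (f :: real ^ 'n \<Rightarrow> real) U K k. \<lbrakk>continuous_on (cball 0 1) u; continuous_on (ball 0 1) f;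
       \<And>L. visc_super lam Lam \<gamma> L (ball 0 1) u f; 0 < K; \<And>z. z \<in> cball 0 1 \<Longrightarrow> \<bar>u z\<bar> \<le> U; 12 * 24\<^sup>2 * U \<le> K;
       set_integrable lebesgue (ball 0 1) (\<lambda>z. \<bar>f z\<bar> ^ CARD('n));
       (LINT z:ball 0 1|lebesgue. \<bar>f z\<bar> ^ CARD('n)) \<le> (K powr (1 + \<gamma>)) ^ CARD('n)\<rbrakk>
     \<Longrightarrow> measure lebesgue (bad_set \<gamma> (K * M ^ k) u) \<le> H * \<tau> ^ k"
proof -
  obtain M \<theta> B where c1: "2 \<le> M" "0 < \<theta>" "\<theta> < 1" "0 < B" and step:
    "\<And>u (f :: real ^ 'n \<Rightarrow> real) U K. \<lbrakk>continuous_on (cball 0 1) u; continuous_on (ball 0 1) f;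
       \<And>L. visc_super lam Lam \<gamma> L (ball 0 1) u f; 0 < K; \<And>z. z \<in> cball 0 1 \<Longrightarrow> \<bar>u z\<bar> \<le> U; 12 * 24\<^sup>2 * U \<le> K;
       set_integrable lebesgue (ball 0 1) (\<lambda>z. \<bar>f z\<bar> ^ CARD('n))\<rbrakk>
     \<Longrightarrow> measure lebesgue (bad_set \<gamma> (M * K) u) \<le> \<theta> * measure lebesgue (bad_set \<gamma> K u)
         + B * ((LINT z:ball 0 1|lebesgue. \<bar>f z\<bar> ^ CARD('n)) / (K powr (1 + \<gamma>)) ^ CARD('n))"
    apply (rule bad_set_step[OF n lam \<gamma>])
    subgoal premises prems by (rule prems(1)[OF prems(2-5)]) (rule prems(6); assumption)
    done
  define \<tau> where "\<tau> = (1 + max \<theta> (1/2)) / 2"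
  have \<tau>: "0 < \<tau>" "\<tau> < 1" "\<theta> < \<tau>" "1/2 \<le> \<tau>" using c1 by (auto simp: \<tau>_def max_def)
  define \<omega> where "\<omega> = measure lebesgue (ball (0 :: real ^ 'n) (1/2))"
  define H where "H = 1 + \<omega> + B / (\<tau> - \<theta>)"
  have \<omega>: "0 \<le> \<omega>" by (simp add: \<omega>_def)
  have H: "0 < H" "B \<le> H * (\<tau> - \<theta>)" "\<omega> \<le> H"
  proof -
    have q: "0 < B / (\<tau> - \<theta>)" using c1 \<tau> by simp
    show "0 < H" "\<omega> \<le> H" using q \<omega> by (auto simp: H_def)
    have "B / (\<tau> - \<theta>) \<le> H" using \<omega> by (simp add: H_def)
    thus "B \<le> H * (\<tau> - \<theta>)" using \<tau> by (simp add: divide_le_eq)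
  qed
  show thesis
  proof (rule that[of M \<tau> H])
    show "2 \<le> M" "0 < \<tau>" "\<tau> < 1" "0 < H" using c1 \<tau> H by auto
    fix u f :: "real ^ 'n \<Rightarrow> real" and U K k
    assume cu: "continuous_on (cball 0 1) u" and cf: "continuous_on (ball 0 1) f"
      and v: "\<And>L. visc_super lam Lam \<gamma> L (ball 0 1) u f" and K: "0 < K"
      and U: "\<And>z. z \<in> cball 0 1 \<Longrightarrow> \<bar>u z\<bar> \<le> U" and UK: "12 * 24\<^sup>2 * U \<le> K"
      and fi: "set_integrable lebesgue (ball 0 1) (\<lambda>z. \<bar>f z\<bar> ^ CARD('n))"
      and fK: "(LINT z:ball 0 1|lebesgue. \<bar>f z\<bar> ^ CARD('n)) \<le> (K powr (1 + \<gamma>)) ^ CARD('n)"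
    show "measure lebesgue (bad_set \<gamma> (K * M ^ k) u) \<le> H * \<tau> ^ k"
    proof (induction k)
      case 0
      have "bad_set \<gamma> (K * M ^ 0) u \<subseteq> ball 0 (1/2)" by (auto simp: bad_set_def)
      hence "measure lebesgue (bad_set \<gamma> (K * M ^ 0) u) \<le> \<omega>"
        unfolding \<omega>_def using lmeasurable_bad_set[OF cu \<gamma>, of "K * M ^ 0"] K
        by (intro measure_mono_fmeasurable) (auto simp: fmeasurableD)
      thus ?case using H by simp
    next
      case (Suc k)
      define Kk where "Kk = K * M ^ k"
      have M1: "1 \<le> M ^ k" using c1 by (intro one_le_power) auto
      have KkK: "K \<le> Kk" using mult_left_mono[OF M1, of K] K by (simp add: Kk_def)
      have Kk: "0 < Kk" "12 * 24\<^sup>2 * U \<le> Kk" using K KkK UK by auto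
      have pk: "(K powr (1 + \<gamma>)) * 2 ^ k \<le> Kk powr (1 + \<gamma>)"
      proof -
        have "(2::real) ^ k \<le> M ^ k" using c1 by (intro power_mono) auto
        also have "M ^ k \<le> (M ^ k) powr (1 + \<gamma>)" using M1 \<gamma> powr_mono[of 1 "1 + \<gamma>" "M ^ k"] by simp
        finally have "K powr (1 + \<gamma>) * 2 ^ k \<le> K powr (1 + \<gamma>) * (M ^ k) powr (1 + \<gamma>)" by (intro mult_left_mono) auto
        thus ?thesis using K M1 by (simp add: Kk_def powr_mult)
      qed
      have "(LINT z:ball 0 1|lebesgue. \<bar>f z\<bar> ^ CARD('n)) / (Kk powr (1 + \<gamma>)) ^ CARD('n) \<le> (1/2) ^ k"
      proof -
        have K1: "0 < (K powr (1 + \<gamma>)) ^ CARD('n)" using K by simp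
        have "(LINT z:ball 0 1|lebesgue. \<bar>f z\<bar> ^ CARD('n)) / (Kk powr (1 + \<gamma>)) ^ CARD('n)
            \<le> (K powr (1 + \<gamma>)) ^ CARD('n) / (Kk powr (1 + \<gamma>)) ^ CARD('n)"
          using fK by (intro divide_right_mono) auto
        also have "\<dots> \<le> (K powr (1 + \<gamma>)) ^ CARD('n) / ((K powr (1 + \<gamma>)) * 2 ^ k) ^ CARD('n)"
          using pk K by (intro divide_left_mono power_mono mult_pos_pos zero_less_power) (use K Kk in auto)
        also have "\<dots> = (1 / 2 ^ k) ^ CARD('n)" using K1 K by (simp add: power_mult_distrib power_divide)
        also have "\<dots> \<le> (1 / 2 ^ k) ^ 1" using n by (intro power_decreasing) auto
        finally show ?thesis by (simp add: power_divide)
      qed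
      hence b: "B * ((LINT z:ball 0 1|lebesgue. \<bar>f z\<bar> ^ CARD('n)) / (Kk powr (1 + \<gamma>)) ^ CARD('n)) \<le> B * (1/2) ^ k"
        using c1 by (intro mult_left_mono) auto
      have "measure lebesgue (bad_set \<gamma> (M * Kk) u) \<le> \<theta> * measure lebesgue (bad_set \<gamma> Kk u)
         + B * ((LINT z:ball 0 1|lebesgue. \<bar>f z\<bar> ^ CARD('n)) / (Kk powr (1 + \<gamma>)) ^ CARD('n))"
        by (rule step[OF cu cf v Kk(1) U Kk(2) fi])
      also have "\<dots> \<le> \<theta> * (H * \<tau> ^ k) + B * (1/2) ^ k"
        using mult_left_mono[OF Suc.IH, of \<theta>] b c1 by (intro add_mono) (simp_all flip: Kk_def)
      also have "\<dots> \<le> \<theta> * (H * \<tau> ^ k) + B * \<tau> ^ k"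
        using c1 \<tau> by (intro add_left_mono mult_left_mono power_mono) auto
      also have "\<dots> \<le> \<theta> * (H * \<tau> ^ k) + (H * (\<tau> - \<theta>)) * \<tau> ^ k"
        using H \<tau> by (intro add_left_mono mult_right_mono) auto
      also have "\<dots> = H * \<tau> ^ Suc k" by (simp add: algebra_simps)
      finally show ?case by (simp add: Kk_def mult_ac)
    qed
  qed
qed

section \<open>Approximate derivatives of fields that are Lipschitz on large sets\<close>

text \<open>\<open>g\<close> satisfies the first-order expansion at all points near
  \<open>x\<close>, and \<open>G\<close> equals \<open>g\<close> on \<open>S\<close>; so the points
  where the error of \<open>G\<close> is large lie off \<open>S\<close>, where only a vanishing
  fraction of small balls lies.\<close>

lemma has_approx_deriv_density_point:
  fixes G g :: "real ^ 'n::finite \<Rightarrow> real ^ 'n"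
  assumes S: "S \<in> sets lebesgue" and x: "x \<in> S" and d: "density_point S x"
    and g: "\<And>y. y \<in> S \<Longrightarrow> g y = G y" "(g has_derivative (\<lambda>h. A *v h)) (at x)"
  shows "has_approx_deriv G A x"
  unfolding has_approx_deriv_def
proof (intro allI impI)
  fix \<epsilon> :: real assume \<epsilon>: "0 < \<epsilon>"
  then obtain \<eta> where \<eta>: "0 < \<eta>" "\<And>y. norm (y - x) < \<eta> \<Longrightarrow> norm (g y - g x - A *v (y - x)) \<le> \<epsilon> * norm (y - x)"
    using g(2) unfolding has_derivative_at_alt by blast
  let ?Q = "\<lambda>r. {y \<in> ball x r. norm (G y - G x - A *v (y - x)) > \<epsilon> * norm (y - x)}"
  have Q: "?Q r \<subseteq> ball x r - S" if "r < \<eta>" for r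
  proof
    fix y assume y: "y \<in> ?Q r"
    hence "norm (y - x) < \<eta>" using that by (auto simp: dist_norm norm_minus_commute)
    thus "y \<in> ball x r - S" using \<eta>(2)[of y] y g(1)[of y] g(1)[OF x] by auto
  qed
  have "measure lebesgue (?Q r) \<le> measure lebesgue (ball x r - S)" if "r < \<eta>" for r
  proof (cases "?Q r \<in> sets lebesgue")
    case True
    have "ball x r - S \<in> lmeasurable" using S by (intro fmeasurable_Diff) auto
    thus ?thesis using Q[OF that] True by (intro measure_mono_fmeasurable)
  next
    \<comment> \<open>\<open>measure\<close> takes the value 0 on sets that are not
      measurable.\<close>
    case False thus ?thesis by (simp add: measure_notin_sets)
  qed
  hence le: "measure lebesgue (?Q r) / measure lebesgue (ball x r)
      \<le> measure lebesgue (ball x r - S) / measure lebesgue (ball x r)" if "r < \<eta>" for r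
    using that by (intro divide_right_mono) auto
  have "\<forall>\<^sub>F r in at_right 0. r < \<eta>" using \<eta>(1) by (rule eventually_at_right_real[THEN eventually_mono]) simp
  thus "((\<lambda>r. measure lebesgue (?Q r) / measure lebesgue (ball x r)) \<longlongrightarrow> 0) (at_right 0)"
    by (intro tendsto_sandwich[OF _ _ tendsto_const d[unfolded density_point_def]])
       (use le \<open>\<forall>\<^sub>F r in at_right 0. r < \<eta>\<close> in \<open>auto simp only: measure_nonneg zero_le_divide_iff elim!: eventually_mono\<close>)
qed

text \<open>Each component is extended from \<open>S\<close> to a Lipschitz function on the whole
  space, which is differentiable almost everywhere. The Borel functions \<open>J\<close> and
  \<open>g\<close> are also returned because they later yield measurability of the assembled
  derivative and of the field.\<close>

lemma lipschitz_has_approx_deriv: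
  fixes G :: "real ^ 'n::finite \<Rightarrow> real ^ 'n"
  assumes L: "0 \<le> L" and lip: "\<And>x y. x \<in> S \<Longrightarrow> y \<in> S \<Longrightarrow> norm (G x - G y) \<le> L * norm (x - y)"
    and S: "S \<in> sets lebesgue"
  obtains J g N where "J \<in> borel_measurable borel" "g \<in> borel_measurable borel"
    "\<And>x. norm (J x) \<le> L * (real CARD('n))\<^sup>2" "\<And>x. x \<in> S \<Longrightarrow> g x = G x" "negligible N"
    "\<And>x. x \<in> S - N \<Longrightarrow> has_approx_deriv G (J x) x"
proof -
  have "\<exists>g. (\<forall>x\<in>S. g x = G x $ i) \<and> (\<forall>x y. \<bar>g x - g y\<bar> \<le> L * norm (x - y))" for i
  proof -
    have "\<bar>G x $ i - G y $ i\<bar> \<le> L * norm (x - y)" if "x \<in> S" "y \<in> S" for x y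
      using component_le_norm_cart[of "G x - G y" i] lip[OF that] by simp
    from lipschitz_extension_real[OF L this] show ?thesis by metis
  qed
  then obtain gi where gi: "\<And>i x. x \<in> S \<Longrightarrow> gi i x = G x $ i" "\<And>i x y. \<bar>gi i x - gi i y\<bar> \<le> L * norm (x - y)"
    by metis
  define g where "g x = (\<chi> i. gi i x)" for x
  define J where "J x = (\<chi> i j. dd L (gi i) (axis j 1) x)" for x
  define N where "N = {x \<in> S. \<not> density_point S x} \<union> (\<Union>i. \<Union>j. {x. \<not> lebesgue_point (dd L (gi i) (axis j 1)) x})"
  have gc: "continuous_on UNIV (gi i)" for i
    by (intro lipschitz_on_continuous_on[of L] lipschitz_onI) (use gi(2) L in \<open>auto simp: dist_norm\<close>)
  have dm: "dd L (gi i) e \<in> borel_measurable borel" for i e by (rule dd_measurable[OF gc])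
  show thesis
  proof (rule that[of J g N])
    have "(\<lambda>x. J x \<bullet> k) \<in> borel_measurable borel" if k: "k \<in> Basis" for k :: "real ^ 'n ^ 'n"
    proof -
      obtain a b where "k = axis a (axis b 1)" using k by (auto simp: Basis_vec_def)
      hence "(\<lambda>x. J x \<bullet> k) = dd L (gi a) (axis b 1)" by (simp add: fun_eq_iff J_def inner_axis)
      thus ?thesis using dm by simp
    qed
    thus "J \<in> borel_measurable borel" using borel_measurable_euclidean_space by blast
    have "continuous_on UNIV g" unfolding g_def by (intro continuous_on_vec_lambda gc)
    thus "g \<in> borel_measurable borel" by (rule borel_measurable_continuous_onI)
    show "norm (J x) \<le> L * (real CARD('n))\<^sup>2" for x
    proof -
      have "norm (J x $ i) \<le> (\<Sum>j\<in>(UNIV::'n set). L)" for i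
        by (rule order_trans[OF norm_le_l1_cart sum_mono]) (simp add: J_def dd_bound[OF L])
      hence "(\<Sum>i\<in>UNIV. norm (J x $ i)) \<le> (\<Sum>i\<in>(UNIV::'n set). \<Sum>j\<in>(UNIV::'n set). L)" by (intro sum_mono)
      moreover have "norm (J x) \<le> (\<Sum>i\<in>UNIV. norm (J x $ i))" unfolding norm_vec_def by (rule L2_set_le_sum) simp
      ultimately show ?thesis by (simp add: power2_eq_square mult_ac)
    qed
    show "g x = G x" if "x \<in> S" for x using gi(1)[OF that] by (simp add: g_def vec_eq_iff)
    have "negligible {x. \<not> lebesgue_point (dd L (gi i) (axis j 1)) x}" for i j
      by (rule negligible_not_lebesgue_point[of _ L]) (use dm dd_bound[OF L] in \<open>auto intro: measurable_completion\<close>)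
    hence "negligible (\<Union>i. \<Union>j. {x. \<not> lebesgue_point (dd L (gi i) (axis j 1)) x})"
      by (intro negligible_countable_Union) (auto intro!: negligible_countable_Union)
    thus "negligible N" unfolding N_def using negligible_not_density_point[OF S] by (rule negligible_Un[rotated])
    show "has_approx_deriv G (J x) x" if x: "x \<in> S - N" for x
    proof (rule has_approx_deriv_density_point[OF S])
      show "x \<in> S" "density_point S x" using x by (auto simp: N_def)
      show "g y = G y" if "y \<in> S" for y using gi(1)[OF that] by (simp add: g_def vec_eq_iff)
      have lp: "lebesgue_point (dd L (gi i) k) x" if "k \<in> Basis" for i and k :: "real ^ 'n"
        using x that by (auto simp: N_def Basis_vec_def)
      have "(\<Sum>k\<in>Basis. dd L (gi i) k x * (h \<bullet> k)) = (J x *v h) $ i" for i h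
      proof -
        have bb: "bij_betw (\<lambda>j. axis j (1::real)) (UNIV::'n set) Basis"
          by (auto simp: bij_betw_def inj_on_def axis_eq_axis Basis_vec_def)
        show ?thesis
          unfolding matrix_vector_mult_def J_def
          by (simp add: sum.reindex_bij_betw[OF bb, symmetric] inner_axis)
      qed
      hence "(gi i has_derivative (\<lambda>h. (J x *v h) $ i)) (at x)" for i
        using has_derivative_at_lebesgue_point[OF L gi(2)[of i] lp] by simp
      hence "((\<lambda>y. g y \<bullet> k) has_derivative (\<lambda>h. (J x *v h) \<bullet> k)) (at x)" if "k \<in> Basis" for k
        using that by (auto simp: Basis_vec_def inner_axis g_def)
      thus "(g has_derivative (\<lambda>h. J x *v h)) (at x)" using has_derivative_componentwise_within by blast
    qed
  qed
qed

text \<open>On the piece of index \<open>k\<close> the integrand is at most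
  \<open>(c * q ^ k) powr delta\<close> and the measure at most \<open>H * tau ^ k\<close>. The sum
  is a geometric series of ratio \<open>q powr delta * tau\<close>, which is why
  \<open>delta\<close> has to be small.\<close>

lemma graded_in_Lp:
  fixes F :: "real ^ 'n::finite \<Rightarrow> 'b::euclidean_space"
  assumes F: "F \<in> borel_measurable (lebesgue_on \<Omega>)" and \<Omega>: "\<Omega> \<in> sets lebesgue"
    and D: "\<And>k. D k \<in> lmeasurable" "negligible (\<Omega> - (\<Union>k. D k))"
    and b: "\<And>k x. x \<in> D k \<Longrightarrow> norm (F x) \<le> c * q ^ k" and m: "\<And>k. measure lebesgue (D k) \<le> H * \<tau> ^ k"
    and c: "0 \<le> c" and q: "0 < q" and H: "0 \<le> H" and \<tau>: "0 \<le> \<tau>" and \<delta>: "0 < \<delta>" and r: "q powr \<delta> * \<tau> < 1"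
  shows "in_Lp \<delta> \<Omega> F" "Lp_norm \<delta> \<Omega> F \<le> c * (H / (1 - q powr \<delta> * \<tau>)) powr (1 / \<delta>)"
proof -
  let ?r = "q powr \<delta> * \<tau>"
  let ?X = "c powr \<delta> * (H / (1 - ?r))"
  have r0: "0 \<le> ?r" using \<tau> by simp
  have X0: "0 \<le> ?X" using H r by simp
  have piece: "ennreal ((c * q ^ k) powr \<delta>) * emeasure lebesgue (D k) \<le> ennreal (c powr \<delta> * H * ?r ^ k)" for k
  proof -
    have "(c * q ^ k) powr \<delta> * measure lebesgue (D k) \<le> (c * q ^ k) powr \<delta> * (H * \<tau> ^ k)"
      using m by (intro mult_left_mono) auto
    also have "\<dots> = c powr \<delta> * H * ?r ^ k"
      using c q by (simp add: powr_mult power_mult_distrib powr_power flip: powr_realpow) (simp add: powr_powr mult.commute)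
    finally have "ennreal ((c * q ^ k) powr \<delta> * measure lebesgue (D k)) \<le> ennreal (c powr \<delta> * H * ?r ^ k)"
      by (rule ennreal_leI)
    thus ?thesis using D(1)[of k] by (simp add: ennreal_mult emeasure_eq_measure2)
  qed
  have pt: "AE x in lebesgue. ennreal (norm (F x) powr \<delta>) * indicator \<Omega> x
      \<le> (\<Sum>k. ennreal ((c * q ^ k) powr \<delta>) * indicator (D k) x)"
  proof (rule AE_I')
    show "\<Omega> - (\<Union>k. D k) \<in> null_sets lebesgue" using D(2) negligible_iff_null_sets by blast
    have le: "ennreal (norm (F x) powr \<delta>) * indicator \<Omega> x \<le> (\<Sum>k. ennreal ((c * q ^ k) powr \<delta>) * indicator (D k) x)"
      if k: "x \<in> D k" for x k
    proof -
      have "ennreal (norm (F x) powr \<delta>) * indicator \<Omega> x \<le> ennreal (norm (F x) powr \<delta>)" by (simp add: indicator_def)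
      also have "\<dots> \<le> ennreal ((c * q ^ k) powr \<delta>)" using b[OF k] \<delta> by (intro ennreal_leI powr_mono2) auto
      also have "\<dots> = (\<Sum>k\<in>{k}. ennreal ((c * q ^ k) powr \<delta>) * indicator (D k) x)" using k by simp
      also have "\<dots> \<le> (\<Sum>k. ennreal ((c * q ^ k) powr \<delta>) * indicator (D k) x)" by (intro sum_le_suminf) auto
      finally show ?thesis .
    qed
    show "{x \<in> space lebesgue. \<not> ennreal (norm (F x) powr \<delta>) * indicator \<Omega> x
      \<le> (\<Sum>k. ennreal ((c * q ^ k) powr \<delta>) * indicator (D k) x)} \<subseteq> \<Omega> - (\<Union>k. D k)" (is "?E \<subseteq> _")
    proof
      fix x assume x: "x \<in> ?E"
      have "x \<in> \<Omega>" using x by (cases "x \<in> \<Omega>") auto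
      moreover have "x \<notin> D k" for k using le[of x k] x by blast
      ultimately show "x \<in> \<Omega> - (\<Union>k. D k)" by blast
    qed
  qed
  have nn: "(\<integral>\<^sup>+x. ennreal (norm (F x) powr \<delta>) \<partial>lebesgue_on \<Omega>) \<le> ennreal ?X"
  proof -
    have "(\<integral>\<^sup>+x. ennreal (norm (F x) powr \<delta>) \<partial>lebesgue_on \<Omega>) = (\<integral>\<^sup>+x. ennreal (norm (F x) powr \<delta>) * indicator \<Omega> x \<partial>lebesgue)"
      using \<Omega> by (intro nn_integral_restrict_space) simp
    also have "\<dots> \<le> (\<integral>\<^sup>+x. (\<Sum>k. ennreal ((c * q ^ k) powr \<delta>) * indicator (D k) x) \<partial>lebesgue)"
      by (rule nn_integral_mono_AE[OF pt])
    also have "\<dots> = (\<Sum>k. \<integral>\<^sup>+x. ennreal ((c * q ^ k) powr \<delta>) * indicator (D k) x \<partial>lebesgue)"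
      using D(1) by (intro nn_integral_suminf borel_measurable_times borel_measurable_indicator) auto
    also have "\<dots> = (\<Sum>k. ennreal ((c * q ^ k) powr \<delta>) * emeasure lebesgue (D k))"
      using D(1) by (intro suminf_cong nn_integral_cmult_indicator) auto
    also have "\<dots> \<le> (\<Sum>k. ennreal (c powr \<delta> * H * ?r ^ k))" by (intro suminf_le piece) auto
    also have "\<dots> = ennreal (\<Sum>k. c powr \<delta> * H * ?r ^ k)"
      using r r0 H by (intro suminf_ennreal2 summable_mult summable_geometric) auto
    also have "(\<Sum>k. c powr \<delta> * H * ?r ^ k) = c powr \<delta> * H * (1 / (1 - ?r))"
      using r r0 by (subst suminf_mult) (auto simp: suminf_geometric summable_geometric)
    finally show ?thesis by simp
  qed
  have meas: "(\<lambda>x. norm (F x) powr \<delta>) \<in> borel_measurable (lebesgue_on \<Omega>)" using F by measurable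
  have int: "integrable (lebesgue_on \<Omega>) (\<lambda>x. norm (F x) powr \<delta>)"
    by (rule integrableI_nonneg[OF meas]) (use nn in \<open>auto intro: le_less_trans\<close>)
  thus "in_Lp \<delta> \<Omega> F" using F by (simp add: in_Lp_def)
  have "ennreal (LINT x|lebesgue_on \<Omega>. norm (F x) powr \<delta>) \<le> ennreal ?X"
    using nn nn_integral_eq_integral[OF int] by simp
  hence "(LINT x|lebesgue_on \<Omega>. norm (F x) powr \<delta>) \<le> ?X" using X0 by (simp add: ennreal_le_iff)
  hence "Lp_norm \<delta> \<Omega> F \<le> ?X powr (1 / \<delta>)"
    unfolding Lp_norm_def using \<delta> by (intro powr_mono2) (auto intro: integral_nonneg_AE)
  also have "\<dots> = c * (H / (1 - ?r)) powr (1 / \<delta>)" using c H r \<delta> by (subst powr_mult) (auto simp: powr_powr)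
  finally show "Lp_norm \<delta> \<Omega> F \<le> c * (H / (1 - ?r)) powr (1 / \<delta>)" .
qed

section \<open>Fields that are Lipschitz on a graded family of sets\<close>

lemma negligible_diff_Union:
  fixes \<Omega> :: "'a::euclidean_space set"
  assumes \<Omega>: "\<Omega> \<in> lmeasurable" and B: "\<And>k. B k \<in> sets lebesgue"
    and m: "\<And>k. measure lebesgue (\<Omega> - B k) \<le> H * \<tau> ^ k" and \<tau>: "0 \<le> \<tau>" "\<tau> < 1"
  shows "negligible (\<Omega> - (\<Union>k. B k))"
proof -
  have meas: "\<Omega> - (\<Union>k. B k) \<in> lmeasurable" using B \<Omega> by (intro fmeasurable_Diff) auto
  have "measure lebesgue (\<Omega> - (\<Union>k. B k)) \<le> 0"
  proof (rule LIMSEQ_le_const)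
    have "(\<lambda>k. H * \<tau> ^ k) \<longlonglongrightarrow> H * 0" using \<tau> by (intro tendsto_intros LIMSEQ_power_zero) auto
    thus "(\<lambda>k. H * \<tau> ^ k) \<longlonglongrightarrow> 0" by simp
    have "measure lebesgue (\<Omega> - (\<Union>k. B k)) \<le> H * \<tau> ^ k" for k
    proof -
      have "measure lebesgue (\<Omega> - (\<Union>k. B k)) \<le> measure lebesgue (\<Omega> - B k)"
        using B \<Omega> meas by (intro measure_mono_fmeasurable fmeasurable_Diff) (auto simp: fmeasurableD)
      thus ?thesis using m[of k] by linarith
    qed
    thus "\<exists>n. \<forall>k\<ge>n. measure lebesgue (\<Omega> - (\<Union>k. B k)) \<le> H * \<tau> ^ k" by blast
  qed
  thus ?thesis using meas by (metis measure_nonneg negligible_iff_measure order_antisym)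
qed

text \<open>For \<open>delta < 1\<close> the derivative in \<open>weak_deriv\<close> is the
  approximate one. At almost every point of \<open>B k\<close> it is determined by the values of the
  field on \<open>B k\<close>, so the derivatives found on the different sets can be assembled into
  one field without gluing conditions.\<close>

lemma graded_lipschitz_W1p:
  fixes G :: "real ^ 'n::finite \<Rightarrow> real ^ 'n"
  assumes \<Omega>: "\<Omega> \<in> lmeasurable" "measure lebesgue \<Omega> \<le> H" and B: "\<And>k. B k \<in> sets lebesgue" "\<And>k. B k \<subseteq> \<Omega>"
    and m: "\<And>k. measure lebesgue (\<Omega> - B k) \<le> H * \<tau> ^ k"
    and b: "\<And>k x. x \<in> B k \<Longrightarrow> norm (G x) \<le> t * q ^ k"
    and lip: "\<And>k x y. x \<in> B k \<Longrightarrow> y \<in> B k \<Longrightarrow> norm (G x - G y) \<le> t * q ^ k * norm (x - y)"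
    and t: "0 \<le> t" and q: "0 < q" and \<tau>: "0 < \<tau>" "\<tau> < 1" and \<delta>: "0 < \<delta>" "\<delta> < 1" and r: "q powr \<delta> * \<tau> < 1"
  obtains V where "in_W1p \<delta> \<Omega> G V"
    "W1p_norm \<delta> \<Omega> G V \<le> t * ((1 + (real CARD('n))\<^sup>2) * (H / \<tau> / (1 - q powr \<delta> * \<tau>)) powr (1 / \<delta>))"
proof -
  have tq: "0 \<le> t * q ^ k" for k using t q by simp
  have H: "0 \<le> H" using \<Omega>(2) measure_nonneg order_trans by blast
  have "\<exists>J g N. J \<in> borel_measurable borel \<and> g \<in> borel_measurable borel \<and> (\<forall>x. norm (J x) \<le> t * q ^ k * (real CARD('n))\<^sup>2)
    \<and> (\<forall>x\<in>B k. g x = G x) \<and> negligible N \<and> (\<forall>x\<in>B k - N. has_approx_deriv G (J x) x)" for k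
    by (rule lipschitz_has_approx_deriv[OF tq lip B(1)]) blast+
  then obtain J g N where Jm: "\<And>k. J k \<in> borel_measurable borel" and gm: "\<And>k. g k \<in> borel_measurable borel"
    and Jb: "\<And>k x. norm (J k x) \<le> t * q ^ k * (real CARD('n))\<^sup>2" and gG: "\<And>k x. x \<in> B k \<Longrightarrow> g k x = G x"
    and N: "\<And>k. negligible (N k)" and Jd: "\<And>k x. x \<in> B k - N k \<Longrightarrow> has_approx_deriv G (J k x) x"
    by metis
  \<comment> \<open>The sets \<open>B k\<close> are not assumed to increase; points are graded by
    the first index \<open>k\<close> with \<open>x\<close> in \<open>B k\<close>.\<close>
  define D where "D k = B k - (\<Union>j<k. B j)" for k
  define \<kappa> where "\<kappa> x = (LEAST k. x \<in> B k)" for x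
  define V where "V x = (if x \<in> (\<Union>k. B k) then J (\<kappa> x) x else 0)" for x
  define g' where "g' x = g (\<kappa> x) x" for x
  have \<kappa>B: "x \<in> B (\<kappa> x)" if "x \<in> B k" for x k using that unfolding \<kappa>_def by (rule LeastI)
  have \<kappa>D: "\<kappa> x = k" if "x \<in> D k" for x k
    unfolding \<kappa>_def by (rule Least_equality) (use that in \<open>auto simp: D_def not_le[symmetric]\<close>)
  have UD: "(\<Union>k. D k) = (\<Union>k. B k)"
  proof -
    have "x \<in> D (\<kappa> x)" if "x \<in> B k" for x k
      using \<kappa>B[OF that] by (auto simp: D_def) (metis \<kappa>_def not_less_Least)
    thus ?thesis by (auto simp: D_def) 
  qed
  have Bm: "B k \<in> lmeasurable" for k using B \<Omega>(1) by (meson fmeasurableI2)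
  have Dm: "D k \<in> lmeasurable" for k unfolding D_def using B(1) by (intro fmeasurable_Diff Bm) auto
  \<comment> \<open>For \<open>k > 0\<close> the piece \<open>D k\<close> lies outside
    \<open>B (k - 1)\<close>, so the measure bound is shifted by one index, which costs the factor
    \<open>1 / tau\<close>.\<close>
  have Dmeas: "measure lebesgue (D k) \<le> H / \<tau> * \<tau> ^ k" for k
  proof (cases k)
    case 0
    have "measure lebesgue (D k) \<le> measure lebesgue \<Omega>"
      using Dm[of k] B(2)[of k] \<Omega>(1) by (intro measure_mono_fmeasurable) (auto simp: D_def)
    also have "\<dots> \<le> H / \<tau>" using \<Omega>(2) divide_left_mono[of \<tau> 1 H] H \<tau> by simp
    finally show ?thesis by (simp add: 0)
  next
    case (Suc j)
    have "measure lebesgue (D k) \<le> measure lebesgue (\<Omega> - B j)"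
      using Dm[of k] B \<Omega>(1) by (intro measure_mono_fmeasurable fmeasurable_Diff) (auto simp: D_def Suc)
    also have "\<dots> \<le> H * \<tau> ^ j" by (rule m)
    finally show ?thesis using \<tau> by (simp add: Suc)
  qed
  have neg: "negligible (\<Omega> - (\<Union>k. B k))" by (rule negligible_diff_Union[OF \<Omega>(1) B(1) m]) (use \<tau> in auto)
  have \<kappa>m: "\<kappa> \<in> measurable lebesgue (count_space UNIV)"
    unfolding \<kappa>_def by (rule measurable_Least) (use B(1) in \<open>simp add: pred_def\<close>)
  have JL: "J k \<in> borel_measurable lebesgue" "g k \<in> borel_measurable lebesgue" for k
    using Jm gm by (auto intro: measurable_completion)
  have g'm: "g' \<in> borel_measurable lebesgue"
    unfolding g'_def by (rule measurable_compose_countable[OF JL(2) \<kappa>m])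
  have Vm: "V \<in> borel_measurable lebesgue"
    unfolding V_def using B(1)
    by (intro measurable_If_set measurable_compose_countable[OF JL(1) \<kappa>m]) auto
  \<comment> \<open>On the union of the \<open>B k\<close> the field coincides with the measurable
    \<open>g'\<close>, and any subset of the negligible rest is Lebesgue measurable.\<close>
  have Gm: "G \<in> borel_measurable (lebesgue_on \<Omega>)"
  proof (rule borel_measurableI)
    fix U :: "(real ^ 'n) set" assume U: "open U"
    let ?N = "\<Omega> - (\<Union>k. B k)"
    have eq: "G -` U \<inter> \<Omega> = (g' -` U \<inter> (\<Union>k. B k)) \<union> (G -` U \<inter> ?N)"
    proof (intro subset_antisym subsetI)
      fix x assume x: "x \<in> G -` U \<inter> \<Omega>"
      show "x \<in> (g' -` U \<inter> (\<Union>k. B k)) \<union> (G -` U \<inter> ?N)"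
      proof (cases "x \<in> (\<Union>k. B k)")
        case True
        then obtain k where "x \<in> B k" by blast
        from gG[OF \<kappa>B[OF this]] show ?thesis using True x by (simp add: g'_def)
      qed (use x in auto)
    next
      fix x assume x: "x \<in> (g' -` U \<inter> (\<Union>k. B k)) \<union> (G -` U \<inter> ?N)"
      show "x \<in> G -` U \<inter> \<Omega>"
      proof (cases "x \<in> (\<Union>k. B k)")
        case True
        then obtain k where k: "x \<in> B k" by blast
        from gG[OF \<kappa>B[OF k]] show ?thesis using True x B(2)[of k] k by (auto simp: g'_def)
      qed (use x in auto)
    qed
    have "g' -` U \<inter> space lebesgue \<in> sets lebesgue" using g'm U by (intro measurable_sets) auto
    hence 1: "g' -` U \<inter> (\<Union>k. B k) \<in> sets lebesgue" using B(1) by auto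
    have "negligible (G -` U \<inter> ?N)" using neg by (rule negligible_subset) auto
    hence 2: "G -` U \<inter> ?N \<in> sets lebesgue" by (rule negligible_imp_sets)
    have "G -` U \<inter> \<Omega> \<in> sets lebesgue" unfolding eq using 1 2 by (rule sets.Un)
    thus "G -` U \<inter> space (lebesgue_on \<Omega>) \<in> sets (lebesgue_on \<Omega>)"
      using \<Omega>(1) by (auto simp: sets_restrict_space_iff fmeasurableD)
  qed
  have \<Omega>s: "\<Omega> \<in> sets lebesgue" using \<Omega>(1) by auto
  have neg': "negligible (\<Omega> - (\<Union>k. D k))" unfolding UD by (rule neg)
  have H': "0 \<le> H / \<tau>" "0 \<le> \<tau>" "0 \<le> t * (real CARD('n))\<^sup>2" using H \<tau> t by auto
  have Gb: "norm (G x) \<le> t * q ^ k" if "x \<in> D k" for k x using b[of x k] that by (simp add: D_def)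
  have Vb: "norm (V x) \<le> t * (real CARD('n))\<^sup>2 * q ^ k" if "x \<in> D k" for k x
    using Jb[of k x] \<kappa>D[OF that] t q by (auto simp: V_def mult_ac)
  note GL = graded_in_Lp[OF Gm \<Omega>s Dm neg' Gb Dmeas t q H'(1,2) \<delta>(1) r]
  note VL = graded_in_Lp[OF measurable_restrict_space1[OF Vm] \<Omega>s Dm neg' Vb Dmeas H'(3) q H'(1,2) \<delta>(1) r]
  show thesis
  proof (rule that)
    have "AE x in lebesgue. x \<in> \<Omega> \<longrightarrow> has_approx_deriv G (V x) x"
    proof (rule AE_I')
      have "negligible ((\<Omega> - (\<Union>k. B k)) \<union> (\<Union>k. N k))"
        using N by (intro negligible_Un neg negligible_countable_Union) auto
      thus "(\<Omega> - (\<Union>k. B k)) \<union> (\<Union>k. N k) \<in> null_sets lebesgue" by (simp add: negligible_iff_null_sets)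
      have "has_approx_deriv G (V x) x" if "x \<in> B k" "\<And>k. x \<notin> N k" for x k
        using Jd[of x "\<kappa> x"] \<kappa>B[OF that(1)] that by (auto simp: V_def)
      thus "{x \<in> space lebesgue. \<not> (x \<in> \<Omega> \<longrightarrow> has_approx_deriv G (V x) x)} \<subseteq> (\<Omega> - (\<Union>k. B k)) \<union> (\<Union>k. N k)"
        by blast
    qed
    hence "AE x in lebesgue_on \<Omega>. has_approx_deriv G (V x) x" using \<Omega>s by (subst AE_restrict_space_iff) auto
    thus "in_W1p \<delta> \<Omega> G V" using GL(1) VL(1) \<delta> by (simp add: in_W1p_def weak_deriv_def)
    show "W1p_norm \<delta> \<Omega> G V \<le> t * ((1 + (real CARD('n))\<^sup>2) * (H / \<tau> / (1 - q powr \<delta> * \<tau>)) powr (1 / \<delta>))"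
      using GL(2) VL(2) by (simp add: W1p_norm_def algebra_simps)
  qed
qed

section \<open>Points at which \<open>u\<close> is touched from both sides\<close>

lemma pucci_minus_uminus:
  fixes N :: "real ^ 'a ^ 'a::finite"
  shows "pucci_minus lam Lam (- N) = - pucci_plus lam Lam N"
proof -
  have mv: "(- N) *v v = - (N *v v)" for v
    using matrix_vector_mult_diff_rdistrib[of 0 N v] by simp
  have neg: "- w = e *\<^sub>R v \<longleftrightarrow> w = - (e *\<^sub>R v)" for w v :: "real ^ 'a" and e :: real
    by (subst minus_equation_iff) (rule eq_commute)
  have ev: "e \<in> eigenvalues (- N) \<longleftrightarrow> - e \<in> eigenvalues N" for e
    by (simp add: eigenvalues_def mv neg)
  have es: "eigenspace (- N) e = eigenspace N (- e)" for e
    by (simp add: eigenspace_def mv neg)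
  have "neg_eigen_sum (- N) = - pos_eigen_sum N"
    unfolding neg_eigen_sum_def pos_eigen_sum_def sum_negf[symmetric]
    by (rule sum.reindex_bij_witness[of _ uminus uminus]) (auto simp: ev es)
  moreover have "pos_eigen_sum (- N) = - neg_eigen_sum N"
    unfolding neg_eigen_sum_def pos_eigen_sum_def sum_negf[symmetric]
    by (rule sum.reindex_bij_witness[of _ uminus uminus]) (auto simp: ev es)
  ultimately show ?thesis by (simp add: pucci_minus_def pucci_plus_def)
qed

text \<open>A test of \<open>- u\<close> from below is the negative of a test of \<open>u\<close>
  from above with data \<open>- p\<close>, \<open>- s1\<close>, \<open>- s2\<close>. Hence every
  one-sided result applies to \<open>- u\<close> with right-hand side \<open>- f\<close>.\<close>

lemma visc_plus_ge_imp_super: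
  fixes u :: "real ^ 'n::finite \<Rightarrow> real"
  assumes v: "visc_plus_ge lam Lam \<gamma> \<Omega> u f" and n: "CARD('n) \<ge> 2"
  shows "visc_super lam Lam \<gamma> L \<Omega> (\<lambda>x. - u x) (\<lambda>x. - f x)"
  unfolding visc_super_def
proof (intro ballI allI impI, elim conjE)
  fix x p e s1 s2
  assume x: "x \<in> \<Omega>" and e: "norm (e :: real ^ 'n) = 1" and s: "0 < s2" "s2 < s1"
    and ev: "\<forall>\<^sub>F z in nhds x. - u x + quad x p e s1 s2 z \<le> - u z"
  let ?q = "quad x (- p) e (- s1) (- s2)"
  have q: "?q z = - quad x p e s1 s2 z" "quad x p e s1 s2 x = 0" for z by (simp_all add: quad_def)
  have "local_max_at (\<lambda>z. u z - ?q z) x"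
    unfolding local_max_at_def using ev by eventually_elim (simp add: q)
  hence "f x \<le> norm_pow (grad ?q x) \<gamma> * pucci_plus lam Lam (hessian ?q x)"
    using v x Ck_on_quad unfolding visc_plus_ge_def by blast
  moreover have "hessian ?q x = - hessian (quad x p e s1 s2) x"
    by (simp add: hessian_quad vec_eq_iff)
  moreover have "hessian (quad x p e s1 s2) x
      = (\<chi> i j. 2 * s1 * e $ i * e $ j - (if i = j then 2 * s2 else 0))" by (rule hessian_quad)
  moreover have "grad ?q x = - p" by (simp add: grad_quad)
  moreover have "pucci_plus lam Lam (- N) = - pucci_minus lam Lam N" for N :: "real ^ 'n ^ 'n"
    using pucci_minus_uminus[of lam Lam "- N"] by simp
  ultimately have "norm_pow p \<gamma> * (lam * (2 * s1 - 2 * s2) - Lam * (real CARD('n) - 1) * (2 * s2)) \<le> - f x"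
    using pucci_minus_quad[OF e, of "2 * s2" "2 * s1" lam Lam] s n by (simp add: norm_pow_eq right_diff_distrib)
  moreover have "lam * (2 * s1 - 2 * s2) - Lam * (real CARD('n) - 1) * (2 * s2)
      = 2 * (lam * (s1 - s2) - Lam * (real CARD('n) - 1) * s2)" by (simp add: algebra_simps)
  ultimately show "norm_pow p \<gamma> * (2 * (lam * (s1 - s2) - Lam * (real CARD('n) - 1) * s2)) \<le> - f x"
    by simp
qed

text \<open>Adding the two bounds, \<open>p + q\<close> paired with \<open>z - x\<close> is at most
  \<open>2 * K * norm (z - x) powr (1 + alpha)\<close>, of order higher than one, so
  \<open>p + q = 0\<close>. The two bounds then enclose the increment of \<open>u\<close>.\<close>

lemma touches_both_has_derivative:
  fixes u :: "real ^ 'n::finite \<Rightarrow> real"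
  assumes \<gamma>: "0 \<le> \<gamma>" and K: "0 \<le> K" and x: "x \<in> ball 0 1"
    and p: "touches_below \<gamma> K (cball 0 1) u x p" and q: "touches_below \<gamma> K (cball 0 1) (\<lambda>z. - u z) x q"
  shows "(u has_derivative (\<lambda>h. p \<bullet> h)) (at x)" "q = - p"
proof -
  define \<alpha> where "\<alpha> = 1 / (1 + \<gamma>)"
  have \<alpha>: "0 < \<alpha>" using \<gamma> by (simp add: \<alpha>_def)
  have up: "u x + p \<bullet> (z - x) - u z \<le> K * norm (z - x) powr (1 + \<alpha>)"
    and uq: "- u x + q \<bullet> (z - x) + u z \<le> K * norm (z - x) powr (1 + \<alpha>)" if "z \<in> cball 0 1" for z
    using p q that by (force simp: touches_below_def \<alpha>_def)+
  have pw0: "norm h powr (1 + \<alpha>) = norm h powr \<alpha> * norm h" for h :: "real ^ 'n"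
    by (cases "h = 0") (auto simp: powr_add)
  have small: "\<forall>\<^sub>F z in at x. z \<in> cball 0 1 \<and> 2 * (K * norm (z - x) powr \<alpha>) < \<epsilon>" if \<epsilon>: "0 < \<epsilon>" for \<epsilon>
  proof -
    have "((\<lambda>z. 2 * (K * norm (z - x) powr \<alpha>)) \<longlongrightarrow> 2 * (K * norm (x - x) powr \<alpha>)) (at x)"
      using \<alpha> by (intro tendsto_intros) auto
    hence "\<forall>\<^sub>F z in at x. 2 * (K * norm (z - x) powr \<alpha>) < \<epsilon>" using \<epsilon> \<alpha> by (auto dest: order_tendstoD(2))
    moreover have "\<forall>\<^sub>F z in at x. z \<in> ball 0 1" using x by (intro eventually_at_in_open') auto
    ultimately show ?thesis by eventually_elim auto
  qed
  show qp: "q = - p"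
  proof (rule ccontr)
    assume ne: "q \<noteq> - p"
    define e where "e = p + q"
    have e: "0 < norm e" using ne by (auto simp: e_def add_eq_0_iff)
    obtain d where d: "0 < d" "\<And>z. z \<noteq> x \<Longrightarrow> dist z x < d \<Longrightarrow> z \<in> cball 0 1 \<and> 2 * (K * norm (z - x) powr \<alpha>) < norm e"
      using small[OF e] unfolding eventually_at by auto
    define s where "s = d / (2 * norm e)"
    define z where "z = x + s *\<^sub>R e"
    have s: "0 < s" using d e by (simp add: s_def)
    have zx: "z - x = s *\<^sub>R e" by (simp add: z_def)
    have "norm (z - x) = d / 2" using d e by (simp add: zx s_def)
    hence z: "z \<in> cball 0 1" "2 * (K * norm (z - x) powr \<alpha>) < norm e" using d(2)[of z] d(1) by (auto simp: dist_norm)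
    have "s * (norm e * norm e) = e \<bullet> (z - x)" by (simp add: zx power2_norm_eq_inner[symmetric] power2_eq_square)
    also have "\<dots> \<le> 2 * (K * norm (z - x) powr \<alpha>) * norm (z - x)"
      using up[OF z(1)] uq[OF z(1)] by (simp add: e_def inner_add_left pw0 algebra_simps)
    also have "\<dots> < norm e * norm (z - x)" using z(2) e s by (intro mult_strict_right_mono) (auto simp: zx)
    also have "\<dots> = s * (norm e * norm e)" using s by (simp add: zx)
    finally show False by simp
  qed
  show "(u has_derivative (\<lambda>h. p \<bullet> h)) (at x)"
    unfolding has_derivative_at_alt
  proof (intro conjI allI impI)
    show "bounded_linear (\<lambda>h. p \<bullet> h)" by (rule bounded_linear_inner_right)
    fix \<epsilon> :: real assume \<epsilon>: "0 < \<epsilon>"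
    obtain d where d: "0 < d" "\<And>z. z \<noteq> x \<Longrightarrow> dist z x < d \<Longrightarrow> z \<in> cball 0 1 \<and> 2 * (K * norm (z - x) powr \<alpha>) < \<epsilon>"
      using small[OF \<epsilon>] unfolding eventually_at by auto
    have "norm (u z - u x - p \<bullet> (z - x)) \<le> \<epsilon> * norm (z - x)" if z: "norm (z - x) < d" for z
    proof (cases "z = x")
      case False
      have 1: "z \<in> cball 0 1" "2 * (K * norm (z - x) powr \<alpha>) < \<epsilon>" using d(2)[OF False] z by (auto simp: dist_norm)
      have "\<bar>u z - u x - p \<bullet> (z - x)\<bar> \<le> K * norm (z - x) powr \<alpha> * norm (z - x)"
        using up[OF 1(1)] uq[OF 1(1)] by (simp add: qp pw0 abs_le_iff algebra_simps)
      also have "K * norm (z - x) powr \<alpha> \<le> 2 * (K * norm (z - x) powr \<alpha>)" using K by simp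
      also have "\<dots> \<le> \<epsilon>" using 1(2) by simp
      finally show ?thesis by (simp add: mult_right_mono)
    qed simp
    thus "\<exists>d>0. \<forall>z. norm (z - x) < d \<longrightarrow> norm (u z - u x - p \<bullet> (z - x)) \<le> \<epsilon> * norm (z - x)"
      using d(1) by blast
  qed
qed

text \<open>Compare the two affine approximations at \<open>x0\<close> and \<open>x1\<close> at the points at distance
  \<open>norm (x1 - x0) / 2\<close> from \<open>x0\<close> on the line in direction \<open>p1 - p0\<close>.\<close>

lemma touches_both_slope_diff:
  fixes u :: "real ^ 'n::finite \<Rightarrow> real"
  assumes \<gamma>: "0 \<le> \<gamma>" and K: "0 < K" and x: "x0 \<in> ball 0 (1/2)" "x1 \<in> ball 0 (1/2)"
    and t: "touches_below \<gamma> K (cball 0 1) u x0 p0" "touches_below \<gamma> K (cball 0 1) (\<lambda>z. - u z) x0 (- p0)"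
      "touches_below \<gamma> K (cball 0 1) u x1 p1" "touches_below \<gamma> K (cball 0 1) (\<lambda>z. - u z) x1 (- p1)"
  shows "pw \<gamma> (norm p0 + norm p1) * norm (p0 - p1)
    \<le> (pw \<gamma> 8 * (12 powr (1 + 1 / (1 + \<gamma>))) powr (1 + \<gamma>) + pw \<gamma> 4 * 12\<^sup>2) * K powr (1 + \<gamma>) * norm (x0 - x1)"
proof (rule ccontr)
  define P where "P = norm p0 + norm p1"
  define m where "m = norm (p1 - p0)"
  define R where "R = norm (x0 - x1)"
  define A where "A = pw \<gamma> 8 * (12 powr (1 + 1 / (1 + \<gamma>))) powr (1 + \<gamma>)"
  define B where "B = pw \<gamma> 4 * 12\<^sup>2"
  define T where "T = K powr (1 + \<gamma>)"
  assume "\<not> ?thesis"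
  hence c: "(A + B) * T * R < pw \<gamma> P * m"
    by (simp add: A_def B_def T_def P_def m_def R_def norm_minus_commute)
  have AB: "0 \<le> A" "0 \<le> B" "0 \<le> T" "0 \<le> R" by (simp_all add: A_def B_def T_def R_def)
  have "0 \<le> (A + B) * T * R" using AB by simp
  hence "0 < pw \<gamma> P * m" using c by linarith
  hence m: "0 < m" unfolding m_def by (metis mult_zero_right norm_ge_zero order_less_le)
  have mP: "m \<le> P" unfolding m_def P_def using norm_triangle_ineq4[of p1 p0] by linarith
  have pP: "(P - m) / 2 \<le> norm p0" "(P - m) / 2 \<le> norm p1"
    unfolding m_def P_def using norm_triangle_ineq2[of p1 p0] norm_triangle_ineq2[of p0 p1] by (auto simp: norm_minus_commute)
  have R: "0 < R" 
  proof (rule ccontr)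
    assume "\<not> 0 < R"
    hence x01: "x0 = x1" by (simp add: R_def)
    have K0: "0 \<le> K" and xb: "x1 \<in> ball 0 1" using K x by auto
    have "- p1 = - p0" using touches_both_has_derivative(2)[OF \<gamma> K0 xb] t unfolding x01 by blast
    thus False using m by (simp add: m_def)
  qed
  have R1: "R < 1" using norm_triangle_ineq4[of x0 x1] x by (simp add: R_def)
  \<comment> \<open>The test points are taken at distance \<open>4 * r = R / 2\<close> from
    \<open>x0\<close>; they lie in the unit ball because \<open>R < 1\<close>, and within
    \<open>12 * r = R + R / 2\<close> of both \<open>x0\<close> and \<open>x1\<close>.\<close>
  define r where "r = R / 8"
  have r: "0 < r" using R by (simp add: r_def)
  have ATR: "0 \<le> A * T * R" "0 \<le> B * T * R" using AB by simp_all
  have b: "A * T * r \<le> pw \<gamma> P * m" "B * T * r \<le> pw \<gamma> P * m"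
    using c ATR by (auto simp: r_def algebra_simps)
  have b1: "pw \<gamma> 8 * (K * 12 powr (1 + 1 / (1 + \<gamma>))) powr (1 + \<gamma>) * r \<le> pw \<gamma> P * m"
    using b(1) K by (simp add: A_def T_def powr_mult mult_ac)
  have b2: "pw \<gamma> 4 * (K powr (1 + \<gamma>) * 12\<^sup>2) * r \<le> pw \<gamma> P * m"
    using b(2) by (simp add: B_def T_def mult_ac)
  have err: "v x + p \<bullet> (z - x) - v z \<le> m * r"
    if "touches_below \<gamma> K (cball 0 1) v x p" "(P - m) / 2 \<le> norm p" "z \<in> cball 0 1" "norm (z - x) \<le> 12 * r" for v x p z
    by (rule touch_error_le[OF that(1,3,4) \<gamma> K _ r m mP that(2) b1 b2]) simp
  define e where "e = (1 / m) *\<^sub>R (p1 - p0)"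
  have e1: "norm e = 1" using m by (simp add: e_def m_def)
  have em: "(p1 - p0) \<bullet> e = m" using m by (simp add: e_def m_def power2_norm_eq_inner[symmetric] power2_eq_square)
  have z: "x0 + s *\<^sub>R e \<in> cball 0 1 \<and> norm (x0 + s *\<^sub>R e - x0) \<le> 12 * r \<and> norm (x0 + s *\<^sub>R e - x1) \<le> 12 * r"
    if s: "\<bar>s\<bar> = 4 * r" for s
  proof -
    have "norm (x0 + s *\<^sub>R e) \<le> norm x0 + \<bar>s\<bar>" using norm_triangle_ineq[of x0 "s *\<^sub>R e"] e1 by simp
    moreover have "norm (x0 + s *\<^sub>R e - x1) \<le> norm (x0 - x1) + \<bar>s\<bar>"
      unfolding add_diff_eq[symmetric] diff_add_eq[symmetric] using norm_triangle_ineq[of "x0 - x1" "s *\<^sub>R e"] e1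
      by (simp add: algebra_simps)
    ultimately show ?thesis using x(1) s R R1 e1 by (simp add: r_def R_def)
  qed
  have np: "(P - m) / 2 \<le> norm (- p0)" "(P - m) / 2 \<le> norm (- p1)" using pP by simp_all
  have E: "\<bar>u (x0 + s *\<^sub>R e) - u xi - pi \<bullet> (x0 + s *\<^sub>R e - xi)\<bar> \<le> m * r"
    if s: "\<bar>s\<bar> = 4 * r" and i: "xi = x0 \<and> pi = p0 \<or> xi = x1 \<and> pi = p1" for s xi pi
    using i err[OF t(1) pP(1)] err[OF t(2) np(1)] err[OF t(3) pP(2)] err[OF t(4) np(2)] z[OF s]
    by (force simp: abs_le_iff)
  have s: "\<bar>4 * r\<bar> = 4 * r" "\<bar>- (4 * r)\<bar> = 4 * r" using r by auto
  \<comment> \<open>Between the two test points the difference of the affine approximations changes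
    by \<open>8 * r * m\<close>, whereas the four errors allow at most
    \<open>4 * m * r\<close>.\<close>
  note E[OF s(1), of x0 p0] E[OF s(1), of x1 p1] E[OF s(2), of x0 p0] E[OF s(2), of x1 p1]
  hence "\<bar>2 * (4 * r) * ((p1 - p0) \<bullet> e)\<bar> \<le> 4 * (m * r)"
    by (simp add: inner_diff_left inner_diff_right inner_add_right algebra_simps abs_le_iff)
  moreover have "0 < m * r" using m r by simp
  ultimately show False unfolding em using r m by (simp add: abs_if mult_ac split: if_splits)
qed

section \<open>The gradient field on sets touched from both sides\<close>

definition double_touch :: "real \<Rightarrow> real \<Rightarrow> (real ^ 'n::finite \<Rightarrow> real) \<Rightarrow> (real ^ 'n) set" where
  "double_touch \<gamma> K u = ball 0 (1/2) \<inter> touch_set \<gamma> K u \<inter> touch_set \<gamma> K (\<lambda>z. - u z)"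

lemma double_touch_slope:
  fixes u :: "real ^ 'n::finite \<Rightarrow> real"
  assumes "0 \<le> \<gamma>" "0 \<le> K" "x \<in> double_touch \<gamma> K u"
  obtains "(u has_derivative (\<lambda>h. grad u x \<bullet> h)) (at x)" "touches_below \<gamma> K (cball 0 1) u x (grad u x)"
    "touches_below \<gamma> K (cball 0 1) (\<lambda>z. - u z) x (- grad u x)"
proof -
  obtain p q where p: "touches_below \<gamma> K (cball 0 1) u x p" and q: "touches_below \<gamma> K (cball 0 1) (\<lambda>z. - u z) x q"
    and x: "x \<in> ball 0 1"
    using assms(3) by (auto simp: double_touch_def touch_set_def)
  note d = touches_both_has_derivative[OF assms(1,2) x p q]
  have "grad u x = p" by (rule grad_eq[OF d(1)])
  thus thesis using that d p q by simp
qed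

lemma grad_field_lipschitz:
  fixes u :: "real ^ 'n::finite \<Rightarrow> real"
  assumes \<gamma>: "0 \<le> \<gamma>"
  obtains C where "0 < C"
    "\<And>(u :: real ^ 'n \<Rightarrow> real) K U x y. \<lbrakk>0 < K; \<And>z. z \<in> cball 0 1 \<Longrightarrow> \<bar>u z\<bar> \<le> U; U \<le> K;
       x \<in> double_touch \<gamma> K u; y \<in> double_touch \<gamma> K u\<rbrakk>
     \<Longrightarrow> norm (grad_field \<gamma> u x) \<le> C * K powr (1 + \<gamma>) \<and>
       norm (grad_field \<gamma> u x - grad_field \<gamma> u y) \<le> C * K powr (1 + \<gamma>) * norm (x - y)"
proof -
  define D where "D = pw \<gamma> 8 * (12 powr (1 + 1 / (1 + \<gamma>))) powr (1 + \<gamma>) + pw \<gamma> 4 * 12\<^sup>2"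
  define C where "C = 6 powr (1 + \<gamma>) + (1 + \<gamma>) * D"
  have D: "0 \<le> D" by (simp add: D_def)
  have C: "6 powr (1 + \<gamma>) \<le> C" "(1 + \<gamma>) * D \<le> C" using D \<gamma> by (auto simp: C_def)
  show thesis
  proof (rule that[of C])
    show "0 < C" using D \<gamma> by (auto simp: C_def intro: add_pos_nonneg)
    fix u :: "real ^ 'n \<Rightarrow> real" and K U x y
    assume K: "0 < K" and U: "\<And>z. z \<in> cball 0 1 \<Longrightarrow> \<bar>u z\<bar> \<le> U" "U \<le> K"
      and x: "x \<in> double_touch \<gamma> K u" and y: "y \<in> double_touch \<gamma> K u"
    have K0: "0 \<le> K" using K by simp
    have xb: "x \<in> ball 0 (1/2)" "y \<in> ball 0 (1/2)" using x y by (auto simp: double_touch_def)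
    obtain tx: "touches_below \<gamma> K (cball 0 1) u x (grad u x)" "touches_below \<gamma> K (cball 0 1) (\<lambda>z. - u z) x (- grad u x)"
      using double_touch_slope[OF \<gamma> K0 x] by blast
    obtain ty: "touches_below \<gamma> K (cball 0 1) u y (grad u y)" "touches_below \<gamma> K (cball 0 1) (\<lambda>z. - u z) y (- grad u y)"
      using double_touch_slope[OF \<gamma> K0 y] by blast
    have "(1 - 1/2) * norm (grad u x) \<le> 2 * U + K"
      using xb by (intro touch_slope_bound[OF tx(1) _ _ K0 \<gamma> U(1)]) auto
    hence g: "norm (grad u x) \<le> 6 * K" using U(2) by simp
    have "norm (grad_field \<gamma> u x) = norm (grad u x) powr (1 + \<gamma>)"
      using \<gamma> by (simp add: grad_field_def norm_pow_eq pw_times_self)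
    also have "\<dots> \<le> (6 * K) powr (1 + \<gamma>)" using g \<gamma> by (intro powr_mono2) auto
    also have "\<dots> = 6 powr (1 + \<gamma>) * K powr (1 + \<gamma>)" using K by (simp add: powr_mult)
    also have "\<dots> \<le> C * K powr (1 + \<gamma>)" using C by (intro mult_right_mono) auto
    finally have 1: "norm (grad_field \<gamma> u x) \<le> C * K powr (1 + \<gamma>)" .
    have "norm (grad_field \<gamma> u x - grad_field \<gamma> u y)
        \<le> (1 + \<gamma>) * pw \<gamma> (norm (grad u x) + norm (grad u y)) * norm (grad u x - grad u y)"
      unfolding grad_field_def by (rule norm_pow_scaleR_diff_le[OF \<gamma>])
    also have "\<dots> \<le> (1 + \<gamma>) * (D * K powr (1 + \<gamma>) * norm (x - y))"
      unfolding D_def mult.assoc[of "1 + \<gamma>"] using touches_both_slope_diff[OF \<gamma> K xb tx ty] \<gamma>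
      by (intro mult_left_mono) auto
    also have "\<dots> = (1 + \<gamma>) * D * (K powr (1 + \<gamma>) * norm (x - y))" by simp
    also have "\<dots> \<le> C * (K powr (1 + \<gamma>) * norm (x - y))" using C by (intro mult_right_mono) auto
    finally show "norm (grad_field \<gamma> u x) \<le> C * K powr (1 + \<gamma>) \<and>
       norm (grad_field \<gamma> u x - grad_field \<gamma> u y) \<le> C * K powr (1 + \<gamma>) * norm (x - y)"
      using 1 by (simp add: mult.assoc)
  qed
qed

section \<open>Integrability of the gradient field\<close>

text \<open>For a continuous function the essential supremum is a supremum, since a nonempty open
  set is not negligible; the boundary is reached by continuity. The bound on the compact ball makes
  the essential supremum finite, so that \<open>real_of_ereal\<close> preserves it.\<close>

lemma abs_le_Linf_norm:
  fixes u :: "real ^ 'n::finite \<Rightarrow> real"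
  assumes u: "continuous_on (cball 0 1) u" and z: "z \<in> cball 0 1"
  shows "\<bar>u z\<bar> \<le> Linf_norm (ball 0 1) u"
proof -
  let ?B = "ball (0 :: real ^ 'n) 1"
  let ?E = "esssup (lebesgue_on ?B) (\<lambda>x. ereal \<bar>u x\<bar>)"
  have "bounded (u ` cball 0 1)" using compact_continuous_image[OF u compact_cball] by (rule compact_imp_bounded)
  then obtain U where U: "\<And>y. y \<in> u ` cball 0 1 \<Longrightarrow> norm y \<le> U" unfolding bounded_iff by blast
  have ub: "continuous_on ?B u" using u by (rule continuous_on_subset) auto
  have um: "(\<lambda>x. ereal \<bar>u x\<bar>) \<in> borel_measurable (lebesgue_on ?B)"
    by (intro borel_measurable_ereal borel_measurable_abs continuous_imp_measurable_on_sets_lebesgue ub) simp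
  have EU: "?E \<le> ereal U"
  proof (rule esssup_I[OF um AE_I2])
    fix x assume "x \<in> space (lebesgue_on ?B)"
    hence "x \<in> cball 0 1" by (simp add: space_restrict_space)
    thus "ereal \<bar>u x\<bar> \<le> ereal U" using U[of "u x"] by simp
  qed
  have uE: "ereal \<bar>u x\<bar> \<le> ?E" if x: "x \<in> ?B" for x
  proof (rule ccontr)
    assume "\<not> ereal \<bar>u x\<bar> \<le> ?E"
    hence ne: "?B \<inter> (\<lambda>x. ereal \<bar>u x\<bar>) -` {?E<..} \<noteq> {}" (is "?S \<noteq> {}") using x by auto
    have op: "open ?S"
      by (intro continuous_open_preimage continuous_on_ereal continuous_on_rabs ub) auto
    have "AE y in lebesgue_on ?B. ereal \<bar>u y\<bar> \<le> ?E" by (rule esssup_AE)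
    hence "AE y in lebesgue. y \<in> ?B \<longrightarrow> ereal \<bar>u y\<bar> \<le> ?E" by (simp add: AE_restrict_space_iff)
    hence "AE y in lebesgue. y \<notin> ?S" by eventually_elim auto
    hence "negligible ?S" using op by (simp add: negligible_iff_null_sets AE_iff_null_sets)
    thus False using open_not_negligible[OF op ne] by blast
  qed
  have E0: "0 \<le> ?E" using order_trans[OF _ uE[of 0], of 0] by simp
  hence E: "?E = ereal (Linf_norm ?B u)" using EU unfolding Linf_norm_def by (cases ?E) auto
  have cl: "closure ?B = cball 0 1" by simp
  show ?thesis
  proof (rule continuous_le_on_closure[where f = "\<lambda>x. \<bar>u x\<bar>" and S = ?B])
    show "continuous_on (closure ?B) (\<lambda>x. \<bar>u x\<bar>)" unfolding cl by (intro continuous_intros u)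
    show "z \<in> closure ?B" unfolding cl by (rule z)
    show "\<bar>u x\<bar> \<le> Linf_norm ?B u" if "x \<in> ?B" for x using uE[OF that] unfolding E by simp
  qed
qed

lemma in_Lp_card_power:
  fixes f :: "real ^ 'n::finite \<Rightarrow> real"
  assumes f: "in_Lp (real CARD('n)) \<Omega> f" and \<Omega>: "\<Omega> \<in> sets lebesgue"
  shows "set_integrable lebesgue \<Omega> (\<lambda>x. \<bar>f x\<bar> ^ CARD('n))"
    "(LINT x:\<Omega>|lebesgue. \<bar>f x\<bar> ^ CARD('n)) = Lp_norm (real CARD('n)) \<Omega> f ^ CARD('n)"
proof -
  have eq: "norm (f x) powr real CARD('n) = \<bar>f x\<bar> ^ CARD('n)" for x
    by (cases "f x = 0") (simp_all add: powr_realpow)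
  show "set_integrable lebesgue \<Omega> (\<lambda>x. \<bar>f x\<bar> ^ CARD('n))"
    using f \<Omega> unfolding in_Lp_def eq set_integrable_def by (simp add: integrable_restrict_space)
  have I: "(LINT x|lebesgue_on \<Omega>. \<bar>f x\<bar> ^ CARD('n)) = (LINT x:\<Omega>|lebesgue. \<bar>f x\<bar> ^ CARD('n))"
    using \<Omega> unfolding set_lebesgue_integral_def by (simp add: integral_restrict_space)
  have "0 \<le> (LINT x:\<Omega>|lebesgue. \<bar>f x\<bar> ^ CARD('n))"
    unfolding I[symmetric] by (rule integral_nonneg_AE) simp
  thus "(LINT x:\<Omega>|lebesgue. \<bar>f x\<bar> ^ CARD('n)) = Lp_norm (real CARD('n)) \<Omega> f ^ CARD('n)"
    unfolding Lp_norm_def eq I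
    by (cases "(LINT x:\<Omega>|lebesgue. \<bar>f x\<bar> ^ CARD('n)) = 0")
       (simp_all add: powr_powr flip: powr_realpow)
qed

lemma powr_add_le:
  fixes a b s :: real
  assumes "0 \<le> a" "0 \<le> b" "0 \<le> s"
  shows "(a + b) powr s \<le> 2 powr s * (a powr s + b powr s)"
proof -
  have "(a + b) powr s \<le> (2 * max a b) powr s" using assms by (intro powr_mono2) auto
  also have "\<dots> = 2 powr s * (max a b) powr s" using assms by (simp add: powr_mult)
  also have "(max a b) powr s \<le> a powr s + b powr s" by (simp add: max_def)
  finally show ?thesis by (simp add: mult_left_mono)
qed

text \<open>\<open>delta\<close> is so small that the growth factor \<open>q\<close> of the
  Lipschitz constants, raised to the power \<open>delta\<close>, does not destroy the decay rate
  \<open>tau\<close>.\<close>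

lemma exponent_exists:
  fixes q \<tau> :: real
  assumes q: "1 < q" and \<tau>: "0 < \<tau>" "\<tau> < 1"
  obtains \<delta> where "0 < \<delta>" "\<delta> < 1" "q powr \<delta> * \<tau> < 1"
proof -
  have l: "0 < ln q" "ln \<tau> < 0" using q \<tau> by simp_all
  define \<delta> where "\<delta> = min (1/2) (- ln \<tau> / (2 * ln q))"
  have "\<delta> * ln q \<le> (- ln \<tau> / (2 * ln q)) * ln q" using l by (intro mult_right_mono) (auto simp: \<delta>_def)
  also have "\<dots> = - ln \<tau> / 2" using l by simp
  finally have "\<delta> * ln q + ln \<tau> < 0" using l by linarith
  hence "exp (\<delta> * ln q + ln \<tau>) < 1" by simp
  hence "q powr \<delta> * \<tau> < 1" using q \<tau> by (simp add: exp_add powr_def)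
  moreover have "0 < \<delta>" "\<delta> < 1" using l by (auto simp: \<delta>_def divide_neg_pos min_def)
  ultimately show thesis using that by blast
qed

lemma measure_diff_double_touch_le:
  assumes u: "continuous_on (cball 0 1) u" and \<gamma>: "0 \<le> \<gamma>" and K: "0 \<le> K"
  shows "double_touch \<gamma> K u \<in> sets lebesgue"
    "measure lebesgue (ball 0 (1/2) - double_touch \<gamma> K u)
      \<le> measure lebesgue (bad_set \<gamma> K u) + measure lebesgue (bad_set \<gamma> K (\<lambda>z. - u z))"
proof -
  have u': "continuous_on (cball 0 1) (\<lambda>z. - u z)" by (intro continuous_intros u)
  note b = lmeasurable_bad_set[OF u \<gamma> K] lmeasurable_bad_set[OF u' \<gamma> K]
  have eq: "ball 0 (1/2) - double_touch \<gamma> K u = bad_set \<gamma> K u \<union> bad_set \<gamma> K (\<lambda>z. - u z)"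
    by (auto simp: double_touch_def bad_set_def)
  have "double_touch \<gamma> K u = ball 0 (1/2) - (bad_set \<gamma> K u \<union> bad_set \<gamma> K (\<lambda>z. - u z))"
    by (auto simp: double_touch_def bad_set_def)
  thus "double_touch \<gamma> K u \<in> sets lebesgue" using b by (simp add: fmeasurableD sets.Diff sets.Un)
  show "measure lebesgue (ball 0 (1/2) - double_touch \<gamma> K u)
      \<le> measure lebesgue (bad_set \<gamma> K u) + measure lebesgue (bad_set \<gamma> K (\<lambda>z. - u z))"
    unfolding eq using b by (intro measure_Un_le) (auto simp: fmeasurableD)
qed

text \<open>For the degenerate case in which the scale \<open>K\<close> of the theorem is 0 and
  \<open>u\<close> vanishes. It is the graded situation with all sets equal to
  \<open>\<Omega>\<close> and Lipschitz constant 0.\<close>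

lemma grad_field_W1p_zero:
  fixes u :: "real ^ 'n::finite \<Rightarrow> real"
  assumes u: "\<And>z. z \<in> \<Omega> \<Longrightarrow> u z = 0" and \<Omega>: "open \<Omega>" "\<Omega> \<in> lmeasurable" and \<delta>: "0 < \<delta>" "\<delta> < 1"
  shows "AE x in lebesgue_on \<Omega>. u differentiable (at x)"
    "\<exists>V. in_W1p \<delta> \<Omega> (grad_field \<gamma> u) V \<and> W1p_norm \<delta> \<Omega> (grad_field \<gamma> u) V \<le> 0"
proof -
  have d: "(u has_derivative (\<lambda>h. 0)) (at x)" if x: "x \<in> \<Omega>" for x
    by (rule has_derivative_transform_within_open[OF has_derivative_const \<Omega>(1) x]) (simp add: u)
  thus "AE x in lebesgue_on \<Omega>. u differentiable (at x)"
    by (intro AE_I2) (auto simp: space_restrict_space differentiable_def)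
  have "grad u x = 0" if "x \<in> \<Omega>" for x using d[OF that] by (intro grad_eq) simp
  hence G: "grad_field \<gamma> u x = 0" if "x \<in> \<Omega>" for x using that by (simp add: grad_field_def)
  define H where "H = measure lebesgue \<Omega>"
  have r: "1 powr \<delta> * (1/2) < (1::real)" by simp
  obtain V where "in_W1p \<delta> \<Omega> (grad_field \<gamma> u) V"
    "W1p_norm \<delta> \<Omega> (grad_field \<gamma> u) V
      \<le> 0 * ((1 + (real CARD('n))\<^sup>2) * (H / (1/2) / (1 - 1 powr \<delta> * (1/2))) powr (1 / \<delta>))"
    by (rule graded_lipschitz_W1p[OF \<Omega>(2), of H "\<lambda>_. \<Omega>" "1/2" "grad_field \<gamma> u" 0 1 \<delta>, OF _ _ _ _ _ _ _ _ _ _ \<delta> r])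
       (use \<Omega> G in \<open>auto simp: H_def fmeasurableD\<close>)
  thus "\<exists>V. in_W1p \<delta> \<Omega> (grad_field \<gamma> u) V \<and> W1p_norm \<delta> \<Omega> (grad_field \<gamma> u) V \<le> 0" by auto
qed

theorem theorem1p1:
  fixes lam Lam \<gamma> :: real
  assumes "CARD('n::finite) \<ge> 2"
    and "0 < lam" and "lam \<le> Lam" and "0 \<le> \<gamma>"
  shows "\<exists>\<delta>>0. \<exists>C>0. \<forall>(f :: real ^ 'n \<Rightarrow> real) (u :: real ^ 'n \<Rightarrow> real).
    continuous_on (ball 0 1) f \<and> in_Lp (real CARD('n)) (ball 0 1) f \<and>
    continuous_on (cball 0 1) u \<and>
    visc_minus_le lam Lam \<gamma> (ball 0 1) u f \<and>
    visc_plus_ge lam Lam \<gamma> (ball 0 1) u f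
    \<longrightarrow>
    (AE x in lebesgue_on (ball 0 (1/2)). u differentiable (at x)) \<and>
    (\<exists>V. in_W1p \<delta> (ball 0 (1/2)) (grad_field \<gamma> u) V \<and>
         W1p_norm \<delta> (ball 0 (1/2)) (grad_field \<gamma> u) V
           \<le> C * (Linf_norm (ball 0 1) u powr (1 + \<gamma>)
                  + Lp_norm (real CARD('n)) (ball 0 1) f))"
proof -
  note n = assms(1) and lam = assms(2,3) and \<gamma> = assms(4)
  obtain M \<tau> H where c: "2 \<le> M" "0 < \<tau>" "\<tau> < 1" "0 < H" and decay:
    "\<And>u (f :: real ^ 'n \<Rightarrow> real) U K k. \<lbrakk>continuous_on (cball 0 1) u; continuous_on (ball 0 1) f;
       \<And>L. visc_super lam Lam \<gamma> L (ball 0 1) u f; 0 < K; \<And>z. z \<in> cball 0 1 \<Longrightarrow> \<bar>u z\<bar> \<le> U; 12 * 24\<^sup>2 * U \<le> K;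
       set_integrable lebesgue (ball 0 1) (\<lambda>z. \<bar>f z\<bar> ^ CARD('n));
       (LINT z:ball 0 1|lebesgue. \<bar>f z\<bar> ^ CARD('n)) \<le> (K powr (1 + \<gamma>)) ^ CARD('n)\<rbrakk>
     \<Longrightarrow> measure lebesgue (bad_set \<gamma> (K * M ^ k) u) \<le> H * \<tau> ^ k"
    apply (rule bad_set_decay[OF n lam \<gamma>])
    subgoal premises prems by (rule prems(1)[OF prems(2-5)]) (rule prems(6); assumption)
    done
  obtain C1 where C1: "0 < C1" and glip:
    "\<And>(u :: real ^ 'n \<Rightarrow> real) K U x y. \<lbrakk>0 < K; \<And>z. z \<in> cball 0 1 \<Longrightarrow> \<bar>u z\<bar> \<le> U; U \<le> K;
       x \<in> double_touch \<gamma> K u; y \<in> double_touch \<gamma> K u\<rbrakk>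
     \<Longrightarrow> norm (grad_field \<gamma> u x) \<le> C1 * K powr (1 + \<gamma>) \<and>
       norm (grad_field \<gamma> u x - grad_field \<gamma> u y) \<le> C1 * K powr (1 + \<gamma>) * norm (x - y)"
    apply (rule grad_field_lipschitz[where 'n = 'n, OF \<gamma>])
    subgoal premises prems by (rule prems(1)[OF prems(2)]) (rule prems(3); assumption)
    done
  \<comment> \<open>From level \<open>k\<close> to \<open>k + 1\<close> the touching constant grows
    by \<open>M\<close>, hence the bounds for \<open>grad_field\<close>, which are of order
    \<open>K powr (1 + gamma)\<close>, grow by this factor.\<close>
  define q where "q = M powr (1 + \<gamma>)"
  have q: "1 < q" using c \<gamma> by (simp add: q_def)
  obtain \<delta> where \<delta>: "0 < \<delta>" "\<delta> < 1" "q powr \<delta> * \<tau> < 1" by (rule exponent_exists[OF q c(2,3)])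
  let ?\<Omega> = "ball (0 :: real ^ 'n) (1/2)"
  define H' where "H' = 2 * H + measure lebesgue ?\<Omega>"
  define C2 where "C2 = (1 + (real CARD('n))\<^sup>2) * (H' / \<tau> / (1 - q powr \<delta> * \<tau>)) powr (1 / \<delta>)"
  define A :: real where "A = 12 * 24\<^sup>2"
  define C where "C = C1 * (A powr (1 + \<gamma>) * 2 powr (1 + \<gamma>)) * C2 + 1"
  have C2: "0 \<le> C2" by (simp add: C2_def)
  have C: "0 < C" using C1 C2 by (auto simp: C_def intro!: add_nonneg_pos)
  have A: "1 \<le> A" by (simp add: A_def)
  show ?thesis
  proof (rule exI[of _ \<delta>], rule conjI, rule \<delta>(1), rule exI[of _ C], rule conjI, rule C, intro allI impI)
    fix f u :: "real ^ 'n \<Rightarrow> real"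
    assume as: "continuous_on (ball 0 1) f \<and> in_Lp (real CARD('n)) (ball 0 1) f \<and>
      continuous_on (cball 0 1) u \<and>
      visc_minus_le lam Lam \<gamma> (ball 0 1) u f \<and> visc_plus_ge lam Lam \<gamma> (ball 0 1) u f"
    hence cf: "continuous_on (ball 0 1) f" and fL: "in_Lp (real CARD('n)) (ball 0 1) f"
      and cu: "continuous_on (cball 0 1) u" and vm: "visc_minus_le lam Lam \<gamma> (ball 0 1) u f"
      and vp: "visc_plus_ge lam Lam \<gamma> (ball 0 1) u f" by blast+
    define a where "a = Linf_norm (ball 0 1) u"
    define F where "F = Lp_norm (real CARD('n)) (ball 0 1) f"
    have ua: "\<bar>u z\<bar> \<le> a" if "z \<in> cball 0 1" for z using abs_le_Linf_norm[OF cu that] by (simp add: a_def)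
    have a0: "0 \<le> a" using ua[of 0] by simp
    have F0: "0 \<le> F" by (simp add: F_def Lp_norm_def)
    \<comment> \<open>The scale at which the decay starts: \<open>A = 12 * 24^2\<close> is the
      factor in the oscillation condition of \<open>bad_set_decay\<close>, and
      \<open>K powr (1 + gamma)\<close> dominates the norm of \<open>f\<close>. Since
      \<open>K\<close> is built from the data, \<open>u\<close> is not normalised, and
      \<open>K powr (1 + gamma)\<close> is bounded by a multiple of the right-hand side of the
      claim.\<close>
    define K where "K = A * (a + F powr (1 / (1 + \<gamma>)))"
    have KT: "K powr (1 + \<gamma>) \<le> A powr (1 + \<gamma>) * 2 powr (1 + \<gamma>) * (a powr (1 + \<gamma>) + F)"
    proof -
      have "K powr (1 + \<gamma>) = A powr (1 + \<gamma>) * (a + F powr (1 / (1 + \<gamma>))) powr (1 + \<gamma>)"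
        using A a0 by (simp add: K_def powr_mult)
      also have "(a + F powr (1 / (1 + \<gamma>))) powr (1 + \<gamma>) \<le> 2 powr (1 + \<gamma>) * (a powr (1 + \<gamma>) + (F powr (1 / (1 + \<gamma>))) powr (1 + \<gamma>))"
        using a0 \<gamma> by (intro powr_add_le) auto
      also have "(F powr (1 / (1 + \<gamma>))) powr (1 + \<gamma>) = F" using F0 \<gamma> by (simp add: powr_powr)
      finally show ?thesis by (simp add: mult.assoc mult_left_mono)
    qed
    have K0: "0 \<le> K" using A a0 by (simp add: K_def)
    show "(AE x in lebesgue_on ?\<Omega>. u differentiable (at x)) \<and>
      (\<exists>V. in_W1p \<delta> ?\<Omega> (grad_field \<gamma> u) V \<and> W1p_norm \<delta> ?\<Omega> (grad_field \<gamma> u) V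
         \<le> C * (Linf_norm (ball 0 1) u powr (1 + \<gamma>) + Lp_norm (real CARD('n)) (ball 0 1) f))"
      unfolding a_def[symmetric] F_def[symmetric]
    proof (cases "K = 0")
      case True
      have "0 \<le> F powr (1 / (1 + \<gamma>))" by simp
      hence "a = 0" using True A a0 unfolding K_def by (simp add: add_nonneg_eq_0_iff)
      hence u0: "u z = 0" if "z \<in> ?\<Omega>" for z using ua[of z] that by simp
      have R0: "0 \<le> C * (a powr (1 + \<gamma>) + F)" using C F0 by simp
      show "(AE x in lebesgue_on ?\<Omega>. u differentiable (at x)) \<and>
        (\<exists>V. in_W1p \<delta> ?\<Omega> (grad_field \<gamma> u) V \<and> W1p_norm \<delta> ?\<Omega> (grad_field \<gamma> u) V \<le> C * (a powr (1 + \<gamma>) + F))"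
        using grad_field_W1p_zero(1)[where u = u, OF u0 open_ball lmeasurable_ball \<delta>(1,2)]
          grad_field_W1p_zero(2)[where u = u and \<gamma> = \<gamma>, OF u0 open_ball lmeasurable_ball \<delta>(1,2)] order_trans[OF _ R0]
        by blast
    next
      case False
      hence K: "0 < K" using K0 by simp
      define B where "B k = double_touch \<gamma> (K * M ^ k) u" for k
      have M1: "1 \<le> M ^ k" for k using c by (intro one_le_power) auto
      have KM: "0 < K * M ^ k" "K \<le> K * M ^ k" for k
        using K mult_left_mono[OF M1[of k], of K] M1[of k] by auto
      have aA: "12 * 24\<^sup>2 * a \<le> K" using A by (simp add: K_def A_def)
      have aK: "a \<le> K" using aA a0 by simp
      have fint: "set_integrable lebesgue (ball 0 1) (\<lambda>z. \<bar>f z\<bar> ^ CARD('n))"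
        and fI: "(LINT z:ball 0 1|lebesgue. \<bar>f z\<bar> ^ CARD('n)) = F ^ CARD('n)"
        using in_Lp_card_power[OF fL] by (simp_all add: F_def)
      have FK: "F \<le> K powr (1 + \<gamma>)"
      proof -
        have "F powr (1 / (1 + \<gamma>)) \<le> a + F powr (1 / (1 + \<gamma>))" using a0 by simp
        also have "\<dots> \<le> K" using mult_right_mono[OF A, of "a + F powr (1 / (1 + \<gamma>))"] a0 by (simp add: K_def)
        finally have "(F powr (1 / (1 + \<gamma>))) powr (1 + \<gamma>) \<le> K powr (1 + \<gamma>)" using \<gamma> by (intro powr_mono2) auto
        thus ?thesis using F0 \<gamma> by (simp add: powr_powr)
      qed
      have fK: "(LINT z:ball 0 1|lebesgue. \<bar>f z\<bar> ^ CARD('n)) \<le> (K powr (1 + \<gamma>)) ^ CARD('n)"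
        unfolding fI using FK F0 by (intro power_mono) auto
      have b1: "measure lebesgue (bad_set \<gamma> (K * M ^ k) u) \<le> H * \<tau> ^ k" for k
        by (rule decay[OF cu cf visc_minus_le_imp_super[OF vm n] K ua aA fint fK])
      have b2: "measure lebesgue (bad_set \<gamma> (K * M ^ k) (\<lambda>z. - u z)) \<le> H * \<tau> ^ k" for k
      proof (rule decay[OF _ _ visc_plus_ge_imp_super[OF vp n] K _ aA])
        show "continuous_on (cball 0 1) (\<lambda>z. - u z)" "continuous_on (ball 0 1) (\<lambda>z. - f z)"
          by (intro continuous_intros cu cf)+
        show "\<bar>- u z\<bar> \<le> a" if "z \<in> cball 0 1" for z using ua[OF that] by simp
      qed (use fint fK in simp_all)
      have Bm: "B k \<in> sets lebesgue" and mB: "measure lebesgue (?\<Omega> - B k) \<le> H' * \<tau> ^ k" for k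
      proof -
        have KM0: "0 \<le> K * M ^ k" using KM(1)[of k] by simp
        note md = measure_diff_double_touch_le[OF cu \<gamma> KM0]
        show "B k \<in> sets lebesgue" unfolding B_def by (rule md(1))
        have "measure lebesgue (?\<Omega> - B k) \<le> 2 * H * \<tau> ^ k" using md(2) b1[of k] b2[of k] by (simp add: B_def)
        also have "\<dots> \<le> H' * \<tau> ^ k" using c by (intro mult_right_mono) (auto simp: H'_def)
        finally show "measure lebesgue (?\<Omega> - B k) \<le> H' * \<tau> ^ k" .
      qed
      have B\<Omega>: "B k \<subseteq> ?\<Omega>" for k by (auto simp: B_def double_touch_def)
      have Kq: "C1 * (K * M ^ k) powr (1 + \<gamma>) = C1 * K powr (1 + \<gamma>) * q ^ k" for k
      proof -
        have "(M ^ k) powr (1 + \<gamma>) = q ^ k"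
          using c unfolding q_def by (simp add: powr_powr mult.commute flip: powr_realpow)
        thus ?thesis using K c by (simp add: powr_mult)
      qed
      have lipB: "norm (grad_field \<gamma> u x) \<le> C1 * K powr (1 + \<gamma>) * q ^ k \<and>
        norm (grad_field \<gamma> u x - grad_field \<gamma> u y) \<le> C1 * K powr (1 + \<gamma>) * q ^ k * norm (x - y)"
        if "x \<in> B k" "y \<in> B k" for x y k
      proof -
        have aKM: "a \<le> K * M ^ k" using aK KM(2)[of k] by linarith
        show ?thesis using glip[OF KM(1) ua aKM that[unfolded B_def]] unfolding Kq .
      qed
      have \<Omega>m: "?\<Omega> \<in> lmeasurable" "measure lebesgue ?\<Omega> \<le> H'" using c by (auto simp: H'_def)
      have t0: "0 \<le> C1 * K powr (1 + \<gamma>)" and q0: "0 < q" using C1 q by auto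
      obtain V where V: "in_W1p \<delta> ?\<Omega> (grad_field \<gamma> u) V"
        "W1p_norm \<delta> ?\<Omega> (grad_field \<gamma> u) V \<le> C1 * K powr (1 + \<gamma>) * C2"
        unfolding C2_def
        by (rule graded_lipschitz_W1p[OF \<Omega>m Bm B\<Omega> mB lipB[THEN conjunct1] lipB[THEN conjunct2] t0 q0 c(2,3) \<delta>])
      have diff: "u differentiable (at x)" if x: "x \<in> B k" for x k
      proof -
        have KM0: "0 \<le> K * M ^ k" using KM(1)[of k] by simp
        show ?thesis using double_touch_slope[OF \<gamma> KM0 x[unfolded B_def]] unfolding differentiable_def by blast
      qed
      have "AE x in lebesgue. x \<in> ?\<Omega> \<longrightarrow> u differentiable (at x)"
      proof (rule AE_I')
        have "negligible (?\<Omega> - (\<Union>k. B k))"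
          by (rule negligible_diff_Union[OF \<Omega>m(1) Bm mB]) (use c in auto)
        thus "?\<Omega> - (\<Union>k. B k) \<in> null_sets lebesgue" by (simp add: negligible_iff_null_sets)
        show "{x \<in> space lebesgue. \<not> (x \<in> ?\<Omega> \<longrightarrow> u differentiable (at x))} \<subseteq> ?\<Omega> - (\<Union>k. B k)"
          using diff by auto
      qed
      hence ae: "AE x in lebesgue_on ?\<Omega>. u differentiable (at x)" by (simp add: AE_restrict_space_iff)
      have "C1 * K powr (1 + \<gamma>) * C2 \<le> C1 * (A powr (1 + \<gamma>) * 2 powr (1 + \<gamma>) * (a powr (1 + \<gamma>) + F)) * C2"
        using KT C1 C2 by (intro mult_right_mono mult_left_mono) auto
      also have "\<dots> = (C1 * (A powr (1 + \<gamma>) * 2 powr (1 + \<gamma>)) * C2) * (a powr (1 + \<gamma>) + F)" by simp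
      also have "\<dots> \<le> C * (a powr (1 + \<gamma>) + F)" using F0 by (intro mult_right_mono) (auto simp: C_def)
      finally show "(AE x in lebesgue_on ?\<Omega>. u differentiable (at x)) \<and>
        (\<exists>V. in_W1p \<delta> ?\<Omega> (grad_field \<gamma> u) V \<and> W1p_norm \<delta> ?\<Omega> (grad_field \<gamma> u) V \<le> C * (a powr (1 + \<gamma>) + F))"
        using ae V by (meson order_trans)
    qed
  qed
qed

end
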